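(* Let $\Omega\subset\mathbb{R}^3$ with subdomain $\Omega_C$ satisfy the geometry assumption, and let the material assumptions and the data assumption hold. Let $T\in\mathbb{R}_{\ge0}\cup\{\infty\}$, $\boldsymbol{v}\in L^2([0,T);\mathbb{R}^m)$ and $\boldsymbol{A}_0\in X_0(\operatorname{curl},\Omega,\Omega_C)$, and let $(\boldsymbol{A},\boldsymbol{i})$ be a solution of the coupled MQS system. Then $\boldsymbol{i}\in L^2([0,T);\mathbb{R}^m)$, and for all $\varepsilon\in(0,2)$, $$\|R^{1/2}\boldsymbol{i}\|^2_{L^2([0,T);\mathbb{R}^m)}\le\tfrac{2}{2-\varepsilon}\,E(\boldsymbol{A}_0)+\tfrac{1}{\varepsilon(2-\varepsilon)}\,\|R^{-1/2}\boldsymbol{v}\|^2_{L^2([0,T);\mathbb{R}^m)},$$ $$\|R^{1/2}\boldsymbol{i}\|_{L^2([0,T);\mathbb{R}^m)}\le\sqrt{\tfrac{L_\nu}{2-\varepsilon}}\,\|\nabla\times\boldsymbol{A}_0\|_{L^2(\Omega;\mathbb{R}^3)}+\tfrac{1}{\sqrt{\varepsilon(2-\varepsilon)}}\,\|R^{-1/2}\boldsymbol{v}\|_{L^2([0,T);\mathbb{R}^m)}.$$ If, moreover, $\boldsymbol{A}_0=0$, then $$\|R^{1/2}\boldsymbol{i}\|_{L^2([0,T);\mathbb{R}^m)}\le\|R^{-1/2}\boldsymbol{v}\|_{L^2([0,T);\mathbb{R}^m)}.$$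
   Context: Geometry assumption: $\Omega\subset\mathbb{R}^3$ is a simply connected bounded Lipschitz domain, decomposed into two Lipschitz regular open subsets $\Omega_C,\Omega_I\subset\Omega$ with $\overline{\Omega}_C\subset\Omega$ and $\Omega_I=\Omega\setminus\overline{\Omega}_C$. $\Omega_C$ is connected, and $\Omega_I$ consists of finitely many connected internal subdomains $\Omega_{I,1},\dots,\Omega_{I,q}$ with single boundary components $\Gamma_1,\dots,\Gamma_q$, respectively, and an external subdomain $\Omega_{I,\rm ext}$ which has two boundary components $\Gamma_{\rm ext}=\overline{\Omega}_{I,\rm ext}\cap\overline{\Omega}_C$ and $\partial\Omega$. Material assumptions: (a) $\sigma=\sigma_C\mathbb{1}_{\Omega_C}$ with a constant $\sigma_C>0$; (b) $\nu:\Omega\times\mathbb{R}_{\ge0}\to\mathbb{R}_{\ge0}$ is measurable and there are $m_\nu,L_\nu>0$ such that for all $\xi\in\Omega$, $\zeta,\varsigma\ge0$: $(\nu(\xi,\zeta)\zeta-\nu(\xi,\varsigma)\varsigma)(\zeta-\varsigma)\ge m_\nu(\zeta-\varsigma)^2$ and $|\nu(\xi,\zeta)\zeta-\nu(\xi,\varsigma)\varsigma|\le L_\nu|\zeta-\varsigma|$; (c) $R\in\mathbb{R}^{m\times m}$ is symmetric positive definite. Spaces: $X(\Omega,\Omega_C)$ is the set of all functions in $L^2(\Omega;\mathbb{R}^3)$ that are $L^2$-orthogonal to $\nabla\psi$ for all $\psi\in H^1_0(\Omega)$ that are constant on each of $\Gamma_1,\dots,\Gamma_q,\Gamma_{\rm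 ext}$; it carries the $L^2$ inner product. $H_0(\operatorname{curl},\Omega)$ is the usual space of $L^2$ fields with weak curl in $L^2$ and vanishing tangential trace, and $X_0(\operatorname{curl},\Omega,\Omega_C)=H_0(\operatorname{curl},\Omega)\cap X(\Omega,\Omega_C)$ with the $H_0(\operatorname{curl},\Omega)$ inner product. Data assumption: $\boldsymbol{A}_0\in X(\Omega,\Omega_C)$, and the columns of $\chi:\Omega\to\mathbb{R}^{3\times m}$ belong to $X(\Omega,\Omega_C)$. Coupled MQS system and solutions: the system is $\frac{\partial}{\partial t}(\sigma\boldsymbol{A})+\nabla\times(\nu(\cdot,\|\nabla\times\boldsymbol{A}\|_2)\nabla\times\boldsymbol{A})=\chi\boldsymbol{i}$ in $\Omega\times(0,T)$, $\frac{\rm d}{{\rm d}t}\int_\Omega\chi^\top\boldsymbol{A}\,{\rm d}\xi+R\boldsymbol{i}=\boldsymbol{v}$ on $(0,T)$, $\boldsymbol{A}\times\boldsymbol{n}_o=0$ on $\partial\Omega\times(0,T)$, $\sigma\boldsymbol{A}(\cdot,0)=\sigma\boldsymbol{A}_0$, $\int_\Omega\chi^\top\boldsymbol{A}(\cdot,0)\,{\rm d}\xi=\int_\Omega\chi^\top\boldsymbol{A}_0\,{\rm d}\xi$. For finite $T>0$ and $\boldsymbol{v}\in L^2([0,T];\mathbb{R}^m)$, a (weak) solution on $[0,T]$ is a pair $(\boldsymbol{A},\boldsymbol{i})$ such that (1) $\sigma\boldsymbol{A}\in C([0,T];X(\Omega,\Omega_C))\cap H^1_{\rm loc}((0,T];X(\Omega,\Omega_C))$,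 $\sigma\boldsymbol{A}(0)=\sigma\boldsymbol{A}_0$; (2) $\int_\Omega\chi^\top\boldsymbol{A}\,{\rm d}\xi\in C([0,T];\mathbb{R}^m)\cap H^1_{\rm loc}((0,T];\mathbb{R}^m)$, with value $\int_\Omega\chi^\top\boldsymbol{A}_0\,{\rm d}\xi$ at $t=0$; (3) $\boldsymbol{A}\in L^2([0,T];X_0(\operatorname{curl},\Omega,\Omega_C))$ and $\boldsymbol{i}\in L^2_{\rm loc}((0,T];\mathbb{R}^m)$; (4) for all $\boldsymbol{F}\in X_0(\operatorname{curl},\Omega,\Omega_C)$ and almost all $t\in[0,T]$, $\frac{\rm d}{{\rm d}t}\int_\Omega\sigma\boldsymbol{A}(t)\cdot\boldsymbol{F}\,{\rm d}\xi+\int_\Omega\nu(\cdot,\|\nabla\times\boldsymbol{A}(t)\|_2)(\nabla\times\boldsymbol{A}(t))\cdot(\nabla\times\boldsymbol{F})\,{\rm d}\xi=\int_\Omega\chi\,\boldsymbol{i}(t)\cdot\boldsymbol{F}\,{\rm d}\xi$ and $\frac{\rm d}{{\rm d}t}\int_\Omega\chi^\top\boldsymbol{A}(t)\,{\rm d}\xi+R\,\boldsymbol{i}(t)=\boldsymbol{v}(t)$. A solution on a half-open interval $[0,T)$, $T\le\infty$, is a pair whose restriction to $[0,T']$ is a solution for every $0<T'<T$. Magnetic energy: with $\vartheta(\xi,\varrho)=\int_0^{\sqrt{\varrho}}\nu(\xi,\zeta)\zeta\,{\rm d}\zeta$, define $E:X(\Omega,\Omega_C)\to\mathbb{R}\cup\{\infty\}$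 by $E(\boldsymbol{A})=\int_\Omega\vartheta(\xi,\|\nabla\times\boldsymbol{A}(\xi)\|_2^2)\,{\rm d}\xi$ if $\boldsymbol{A}\in X_0(\operatorname{curl},\Omega,\Omega_C)$ and $E(\boldsymbol{A})=\infty$ otherwise. $R^{1/2}$ is the symmetric positive definite square root of $R$ and $R^{-1/2}$ its inverse. *)

theory Defs
  imports "HOL-Analysis.Analysis"
begin

definition square_integrable_on ::
    "('a::euclidean_space \<Rightarrow> 'b::real_normed_vector) \<Rightarrow> 'a set \<Rightarrow> bool"  (infixr "square'_integrable'_on" 46)
  where "f square_integrable_on S \<longleftrightarrow>
    f \<in> borel_measurable (lebesgue_on S) \<and> integrable (lebesgue_on S) (\<lambda>x. (norm (f x))\<^sup>2)"

lemma square_integrable_on_UNIV: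
  "f square_integrable_on UNIV \<longleftrightarrow>
    f \<in> borel_measurable lebesgue \<and> integrable lebesgue (\<lambda>x. (norm (f x))\<^sup>2)"
  by (simp add: square_integrable_on_def lebesgue_on_UNIV_eq)

lemma square_integrable_zero: "(\<lambda>x. 0) square_integrable_on UNIV"
  by (simp add: square_integrable_on_UNIV)

lemma square_integrable_scaleR:
  "f square_integrable_on UNIV \<Longrightarrow> (\<lambda>x. c *\<^sub>R f x) square_integrable_on UNIV"
  for f :: "'a::euclidean_space \<Rightarrow> 'b::euclidean_space"
  by (auto simp: square_integrable_on_UNIV power_mult_distrib intro: borel_measurable_scaleR)

lemma square_integrable_add:
  fixes f g :: "'a::euclidean_space \<Rightarrow> 'b::euclidean_space"
  assumes "f square_integrable_on UNIV" "g square_integrable_on UNIV"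
  shows "(\<lambda>x. f x + g x) square_integrable_on UNIV"
proof -
  note m [measurable] = assms[unfolded square_integrable_on_UNIV, THEN conjunct1]
  have "integrable lebesgue (\<lambda>x. 2 * (norm (f x))\<^sup>2 + 2 * (norm (g x))\<^sup>2)"
    using assms by (simp add: square_integrable_on_UNIV)
  then have "integrable lebesgue (\<lambda>x. (norm (f x + g x))\<^sup>2)"
  proof (rule Bochner_Integration.integrable_bound, measurable)
    show "AE x in lebesgue. norm ((norm (f x + g x))\<^sup>2) \<le> norm (2 * (norm (f x))\<^sup>2 + 2 * (norm (g x))\<^sup>2)"
    proof (rule AE_I2)
      fix x
      have "(norm (f x + g x))\<^sup>2 \<le> (norm (f x) + norm (g x))\<^sup>2"
        by (simp add: norm_triangle_ineq power_mono)
      also have "\<dots> \<le> 2 * (norm (f x))\<^sup>2 + 2 * (norm (g x))\<^sup>2"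
        using zero_le_power2[of "norm (f x) - norm (g x)"]
        by (simp add: power2_eq_square algebra_simps)
      finally show "norm ((norm (f x + g x))\<^sup>2) \<le> norm (2 * (norm (f x))\<^sup>2 + 2 * (norm (g x))\<^sup>2)"
        by simp
    qed
  qed
  then show ?thesis by (simp add: square_integrable_on_UNIV)
qed

lemma square_integrable_inner:
  fixes f g :: "'a::euclidean_space \<Rightarrow> 'b::euclidean_space"
  assumes "f square_integrable_on UNIV" "g square_integrable_on UNIV"
  shows "integrable lebesgue (\<lambda>x. f x \<bullet> g x)"
proof -
  note m [measurable] = assms[unfolded square_integrable_on_UNIV, THEN conjunct1]
  have "integrable lebesgue (\<lambda>x. (norm (f x))\<^sup>2 + (norm (g x))\<^sup>2)"
    using assms by (simp add: square_integrable_on_UNIV)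
  then show ?thesis
  proof (rule Bochner_Integration.integrable_bound, measurable)
    show "AE x in lebesgue. norm (f x \<bullet> g x) \<le> norm ((norm (f x))\<^sup>2 + (norm (g x))\<^sup>2)"
    proof (rule AE_I2)
      fix x
      have "\<bar>f x \<bullet> g x\<bar> \<le> norm (f x) * norm (g x)" by (rule Cauchy_Schwarz_ineq2)
      also have "\<dots> \<le> (norm (f x))\<^sup>2 + (norm (g x))\<^sup>2"
        using zero_le_power2[of "norm (f x) - norm (g x)"]
        by (simp add: power2_eq_square algebra_simps) (smt (verit) mult_nonneg_nonneg norm_ge_zero)
      finally show "norm (f x \<bullet> g x) \<le> norm ((norm (f x))\<^sup>2 + (norm (g x))\<^sup>2)"
        by simp
    qed
  qed
qed

text \<open>
  The elements of \<open>('a, 'b) L2\<close> are the square integrable functions on the whole space up to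
  equality almost everywhere; \<open>rep_L2\<close> chooses a representative and \<open>abs_L2\<close> forms the class.
\<close>

definition L2_eq :: "('a::euclidean_space \<Rightarrow> 'b::euclidean_space) \<Rightarrow> ('a \<Rightarrow> 'b) \<Rightarrow> bool"
  where "L2_eq f g \<longleftrightarrow> f square_integrable_on UNIV \<and> g square_integrable_on UNIV \<and>
    (AE x in lebesgue. f x = g x)"

quotient_type (overloaded) ('a, 'b) L2 =
    "'a::euclidean_space \<Rightarrow> 'b::euclidean_space" / partial: L2_eq
proof (rule part_equivpI)
  show "\<exists>f. L2_eq f f"
    using square_integrable_zero by (auto simp: L2_eq_def)
  show "symp L2_eq" by (auto simp: symp_def L2_eq_def)
  show "transp L2_eq"
    by (auto simp: transp_def L2_eq_def)
qed

instantiation L2 :: (euclidean_space, euclidean_space) real_inner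
begin

lift_definition zero_L2 :: "('a, 'b) L2" is "\<lambda>x. 0"
  by (simp add: L2_eq_def square_integrable_zero)

lift_definition plus_L2 :: "('a, 'b) L2 \<Rightarrow> ('a, 'b) L2 \<Rightarrow> ('a, 'b) L2" is "\<lambda>f g x. f x + g x"
  by (auto simp: L2_eq_def square_integrable_add)

lift_definition scaleR_L2 :: "real \<Rightarrow> ('a, 'b) L2 \<Rightarrow> ('a, 'b) L2" is "\<lambda>c f x. c *\<^sub>R f x"
  by (auto simp: L2_eq_def square_integrable_scaleR)

lift_definition inner_L2 :: "('a, 'b) L2 \<Rightarrow> ('a, 'b) L2 \<Rightarrow> real" is "\<lambda>f g. LINT x|lebesgue. f x \<bullet> g x"
  by (auto simp: L2_eq_def square_integrable_on_UNIV intro!: integral_cong_AE)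

definition uminus_L2 :: "('a, 'b) L2 \<Rightarrow> ('a, 'b) L2" where "uminus_L2 u = (-1) *\<^sub>R u"
definition minus_L2 :: "('a, 'b) L2 \<Rightarrow> ('a, 'b) L2 \<Rightarrow> ('a, 'b) L2" where "minus_L2 u v = u + (- v)"
definition norm_L2 :: "('a, 'b) L2 \<Rightarrow> real" where "norm_L2 u = sqrt (u \<bullet> u)"
definition dist_L2 :: "('a, 'b) L2 \<Rightarrow> ('a, 'b) L2 \<Rightarrow> real" where "dist_L2 u v = norm (u - v)"
definition sgn_L2 :: "('a, 'b) L2 \<Rightarrow> ('a, 'b) L2" where "sgn_L2 u = inverse (norm u) *\<^sub>R u"
definition uniformity_L2 :: "(('a, 'b) L2 \<times> ('a, 'b) L2) filter"
  where "uniformity_L2 = (INF e\<in>{0<..}. principal {(u, v). dist u v < e})"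
definition open_L2 :: "('a, 'b) L2 set \<Rightarrow> bool"
  where "open_L2 U \<longleftrightarrow> (\<forall>x\<in>U. eventually (\<lambda>(x', y). x' = x \<longrightarrow> y \<in> U) uniformity)"

instance
proof
  fix a b :: real and u v w :: "('a, 'b) L2"
  show "u + v + w = u + (v + w)"
    by transfer (auto simp: L2_eq_def square_integrable_add add.assoc)
  show "u + v = v + u"
    by transfer (auto simp: L2_eq_def square_integrable_add add.commute)
  show "0 + u = u"
    by transfer (auto simp: L2_eq_def)
  show "- u + u = 0"
    unfolding uminus_L2_def
    by transfer (auto simp: L2_eq_def square_integrable_zero)
  show "u - v = u + - v" by (simp add: minus_L2_def)
  show "a *\<^sub>R (u + v) = a *\<^sub>R u + a *\<^sub>R v"
    by transfer (auto simp: L2_eq_def square_integrable_add square_integrable_scaleR algebra_simps)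
  show "(a + b) *\<^sub>R u = a *\<^sub>R u + b *\<^sub>R u"
    by transfer (auto simp: L2_eq_def square_integrable_add square_integrable_scaleR algebra_simps)
  show "a *\<^sub>R b *\<^sub>R u = (a * b) *\<^sub>R u"
    by transfer (auto simp: L2_eq_def square_integrable_scaleR)
  show "1 *\<^sub>R u = u"
    by transfer (auto simp: L2_eq_def)
  show "u \<bullet> v = v \<bullet> u"
    by transfer (simp add: inner_commute)
  show "(u + v) \<bullet> w = u \<bullet> w + v \<bullet> w"
    by transfer (auto simp: L2_eq_def inner_add_left intro!: Bochner_Integration.integral_add square_integrable_inner)
  show "(a *\<^sub>R u) \<bullet> v = a * (u \<bullet> v)"
    by transfer simp
  show "0 \<le> u \<bullet> u"
    by transfer simp
  show "(u \<bullet> u = 0) = (u = 0)"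
  proof transfer
    fix f :: "'a \<Rightarrow> 'b" assume f: "L2_eq f f"
    then have "(LINT x|lebesgue. f x \<bullet> f x) = 0 \<longleftrightarrow> (AE x in lebesgue. f x \<bullet> f x = 0)"
      by (intro integral_nonneg_eq_0_iff_AE square_integrable_inner) (auto simp: L2_eq_def)
    then show "((LINT x|lebesgue. f x \<bullet> f x) = 0) = L2_eq f (\<lambda>x. 0)"
      using f by (simp add: L2_eq_def square_integrable_zero)
  qed
qed (simp_all add: norm_L2_def dist_L2_def sgn_L2_def uniformity_L2_def open_L2_def)

end

lemma rep_L2_square_integrable: "rep_L2 u square_integrable_on UNIV"
  using Quotient3_rep_reflp[OF Quotient3_L2] by (auto simp: L2_eq_def)

lemma rep_abs_L2_AE:
  assumes "f square_integrable_on UNIV"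
  shows "AE x in lebesgue. rep_L2 (abs_L2 f) x = f x"
  using rep_abs_rsp_left[OF Quotient3_L2, of f f] assms by (auto simp: L2_eq_def)

lemma abs_rep_L2: "abs_L2 (rep_L2 u) = u"
  by (rule Quotient3_abs_rep[OF Quotient3_L2])

lemma abs_L2_eqI:
  assumes "f square_integrable_on UNIV" "g square_integrable_on UNIV" "AE x in lebesgue. f x = g x"
  shows "abs_L2 f = abs_L2 g"
  using Quotient3_rel_abs[OF Quotient3_L2, of f g] assms by (auto simp: L2_eq_def)

lemma norm_L2_power2: "(norm u)\<^sup>2 = (LINT x|lebesgue. (norm (rep_L2 u x))\<^sup>2)"
proof -
  have "(norm u)\<^sup>2 = u \<bullet> u" by (simp add: power2_norm_eq_inner)
  also have "\<dots> = (LINT x|lebesgue. rep_L2 u x \<bullet> rep_L2 u x)"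
    by (simp add: inner_L2.rep_eq)
  finally show ?thesis by (simp add: power2_norm_eq_inner)
qed

lemma abs_L2_add:
  assumes "f square_integrable_on UNIV" "g square_integrable_on UNIV"
  shows "abs_L2 (\<lambda>x. f x + g x) = abs_L2 f + abs_L2 g"
  using plus_L2.abs_eq[of f g] assms by (simp add: L2_eq_def)

lemma abs_L2_scaleR:
  assumes "f square_integrable_on UNIV"
  shows "abs_L2 (\<lambda>x. c *\<^sub>R f x) = c *\<^sub>R abs_L2 f"
  using scaleR_L2.abs_eq[of f c] assms by (simp add: L2_eq_def)

lemma square_integrable_diff:
  fixes f g :: "'a::euclidean_space \<Rightarrow> 'b::euclidean_space"
  assumes "f square_integrable_on UNIV" "g square_integrable_on UNIV"
  shows "(\<lambda>x. f x - g x) square_integrable_on UNIV"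
  using square_integrable_add[OF assms(1) square_integrable_scaleR[OF assms(2), of "-1"]] by simp

lemma abs_L2_diff:
  assumes "f square_integrable_on UNIV" "g square_integrable_on UNIV"
  shows "abs_L2 (\<lambda>x. f x - g x) = abs_L2 f - abs_L2 g"
  using abs_L2_add[OF assms(1) square_integrable_scaleR[OF assms(2), of "-1"]]
    abs_L2_scaleR[OF assms(2), of "-1"] by simp

lemma norm_abs_L2_power2:
  assumes "f square_integrable_on UNIV"
  shows "(norm (abs_L2 f))\<^sup>2 = (LINT x|lebesgue. (norm (f x))\<^sup>2)"
proof -
  have "(norm (abs_L2 f))\<^sup>2 = abs_L2 f \<bullet> abs_L2 f" by (simp add: power2_norm_eq_inner)
  also have "\<dots> = (LINT x|lebesgue. f x \<bullet> f x)"
    using inner_L2.abs_eq[of f f] assms by (simp add: L2_eq_def)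
  finally show ?thesis by (simp add: power2_norm_eq_inner)
qed

lemma abs_L2_dominated_convergence:
  fixes f :: "'a::euclidean_space \<Rightarrow> 'b::euclidean_space"
  assumes s: "\<And>n. s n square_integrable_on UNIV" and f: "f square_integrable_on UNIV"
    and lim: "AE x in lebesgue. (\<lambda>n. s n x) \<longlonglongrightarrow> f x"
    and g: "g square_integrable_on UNIV"
    and bound: "\<And>n. AE x in lebesgue. norm (s n x) \<le> norm (g x)"
  shows "(\<lambda>n. abs_L2 (s n)) \<longlonglongrightarrow> abs_L2 f"
proof -
  note m [measurable] = s[unfolded square_integrable_on_UNIV, THEN conjunct1]
    f[unfolded square_integrable_on_UNIV, THEN conjunct1]
  have "(\<lambda>n. LINT x|lebesgue. (norm (s n x - f x))\<^sup>2) \<longlonglongrightarrow> (LINT (x::'a)|lebesgue. (0::real))"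
  proof (rule integral_dominated_convergence[where s = "\<lambda>n x. (norm (s n x - f x))\<^sup>2" and f = "\<lambda>x. 0"
        and w = "\<lambda>x. 2 * (norm (g x))\<^sup>2 + 2 * (norm (f x))\<^sup>2"])
    show "integrable lebesgue (\<lambda>x. 2 * (norm (g x))\<^sup>2 + 2 * (norm (f x))\<^sup>2)"
      using f g by (simp add: square_integrable_on_UNIV)
    show "AE x in lebesgue. (\<lambda>n. (norm (s n x - f x))\<^sup>2) \<longlonglongrightarrow> 0"
      using lim
    proof eventually_elim
      case (elim x)
      then have "(\<lambda>n. norm (s n x - f x)) \<longlonglongrightarrow> 0"
        by (simp add: LIM_zero tendsto_norm_zero)
      then show ?case using tendsto_power[of _ 0 _ 2] by fastforce
    qed
    show "AE x in lebesgue. norm ((norm (s n x - f x))\<^sup>2) \<le> 2 * (norm (g x))\<^sup>2 + 2 * (norm (f x))\<^sup>2" for n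
      using bound[of n]
    proof eventually_elim
      case (elim x)
      have "(norm (s n x - f x))\<^sup>2 \<le> (norm (g x) + norm (f x))\<^sup>2"
        using norm_triangle_ineq4[of "s n x" "f x"] elim by (intro power_mono) auto
      also have "\<dots> \<le> 2 * (norm (g x))\<^sup>2 + 2 * (norm (f x))\<^sup>2"
        using zero_le_power2[of "norm (g x) - norm (f x)"]
        by (simp add: power2_eq_square algebra_simps)
      finally show ?case by simp
    qed
  qed simp_all
  then have "(\<lambda>n. (norm (abs_L2 (s n) - abs_L2 f))\<^sup>2) \<longlonglongrightarrow> 0"
    by (simp add: norm_abs_L2_power2 square_integrable_diff s f flip: abs_L2_diff)
  then have "(\<lambda>n. sqrt ((norm (abs_L2 (s n) - abs_L2 f))\<^sup>2)) \<longlonglongrightarrow> sqrt 0"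
    by (rule tendsto_real_sqrt)
  then have "(\<lambda>n. norm (abs_L2 (s n) - abs_L2 f)) \<longlonglongrightarrow> 0" by simp
  then show ?thesis
    by (simp add: LIM_zero_iff tendsto_norm_zero_iff)
qed

lemma second_countable_if_countable_total:
  fixes C :: "'c::real_normed_vector set"
  assumes C: "countable C" and total: "closure (span C) = UNIV"
  shows "\<exists>B::'c set set. countable B \<and> open = generate_topology B"
proof -
  define v :: "(rat \<times> 'c) list \<Rightarrow> 'c" where "v = (\<lambda>xs. \<Sum>(q, c)\<leftarrow>xs. of_rat q *\<^sub>R c)"
  define D where "D = v ` lists (UNIV \<times> C)"
  have D: "countable D"
    using C by (simp add: D_def countable_lists)
  have v_app: "v (xs @ ys) = v xs + v ys" for xs ys by (simp add: v_def)
  have v_scale: "of_rat q *\<^sub>R v xs = v (map (\<lambda>(r, c). (q * r, c)) xs)" for q xs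
    by (induction xs) (auto simp: v_def scaleR_add_right of_rat_mult)
  have D_add: "x + y \<in> D" if xy: "x \<in> D" "y \<in> D" for x y
  proof -
    obtain xs ys where "xs \<in> lists (UNIV \<times> C)" "ys \<in> lists (UNIV \<times> C)" "x = v xs" "y = v ys"
      using xy by (auto simp: D_def)
    then show ?thesis unfolding D_def by (intro image_eqI[of _ _ "xs @ ys"]) (auto simp: v_app)
  qed
  have D_scale: "of_rat q *\<^sub>R x \<in> D" if x: "x \<in> D" for q x
  proof -
    obtain xs where "xs \<in> lists (UNIV \<times> C)" "x = v xs"
      using x by (auto simp: D_def)
    then show ?thesis unfolding D_def
      by (intro image_eqI[of _ _ "map (\<lambda>(r, c). (q * r, c)) xs"]) (auto simp: v_scale)
  qed
  have D_scale': "r *\<^sub>R x \<in> closure D" if x: "x \<in> D" for r x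
  proof -
    have "r \<in> closure \<rat>" by (simp add: Rats_closure_real)
    then obtain f where f: "\<And>n. f n \<in> \<rat>" "f \<longlonglongrightarrow> r"
      by (auto simp: closure_sequential)
    have "f n *\<^sub>R x \<in> D" for n using f(1)[of n] D_scale[OF x] by (auto simp: Rats_def)
    moreover have "(\<lambda>n. f n *\<^sub>R x) \<longlonglongrightarrow> r *\<^sub>R x" using f(2) by (intro tendsto_intros)
    ultimately show ?thesis
      unfolding closure_sequential by (intro exI[of _ "\<lambda>n. f n *\<^sub>R x"] conjI allI)
  qed
  have sub: "subspace (closure D)"
  proof (rule subspaceI)
    have "v [] \<in> D" by (simp add: D_def)
    then show "0 \<in> closure D" using closure_subset by (auto simp: v_def)
  next
    fix x y assume "x \<in> closure D" "y \<in> closure D"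
    then obtain f g where "\<And>n. f n \<in> D" "f \<longlonglongrightarrow> x" "\<And>n. g n \<in> D" "g \<longlonglongrightarrow> y"
      by (auto simp: closure_sequential)
    then show "x + y \<in> closure D"
      unfolding closure_sequential by (intro exI[of _ "\<lambda>n. f n + g n"]) (auto intro: D_add tendsto_add)
  next
    fix r x assume "x \<in> closure D"
    then obtain f where "\<And>n. f n \<in> D" "f \<longlonglongrightarrow> x"
      by (auto simp: closure_sequential)
    then have "(\<And>n. r *\<^sub>R f n \<in> closure D)" "(\<lambda>n. r *\<^sub>R f n) \<longlonglongrightarrow> r *\<^sub>R x"
      by (auto intro: D_scale' tendsto_intros)
    then show "r *\<^sub>R x \<in> closure D"
      by (rule closed_sequentially[OF closed_closure])
  qed
  have "C \<subseteq> D"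
  proof
    fix c assume "c \<in> C"
    then show "c \<in> D" unfolding D_def by (intro image_eqI[of _ _ "[(1, c)]"]) (auto simp: v_def)
  qed
  then have "span C \<subseteq> closure D"
    using sub closure_subset by (intro span_minimal) auto
  then have dense: "closure D = UNIV"
    using total closure_minimal[OF _ closed_closure] by blast
  define B where "B = (\<lambda>(d, n). ball d (1 / real (Suc n))) ` (D \<times> UNIV)"
  have "countable B" using D by (simp add: B_def)
  moreover have "topological_basis B"
  proof (rule topological_basisI)
    show "open b" if "b \<in> B" for b using that by (auto simp: B_def)
  next
    fix U :: "'c set" and x assume "open U" "x \<in> U"
    then obtain e where e: "e > 0" "ball x e \<subseteq> U" by (auto simp: open_contains_ball)
    obtain n where n: "1 / real (Suc n) < e / 2"
      using reals_Archimedean[of "e / 2"] e(1) by (auto simp: inverse_eq_divide)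
    have "x \<in> closure D" by (simp add: dense)
    then obtain d where d: "d \<in> D" "dist d x < 1 / real (Suc n)"
      by (metis closure_approachable divide_pos_pos of_nat_0_less_iff zero_less_Suc zero_less_one)
    have "ball d (1 / real (Suc n)) \<subseteq> ball x e"
    proof
      fix y assume "y \<in> ball d (1 / real (Suc n))"
      then show "y \<in> ball x e"
        using dist_triangle[of x y d] d(2) n by (simp add: dist_commute)
    qed
    with d e(2) show "\<exists>b\<in>B. x \<in> b \<and> b \<subseteq> U"
      unfolding B_def by (intro bexI[of _ "ball d (1 / real (Suc n))"]) auto
  qed
  ultimately show ?thesis using topological_basis_imp_subbasis by blast
qed

lemma AE_lebesgue_mem_main_part:
  fixes A :: "'a::euclidean_space set"
  assumes "A \<in> sets lebesgue"
  shows "AE x in lebesgue. x \<in> main_part lborel A \<longleftrightarrow> x \<in> A"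
proof (rule AE_I)
  show "{x \<in> space lebesgue. \<not> (x \<in> main_part lborel A \<longleftrightarrow> x \<in> A)} \<subseteq> null_part lborel A"
    using main_part_null_part_Un[OF assms] by auto
  show "emeasure lebesgue (null_part lborel A) = 0"
    using null_part_null_sets[OF assms] by auto
  show "null_part lborel A \<in> sets lebesgue"
    using null_part_null_sets[OF assms] by auto
qed

lemma square_integrable_indicator:
  fixes e :: "'b::euclidean_space" and A :: "'a::euclidean_space set"
  assumes "A \<in> lmeasurable"
  shows "(\<lambda>x. indicator A x *\<^sub>R e) square_integrable_on UNIV"
proof -
  have A: "A \<in> sets lebesgue" using assms by auto
  have "(norm (indicat_real A x *\<^sub>R e))\<^sup>2 = indicator A x * (norm e)\<^sup>2" for x
    by (auto simp: indicator_def)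
  moreover have "integrable lebesgue (\<lambda>x. indicator A x * (norm e)\<^sup>2)"
    using assms by (intro integrable_mult_left) (auto simp: fmeasurable_def)
  ultimately show ?thesis
    using A by (simp add: square_integrable_on_UNIV)
qed

lemma subspace_closure_normed:
  fixes S :: "'c::real_normed_vector set"
  assumes "subspace S"
  shows "subspace (closure S)"
proof (rule subspaceI)
  show "0 \<in> closure S" using subspace_0[OF assms] closure_subset by blast
next
  fix x y assume "x \<in> closure S" "y \<in> closure S"
  then obtain f g where "\<And>n. f n \<in> S" "f \<longlonglongrightarrow> x" "\<And>n. g n \<in> S" "g \<longlonglongrightarrow> y"
    by (auto simp: closure_sequential)
  then show "x + y \<in> closure S"
    unfolding closure_sequential using assms
    by (intro exI[of _ "\<lambda>n. f n + g n"]) (auto intro: subspace_add tendsto_add)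
next
  fix r x assume "x \<in> closure S"
  then obtain f where "\<And>n. f n \<in> S" "f \<longlonglongrightarrow> x"
    by (auto simp: closure_sequential)
  then show "r *\<^sub>R x \<in> closure S"
    unfolding closure_sequential using assms
    by (intro exI[of _ "\<lambda>n. r *\<^sub>R f n"]) (auto intro: subspace_scale tendsto_intros)
qed

lemma countable_total_L2:
  "\<exists>C :: ('a::euclidean_space, 'b::euclidean_space) L2 set. countable C \<and> closure (span C) = UNIV"
proof -
  obtain B :: "'a set set" where B: "countable B" "topological_basis B"
    using ex_countable_basis by auto
  define G where "G = (\<lambda>F. \<Inter>F) ` {F. finite F \<and> F \<subseteq> B}"
  define R :: "nat \<Rightarrow> 'a set" where "R n = ball 0 (real n)" for n
  define ind :: "'a set \<Rightarrow> 'b \<Rightarrow> ('a, 'b) L2" where "ind A e = abs_L2 (\<lambda>x. indicator A x *\<^sub>R e)" for A e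
  define C where "C = (\<lambda>(A, n, e). ind (A \<inter> R n) e) ` (G \<times> UNIV \<times> Basis)"
  define V where "V = closure (span C)"
  have countG: "countable G" unfolding G_def
    by (intro countable_image countable_Collect_finite_subset B)
  then have "countable C"
    by (simp add: C_def countable_finite)
  have openG: "open A" if "A \<in> G" for A
    using that B(2) by (auto simp: G_def topological_basis_open intro!: open_Inter)
  have "\<Inter>{b} \<in> G" if "b \<in> B" for b
    unfolding G_def using that by (intro imageI) auto
  then have BG: "B \<subseteq> G" by auto
  have stable: "Int_stable G"
  proof (rule Int_stableI)
    fix a b assume "a \<in> G" "b \<in> G"
    then obtain F F' where "finite F" "F \<subseteq> B" "a = \<Inter>F" "finite F'" "F' \<subseteq> B" "b = \<Inter>F'"
      by (auto simp: G_def)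
    then show "a \<inter> b \<in> G"
      unfolding G_def by (intro image_eqI[of _ _ "F \<union> F'"]) auto
  qed
  have V: "subspace V" "closed V"
    by (auto simp: V_def intro: subspace_closure_normed)
  have CV: "C \<subseteq> V" unfolding V_def using span_superset closure_subset by blast
  have R [measurable]: "R n \<in> sets borel" for n by (simp add: R_def)
  have fin: "A \<inter> R n \<in> lmeasurable" if "A \<in> sets lebesgue" for A n
    using fmeasurable_Int_fmeasurable[OF lmeasurable_ball that, of 0 "real n"] by (simp add: R_def inf_commute)
  have fin': "A \<inter> R n \<in> lmeasurable" if "A \<in> sets borel" for A n
    using that fin by auto
  have si: "(\<lambda>x. indicat_real (A \<inter> R n) x *\<^sub>R e) square_integrable_on UNIV"
    if "A \<in> sets borel" for A n and e :: 'b
    using that by (intro square_integrable_indicator fin')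
  have step1: "\<forall>n. \<forall>e\<in>Basis. ind (A \<inter> R n) e \<in> V" if A: "A \<in> sets borel" for A
  proof -
    have sets: "sets (borel :: 'a measure) = sigma_sets UNIV G"
    proof
      have "sets (borel :: 'a measure) = sigma_sets UNIV B"
        by (subst borel_eq_countable_basis[OF B]) simp
      also have "\<dots> \<subseteq> sigma_sets UNIV G" by (rule sigma_sets_mono') (rule BG)
      finally show "sets borel \<subseteq> sigma_sets UNIV G" .
      show "sigma_sets UNIV G \<subseteq> sets (borel :: 'a measure)"
        using openG by (intro sets.sigma_sets_subset[of G borel, simplified]) auto
    qed
    have UNIVG: "UNIV \<in> G" unfolding G_def by (intro image_eqI[of _ _ "{}"]) auto
    have "A \<in> sigma_sets UNIV G" using A sets by simp
    then show ?thesis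
    proof (induction rule: sigma_sets_induct_disjoint[OF stable subset_UNIV[of G, unfolded Pow_UNIV[symmetric]], consumes 1, case_names basic empty compl union])
      case (basic A)
      have "ind (A \<inter> R n) e \<in> C" if "e \<in> Basis" for n e
        unfolding C_def using basic that by (intro image_eqI[of _ _ "(A, n, e)"]) auto
      then show ?case using CV by auto
    next
      case empty
      have "ind {} e = 0" for e by (simp add: ind_def zero_L2_def)
      then show ?case using V(1) by (simp add: subspace_0)
    next
      case (compl A)
      then have Ab: "A \<in> sets borel" by (simp add: sets)
      have Ub: "UNIV \<in> sets (borel :: 'a measure)" by simp
      have "ind ((UNIV - A) \<inter> R n) e = ind (UNIV \<inter> R n) e - ind (A \<inter> R n) e" for n e
      proof -
        have "(\<lambda>x. indicat_real ((UNIV - A) \<inter> R n) x *\<^sub>R e)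
          = (\<lambda>x. indicat_real (UNIV \<inter> R n) x *\<^sub>R e - indicat_real (A \<inter> R n) x *\<^sub>R e)"
          by (auto simp: indicator_def)
        then show ?thesis
          unfolding ind_def by (simp only: abs_L2_diff[OF si[OF Ub] si[OF Ab]])
      qed
      moreover have "ind (UNIV \<inter> R n) e \<in> V" if "e \<in> Basis" for n e
      proof -
        have "ind (UNIV \<inter> R n) e \<in> C"
          unfolding C_def using UNIVG that by (intro image_eqI[of _ _ "(UNIV, n, e)"]) auto
        then show ?thesis using CV by auto
      qed
      ultimately show ?case using compl(2) V(1) by (simp add: subspace_diff)
    next
      case (union A)
      then have Ab: "A i \<in> sets borel" for i by (auto simp: sets)
      have "ind ((\<Union>i. A i) \<inter> R n) e \<in> V" if e: "e \<in> Basis" for n e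
      proof -
        define S where "S k = (\<Union>i<k. A i)" for k
        have Sb: "S k \<in> sets borel" for k using Ab by (auto simp: S_def)
        have "ind (S k \<inter> R n) e \<in> V" for k
        proof (induction k)
          case 0
          then show ?case using V(1) by (simp add: S_def ind_def zero_L2_def[symmetric] subspace_0)
        next
          case (Suc k)
          have disj: "S k \<inter> A k = {}"
            using union(1) unfolding S_def disjoint_family_on_def
            by (auto simp: disjoint_iff) (metis IntI UNIV_I empty_iff less_irrefl)
          have "S (Suc k) = S k \<union> A k" by (auto simp: S_def lessThan_Suc)
          then have "(\<lambda>x. indicat_real (S (Suc k) \<inter> R n) x *\<^sub>R e)
            = (\<lambda>x. indicat_real (S k \<inter> R n) x *\<^sub>R e + indicat_real (A k \<inter> R n) x *\<^sub>R e)"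
            using disj by (auto simp: indicator_def fun_eq_iff)
          then have "ind (S (Suc k) \<inter> R n) e = ind (S k \<inter> R n) e + ind (A k \<inter> R n) e"
            unfolding ind_def by (simp only: abs_L2_add[OF si[OF Sb] si[OF Ab]])
          then show ?case using Suc union(3)[of k] e V(1) by (simp add: subspace_add)
        qed
        moreover have "(\<lambda>k. ind (S k \<inter> R n) e) \<longlonglongrightarrow> ind ((\<Union>i. A i) \<inter> R n) e"
          unfolding ind_def
        proof (rule abs_L2_dominated_convergence[where g = "\<lambda>x. indicator (R n) x *\<^sub>R e"])
          show "AE x in lebesgue. (\<lambda>k. indicat_real (S k \<inter> R n) x *\<^sub>R e) \<longlonglongrightarrow> indicat_real ((\<Union>i. A i) \<inter> R n) x *\<^sub>R e"
          proof (rule AE_I2)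
            fix x
            have "\<forall>\<^sub>F k in sequentially. indicat_real (S k \<inter> R n) x = indicat_real ((\<Union>i. A i) \<inter> R n) x"
            proof (cases "\<exists>i. x \<in> A i")
              case True
              then obtain i where "x \<in> A i" by blast
              then show ?thesis
                by (intro eventually_sequentiallyI[of "Suc i"]) (auto simp: S_def indicator_def)
            qed (auto simp: S_def indicator_def)
            then have "(\<lambda>k. indicat_real (S k \<inter> R n) x) \<longlonglongrightarrow> indicat_real ((\<Union>i. A i) \<inter> R n) x"
              by (rule tendsto_eventually)
            then show "(\<lambda>k. indicat_real (S k \<inter> R n) x *\<^sub>R e) \<longlonglongrightarrow> indicat_real ((\<Union>i. A i) \<inter> R n) x *\<^sub>R e"
              by (intro tendsto_intros)
          qed
          show "(\<lambda>x. indicat_real (R n) x *\<^sub>R e) square_integrable_on UNIV"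
            by (intro square_integrable_indicator) (simp add: R_def)
        next
          show "(\<lambda>x. indicat_real ((\<Union>i. A i) \<inter> R n) x *\<^sub>R e) square_integrable_on UNIV"
            using Ab by (intro si) auto
          show "AE x in lebesgue. norm (indicat_real (S k \<inter> R n) x *\<^sub>R e) \<le> norm (indicat_real (R n) x *\<^sub>R e)" for k
            by (rule AE_I2) (auto simp: indicator_def)
        qed (rule si[OF Sb])
        ultimately show ?thesis by (rule closed_sequentially[OF V(2)])
      qed
      then show ?case by blast
    qed
  qed
  have step2: "ind (A \<inter> R n) e \<in> V" if A: "A \<in> sets lebesgue" for A n e
  proof -
    let ?M = "main_part lborel A"
    have Mb: "?M \<in> sets borel" using A main_part_sets[of A lborel] by simp
    have eq: "ind (A \<inter> R n) b = ind (?M \<inter> R n) b" for b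
      unfolding ind_def
    proof (rule abs_L2_eqI)
      show "AE x in lebesgue. indicat_real (A \<inter> R n) x *\<^sub>R b = indicat_real (?M \<inter> R n) x *\<^sub>R b"
        using AE_lebesgue_mem_main_part[OF A] by eventually_elim (auto simp: indicator_def)
    qed (intro square_integrable_indicator fin A, intro si Mb)
    have si': "(\<lambda>x. indicat_real (A \<inter> R n) x *\<^sub>R b) square_integrable_on UNIV" for b :: 'b
      using A by (intro square_integrable_indicator fin)
    have "ind (A \<inter> R n) (\<Sum>b\<in>F. (e \<bullet> b) *\<^sub>R b) = (\<Sum>b\<in>F. (e \<bullet> b) *\<^sub>R ind (A \<inter> R n) b)" if "finite F" for F
      using that
    proof induction
      case empty
      then show ?case by (simp add: ind_def zero_L2_def)
    next
      case (insert b F)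
      have "ind (A \<inter> R n) (x + c *\<^sub>R y) = ind (A \<inter> R n) x + c *\<^sub>R ind (A \<inter> R n) y" for x y c
        unfolding ind_def using si'
        by (simp add: scaleR_add_right abs_L2_add scaleR_left_commute[of _ c] abs_L2_scaleR square_integrable_scaleR del: scaleR_scaleR)
      from this[of "\<Sum>b\<in>F. (e \<bullet> b) *\<^sub>R b" "e \<bullet> b" b] insert show ?case
        by (simp add: add.commute)
    qed
    from this[OF finite_Basis]
    have "ind (A \<inter> R n) e = (\<Sum>b\<in>Basis. (e \<bullet> b) *\<^sub>R ind (A \<inter> R n) b)"
      by (simp add: euclidean_representation)
    also have "\<dots> \<in> V"
      using step1[OF Mb] V(1) by (intro subspace_sum subspace_scale) (auto simp: eq)
    finally show ?thesis .
  qed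
  have "u \<in> V" for u
  proof -
    define f where "f = rep_L2 u"
    have f: "f square_integrable_on UNIV" by (simp add: f_def rep_L2_square_integrable)
    then have [measurable]: "f \<in> borel_measurable lebesgue" by (simp add: square_integrable_on_UNIV)
    from borel_measurable_implies_sequence_metric[OF this, of 0] obtain s where
      s: "\<And>i. simple_function lebesgue (s i)" and
      lim: "\<And>x. (\<lambda>i. s i x) \<longlonglongrightarrow> f x" and
      bound: "\<And>i x. norm (s i x) \<le> 2 * norm (f x)"
      by auto
    define r where "r i = (\<lambda>x. indicat_real (R i) x *\<^sub>R s i x)" for i
    define J where "J i y = (\<lambda>x. indicat_real ((s i -` {y}) \<inter> R i) x *\<^sub>R y)" for i y
    have fin_s: "finite (range (s i))" for i using s[of i] by (simp add: simple_function_def)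
    have r_eq: "r i x = (\<Sum>y\<in>range (s i). J i y x)" for i x
    proof -
      have "(\<Sum>y\<in>range (s i). J i y x) = (\<Sum>y\<in>{s i x}. J i y x)"
        using fin_s by (intro sum.mono_neutral_right) (auto simp: indicator_def J_def)
      then show ?thesis by (auto simp: r_def J_def indicator_def)
    qed
    have sV: "(\<lambda>x. \<Sum>y\<in>F. J i y x) square_integrable_on UNIV \<and>
      abs_L2 (\<lambda>x. \<Sum>y\<in>F. J i y x) \<in> V" if "finite F" for F i
      using that
    proof induction
      case empty
      then show ?case using V(1) by (simp add: square_integrable_zero zero_L2_def[symmetric] subspace_0)
    next
      case (insert y F)
      have A: "s i -` {y} \<in> sets lebesgue"
        using simple_functionD(2)[OF s, of i "{y}"] by simp
      have "J i y square_integrable_on UNIV"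
        unfolding J_def using A by (intro square_integrable_indicator fin)
      moreover have "abs_L2 (J i y) \<in> V"
        using step2[OF A, of i y] by (simp add: ind_def J_def)
      ultimately show ?case
        using insert V(1) by (simp add: abs_L2_add square_integrable_add subspace_add)
    qed
    have r: "r i square_integrable_on UNIV" "abs_L2 (r i) \<in> V" for i
    proof -
      have "r i = (\<lambda>x. \<Sum>y\<in>range (s i). J i y x)"
        using r_eq by auto
      then show "r i square_integrable_on UNIV" "abs_L2 (r i) \<in> V"
        using sV[OF fin_s, of i i] by auto
    qed
    have "(\<lambda>i. abs_L2 (r i)) \<longlonglongrightarrow> abs_L2 f"
    proof (rule abs_L2_dominated_convergence[where g = "\<lambda>x. 2 *\<^sub>R f x"])
      show "AE x in lebesgue. (\<lambda>i. r i x) \<longlonglongrightarrow> f x"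
      proof (rule AE_I2)
        fix x :: 'a
        obtain k where k: "norm x < real k" using reals_Archimedean2 by blast
        have "r i x = s i x" if "i \<ge> k" for i
        proof -
          have "x \<in> R i" using k that by (simp add: R_def)
          then show ?thesis by (simp add: r_def)
        qed
        then have "\<forall>\<^sub>F i in sequentially. s i x = r i x"
          by (intro eventually_sequentiallyI[of k]) simp
        with lim[of x] show "(\<lambda>i. r i x) \<longlonglongrightarrow> f x"
          by (rule Lim_transform_eventually)
      qed
    qed (use f r bound in \<open>auto intro!: square_integrable_scaleR simp: r_def indicator_def\<close>)
    with r(2) have "abs_L2 f \<in> V" by (rule closed_sequentially[OF V(2)])
    then show "u \<in> V" by (simp add: f_def abs_rep_L2)
  qed
  then have "V = UNIV" by auto
  then show ?thesis using \<open>countable C\<close> V_def by blast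
qed

instance L2 :: (euclidean_space, euclidean_space) second_countable_topology
proof
  show "\<exists>B::('a, 'b) L2 set set. countable B \<and> open = generate_topology B"
    using countable_total_L2 second_countable_if_countable_total by metis
qed

lemma ex_positive_square_integrable:
  "\<exists>w :: 'a::euclidean_space \<Rightarrow> real. w square_integrable_on UNIV \<and> (\<forall>x. 0 < w x)"
proof -
  obtain h :: "'a \<Rightarrow> ennreal" where h [measurable]: "h \<in> borel_measurable lborel"
    and fin: "(\<integral>\<^sup>+x. h x \<partial>lborel) \<noteq> \<infinity>" and pos: "\<And>x. 0 < h x" "\<And>x. h x < \<infinity>"
    using sigma_finite_measure.Ex_finite_integrable_function[OF sigma_finite_lborel] by auto
  define w where "w x = sqrt (enn2real (h x))" for x
  have w2: "ennreal ((norm (w x))\<^sup>2) = h x" for x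
    using pos[of x] by (simp add: w_def ennreal_enn2real_if)
  have [measurable]: "w \<in> borel_measurable lborel" unfolding w_def by measurable
  have "integrable lborel (\<lambda>x. (norm (w x))\<^sup>2)"
    using fin w2 by (intro integrableI_nonneg) (auto simp: top.not_eq_extremum simp del: real_norm_def)
  then have "integrable lebesgue (\<lambda>x. (norm (w x))\<^sup>2)"
    by (subst integrable_completion) auto
  moreover have "w \<in> borel_measurable lebesgue"
    by (rule measurable_completion) measurable
  moreover have "0 < w x" for x
    using pos[of x] by (simp add: w_def enn2real_positive_iff)
  ultimately show ?thesis unfolding square_integrable_on_UNIV by blast
qed

lemma square_integrable_norm:
  fixes f :: "'a::euclidean_space \<Rightarrow> 'b::euclidean_space"
  shows "f square_integrable_on UNIV \<Longrightarrow> (\<lambda>x. norm (f x)) square_integrable_on UNIV"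
  by (auto simp: square_integrable_on_UNIV)

lemma inner_abs_L2:
  assumes "f square_integrable_on UNIV" "g square_integrable_on UNIV"
  shows "abs_L2 f \<bullet> abs_L2 g = (LINT x|lebesgue. f x \<bullet> g x)"
  using inner_L2.abs_eq[of f g] assms by (simp add: L2_eq_def)

instance L2 :: (euclidean_space, euclidean_space) banach
proof
  fix X :: "nat \<Rightarrow> ('a, 'b) L2" assume X: "Cauchy X"
  define f where "f n = rep_L2 (X n)" for n
  have f: "f n square_integrable_on UNIV" for n
    by (simp add: f_def rep_L2_square_integrable)
  note m [measurable] = f[unfolded square_integrable_on_UNIV, THEN conjunct1]
  have absf: "abs_L2 (f n) = X n" for n by (simp add: f_def abs_rep_L2)
  obtain w :: "'a \<Rightarrow> real" where w: "w square_integrable_on UNIV" "\<And>x. 0 < w x"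
    using ex_positive_square_integrable by blast
  have [measurable]: "w \<in> borel_measurable lebesgue" using w(1) by (simp add: square_integrable_on_UNIV)
  have int: "integrable lebesgue (\<lambda>x. w x *\<^sub>R f n x)" for n
  proof -
    have "integrable lebesgue (\<lambda>x. w x \<bullet> norm (f n x))"
      using w(1) f by (intro square_integrable_inner square_integrable_norm)
    then show ?thesis
      by (rule Bochner_Integration.integrable_bound) (use w(2) in \<open>auto intro!: borel_measurable_scaleR\<close>)
  qed
  have L1: "(LINT x|lebesgue. norm (w x *\<^sub>R f i x - w x *\<^sub>R f j x)) \<le> norm (abs_L2 w) * norm (X i - X j)" for i j
  proof -
    define d where "d x = norm (f i x - f j x)" for x
    have dsi: "(\<lambda>x. f i x - f j x) square_integrable_on UNIV"
      by (intro square_integrable_diff f)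
    then have d: "d square_integrable_on UNIV"
      unfolding d_def by (rule square_integrable_norm)
    have "norm (w x *\<^sub>R f i x - w x *\<^sub>R f j x) = w x \<bullet> d x" for x
      using w(2)[of x] by (simp add: d_def flip: scaleR_diff_right)
    then have "(LINT x|lebesgue. norm (w x *\<^sub>R f i x - w x *\<^sub>R f j x)) = abs_L2 w \<bullet> abs_L2 d"
      by (simp add: inner_abs_L2 w(1) d)
    also have "\<dots> \<le> norm (abs_L2 w) * norm (abs_L2 d)" by (rule norm_cauchy_schwarz)
    also have "norm (abs_L2 d) = norm (X i - X j)"
    proof -
      have "(norm (abs_L2 d))\<^sup>2 = (norm (X i - X j))\<^sup>2"
        using norm_abs_L2_power2[OF d] norm_abs_L2_power2[OF dsi]
        by (simp add: abs_L2_diff f absf d_def)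
      then show ?thesis by simp
    qed
    finally show ?thesis .
  qed
  have "\<exists>N. \<forall>i\<ge>N. \<forall>j\<ge>N. (LINT x|lebesgue. norm (w x *\<^sub>R f i x - w x *\<^sub>R f j x)) < e" if e: "e > 0" for e
  proof -
    define c where "c = norm (abs_L2 w) + 1"
    have c: "c > 0" by (simp add: c_def add_nonneg_pos)
    then obtain N where N: "\<And>i j. i \<ge> N \<Longrightarrow> j \<ge> N \<Longrightarrow> norm (X i - X j) < e / c"
      using CauchyD[OF X, of "e / c"] e by auto
    have "(LINT x|lebesgue. norm (w x *\<^sub>R f i x - w x *\<^sub>R f j x)) < e" if "i \<ge> N" "j \<ge> N" for i j
    proof -
      note L1[of i j]
      also have "norm (abs_L2 w) * norm (X i - X j) \<le> c * norm (X i - X j)"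
        by (intro mult_right_mono) (auto simp: c_def)
      also have "\<dots> < e" using N[OF that] c by (simp add: field_simps)
      finally show ?thesis .
    qed
    then show ?thesis by blast
  qed
  with int obtain r where r: "strict_mono r" "AE x in lebesgue. Cauchy (\<lambda>n. w x *\<^sub>R f (r n) x)"
    by (rule cauchy_L1_AE_cauchy_subseq)
  define F where "F x = lim (\<lambda>n. f (r n) x)" for x
  have [measurable]: "F \<in> borel_measurable lebesgue" unfolding F_def by measurable
  have lim: "AE x in lebesgue. (\<lambda>n. f (r n) x) \<longlonglongrightarrow> F x"
    using r(2)
  proof eventually_elim
    case (elim x)
    then have "convergent (\<lambda>n. w x *\<^sub>R f (r n) x)" by (rule Cauchy_convergent)
    then obtain l where "(\<lambda>n. w x *\<^sub>R f (r n) x) \<longlonglongrightarrow> l" by (auto simp: convergent_def)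
    then have "(\<lambda>n. inverse (w x) *\<^sub>R w x *\<^sub>R f (r n) x) \<longlonglongrightarrow> inverse (w x) *\<^sub>R l"
      by (rule tendsto_scaleR[OF tendsto_const])
    then have "(\<lambda>n. f (r n) x) \<longlonglongrightarrow> inverse (w x) *\<^sub>R l"
      using w(2)[of x] by simp
    then show ?case unfolding F_def by (metis limI)
  qed
  have fatou: "(\<integral>\<^sup>+x. ennreal ((norm (f n x - F x))\<^sup>2) \<partial>lebesgue) \<le> ennreal (e\<^sup>2)"
    if N: "\<And>k. k \<ge> N \<Longrightarrow> norm (X n - X k) \<le> e" for n N e
  proof -
    have "(\<integral>\<^sup>+x. ennreal ((norm (f n x - F x))\<^sup>2) \<partial>lebesgue)
      = (\<integral>\<^sup>+x. liminf (\<lambda>k. ennreal ((norm (f n x - f (r k) x))\<^sup>2)) \<partial>lebesgue)"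
    proof (rule nn_integral_cong_AE)
      show "AE x in lebesgue. ennreal ((norm (f n x - F x))\<^sup>2) = liminf (\<lambda>k. ennreal ((norm (f n x - f (r k) x))\<^sup>2))"
        using lim
      proof eventually_elim
        case (elim x)
        then have "(\<lambda>k. ennreal ((norm (f n x - f (r k) x))\<^sup>2)) \<longlonglongrightarrow> ennreal ((norm (f n x - F x))\<^sup>2)"
          by (intro tendsto_ennrealI tendsto_intros)
        then show ?case using lim_imp_Liminf[OF sequentially_bot] by metis
      qed
    qed
    also have "\<dots> \<le> liminf (\<lambda>k. \<integral>\<^sup>+x. ennreal ((norm (f n x - f (r k) x))\<^sup>2) \<partial>lebesgue)"
      by (intro nn_integral_liminf) measurable
    also have "\<dots> \<le> liminf (\<lambda>k. ennreal (e\<^sup>2))"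
    proof (rule Liminf_mono)
      show "\<forall>\<^sub>F k in sequentially. (\<integral>\<^sup>+x. ennreal ((norm (f n x - f (r k) x))\<^sup>2) \<partial>lebesgue) \<le> ennreal (e\<^sup>2)"
      proof (rule eventually_sequentiallyI[of N])
        fix k assume "k \<ge> N"
        then have "r k \<ge> N" using seq_suble[OF r(1), of k] by simp
        have si: "(\<lambda>x. f n x - f (r k) x) square_integrable_on UNIV"
          by (intro square_integrable_diff f)
        then have "(\<integral>\<^sup>+x. ennreal ((norm (f n x - f (r k) x))\<^sup>2) \<partial>lebesgue)
          = ennreal (LINT x|lebesgue. (norm (f n x - f (r k) x))\<^sup>2)"
          by (intro nn_integral_eq_integral) (auto simp: square_integrable_on_UNIV)
        also have "\<dots> = ennreal ((norm (X n - X (r k)))\<^sup>2)"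
          using norm_abs_L2_power2[OF si] by (simp add: abs_L2_diff f absf)
        also have "\<dots> \<le> ennreal (e\<^sup>2)"
          using N[OF \<open>r k \<ge> N\<close>] by (intro ennreal_leI power_mono) auto
        finally show "(\<integral>\<^sup>+x. ennreal ((norm (f n x - f (r k) x))\<^sup>2) \<partial>lebesgue) \<le> ennreal (e\<^sup>2)" .
      qed
    qed
    also have "\<dots> = ennreal (e\<^sup>2)" by (simp add: Liminf_const)
    finally show ?thesis .
  qed
  have diff_si: "(\<lambda>x. f n x - F x) square_integrable_on UNIV"
    if N: "\<And>k. k \<ge> N \<Longrightarrow> norm (X n - X k) \<le> e" for n N e
  proof -
    have "(\<integral>\<^sup>+x. ennreal ((norm (f n x - F x))\<^sup>2) \<partial>lebesgue) \<le> ennreal (e\<^sup>2)"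
      using N by (rule fatou)
    then have "(\<integral>\<^sup>+x. ennreal ((norm (f n x - F x))\<^sup>2) \<partial>lebesgue) < \<infinity>"
      by (rule le_less_trans) simp
    then show ?thesis
      unfolding square_integrable_on_UNIV by (auto intro!: integrableI_nonneg)
  qed
  obtain N1 where N1: "\<And>k. k \<ge> N1 \<Longrightarrow> norm (X N1 - X k) \<le> 1"
    using CauchyD[OF X, of 1] by (auto intro: less_imp_le)
  have F: "F square_integrable_on UNIV"
    using square_integrable_diff[OF f[of N1] diff_si[OF N1]] by simp
  have "X \<longlonglongrightarrow> abs_L2 F"
  proof (rule LIMSEQ_I)
    fix e :: real assume e: "e > 0"
    obtain N where N: "\<And>n k. n \<ge> N \<Longrightarrow> k \<ge> N \<Longrightarrow> norm (X n - X k) < e / 2"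
      using CauchyD[OF X, of "e / 2"] e by auto
    have "norm (X n - abs_L2 F) < e" if "n \<ge> N" for n
    proof -
      have Nk: "norm (X n - X k) \<le> e / 2" if "k \<ge> N" for k
        using N[OF \<open>n \<ge> N\<close> that] by simp
      have "ennreal ((norm (X n - abs_L2 F))\<^sup>2) = ennreal (LINT x|lebesgue. (norm (f n x - F x))\<^sup>2)"
        using norm_abs_L2_power2[OF diff_si[OF Nk]] by (simp add: abs_L2_diff f F absf)
      also have "\<dots> = (\<integral>\<^sup>+x. ennreal ((norm (f n x - F x))\<^sup>2) \<partial>lebesgue)"
        using diff_si[OF Nk] by (intro nn_integral_eq_integral[symmetric]) (auto simp: square_integrable_on_UNIV)
      also have "\<dots> \<le> ennreal ((e / 2)\<^sup>2)" by (rule fatou[OF Nk])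
      finally have "(norm (X n - abs_L2 F))\<^sup>2 \<le> (e / 2)\<^sup>2" by (simp add: ennreal_le_iff)
      then have "norm (X n - abs_L2 F) \<le> e / 2" using e by (simp add: power2_le_iff_abs_le)
      then show ?thesis using e by simp
    qed
    then show "\<exists>no. \<forall>n\<ge>no. norm (X n - abs_L2 F) < e" by blast
  qed
  then show "convergent X" by (auto simp: convergent_def)
qed

lemma metric_outer_measure_borel:
  fixes H :: "'a::metric_space set \<Rightarrow> ennreal"
  assumes empty: "H {} = 0"
    and mono: "\<And>A B. A \<subseteq> B \<Longrightarrow> H A \<le> H B"
    and subadd: "\<And>A :: nat \<Rightarrow> 'a set. H (\<Union>i. A i) \<le> (\<Sum>i. H (A i))"
    and sep: "\<And>A B e. e > 0 \<Longrightarrow> (\<And>x y. x \<in> A \<Longrightarrow> y \<in> B \<Longrightarrow> e \<le> dist x y) \<Longrightarrow> H A + H B \<le> H (A \<union> B)"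
  shows "measure_space UNIV (sets borel) H"
proof -
  have subadd2: "H (A \<union> B) \<le> H A + H B" for A B
  proof -
    have "(\<Union>i. if i = 0 then A else if i = (1::nat) then B else {}) = A \<union> B"
      by (auto split: if_splits)
    moreover have "(\<Sum>i. H (if i = 0 then A else if i = (1::nat) then B else {}))
      = (\<Sum>i<2. H (if i = 0 then A else if i = (1::nat) then B else {}))"
      by (intro suminf_finite) (auto simp: empty)
    ultimately show ?thesis
      using subadd[of "\<lambda>i. if i = 0 then A else if i = (1::nat) then B else {}"]
      by (simp add: numeral_2_eq_2)
  qed
  have closed: "H (T \<inter> C) + H (T - C) \<le> H T" if C: "closed C" for C T
  proof (cases "C = {} \<or> H T = top")
    case True
    then show ?thesis by (auto simp: empty)
  next
    case False
    then have ne: "C \<noteq> {}" and fin: "H T \<noteq> top" by auto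
    define d where "d x = infdist x C" for x
    have lip: "d x - d y \<le> dist x y" for x y
      using infdist_triangle[of x C y] by (simp add: d_def)
    have d0: "d x = 0" if "x \<in> C" for x using that by (simp add: d_def)
    have dpos: "d x > 0" if "x \<notin> C" for x
      using that C ne by (simp add: d_def infdist_pos_not_in_closed)
    define Tn where "Tn n = {x \<in> T. 1 / real (Suc n) \<le> d x}" for n
    define R where "R k = {x \<in> T. 1 / real (k + 2) \<le> d x \<and> d x < 1 / real (k + 1)}" for k
    have add_R: "(\<Sum>k<N. H (R (2 * k + p))) \<le> H (\<Union>k<N. R (2 * k + p))" for N p
    proof (induction N)
      case (Suc N)
      define m where "m = 2 * N + p"
      have "H (\<Union>k<N. R (2 * k + p)) + H (R m) \<le> H ((\<Union>k<N. R (2 * k + p)) \<union> R m)"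
      proof (cases "N = 0")
        case False
        then have m: "m > 0" by (simp add: m_def)
        show ?thesis
        proof (rule sep[of "1 / real m - 1 / real (m + 1)"])
          show "0 < 1 / real m - 1 / real (m + 1)"
            using m frac_less2[of 1 1 "real m" "real (m + 1)"] by simp
          fix x y assume "x \<in> (\<Union>k<N. R (2 * k + p))" "y \<in> R m"
          then obtain k where k: "k < N" "1 / real (2 * k + p + 2) \<le> d x" "d y < 1 / real (m + 1)"
            by (auto simp: R_def)
          have "1 / real m \<le> 1 / real (2 * k + p + 2)"
            using k(1) m by (intro divide_left_mono) (auto simp: m_def)
          then show "1 / real m - 1 / real (m + 1) \<le> dist x y"
            using k lip[of x y] by simp
        qed
      qed (simp add: empty)
      then show ?case using Suc
        by (simp add: lessThan_Suc Un_commute m_def add.commute) (meson add_left_mono order_trans)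
    qed (simp add: empty)
    have sum_half: "(\<Sum>k<N. H (R (2 * k + p))) \<le> H T" for N p
      by (rule order_trans[OF add_R mono]) (auto simp: R_def)
    have "(\<Sum>k<N. H (R k)) \<le> H T + H T" for N
    proof -
      have "(\<Sum>k<2*N. H (R k)) = (\<Sum>k<N. H (R (2 * k + 0))) + (\<Sum>k<N. H (R (2 * k + 1)))"
        by (induction N) (auto simp: add_ac)
      also have "\<dots> \<le> H T + H T" by (intro add_mono sum_half)
      finally have "(\<Sum>k<2*N. H (R k)) \<le> H T + H T" .
      moreover have "(\<Sum>k<N. H (R k)) \<le> (\<Sum>k<2*N. H (R k))" by (intro sum_mono2) auto
      ultimately show ?thesis by (rule order_trans[rotated])
    qed
    then have "(\<Sum>k. H (R k)) \<le> H T + H T"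
      by (intro suminf_le_const) auto
    then have finS: "(\<Sum>k. H (R k)) \<noteq> top"
      using fin by (metis ennreal_add_eq_top top.extremum_uniqueI)
    have "H (T \<inter> C) + H (T - C) + (\<Sum>k<n. H (R k)) \<le> H T + (\<Sum>k. H (R k))" for n
    proof -
      have "T - C \<subseteq> Tn n \<union> (\<Union>k. R (k + n))"
      proof
        fix x assume x: "x \<in> T - C"
        show "x \<in> Tn n \<union> (\<Union>k. R (k + n))"
        proof (cases "1 / real (Suc n) \<le> d x")
          case True
          then show ?thesis using x by (simp add: Tn_def)
        next
          case False
          define P where "P k \<longleftrightarrow> 1 / real (k + 2) \<le> d x" for k
          have "\<exists>k. P k"
          proof -
            obtain k where "inverse (real (Suc k)) < d x"
              using reals_Archimedean[OF dpos] x by auto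
            moreover have "1 / real (k + 2) \<le> inverse (real (Suc k))"
              by (simp add: field_simps)
            ultimately show ?thesis by (auto simp: P_def intro!: exI[of _ k])
          qed
          define k where "k = (LEAST k. P k)"
          have Pk: "P k" unfolding k_def using \<open>\<exists>k. P k\<close> by (rule LeastI_ex)
          have nP: "\<not> P j" if "j < k" for j using that not_less_Least[of j P] by (simp add: k_def)
          have up: "d x < 1 / real (k + 1)"
          proof (cases k)
            case 0
            have "d x < 1 / real (Suc n)" using False by simp
            also have "\<dots> \<le> 1" by simp
            finally show ?thesis using 0 by simp
          next
            case (Suc j)
            then show ?thesis using nP[of j] by (simp add: P_def not_le add.commute)
          qed
          have "n \<le> k"
          proof (rule ccontr)
            assume "\<not> n \<le> k"
            then have "1 / real (Suc n) \<le> 1 / real (k + 2)" by (intro divide_left_mono) auto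
            then show False using Pk False by (simp add: P_def)
          qed
          then show ?thesis using Pk up x
            by (intro UnI2 UN_I[of "k - n"]) (auto simp: R_def P_def)
        qed
      qed
      then have "H (T - C) \<le> H (Tn n \<union> (\<Union>k. R (k + n)))" by (rule mono)
      also have "\<dots> \<le> H (Tn n) + (\<Sum>k. H (R (k + n)))"
        using subadd2 subadd by (meson add_left_mono order_trans)
      finally have 1: "H (T - C) \<le> H (Tn n) + (\<Sum>k. H (R (k + n)))" .
      have "H (T \<inter> C) + H (Tn n) \<le> H ((T \<inter> C) \<union> Tn n)"
      proof (rule sep[of "1 / real (Suc n)"])
        fix x y assume "x \<in> T \<inter> C" "y \<in> Tn n"
        then show "1 / real (Suc n) \<le> dist x y"
          using lip[of y x] d0[of x] by (simp add: Tn_def dist_commute)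
      qed simp
      also have "\<dots> \<le> H T" by (rule mono) (auto simp: Tn_def)
      finally have 2: "H (T \<inter> C) + H (Tn n) \<le> H T" .
      have "H (T \<inter> C) + H (T - C) + (\<Sum>k<n. H (R k))
        \<le> H (T \<inter> C) + (H (Tn n) + (\<Sum>k. H (R (k + n)))) + (\<Sum>k<n. H (R k))"
        using 1 by (intro add_mono) auto
      also have "\<dots> = (H (T \<inter> C) + H (Tn n)) + ((\<Sum>k. H (R (k + n))) + (\<Sum>k<n. H (R k)))"
        by (simp add: add_ac)
      also have "(\<Sum>k. H (R (k + n))) + (\<Sum>k<n. H (R k)) = (\<Sum>k. H (R k))"
        using suminf_offset[of "\<lambda>k. H (R k)" n] by simp
      finally show ?thesis using 2 by (meson add_right_mono order_trans)
    qed
    moreover have "(\<lambda>n. H (T \<inter> C) + H (T - C) + (\<Sum>k<n. H (R k))) \<longlonglongrightarrow> H (T \<inter> C) + H (T - C) + (\<Sum>k. H (R k))"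
      by (intro tendsto_add tendsto_const summable_LIMSEQ) simp
    ultimately have "H (T \<inter> C) + H (T - C) + (\<Sum>k. H (R k)) \<le> H T + (\<Sum>k. H (R k))"
      by (intro LIMSEQ_le_const2) auto
    then show ?thesis
      using finS by (simp add: add.commute[of _ "\<Sum>k. H (R k)"] ennreal_add_left_cancel_le)
  qed
  interpret P: sigma_algebra UNIV "Pow (UNIV :: 'a set)" by (rule sigma_algebra_Pow)
  let ?L = "lambda_system UNIV (Pow UNIV) H"
  have "outer_measure_space (Pow UNIV) H"
    using empty mono subadd
    by (auto simp: outer_measure_space_def positive_def increasing_def countably_subadditive_def)
  then have ms: "measure_space UNIV ?L H" by (rule P.caratheodory_lemma)
  have "C \<in> ?L" if "closed C" for C
    unfolding P.lambda_system_eq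
  proof (clarsimp)
    fix x
    have "H x \<le> H (x \<inter> C) + H (x - C)"
      using subadd2[of "x \<inter> C" "x - C"] by (simp add: Int_Diff_Un)
    then show "H (x \<inter> C) + H (x - C) = H x"
      using closed[OF that, of x] by (intro antisym)
  qed
  then have "sigma_sets UNIV (Collect closed) \<subseteq> ?L"
    using ms by (intro sigma_algebra.sigma_sets_subset) (auto simp: measure_space_def)
  then have sub: "sets (borel :: 'a measure) \<subseteq> ?L"
    by (simp add: borel_eq_closed)
  show ?thesis
    unfolding measure_space_def
  proof (intro conjI)
    show "sigma_algebra UNIV (sets (borel :: 'a measure))"
      using sets.sigma_algebra_axioms[of "borel :: 'a measure"] by simp
    show "positive (sets borel) H" by (simp add: positive_def empty)
    show "countably_additive (sets borel) H"
      using ms sub by (auto simp: measure_space_def countably_additive_def)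
  qed
qed

text \<open>
  Two-dimensional Hausdorff measure, normalised so that it is surface area on Lipschitz
  surfaces. Since \<open>measure_of\<close> yields the null measure for a set function that is not
  a measure, \<open>emeasure_hausdorff2\<close> below shows that this case does not arise.
\<close>

definition hausdorff2_pre :: "real \<Rightarrow> 'a::metric_space set \<Rightarrow> ennreal"
  where "hausdorff2_pre \<delta> S =
    (INF U\<in>{U :: nat \<Rightarrow> 'a set. S \<subseteq> (\<Union>n. U n) \<and> (\<forall>n. bounded (U n) \<and> diameter (U n) \<le> \<delta>)}.
      \<Sum>n. ennreal (pi / 4 * (diameter (U n))\<^sup>2))"

definition hausdorff2 :: "'a::metric_space measure"
  where "hausdorff2 = measure_of UNIV (sets borel) (\<lambda>S. SUP \<delta>\<in>{0<..}. hausdorff2_pre \<delta> S)"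

lemma hausdorff2_pre_antimono:
  "\<delta> \<le> \<delta>' \<Longrightarrow> hausdorff2_pre \<delta>' S \<le> hausdorff2_pre \<delta> S"
  unfolding hausdorff2_pre_def by (rule INF_superset_mono) (auto intro: order_trans)

lemma hausdorff2_pre_subadd:
  fixes A :: "nat \<Rightarrow> 'a::metric_space set"
  shows "hausdorff2_pre \<delta> (\<Union>i. A i) \<le> (\<Sum>i. hausdorff2_pre \<delta> (A i))"
proof (rule ennreal_le_epsilon)
  fix e :: real assume e: "e > 0" and fin: "(\<Sum>i. hausdorff2_pre \<delta> (A i)) < top"
  define c where "c U = ennreal (pi / 4 * (diameter U)\<^sup>2)" for U :: "'a set"
  define cov where "cov S = {U :: nat \<Rightarrow> 'a set. S \<subseteq> (\<Union>n. U n) \<and> (\<forall>n. bounded (U n) \<and> diameter (U n) \<le> \<delta>)}" for S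
  have pre: "hausdorff2_pre \<delta> S = (INF U\<in>cov S. \<Sum>n. c (U n))" for S
    by (simp add: hausdorff2_pre_def cov_def c_def)
  have "\<exists>U\<in>cov (A i). (\<Sum>n. c (U n)) \<le> hausdorff2_pre \<delta> (A i) + ennreal (e * (1/2) ^ Suc i)" for i
  proof -
    have "hausdorff2_pre \<delta> (A i) < top"
      using fin by (rule ennreal_suminf_lessD)
    then have "(INF U\<in>cov (A i). \<Sum>n. c (U n)) < hausdorff2_pre \<delta> (A i) + ennreal (e * (1/2) ^ Suc i)"
      unfolding pre[symmetric] using e
      by (metis add.right_neutral ennreal_add_left_cancel_less ennreal_less_zero_iff infinity_ennreal_def
          mult_pos_pos order_less_irrefl zero_less_divide_1_iff zero_less_numeral zero_less_power)
    then show ?thesis unfolding INF_less_iff by (auto intro: less_imp_le)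
  qed
  then obtain U where U: "\<And>i. U i \<in> cov (A i)"
    "\<And>i. (\<Sum>n. c (U i n)) \<le> hausdorff2_pre \<delta> (A i) + ennreal (e * (1/2) ^ Suc i)"
    by metis
  define W where "W k = case_prod U (prod_decode k)" for k
  have "W \<in> cov (\<Union>i. A i)"
    unfolding cov_def
  proof (intro CollectI conjI allI)
    show "(\<Union>i. A i) \<subseteq> (\<Union>k. W k)"
    proof
      fix x assume "x \<in> (\<Union>i. A i)"
      then obtain i n where "x \<in> U i n" using U(1) by (fastforce simp: cov_def)
      then show "x \<in> (\<Union>k. W k)"
        by (intro UN_I[of "prod_encode (i, n)"]) (auto simp: W_def)
    qed
    show "bounded (W k)" "diameter (W k) \<le> \<delta>" for k
      using U(1) by (auto simp: W_def cov_def split: prod.split)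
  qed
  then have "hausdorff2_pre \<delta> (\<Union>i. A i) \<le> (\<Sum>k. c (W k))"
    unfolding pre by (rule INF_lower)
  also have "\<dots> = (\<Sum>i. \<Sum>n. c (U i n))"
    unfolding W_def using suminf_ennreal_2dimen[of "\<lambda>i. \<Sum>n. c (U i n)" "\<lambda>p. c (case_prod U p)"] by simp
  also have "\<dots> \<le> (\<Sum>i. hausdorff2_pre \<delta> (A i) + ennreal (e * (1/2) ^ Suc i))"
    by (intro suminf_le U(2)) auto
  also have "\<dots> = (\<Sum>i. hausdorff2_pre \<delta> (A i)) + (\<Sum>i. ennreal (e * (1/2) ^ Suc i))"
    by (intro suminf_add[symmetric]) auto
  also have "(\<Sum>i. ennreal (e * (1/2) ^ Suc i)) = ennreal e"
    using sums_mult[OF power_half_series, of e] e by (intro suminf_ennreal_eq) auto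
  finally show "hausdorff2_pre \<delta> (\<Union>i. A i) \<le> (\<Sum>i. hausdorff2_pre \<delta> (A i)) + ennreal e" .
qed

lemma hausdorff2_pre_sep:
  fixes A B :: "'a::metric_space set"
  assumes e: "\<delta> < e" and sep: "\<And>x y. x \<in> A \<Longrightarrow> y \<in> B \<Longrightarrow> e \<le> dist x y"
  shows "hausdorff2_pre \<delta> A + hausdorff2_pre \<delta> B \<le> hausdorff2_pre \<delta> (A \<union> B)"
proof -
  define c where "c U = ennreal (pi / 4 * (diameter U)\<^sup>2)" for U :: "'a set"
  have c0: "c {} = 0" by (simp add: c_def)
  define cov where "cov S = {U :: nat \<Rightarrow> 'a set. S \<subseteq> (\<Union>n. U n) \<and> (\<forall>n. bounded (U n) \<and> diameter (U n) \<le> \<delta>)}" for S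
  have pre: "hausdorff2_pre \<delta> S = (INF U\<in>cov S. \<Sum>n. c (U n))" for S
    by (simp add: hausdorff2_pre_def cov_def c_def)
  show ?thesis
    unfolding pre[of "A \<union> B"]
  proof (rule INF_greatest)
    fix U assume U: "U \<in> cov (A \<union> B)"
    have dge: "0 \<le> \<delta>" using U diameter_ge_0[of "U 0"] by (auto simp: cov_def intro: order_trans)
    define V where "V S n = (if U n \<inter> S = {} then {} else U n)" for S n
    have "V A \<in> cov A" "V B \<in> cov B"
      using U dge by (fastforce simp: cov_def V_def)+
    then have "hausdorff2_pre \<delta> A + hausdorff2_pre \<delta> B \<le> (\<Sum>n. c (V A n)) + (\<Sum>n. c (V B n))"
      unfolding pre by (intro add_mono INF_lower)
    also have "\<dots> = (\<Sum>n. c (V A n) + c (V B n))" by (intro suminf_add) auto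
    also have "\<dots> \<le> (\<Sum>n. c (U n))"
    proof (intro suminf_le)
      fix n
      have "U n \<inter> A = {} \<or> U n \<inter> B = {}"
      proof (rule ccontr)
        assume "\<not> ?thesis"
        then obtain x y where "x \<in> U n" "x \<in> A" "y \<in> U n" "y \<in> B" by auto
        then show False
          using sep[of x y] e U diameter_bounded_bound[of "U n" x y]
          by (auto simp: cov_def dest: spec[of _ n])
      qed
      then show "c (V A n) + c (V B n) \<le> c (U n)" by (auto simp: V_def c0)
    qed auto
    finally show "hausdorff2_pre \<delta> A + hausdorff2_pre \<delta> B \<le> (\<Sum>n. c (U n))" .
  qed
qed

lemma measure_space_hausdorff2:
  "measure_space UNIV (sets borel) (\<lambda>S :: 'a::metric_space set. SUP \<delta>\<in>{0<..}. hausdorff2_pre \<delta> S)"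
proof (rule metric_outer_measure_borel)
  have "hausdorff2_pre \<delta> ({} :: 'a set) = 0" if "0 < \<delta>" for \<delta>
  proof -
    have "hausdorff2_pre \<delta> ({} :: 'a set) \<le> (\<Sum>n::nat. ennreal (pi / 4 * (diameter ({} :: 'a set))\<^sup>2))"
      unfolding hausdorff2_pre_def by (rule INF_lower) (use that in auto)
    then show ?thesis by simp
  qed
  then show "(SUP \<delta>\<in>{0<..}. hausdorff2_pre \<delta> ({} :: 'a set)) = 0" by simp
next
  fix A B :: "'a set" assume "A \<subseteq> B"
  then show "(SUP \<delta>\<in>{0<..}. hausdorff2_pre \<delta> A) \<le> (SUP \<delta>\<in>{0<..}. hausdorff2_pre \<delta> B)"
    unfolding hausdorff2_pre_def by (intro SUP_mono' INF_superset_mono) auto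
next
  fix A :: "nat \<Rightarrow> 'a set"
  show "(SUP \<delta>\<in>{0<..}. hausdorff2_pre \<delta> (\<Union>i. A i)) \<le> (\<Sum>i. SUP \<delta>\<in>{0<..}. hausdorff2_pre \<delta> (A i))"
  proof (rule SUP_least)
    fix \<delta> :: real assume "\<delta> \<in> {0<..}"
    then have "(\<Sum>i. hausdorff2_pre \<delta> (A i)) \<le> (\<Sum>i. SUP \<delta>\<in>{0<..}. hausdorff2_pre \<delta> (A i))"
      by (intro suminf_le SUP_upper) auto
    with hausdorff2_pre_subadd show "hausdorff2_pre \<delta> (\<Union>i. A i) \<le> (\<Sum>i. SUP \<delta>\<in>{0<..}. hausdorff2_pre \<delta> (A i))"
      by (rule order_trans)
  qed
next
  fix A B :: "'a set" and e :: real
  assume e: "e > 0" and sep: "\<And>x y. x \<in> A \<Longrightarrow> y \<in> B \<Longrightarrow> e \<le> dist x y"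
  have "(SUP \<delta>\<in>{0<..}. hausdorff2_pre \<delta> A) + (SUP \<delta>\<in>{0<..}. hausdorff2_pre \<delta> B)
    = (SUP \<delta>\<in>{0<..}. hausdorff2_pre \<delta> A + hausdorff2_pre \<delta> B)"
  proof (rule SUP_add_directed_ennreal[symmetric])
    fix i j :: real assume "i \<in> {0<..}" "j \<in> {0<..}"
    then show "\<exists>k\<in>{0<..}. hausdorff2_pre i A + hausdorff2_pre j B \<le> hausdorff2_pre k A + hausdorff2_pre k B"
      by (intro bexI[of _ "min i j"] add_mono hausdorff2_pre_antimono) auto
  qed
  also have "\<dots> \<le> (SUP \<delta>\<in>{0<..}. hausdorff2_pre \<delta> (A \<union> B))"
  proof (rule SUP_mono)
    fix \<delta> :: real assume "\<delta> \<in> {0<..}"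
    then have "hausdorff2_pre \<delta> A + hausdorff2_pre \<delta> B
      \<le> hausdorff2_pre (min \<delta> (e / 2)) A + hausdorff2_pre (min \<delta> (e / 2)) B"
      by (intro add_mono hausdorff2_pre_antimono) auto
    also have "\<dots> \<le> hausdorff2_pre (min \<delta> (e / 2)) (A \<union> B)"
      using e sep by (intro hausdorff2_pre_sep[of _ e]) auto
    finally show "\<exists>m\<in>{0<..}. hausdorff2_pre \<delta> A + hausdorff2_pre \<delta> B \<le> hausdorff2_pre m (A \<union> B)"
      using e \<open>\<delta> \<in> {0<..}\<close> by (intro bexI[of _ "min \<delta> (e / 2)"]) auto
  qed
  finally show "(SUP \<delta>\<in>{0<..}. hausdorff2_pre \<delta> A) + (SUP \<delta>\<in>{0<..}. hausdorff2_pre \<delta> B)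
    \<le> (SUP \<delta>\<in>{0<..}. hausdorff2_pre \<delta> (A \<union> B))" .
qed

lemma emeasure_hausdorff2:
  "S \<in> sets borel \<Longrightarrow> emeasure hausdorff2 S = (SUP \<delta>\<in>{0<..}. hausdorff2_pre \<delta> S)"
  unfolding hausdorff2_def using measure_space_hausdorff2
  by (intro emeasure_measure_of_sigma) (auto simp: measure_space_def)

lemma sets_hausdorff2: "sets hausdorff2 = sets borel"
  using sets.sigma_sets_eq[of borel] by (simp add: hausdorff2_def sets_measure_of)

text \<open>All partial derivatives up to order \<^term>\<open>k\<close> exist and are continuous.\<close>

primrec Ck :: "nat \<Rightarrow> ('a::euclidean_space \<Rightarrow> 'b::real_normed_vector) \<Rightarrow> bool"
  where
    "Ck 0 f \<longleftrightarrow> continuous_on UNIV f"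
  | "Ck (Suc k) f \<longleftrightarrow> (\<forall>x. f differentiable (at x)) \<and>
       (\<forall>b\<in>Basis. Ck k (\<lambda>x. frechet_derivative f (at x) b))"

definition test_function :: "'a::euclidean_space set \<Rightarrow> ('a \<Rightarrow> 'b::real_normed_vector) \<Rightarrow> bool"
  where "test_function U \<phi> \<longleftrightarrow> (\<forall>k. Ck k \<phi>) \<and>
    (\<exists>K. compact K \<and> K \<subseteq> U \<and> (\<forall>x. x \<notin> K \<longrightarrow> \<phi> x = 0))"

definition pd :: "3 \<Rightarrow> (real^3 \<Rightarrow> 'b::real_normed_vector) \<Rightarrow> real^3 \<Rightarrow> 'b"
  where "pd j f x = frechet_derivative f (at x) (axis j 1)"

definition grad :: "(real^3 \<Rightarrow> real) \<Rightarrow> real^3 \<Rightarrow> real^3"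
  where "grad f x = (\<chi> j. pd j f x)"

definition curl :: "(real^3 \<Rightarrow> real^3) \<Rightarrow> real^3 \<Rightarrow> real^3"
  where "curl f x = vector
    [pd 2 f x $ 3 - pd 3 f x $ 2, pd 3 f x $ 1 - pd 1 f x $ 3, pd 1 f x $ 2 - pd 2 f x $ 1]"

definition lipschitz_boundary :: "(real^3) set \<Rightarrow> bool"
  where "lipschitz_boundary U \<longleftrightarrow> (\<forall>x\<in>frontier U.
    \<exists>N (f :: real^3 \<Rightarrow> real^3) (g :: real^2 \<Rightarrow> real) L.
      open N \<and> x \<in> N \<and> orthogonal_transformation f \<and> L-lipschitz_on UNIV g \<and>
      U \<inter> N = {y \<in> N. f y $ 3 < g (vector [f y $ 1, f y $ 2])})"

text \<open>
  The subdomains of the insulating region are the connected components of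
  \<^term>\<open>\<Omega> - closure \<Omega>C\<close>. An internal one has its closure inside \<^term>\<open>\<Omega>\<close>; the
  external one reaches \<^term>\<open>frontier \<Omega>\<close>.
\<close>

definition internal_subdomains :: "(real^3) set \<Rightarrow> (real^3) set \<Rightarrow> (real^3) set set"
  where "internal_subdomains \<Omega> \<Omega>C = {U \<in> components (\<Omega> - closure \<Omega>C). closure U \<subseteq> \<Omega>}"

definition external_subdomains :: "(real^3) set \<Rightarrow> (real^3) set \<Rightarrow> (real^3) set set"
  where "external_subdomains \<Omega> \<Omega>C = {U \<in> components (\<Omega> - closure \<Omega>C). \<not> closure U \<subseteq> \<Omega>}"

definition geometry :: "(real^3) set \<Rightarrow> (real^3) set \<Rightarrow> bool"
  where "geometry \<Omega> \<Omega>C \<longleftrightarrow>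
    open \<Omega> \<and> \<Omega> \<noteq> {} \<and> bounded \<Omega> \<and> simply_connected \<Omega> \<and> lipschitz_boundary \<Omega> \<and>
    open \<Omega>C \<and> connected \<Omega>C \<and> closure \<Omega>C \<subseteq> \<Omega> \<and> lipschitz_boundary \<Omega>C \<and>
    lipschitz_boundary (\<Omega> - closure \<Omega>C) \<and>
    finite (internal_subdomains \<Omega> \<Omega>C) \<and>
    (\<forall>U\<in>internal_subdomains \<Omega> \<Omega>C. connected (frontier U)) \<and>
    (\<exists>\<Omega>ext. external_subdomains \<Omega> \<Omega>C = {\<Omega>ext} \<and>
      closure \<Omega>ext \<inter> closure \<Omega>C \<noteq> frontier \<Omega> \<and>
      components (frontier \<Omega>ext) = {closure \<Omega>ext \<inter> closure \<Omega>C, frontier \<Omega>})"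

text \<open>
  An internal subdomain contributes its whole boundary, the external one only the part that
  it shares with the conductor.
\<close>

definition interfaces :: "(real^3) set \<Rightarrow> (real^3) set \<Rightarrow> (real^3) set set"
  where "interfaces \<Omega> \<Omega>C = frontier ` internal_subdomains \<Omega> \<Omega>C \<union>
    (\<lambda>U. closure U \<inter> closure \<Omega>C) ` external_subdomains \<Omega> \<Omega>C"

text \<open>
  A field on \<^term>\<open>\<Omega>\<close> is identified with its extension by zero, so that \<open>L\<^sup>2(\<Omega>)\<close> is the
  closed subspace \<open>L2_space \<Omega>\<close> of \<open>L\<^sup>2(\<real>\<^sup>3)\<close>, with the induced inner product and norm.
\<close>

definition L2_space :: "'a::euclidean_space set \<Rightarrow> ('a, 'b::euclidean_space) L2 set"
  where "L2_space \<Omega> = {u. AE x in lebesgue. x \<notin> \<Omega> \<longrightarrow> rep_L2 u x = 0}"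

definition L2_of :: "'a::euclidean_space set \<Rightarrow> ('a \<Rightarrow> 'b::euclidean_space) \<Rightarrow> ('a, 'b) L2"
  where "L2_of \<Omega> f = abs_L2 (\<lambda>x. if x \<in> \<Omega> then f x else 0)"

text \<open>
  \<open>H\<^sup>1\<^sub>0(\<Omega>)\<close> is the closure of the test functions in the \<open>H\<^sup>1\<close> norm; its elements are
  represented as pairs \<open>(\<psi>, \<nabla>\<psi>)\<close>.
\<close>

definition H1_pair :: "(real^3) set \<Rightarrow> (real^3 \<Rightarrow> real) \<Rightarrow> (real^3, real) L2 \<times> (real^3, real^3) L2"
  where "H1_pair \<Omega> \<phi> = (L2_of \<Omega> \<phi>, L2_of \<Omega> (grad \<phi>))"

definition H10 :: "(real^3) set \<Rightarrow> ((real^3, real) L2 \<times> (real^3, real^3) L2) set"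
  where "H10 \<Omega> = closure (H1_pair \<Omega> ` {\<phi>. test_function \<Omega> \<phi>})"

text \<open>
  The trace on a Lipschitz surface \<open>\<Gamma> \<subseteq> \<Omega>\<close> is the continuous extension, from \<open>H\<^sup>1\<^sub>0(\<Omega>)\<close> to
  \<open>L\<^sup>2(\<Gamma>)\<close> with respect to surface measure, of the restriction of test functions.
\<close>

definition constant_trace ::
    "(real^3) set \<Rightarrow> (real^3) set \<Rightarrow> (real^3, real) L2 \<times> (real^3, real^3) L2 \<Rightarrow> bool"
  where "constant_trace \<Omega> \<Gamma> p \<longleftrightarrow> (\<exists>c \<phi>. (\<forall>n::nat. test_function \<Omega> (\<phi> n)) \<and>
    (\<lambda>n. H1_pair \<Omega> (\<phi> n)) \<longlonglongrightarrow> p \<and>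
    (\<lambda>n. \<integral>\<^sup>+x\<in>\<Gamma>. ennreal ((\<phi> n x - c)\<^sup>2) \<partial>hausdorff2) \<longlonglongrightarrow> 0)"

definition X_space :: "(real^3) set \<Rightarrow> (real^3) set \<Rightarrow> (real^3, real^3) L2 set"
  where "X_space \<Omega> \<Omega>C = {A \<in> L2_space \<Omega>. \<forall>(\<psi>, g)\<in>H10 \<Omega>.
    (\<forall>\<Gamma>\<in>interfaces \<Omega> \<Omega>C. constant_trace \<Omega> \<Gamma> (\<psi>, g)) \<longrightarrow> A \<bullet> g = 0}"

definition has_weak_curl ::
    "(real^3) set \<Rightarrow> (real^3, real^3) L2 \<Rightarrow> (real^3, real^3) L2 \<Rightarrow> bool"
  where "has_weak_curl \<Omega> A B \<longleftrightarrow> (\<forall>\<phi>. test_function \<Omega> \<phi> \<longrightarrow>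
    (LINT x|lebesgue_on \<Omega>. rep_L2 A x \<bullet> curl \<phi> x) = (LINT x|lebesgue_on \<Omega>. rep_L2 B x \<bullet> \<phi> x))"

definition H_curl :: "(real^3) set \<Rightarrow> (real^3, real^3) L2 set"
  where "H_curl \<Omega> = {A \<in> L2_space \<Omega>. \<exists>B\<in>L2_space \<Omega>. has_weak_curl \<Omega> A B}"

definition wcurl :: "(real^3) set \<Rightarrow> (real^3, real^3) L2 \<Rightarrow> (real^3, real^3) L2"
  where "wcurl \<Omega> A = (THE B. B \<in> L2_space \<Omega> \<and> has_weak_curl \<Omega> A B)"

text \<open>
  The tangential trace of \<^term>\<open>A\<close> is the functional on the boundary values of \<open>\<phi>\<close> given by
  Green's formula \<open>\<integral>\<^bsub>\<Omega>\<^esub> (\<nabla>\<times>A) \<cdot> \<phi> - A \<cdot> (\<nabla>\<times>\<phi>)\<close>; here \<open>\<phi>\<close> is not required to vanish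
  on the boundary of \<^term>\<open>\<Omega>\<close>.
\<close>

definition H0_curl :: "(real^3) set \<Rightarrow> (real^3, real^3) L2 set"
  where "H0_curl \<Omega> = {A \<in> H_curl \<Omega>. \<forall>\<phi>. test_function UNIV \<phi> \<longrightarrow>
    (LINT x|lebesgue_on \<Omega>. rep_L2 (wcurl \<Omega> A) x \<bullet> \<phi> x - rep_L2 A x \<bullet> curl \<phi> x) = 0}"

definition X0_curl :: "(real^3) set \<Rightarrow> (real^3) set \<Rightarrow> (real^3, real^3) L2 set"
  where "X0_curl \<Omega> \<Omega>C = H0_curl \<Omega> \<inter> X_space \<Omega> \<Omega>C"

text \<open>
  On separable Banach spaces, such as \<open>L2\<close>, Borel measurability with respect to the Lebesgue
  sets is strong measurability, so \<open>square_integrable_on\<close> describes Bochner spaces, too.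
\<close>

definition L2_loc :: "real \<Rightarrow> (real \<Rightarrow> 'b::real_normed_vector) \<Rightarrow> bool"
  where "L2_loc T u \<longleftrightarrow> (\<forall>\<delta>. 0 < \<delta> \<and> \<delta> < T \<longrightarrow> u square_integrable_on {\<delta>..T})"

definition has_weak_derivative ::
    "(real \<Rightarrow> 'b::{banach, second_countable_topology}) \<Rightarrow> (real \<Rightarrow> 'b) \<Rightarrow> real \<Rightarrow> bool"
  where "has_weak_derivative u g T \<longleftrightarrow>
    (\<forall>a b. 0 < a \<and> a < b \<and> b < T \<longrightarrow>
      integrable (lebesgue_on {a..b}) u \<and> integrable (lebesgue_on {a..b}) g) \<and>
    (\<forall>\<phi> :: real \<Rightarrow> real. test_function {0<..<T} \<phi> \<longrightarrow>
      (LINT t|lebesgue_on {0<..<T}. deriv \<phi> t *\<^sub>R u t)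
        = - (LINT t|lebesgue_on {0<..<T}. \<phi> t *\<^sub>R g t))"

text \<open>
  For a closed subspace \<^term>\<open>V\<close>, such as \<open>X_space \<Omega> \<Omega>C\<close>, Bochner integrals of
  \<^term>\<open>V\<close>-valued functions in \<^term>\<open>V\<close> and in the ambient space agree, so it suffices to
  require that the function and its weak derivative take values in \<^term>\<open>V\<close>.
\<close>

definition H1_loc :: "real \<Rightarrow> 'b::{banach, second_countable_topology} set \<Rightarrow> (real \<Rightarrow> 'b) \<Rightarrow> bool"
  where "H1_loc T V u \<longleftrightarrow> L2_loc T u \<and> (AE t in lebesgue_on {0<..T}. u t \<in> V) \<and>
    (\<exists>g. L2_loc T g \<and> (AE t in lebesgue_on {0<..T}. g t \<in> V) \<and> has_weak_derivative u g T)"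

definition L2_norm_on :: "real set \<Rightarrow> (real \<Rightarrow> 'b::real_normed_vector) \<Rightarrow> real"
  where "L2_norm_on I u = sqrt (LINT t|lebesgue_on I. (norm (u t))\<^sup>2)"

definition Ico :: "ereal \<Rightarrow> real set"
  where "Ico T = {t. 0 \<le> t \<and> ereal t < T}"

definition flux :: "(real^3) set \<Rightarrow> (real^3 \<Rightarrow> real^'m^3) \<Rightarrow> (real^3, real^3) L2 \<Rightarrow> real^'m"
  where "flux \<Omega> X A = (LINT x|lebesgue_on \<Omega>. transpose (X x) *v rep_L2 A x)"

text \<open>
  Since \<^term>\<open>A\<close> is determined only for almost every time, continuity and the initial values
  refer to the continuous representatives \<^term>\<open>w\<close> and \<^term>\<open>y\<close> of \<open>\<sigma>A\<close> and
  \<open>\<integral>\<^bsub>\<Omega>\<^esub> \<chi>\<^sup>TA\<close>. The time derivatives in the equations are weak derivatives on \<open>(0,T)\<close>.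
  The matrix field \<open>\<chi>\<close> is called \<^term>\<open>X\<close>.
\<close>

definition mqs_solution ::
    "(real^3) set \<Rightarrow> (real^3) set \<Rightarrow> (real^3 \<Rightarrow> real) \<Rightarrow> (real^3 \<Rightarrow> real \<Rightarrow> real) \<Rightarrow> real^'m^'m \<Rightarrow>
     (real^3 \<Rightarrow> real^'m^3) \<Rightarrow> (real^3, real^3) L2 \<Rightarrow> (real \<Rightarrow> real^'m) \<Rightarrow> real \<Rightarrow>
     (real \<Rightarrow> (real^3, real^3) L2) \<Rightarrow> (real \<Rightarrow> real^'m) \<Rightarrow> bool"
  where "mqs_solution \<Omega> \<Omega>C \<sigma> \<nu> R X A\<^sub>0 v T A i \<longleftrightarrow>
    (\<exists>w. continuous_on {0..T} w \<and> w ` {0..T} \<subseteq> X_space \<Omega> \<Omega>C \<and> H1_loc T (X_space \<Omega> \<Omega>C) w \<and>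
      (AE t in lebesgue_on {0..T}. w t = L2_of \<Omega> (\<lambda>x. \<sigma> x *\<^sub>R rep_L2 (A t) x)) \<and>
      w 0 = L2_of \<Omega> (\<lambda>x. \<sigma> x *\<^sub>R rep_L2 A\<^sub>0 x)) \<and>
    (\<exists>y. continuous_on {0..T} y \<and> H1_loc T UNIV y \<and>
      (AE t in lebesgue_on {0..T}. y t = flux \<Omega> X (A t)) \<and>
      y 0 = flux \<Omega> X A\<^sub>0) \<and>
    (AE t in lebesgue_on {0..T}. A t \<in> X0_curl \<Omega> \<Omega>C) \<and>
    (\<lambda>t. (A t, wcurl \<Omega> (A t))) square_integrable_on {0..T} \<and>
    L2_loc T i \<and>
    (\<forall>F\<in>X0_curl \<Omega> \<Omega>C. \<exists>d.
      has_weak_derivative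
        (\<lambda>t. LINT x|lebesgue_on \<Omega>. (\<sigma> x *\<^sub>R rep_L2 (A t) x) \<bullet> rep_L2 F x) d T \<and>
      (AE t in lebesgue_on {0..T}.
        d t + (LINT x|lebesgue_on \<Omega>.
                (\<nu> x (norm (rep_L2 (wcurl \<Omega> (A t)) x)) *\<^sub>R rep_L2 (wcurl \<Omega> (A t)) x)
                  \<bullet> rep_L2 (wcurl \<Omega> F) x)
          = (LINT x|lebesgue_on \<Omega>. (X x *v i t) \<bullet> rep_L2 F x))) \<and>
    (\<exists>d. has_weak_derivative (\<lambda>t. flux \<Omega> X (A t)) d T \<and>
      (AE t in lebesgue_on {0..T}. d t + R *v i t = v t))"

definition mqs_solution_Ico ::
    "(real^3) set \<Rightarrow> (real^3) set \<Rightarrow> (real^3 \<Rightarrow> real) \<Rightarrow> (real^3 \<Rightarrow> real \<Rightarrow> real) \<Rightarrow> real^'m^'m \<Rightarrow>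
     (real^3 \<Rightarrow> real^'m^3) \<Rightarrow> (real^3, real^3) L2 \<Rightarrow> (real \<Rightarrow> real^'m) \<Rightarrow> ereal \<Rightarrow>
     (real \<Rightarrow> (real^3, real^3) L2) \<Rightarrow> (real \<Rightarrow> real^'m) \<Rightarrow> bool"
  where "mqs_solution_Ico \<Omega> \<Omega>C \<sigma> \<nu> R X A\<^sub>0 v T A i \<longleftrightarrow>
    (\<forall>T'. 0 < T' \<and> ereal T' < T \<longrightarrow> mqs_solution \<Omega> \<Omega>C \<sigma> \<nu> R X A\<^sub>0 v T' A i)"

definition energy_density :: "(real^3 \<Rightarrow> real \<Rightarrow> real) \<Rightarrow> real^3 \<Rightarrow> real \<Rightarrow> real"
  where "energy_density \<nu> x \<rho> = integral {0..sqrt \<rho>} (\<lambda>\<zeta>. \<nu> x \<zeta> * \<zeta>)"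

definition magnetic_energy ::
    "(real^3) set \<Rightarrow> (real^3) set \<Rightarrow> (real^3 \<Rightarrow> real \<Rightarrow> real) \<Rightarrow> (real^3, real^3) L2 \<Rightarrow> ereal"
  where "magnetic_energy \<Omega> \<Omega>C \<nu> A = (if A \<in> X0_curl \<Omega> \<Omega>C
    then ereal (LINT x|lebesgue_on \<Omega>. energy_density \<nu> x ((norm (rep_L2 (wcurl \<Omega> A) x))\<^sup>2))
    else \<infinity>)"

definition spd :: "real^'m^'m \<Rightarrow> bool"
  where "spd R \<longleftrightarrow> transpose R = R \<and> (\<forall>x. x \<noteq> 0 \<longrightarrow> 0 < x \<bullet> (R *v x))"

definition matrix_sqrt :: "real^'m^'m \<Rightarrow> real^'m^'m"
  where "matrix_sqrt R = (THE S. spd S \<and> S ** S = R)"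

end

theory Submission
  imports Defs
begin

text \<open>
  Put \<open>u = (\<sigma>\<^sub>C\<^bsup>-1/2\<^esup> \<sigma>A, R\<^bsup>-1/2\<^esup> \<integral>\<chi>\<^sup>TA)\<close>, \<open>f = (0, R\<^bsup>-1/2\<^esup> v)\<close> and \<open>p = f - u'\<close>, so that the second
  component of \<open>p\<close> is \<open>R\<^bsup>1/2\<^esup> i\<close>. Convexity of \<open>E\<close> and the weak equation, tested with \<open>A(s) - A(t)\<close>,
  give the subgradient inequality \<open>E(A(t)) - E(A(s)) \<le> p(t) \<bullet> (u(t) - u(s))\<close> for almost all \<open>s\<close>, \<open>t\<close>,
  and also with \<open>A\<^sub>0\<close>, \<open>u(0)\<close> in place of \<open>A(s)\<close>, \<open>u(s)\<close>. Taking \<open>s = t - h\<close>, dividing by \<open>h\<close> and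
  letting \<open>h \<rightarrow> 0\<close> yields \<open>-\<integral>p \<bullet> u' \<le> E(A(a))\<close> over \<open>(a, b)\<close> (in an averaged sense); no chain rule for
  \<open>E\<close> is needed, only the weak convergence of difference quotients of \<open>u\<close>. Since \<open>u'\<close> need not be square
  integrable at \<open>0\<close>, the average of \<open>E(A)\<close> near \<open>0\<close> is bounded by \<open>E(A\<^sub>0)\<close> separately, by comparison
  with the initial value. As \<open>-p \<bullet> u' = |p|\<^sup>2 - p \<bullet> f\<close>, Young's inequality finishes the proof.
\<close>

subsection \<open>Smooth steps and test functions\<close>

text \<open>The conductivity vanishes off the conductor, so \<open>u\<close> sees only the conductor
  part of \<open>A\<close> and the winding fluxes. \<open>A\<close> itself need not be continuous in
  time, and \<open>E(A(t))\<close> is known only to be integrable in \<open>t\<close>; an inequality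
  between two times is what survives without differentiating \<open>E(A(t))\<close>. The
  normalisation of \<open>u\<close> lets \<open>p \<bullet> (u(t) - u(s))\<close> reproduce both
  pairings of the weak equation, conductor current against field and coil current against flux,
  while the resistive loss is exactly the square of the second component of \<open>p\<close>. Weak
  convergence of the quotients suffices because the other factor \<open>p\<close> is fixed; it uses
  a square integrable \<open>u'\<close>, hence a start at positive time and a ramp as weight.
  Young's inequality with weight \<epsilon> keeps \<open>1 - \<epsilon>/2\<close> of the loss
  against \<open>1/(2\<epsilon>)\<close> of \<open>|f|^2\<close>, and division by
  \<open>1 - \<epsilon>/2\<close> gives both constants of the first estimate. The second follows
  from \<open>E(A\<^sub>0) \<le> (L/2) |curl A\<^sub>0|^2\<close> and subadditivity of the square
  root, the third from \<epsilon> = 1.\<close>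

lemma Ck_Suc_D: "Ck (Suc k) f \<Longrightarrow> Ck k f"
proof (induction k arbitrary: f)
  case 0
  then show ?case
    by (auto intro!: continuous_at_imp_continuous_on differentiable_imp_continuous_within)
next
  case (Suc k)
  have "\<And>x. f differentiable (at x)" using Suc.prems by simp
  moreover have "\<And>b. b \<in> Basis \<Longrightarrow> Ck k (\<lambda>x. frechet_derivative f (at x) b)"
    using Suc.prems by (intro Suc.IH) (simp del: Ck.simps(2) add: Ck.simps(2)[of "Suc k" f])
  ultimately show ?case by simp
qed

lemma Ck_differentiable: "Ck (Suc k) f \<Longrightarrow> (f has_derivative frechet_derivative f (at x)) (at x)"
  by (simp add: frechet_derivative_works)

lemma Ck_Suc_I:
  assumes "\<And>x. (f has_derivative f' x) (at x)" "\<And>b. b \<in> Basis \<Longrightarrow> Ck k (\<lambda>x. f' x b)"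
  shows "Ck (Suc k) f"
  using assms frechet_derivative_at[OF assms(1)] by (auto simp: differentiable_def)

lemma Ck_continuous: "Ck k f \<Longrightarrow> continuous_on UNIV f"
  by (induction k) (auto dest: Ck_Suc_D simp del: Ck.simps(2))

lemma Ck_const: "Ck k (\<lambda>x. c)"
proof (induction k arbitrary: c)
  case (Suc k)
  show ?case by (rule Ck_Suc_I[where f' = "\<lambda>x h. 0"]) (auto intro: Suc)
qed simp

lemma Ck_add: "Ck k f \<Longrightarrow> Ck k g \<Longrightarrow> Ck k (\<lambda>x. f x + g x)"
proof (induction k arbitrary: f g)
  case (Suc k)
  show ?case
    by (rule Ck_Suc_I[OF has_derivative_add[OF Suc.prems[THEN Ck_differentiable]]])
      (use Suc in auto)
qed (auto intro: continuous_intros)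

lemma Ck_bounded_linear:
  assumes T: "bounded_linear T"
  shows "Ck k f \<Longrightarrow> Ck k (\<lambda>x. T (f x))"
proof (induction k arbitrary: f)
  case (Suc k)
  show ?case
    by (rule Ck_Suc_I[OF bounded_linear.has_derivative[OF T Suc.prems[THEN Ck_differentiable]]])
      (use Suc in auto)
qed (auto intro: bounded_linear.continuous_on[OF T])

lemma Ck_scaleR:
  fixes f :: "'a::euclidean_space \<Rightarrow> real"
  shows "Ck k f \<Longrightarrow> Ck k g \<Longrightarrow> Ck k (\<lambda>x. f x *\<^sub>R g x)"
proof (induction k arbitrary: f g)
  case (Suc k)
  show ?case
    by (rule Ck_Suc_I[OF has_derivative_scaleR[OF Suc.prems[THEN Ck_differentiable]]])
      (intro Ck_add Suc.IH Suc.prems[THEN Ck_Suc_D], use Suc.prems in auto)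
qed (auto intro: continuous_intros)

lemma Ck_prod:
  fixes f :: "'i \<Rightarrow> 'a::euclidean_space \<Rightarrow> real"
  assumes "finite I" "\<And>i. i \<in> I \<Longrightarrow> Ck k (f i)"
  shows "Ck k (\<lambda>x. \<Prod>i\<in>I. f i x)"
  using assms
proof induction
  case (insert i I)
  then show ?case using Ck_scaleR[of k "f i" "\<lambda>x. \<Prod>i\<in>I. f i x"] by simp
qed (simp add: Ck_const)

text \<open>A partial derivative of the composition is a constant times the same composition with
  the derivative of \<open>f\<close>, so the induction on \<open>k\<close> closes. All rescaled,
  shifted and reflected steps used below have this form.\<close>

lemma Ck_compose_affine:
  fixes f :: "real \<Rightarrow> 'b::real_normed_vector"
  shows "Ck k f \<Longrightarrow> Ck k (\<lambda>x :: 'a::euclidean_space. f (x \<bullet> a + c))"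
proof (induction k arbitrary: f)
  case 0
  then have "continuous_on UNIV f" by simp
  then have "continuous_on UNIV (f \<circ> (\<lambda>x. x \<bullet> a + c))"
    by (intro continuous_on_compose continuous_intros) (rule continuous_on_subset, auto)
  then show ?case by (simp add: o_def)
next
  case (Suc k)
  let ?f' = "\<lambda>y. frechet_derivative f (at y)"
  have d: "(f has_derivative ?f' y) (at y)" for y using Ck_differentiable[OF Suc.prems] .
  have "((\<lambda>x. f (x \<bullet> a + c)) has_derivative (\<lambda>h. ?f' (x \<bullet> a + c) (h \<bullet> a))) (at x)" for x
    by (rule has_derivative_compose[OF _ d, of "\<lambda>x. x \<bullet> a + c" "\<lambda>h. h \<bullet> a"]) (auto intro!: derivative_eq_intros)
  moreover have "?f' y (b \<bullet> a) = (b \<bullet> a) *\<^sub>R ?f' y 1" for y b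
  proof -
    interpret bounded_linear "?f' y" using d by (rule has_derivative_bounded_linear)
    show ?thesis using scaleR[of "b \<bullet> a" 1] by simp
  qed
  moreover have "Ck k (\<lambda>x. (b \<bullet> a) *\<^sub>R ?f' (x \<bullet> a + c) 1)" for b
    using Suc.prems by (intro Ck_bounded_linear[OF bounded_linear_scaleR_right] Suc.IH) simp
  ultimately show ?case by (intro Ck_Suc_I) auto
qed

lemma Ck_real_I:
  fixes f :: "real \<Rightarrow> real"
  assumes "\<And>x. (f has_real_derivative f' x) (at x)" "Ck k f'"
  shows "Ck (Suc k) f"
  by (rule Ck_Suc_I[OF assms(1)[unfolded has_field_derivative_def]]) (simp add: assms(2))

text \<open>Derivatives of members of this family are linear combinations of members.\<close>

definition exp_inv :: "nat \<Rightarrow> real \<Rightarrow> real"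
  where "exp_inv n x = (if x > 0 then exp (- (1 / x)) / x ^ n else 0)"

text \<open>The substitution \<open>y = 1 / x\<close> turns this into the decay of
  \<open>y ^ n / exp y\<close> at infinity.\<close>

lemma exp_inv_at_right: "(exp_inv n \<longlongrightarrow> 0) (at_right 0)"
proof -
  have "((\<lambda>y. y ^ n / exp y) \<longlongrightarrow> (0::real)) at_top" by (rule tendsto_power_div_exp_0)
  then have "((\<lambda>x::real. inverse x ^ n / exp (inverse x)) \<longlongrightarrow> 0) (at_right 0)"
    by (rule filterlim_compose[OF _ filterlim_inverse_at_top_right])
  moreover have "\<forall>\<^sub>F x in at_right 0. inverse x ^ n / exp (inverse x) = exp_inv n x"
    by (intro eventually_at_rightI[of _ 1]) (auto simp: exp_inv_def field_simps exp_minus power_inverse)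
  ultimately show ?thesis by (rule Lim_transform_eventually)
qed

lemma exp_inv_has_derivative:
  "(exp_inv n has_real_derivative (exp_inv (n + 2) x - n * exp_inv (n + 1) x)) (at x)"
proof -
  consider "x > 0" | "x < 0" | "x = 0" by linarith
  then show ?thesis
  proof cases
    case 1
    have "((\<lambda>x. exp (- (1 / x)) / x ^ n) has_real_derivative
        (exp_inv (n + 2) x - n * exp_inv (n + 1) x)) (at x)"
    proof -
      have "((\<lambda>x. exp (- (1 / x)) / x ^ n) has_real_derivative
        ((exp (- (1 / x)) * (1 / x\<^sup>2)) * x ^ n - exp (- (1 / x)) * (n * x ^ (n - 1))) / (x ^ n * x ^ n)) (at x)"
        using 1 by (auto intro!: derivative_eq_intros simp: power2_eq_square)
      moreover have "((exp (- (1 / x)) * (1 / x\<^sup>2)) * x ^ n - exp (- (1 / x)) * (n * x ^ (n - 1))) / (x ^ n * x ^ n)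
        = exp_inv (n + 2) x - n * exp_inv (n + 1) x"
        using 1 by (cases n) (auto simp: exp_inv_def field_simps power2_eq_square)
      ultimately show ?thesis by simp
    qed
    then show ?thesis
      by (rule DERIV_cong_ev[THEN iffD1, rotated 3])
        (use 1 in \<open>auto simp: exp_inv_def intro!: eventually_nhds_in_open[of "{0<..}" x, THEN eventually_mono]\<close>)
  next
    case 2
    have "((\<lambda>x. 0) has_real_derivative 0) (at x)" by simp
    then have "(exp_inv n has_real_derivative 0) (at x)"
      by (rule DERIV_cong_ev[THEN iffD1, rotated 3])
        (use 2 in \<open>auto simp: exp_inv_def intro!: eventually_nhds_in_open[of "{..<0}" x, THEN eventually_mono]\<close>)
    then show ?thesis using 2 by (simp add: exp_inv_def)
  next
    case 3
    have "((\<lambda>y. exp_inv (n + 1) y) \<longlongrightarrow> 0) (at 0)"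
    proof (rule filterlim_split_at)
      have "\<forall>\<^sub>F y in at_left 0. 0 = exp_inv (n + 1) y"
        by (intro eventually_at_leftI[of "-1"]) (auto simp: exp_inv_def)
      then show "(exp_inv (n + 1) \<longlongrightarrow> 0) (at_left 0)"
        by (rule Lim_transform_eventually[OF tendsto_const])
    qed (rule exp_inv_at_right)
    \<comment> \<open>Division by \<open>y\<close> raises the index by one, so the difference
      quotient at 0 is itself a member of the family and tends to 0.\<close>
    moreover have "(exp_inv n y - exp_inv n 0) / (y - 0) = exp_inv (n + 1) y" for y
      by (auto simp: exp_inv_def)
    ultimately show ?thesis using 3 by (simp add: has_field_derivative_iff) (simp add: exp_inv_def)
  qed
qed

lemma Ck_exp_inv: "Ck k (exp_inv n)"
proof (induction k arbitrary: n)
  case 0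
  show ?case
    by (simp only: Ck.simps)
      (rule DERIV_continuous_on[OF has_field_derivative_at_within[OF exp_inv_has_derivative]])
next
  case (Suc k)
  have "Ck k (\<lambda>x. exp_inv (n + 2) x + (- real n) *\<^sub>R exp_inv (n + 1) x)"
    by (rule Ck_add[OF Suc Ck_bounded_linear[OF bounded_linear_scaleR_right Suc]])
  then show ?case by (intro Ck_real_I[OF exp_inv_has_derivative]) simp
qed

text \<open>The step is the primitive of the bump \<open>exp (-1/x) * exp (-1/(1-x))\<close> on
  (0,1), normalised to end at 1. Its derivative then has mass 1 and serves as a mollifying kernel,
  while products of steepened steps approximate indicators of boxes.\<close>

lemma smooth_step_exists:
  obtains S S' :: "real \<Rightarrow> real" where
    "\<And>k. Ck k S" "\<And>x. (S has_real_derivative S' x) (at x)" "continuous_on UNIV S'"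
    "\<And>x. 0 \<le> S' x" "\<And>x. x \<notin> {0<..<1} \<Longrightarrow> S' x = 0"
    "\<And>x. x \<le> 0 \<Longrightarrow> S x = 0" "\<And>x. x \<ge> 1 \<Longrightarrow> S x = 1" "\<And>x. 0 \<le> S x" "\<And>x. S x \<le> 1"
proof -
  define b where "b x = exp_inv 0 x * exp_inv 0 (1 - x)" for x
  have Ckb: "Ck k b" for k
  proof -
    have "Ck k (\<lambda>x :: real. exp_inv 0 x *\<^sub>R exp_inv 0 (x \<bullet> (-1) + 1))"
      by (rule Ck_scaleR[OF Ck_exp_inv Ck_compose_affine[OF Ck_exp_inv]])
    then show ?thesis by (simp add: b_def[abs_def] inner_real_def)
  qed
  have cont: "continuous_on A b" for A
    using Ck_continuous[OF Ckb[of 0]] continuous_on_subset by blast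
  have bnn: "b x \<ge> 0" for x by (simp add: b_def exp_inv_def)
  have b0: "b x = 0" if "x \<notin> {0<..<1}" for x using that by (auto simp: b_def exp_inv_def)
  define c where "c = integral {-1..1} b"
  have int: "b integrable_on {u..v}" for u v by (intro integrable_continuous_real cont)
  have "c \<noteq> 0"
  proof
    assume "c = 0"
    then have "b (1/2) = 0"
      unfolding c_def by (subst (asm) integral_eq_0_iff) (auto simp: bnn intro: cont)
    then show False by (simp add: b_def exp_inv_def)
  qed
  moreover have "c \<ge> 0" unfolding c_def by (intro integral_nonneg int bnn)
  ultimately have c: "c > 0" by simp
  \<comment> \<open>The base point -1 lies off the support of \<open>b\<close>. The fundamental
    theorem thus covers the edge 0 of the support, and further to the left \<open>B\<close> vanishes
    locally.\<close>
  define B where "B x = integral {-1..x} b" for x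
  have B_le0: "B x = 0" if "x \<le> 0" for x
  proof -
    have "B x = integral {-1..x} (\<lambda>x. 0)" unfolding B_def
      using that by (intro integral_cong b0) auto
    then show ?thesis by simp
  qed
  have B_ge1: "B x = c" if "x \<ge> 1" for x
  proof -
    have "integral {-1..1} b + integral {1..x} b = B x" unfolding B_def
      using that by (intro Henstock_Kurzweil_Integration.integral_combine int) auto
    moreover have "integral {1..x} b = integral {1..x} (\<lambda>x. 0)"
      by (intro integral_cong b0) auto
    ultimately show ?thesis by (simp add: c_def)
  qed
  have B_deriv: "(B has_real_derivative b x) (at x)" for x
  proof (cases "x > -1")
    case True
    have "(B has_real_derivative b x) (at x within {-1..x + 1})"
      unfolding B_def using True by (intro integral_has_real_derivative cont) auto
    moreover have "at x within {-1..x + 1} = at x" using True by (intro at_within_interior) auto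
    ultimately show ?thesis by simp
  next
    case False
    have "((\<lambda>x. 0) has_real_derivative 0) (at x)" by simp
    then have "(B has_real_derivative 0) (at x)"
      by (rule DERIV_cong_ev[THEN iffD1, rotated 3])
        (use False in \<open>auto simp: B_le0 intro!: eventually_nhds_in_open[of "{..<0}" x, THEN eventually_mono]\<close>)
    then show ?thesis using False b0[of x] by simp
  qed
  have B_mono: "B x \<le> B y" if "x \<le> y" for x y
    by (rule DERIV_nonneg_imp_nondecreasing[OF that]) (use B_deriv bnn in blast)
  have Bb: "0 \<le> B x \<and> B x \<le> c" for x
  proof
    show "0 \<le> B x" using B_mono[of 0 x] B_le0[of 0] B_le0[of x] by linarith
    show "B x \<le> c" using B_mono[of x 1] B_ge1[of 1] B_ge1[of x] by linarith
  qed
  define S where "S x = (1 / c) *\<^sub>R B x" for x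
  show thesis
  proof (rule that[of S "\<lambda>x. b x / c"])
    have "Ck k B" for k
      by (rule Ck_Suc_D[OF Ck_real_I[OF B_deriv Ckb]])
    then show "Ck k S" for k
      unfolding S_def[abs_def] by (intro Ck_bounded_linear[OF bounded_linear_scaleR_right])
    show "(S has_real_derivative b x / c) (at x)" for x
      unfolding S_def using B_deriv[of x] c by (auto intro!: derivative_eq_intros)
    show "continuous_on UNIV (\<lambda>x. b x / c)" using c by (intro continuous_intros cont) auto
    show "0 \<le> b x / c" for x using bnn c by simp
    show "b x / c = 0" if "x \<notin> {0<..<1}" for x using b0[OF that] by simp
    show "S x = 0" if "x \<le> 0" for x using that B_le0 by (simp add: S_def)
    show "S x = 1" if "x \<ge> 1" for x using that B_ge1 c by (simp add: S_def)
    show "0 \<le> S x" "S x \<le> 1" for x using Bb[of x] c by (simp_all add: S_def)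
  qed
qed

section \<open>Vanishing integrals and the fundamental lemma of the calculus of variations\<close>

lemma sigma_finite_lebesgue: "sigma_finite_measure (lebesgue :: 'a::euclidean_space measure)"
proof
  obtain A :: "'a set set" where "countable A" "A \<subseteq> sets lborel" "\<Union>A = space lborel" "\<forall>a\<in>A. emeasure lborel a \<noteq> \<infinity>"
    using sigma_finite_measure.sigma_finite_countable[OF sigma_finite_lborel] by blast
  then show "\<exists>A :: 'a set set. countable A \<and> A \<subseteq> sets lebesgue \<and> \<Union>A = space lebesgue \<and> (\<forall>a\<in>A. emeasure lebesgue a \<noteq> \<infinity>)"
    by (intro exI[of _ A]) (auto simp: main_part_sets)
qed

text \<open>Boxes are stable under intersection and generate the Borel sets, so Dynkin's argument
  carries vanishing integrals from boxes to Borel sets. A Lebesgue set differs from its Borel main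
  part by a null set, and vanishing integrals over all Lebesgue sets force \<open>f = 0\<close>
  almost everywhere.\<close>

lemma AE_zero_if_box_integrals_zero:
  fixes f :: "'a::euclidean_space \<Rightarrow> 'b::{banach, second_countable_topology}"
  assumes f: "integrable lebesgue f"
    and box: "\<And>a b. (LINT x:box a b|lebesgue. f x) = 0"
  shows "AE x in lebesgue. f x = 0"
proof -
  have si: "set_integrable lebesgue A f" if "A \<in> sets lebesgue" for A
    using integrable_mult_indicator[OF that f] by (simp add: set_integrable_def)
  \<comment> \<open>The complement step of Dynkin's argument needs the integral over the whole
    space, which is not a box but an increasing union of boxes.\<close>
  have UNIV: "(LINT x:UNIV|lebesgue. f x) = 0"
  proof -
    define K where "K n = box (- real n *\<^sub>R One) (real n *\<^sub>R One :: 'a)" for n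
    have One: "(One :: 'a) \<bullet> i = 1" if "i \<in> Basis" for i
      using that by (simp add: inner_sum_left inner_Basis)
    have "incseq K" unfolding K_def
      by (intro incseq_SucI subset_box_imp) (simp add: One algebra_simps)
    moreover have "(\<Union>n. K n) = UNIV"
    proof -
      have "\<exists>n. x \<in> K n" for x
      proof -
        obtain n where "norm x < real n" using reals_Archimedean2 by blast
        then show ?thesis
        proof (intro exI)
          have "\<bar>x \<bullet> i\<bar> < real n" if "i \<in> Basis" for i
            using \<open>norm x < real n\<close> Basis_le_norm[OF that, of x] by linarith
          then show "x \<in> K n" unfolding K_def mem_box by (simp add: One abs_less_iff minus_less_iff)
        qed
      qed
      then show ?thesis by auto
    qed
    moreover have "K n \<in> sets lebesgue" for n by (simp add: K_def)
    ultimately have "(\<lambda>n. LINT x:K n|lebesgue. f x) \<longlonglongrightarrow> (LINT x:UNIV|lebesgue. f x)"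
      using set_integral_cont_up[of K lebesgue f] si by simp
    then show ?thesis by (simp add: K_def box LIMSEQ_const_iff)
  qed
  have borel: "(LINT x:A|lebesgue. f x) = 0" if "A \<in> sets borel" for A
  proof -
    have "Int_stable (range (\<lambda>(a, b). box a b :: 'a set))"
      by (auto simp: Int_stable_def box_Int_box)
    moreover have "range (\<lambda>(a, b). box a b :: 'a set) \<subseteq> Pow UNIV" by simp
    moreover have "A \<in> sigma_sets UNIV (range (\<lambda>(a, b). box a b))"
      using that unfolding borel_eq_box by simp
    ultimately show ?thesis
    proof (induction rule: sigma_sets_induct_disjoint)
      case (compl A)
      then have A: "A \<in> sets lebesgue" by (auto simp: borel_eq_box)
      then have "(LINT x:A \<union> (UNIV - A)|lebesgue. f x)
        = (LINT x:A|lebesgue. f x) + (LINT x:UNIV - A|lebesgue. f x)"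
        by (intro set_integral_Un si) auto
      then show ?case using compl UNIV by simp
    next
      case (union A)
      have A: "A i \<in> sets lebesgue" for i
        using subsetD[OF union(2), of "A i"] by (simp add: borel_eq_box)
      have "(LINT x:(\<Union>i. A i)|lebesgue. f x) = (\<Sum>i. LINT x:A i|lebesgue. f x)"
        using union(1) by (intro lebesgue_integral_countable_add si A sets.countable_UN)
          (auto simp: disjoint_family_on_def A)
      then show ?case using union by simp
    qed (use box in \<open>auto simp: set_lebesgue_integral_def\<close>)
  qed
  show ?thesis
  proof (rule sigma_finite_measure.density_zero[OF sigma_finite_lebesgue f])
    fix A :: "'a set" assume A: "A \<in> sets lebesgue"
    let ?M = "main_part lborel A"
    have M: "?M \<in> sets borel" using A main_part_sets[of A lborel] by simp
    have "(LINT x:A|lebesgue. f x) = (LINT x:?M|lebesgue. f x)"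
      unfolding set_lebesgue_integral_def
    proof (rule integral_cong_AE)
      show "AE x in lebesgue. indicat_real A x *\<^sub>R f x = indicat_real ?M x *\<^sub>R f x"
        using AE_lebesgue_mem_main_part[OF A] by eventually_elim (auto simp: indicator_def)
    qed (use si[OF A] si[of ?M] M in \<open>auto simp: set_integrable_def dest: borel_measurable_integrable\<close>)
    then show "(LINT x:A|lebesgue. f x) = 0" using borel[OF M] by simp
  qed
qed

text \<open>Smooth cut-offs bounded by 1 converge pointwise to the indicator of an open box, so
  dominated convergence turns the hypothesis into vanishing box integrals.\<close>

lemma fundamental_lemma_variations:
  fixes f :: "'a::euclidean_space \<Rightarrow> real"
  assumes U: "open U" and f: "integrable lebesgue f"
    and test: "\<And>\<phi>. test_function U \<phi> \<Longrightarrow> (LINT x|lebesgue. \<phi> x * f x) = 0"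
  shows "AE x in lebesgue. x \<in> U \<longrightarrow> f x = 0"
proof -
  obtain S S' :: "real \<Rightarrow> real" where S: "\<And>k. Ck k S"
    "\<And>x. x \<le> 0 \<Longrightarrow> S x = 0" "\<And>x. x \<ge> 1 \<Longrightarrow> S x = 1" "\<And>x. 0 \<le> S x" "\<And>x. S x \<le> 1"
    using smooth_step_exists by metis
  have box: "(LINT x:box a b|lebesgue. f x) = 0" if ab: "cbox a b \<subseteq> U" for a b
  proof -
    \<comment> \<open>In each coordinate one factor rises at the lower face and one falls at the
      upper face. The product vanishes off the open box for every \<open>n\<close> and equals 1 at
      any given interior point for large \<open>n\<close>.\<close>
    define \<psi> where "\<psi> n x = (\<Prod>i\<in>Basis. S (real n * (x \<bullet> i - a \<bullet> i)) * S (real n * (b \<bullet> i - x \<bullet> i)))" for n x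
    have Ck: "Ck k (\<psi> n)" for k n
    proof -
      have "Ck k (\<lambda>x. S (x \<bullet> (real n *\<^sub>R i) + - (n * (a \<bullet> i))) *\<^sub>R S (x \<bullet> (- real n *\<^sub>R i) + n * (b \<bullet> i)))" for i
        by (intro Ck_scaleR Ck_compose_affine S)
      then have "Ck k (\<lambda>x. S (real n * (x \<bullet> i - a \<bullet> i)) * S (real n * (b \<bullet> i - x \<bullet> i)))" for i
        by (simp add: algebra_simps)
      then show ?thesis unfolding \<psi>_def by (intro Ck_prod) auto
    qed
    have out: "\<psi> n x = 0" if nb: "x \<notin> box a b" for n x
    proof -
      obtain i where "i \<in> Basis" "x \<bullet> i \<le> a \<bullet> i \<or> b \<bullet> i \<le> x \<bullet> i"
        using nb unfolding mem_box by (metis linorder_not_le)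
      then have "S (real n * (x \<bullet> i - a \<bullet> i)) * S (real n * (b \<bullet> i - x \<bullet> i)) = 0"
        using S(2)[of "real n * (x \<bullet> i - a \<bullet> i)"] S(2)[of "real n * (b \<bullet> i - x \<bullet> i)"]
        by (auto simp: mult_nonneg_nonpos)
      with \<open>i \<in> Basis\<close> show ?thesis unfolding \<psi>_def by (intro prod_zero[OF finite_Basis]) blast
    qed
    have bd: "\<bar>\<psi> n x\<bar> \<le> 1" for n x
    proof -
      have "0 \<le> \<psi> n x" "\<psi> n x \<le> 1" unfolding \<psi>_def
        by (auto intro!: prod_nonneg prod_le_1 mult_le_one S mult_nonneg_nonneg)
      then show ?thesis by simp
    qed
    have lim: "(\<lambda>n. \<psi> n x) \<longlonglongrightarrow> indicator (box a b) x" for x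
    proof (cases "x \<in> box a b")
      case True
      have ev: "\<forall>\<^sub>F n in sequentially. real n * d \<ge> 1" if d: "d > 0" for d :: real
      proof -
        obtain N where "inverse (real (Suc N)) < d" using reals_Archimedean[OF d] by blast
        then have N: "1 \<le> real (Suc N) * d" by (simp add: field_simps)
        show ?thesis
        proof (rule eventually_sequentiallyI[of "Suc N"])
          fix n assume "Suc N \<le> n"
          then have "real (Suc N) * d \<le> real n * d" using d by (intro mult_right_mono) auto
          with N show "1 \<le> real n * d" by simp
        qed
      qed
      have "\<forall>\<^sub>F n in sequentially. \<forall>i\<in>Basis. real n * (x \<bullet> i - a \<bullet> i) \<ge> 1 \<and> real n * (b \<bullet> i - x \<bullet> i) \<ge> 1"
        using True by (intro eventually_ball_finite ballI eventually_conj ev) (auto simp: mem_box)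
      then have "\<forall>\<^sub>F n in sequentially. 1 = \<psi> n x"
        by eventually_elim (auto simp: \<psi>_def S(3) intro!: prod.neutral[symmetric])
      then show ?thesis using True by (auto intro: Lim_transform_eventually[OF tendsto_const])
    qed (simp add: out)
    have test': "test_function U (\<psi> n)" for n
      unfolding test_function_def using ab out box_subset_cbox[of a b]
      by (intro conjI allI Ck exI[of _ "cbox a b"]) auto
    have fm: "f \<in> borel_measurable lebesgue" using f by auto
    have \<psi>m: "\<psi> n \<in> borel_measurable lebesgue" for n
      using Ck_continuous[OF Ck[of 0 n]] by (intro measurable_completion) (auto intro: borel_measurable_continuous_onI)
    have "(\<lambda>n. LINT x|lebesgue. \<psi> n x * f x) \<longlonglongrightarrow> (LINT x|lebesgue. indicator (box a b) x * f x)"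
    proof (rule integral_dominated_convergence[where w = "\<lambda>x. norm (f x)"])
      show "AE x in lebesgue. norm (\<psi> n x * f x) \<le> norm (f x)" for n
        using bd by (auto simp: abs_mult intro!: mult_left_le_one_le)
      show "AE x in lebesgue. (\<lambda>n. \<psi> n x * f x) \<longlonglongrightarrow> indicator (box a b) x * f x"
        by (intro AE_I2 tendsto_mult lim tendsto_const)
      show "(\<lambda>x. indicat_real (box a b) x * f x) \<in> borel_measurable lebesgue"
        by (intro borel_measurable_times fm borel_measurable_indicator) simp
    qed (use f fm \<psi>m in \<open>auto intro!: borel_measurable_times\<close>)
    then show ?thesis using test[OF test'] by (simp add: set_lebesgue_integral_def LIMSEQ_const_iff)
  qed
  \<comment> \<open>Only boxes with closure inside \<open>U\<close> are under control. Cutting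
    \<open>f\<close> off by \<open>box c d\<close> reduces an arbitrary box to its intersection with
    \<open>box c d\<close>, which is again a box with closure in \<open>cbox c d\<close>.\<close>
  have loc: "AE x in lebesgue. x \<in> cbox c d \<longrightarrow> f x = 0" if cd: "cbox c d \<subseteq> U" for c d
  proof -
    have "AE x in lebesgue. indicator (box c d) x * f x = 0"
    proof (rule AE_zero_if_box_integrals_zero)
      show "integrable lebesgue (\<lambda>x. indicator (box c d) x * f x)"
        using integrable_mult_indicator[OF _ f, of "box c d"] by simp
      fix a b
      obtain a' b' where ab': "box a b \<inter> box c d = box a' b'" by (rule that[OF box_Int_box])
      have "(LINT x:box a b|lebesgue. indicator (box c d) x * f x) = (LINT x:box a' b'|lebesgue. f x)"
        unfolding set_lebesgue_integral_def ab'[symmetric]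
        by (intro Bochner_Integration.integral_cong) (auto simp: indicator_def)
      also have "\<dots> = 0"
      proof (cases "box a' b' = {}")
        case False
        then have "cbox a' b' = closure (box a' b')" by (simp add: closure_box)
        also have "\<dots> \<subseteq> cbox c d"
          using ab' box_subset_cbox[of c d] by (intro closure_minimal) (auto simp: closed_cbox)
        finally show ?thesis using cd by (intro box) auto
      qed (simp add: set_lebesgue_integral_def)
      finally show "(LINT x:box a b|lebesgue. indicator (box c d) x * f x) = 0" .
    qed
    moreover have "AE x in lebesgue. x \<notin> cbox c d - box c d"
      using negligible_frontier_interval[of c d] unfolding negligible_iff_null_sets by (rule AE_not_in)
    ultimately show ?thesis by eventually_elim (auto simp: indicator_def split: if_splits)
  qed
  obtain D where D: "countable D" "D \<subseteq> Pow U" "\<And>X. X \<in> D \<Longrightarrow> \<exists>a b. X = cbox a b" "\<Union>D = U"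
    using open_countable_Union_open_cbox[OF U] by metis
  have "AE x in lebesgue. \<forall>X\<in>D. x \<in> X \<longrightarrow> f x = 0"
  proof (rule AE_ball_countable[THEN iffD2, OF D(1)], rule ballI)
    fix X assume X: "X \<in> D"
    then obtain a b where "X = cbox a b" using D(3) by blast
    then show "AE x in lebesgue. x \<in> X \<longrightarrow> f x = 0" using loc[of a b] D(2) X by blast
  qed
  then show ?thesis by eventually_elim (use D(4) in auto)
qed

subsection \<open>Weak derivatives\<close>

lemma integrable_lebesgue_on_subset:
  fixes f :: "'a::euclidean_space \<Rightarrow> 'b::{banach, second_countable_topology}"
  assumes "integrable (lebesgue_on S) f" "T \<subseteq> S" "S \<in> sets lebesgue" "T \<in> sets lebesgue"
  shows "integrable (lebesgue_on T) f"
  using set_integrable_subset[of lebesgue S f T] assms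
  by (simp add: integrable_restrict_space set_integrable_def)

text \<open>The kernel is an approximate identity with support to the right of \<open>t\<close>,
  inside \<open>[t, t + 1/n]\<close>. This one-sidedness admits \<open>t = s\<close> and excludes
  \<open>t = b\<close>.\<close>

lemma smooth_step_kernel_limit:
  fixes S S' v :: "real \<Rightarrow> real"
  assumes S: "\<And>x. (S has_real_derivative S' x) (at x)" "continuous_on UNIV S'"
    "\<And>x. 0 \<le> S' x" "\<And>x. x \<notin> {0<..<1} \<Longrightarrow> S' x = 0"
    "\<And>x. x \<le> 0 \<Longrightarrow> S x = 0" "\<And>x. x \<ge> 1 \<Longrightarrow> S x = 1"
    and v: "continuous_on {s..b} v" and t: "s \<le> t" "t < b"
  shows "(\<lambda>n. integral {s..b} (\<lambda>x. real n * S' (real n * (x - t)) * v x)) \<longlonglongrightarrow> v t"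
proof (rule LIMSEQ_I)
  fix e :: real assume e: "e > 0"
  have "t \<in> {s..b}" using t by simp
  then obtain d where d: "d > 0" "\<And>x. x \<in> {s..b} \<Longrightarrow> dist x t < d \<Longrightarrow> dist (v x) (v t) < e / 2"
    using v e unfolding continuous_on_iff by (meson half_gt_zero)
  obtain N where N: "inverse (real (Suc N)) < min d (b - t)"
    using reals_Archimedean[of "min d (b - t)"] d t by auto
  have "norm (integral {s..b} (\<lambda>x. real n * S' (real n * (x - t)) * v x) - v t) < e" if n: "n \<ge> Suc N" for n
  proof -
    define k where "k x = real n * S' (real n * (x - t))" for x
    have n0: "real n > 0" using n by simp
    have "inverse (real n) \<le> inverse (real (Suc N))" using n by (intro le_imp_inverse_le) auto
    then have nd: "1 / real n < d" "t + 1 / real n < b" using N by (auto simp: inverse_eq_divide)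
    have k_nn: "k x \<ge> 0" for x by (simp add: k_def S)
    have k0: "k x = 0" if "x \<notin> {t<..<t + 1 / real n}" for x
    proof -
      have "real n * (x - t) \<notin> {0<..<1}"
        using that n0 by (auto simp: field_simps zero_less_mult_iff)
      then show ?thesis by (simp add: k_def S(4))
    qed
    have kc: "continuous_on A k" for A
      unfolding k_def by (intro continuous_intros continuous_on_compose2[OF S(2)]) auto
    have deriv: "((\<lambda>x. S (real n * (x - t))) has_real_derivative k x) (at x)" for x
      unfolding k_def
      by (rule DERIV_cong[OF DERIV_chain'[OF _ S(1), of "\<lambda>x. real n * (x - t)" "real n"]])
        (auto intro!: derivative_eq_intros)
    have "(k has_integral S (real n * (b - t)) - S (real n * (s - t))) {s..b}"
      using t deriv
      by (intro fundamental_theorem_of_calculus)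
        (auto simp flip: has_real_derivative_iff_has_vector_derivative intro: has_field_derivative_at_within)
    moreover have "S (real n * (b - t)) = 1" using nd n0 by (intro S) (simp add: field_simps)
    moreover have "S (real n * (s - t)) = 0" using t by (intro S) (simp add: mult_nonneg_nonpos)
    ultimately have k1: "(k has_integral 1) {s..b}" by simp
    have "norm (k x * (v x - v t)) \<le> k x * (e / 2)" if "x \<in> {s..b}" for x
    proof (cases "x \<in> {t<..<t + 1 / real n}")
      case True
      then have "dist (v x) (v t) < e / 2" using that nd by (intro d) (auto simp: dist_real_def)
      then have "\<bar>v x - v t\<bar> \<le> e / 2" by (simp add: dist_real_def)
      from mult_left_mono[OF this k_nn[of x]] show ?thesis using k_nn[of x] by (simp add: abs_mult)
    qed (simp add: k0)
    then have "norm (integral {s..b} (\<lambda>x. k x * (v x - v t))) \<le> integral {s..b} (\<lambda>x. k x * (e / 2))"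
      by (intro integral_norm_bound_integral integrable_continuous_real continuous_intros kc v) auto
    also have "\<dots> = e / 2" by (simp add: integral_unique[OF k1])
    finally have le: "norm (integral {s..b} (\<lambda>x. k x * (v x - v t))) \<le> e / 2" .
    have "integral {s..b} (\<lambda>x. k x * (v x - v t)) = integral {s..b} (\<lambda>x. k x * v x) - integral {s..b} (\<lambda>x. k x * v t)"
      unfolding right_diff_distrib
      by (intro Henstock_Kurzweil_Integration.integral_diff integrable_continuous_real continuous_intros kc v)
    also have "integral {s..b} (\<lambda>x. k x * v t) = v t"
      by (simp add: integral_unique[OF k1])
    finally show ?thesis using le e by (simp add: k_def)
  qed
  then show "\<exists>no. \<forall>n\<ge>no. norm (integral {s..b} (\<lambda>x. real n * S' (real n * (x - t)) * v x) - v t) < e"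
    by blast
qed

text \<open>The du Bois-Reymond lemma; the test functions are differences of two steepening steps.\<close>

lemma weak_derivative_increment:
  fixes u g v :: "real \<Rightarrow> real"
  assumes wd: "has_weak_derivative u g T"
    and v: "continuous_on {s..t} v" "\<And>r. s \<le> r \<Longrightarrow> r < T \<Longrightarrow> isCont v r"
    and uv: "AE r in lebesgue. 0 < r \<and> r < T \<longrightarrow> u r = v r"
    and st: "0 < s" "s \<le> t" "t < T"
  shows "v t - v s = integral {s..t} g"
proof -
  obtain S S' :: "real \<Rightarrow> real" where S: "\<And>k. Ck k S" "\<And>x. (S has_real_derivative S' x) (at x)" "continuous_on UNIV S'"
    "\<And>x. 0 \<le> S' x" "\<And>x. x \<notin> {0<..<1} \<Longrightarrow> S' x = 0"
    "\<And>x. x \<le> 0 \<Longrightarrow> S x = 0" "\<And>x. x \<ge> 1 \<Longrightarrow> S x = 1" "\<And>x. 0 \<le> S x" "\<And>x. S x \<le> 1"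
    using smooth_step_exists by metis
  \<comment> \<open>The test functions fall from 1 to 0 just after \<open>t\<close>; a point
    strictly between \<open>t\<close> and \<open>T\<close> leaves room for this inside the
    interval.\<close>
  define b where "b = (t + T) / 2"
  have b: "t < b" "b < T" using st by (auto simp: b_def)
  have ui: "integrable (lebesgue_on {s..b}) u" and gi: "integrable (lebesgue_on {s..b}) g"
    using wd st b by (auto simp: has_weak_derivative_def)
  have vc: "continuous_on {s..b} v"
    using b st v(2) by (intro continuous_at_imp_continuous_on) auto
  define \<phi> where "\<phi> n x = S (real n * (x - s)) - S (real n * (x - t))" for n x
  define \<phi>' where "\<phi>' n x = real n * S' (real n * (x - s)) - real n * S' (real n * (x - t))" for n x
  have deriv0: "((\<lambda>x. S (real n * (x - c))) has_real_derivative real n * S' (real n * (x - c))) (at x)" for n c x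
    by (rule DERIV_cong[OF DERIV_chain'[OF _ S(2), of "\<lambda>x. real n * (x - c)" "real n"]])
      (auto intro!: derivative_eq_intros)
  have deriv: "(\<phi> n has_real_derivative \<phi>' n x) (at x)" for n x
    unfolding \<phi>_def[abs_def] \<phi>'_def by (intro DERIV_diff deriv0)
  have Ck: "Ck k (\<phi> n)" for k n
  proof -
    have "Ck k (\<lambda>x. S (x \<bullet> real n + - (real n * s)) + - 1 *\<^sub>R S (x \<bullet> real n + - (real n * t)))"
      by (intro Ck_add Ck_bounded_linear[OF bounded_linear_scaleR_right] Ck_compose_affine S)
    then show ?thesis by (simp add: \<phi>_def[abs_def] inner_real_def algebra_simps)
  qed
  obtain N where N: "inverse (real (Suc N)) < b - t" using reals_Archimedean[of "b - t"] b by auto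
  have supp: "\<phi> n x = 0" "\<phi>' n x = 0" if n: "n \<ge> Suc N" and x: "x \<notin> {s..b}" for n x
  proof -
    have n0: "real n > 0" using n by simp
    have "inverse (real n) \<le> inverse (real (Suc N))" using n by (intro le_imp_inverse_le) auto
    then have nb: "t + 1 / real n < b" using N by (auto simp: inverse_eq_divide)
    have "real n * (x - s) \<le> 0 \<and> real n * (x - t) \<le> 0 \<or> real n * (x - s) \<ge> 1 \<and> real n * (x - t) \<ge> 1"
    proof (cases "x < s")
      case True
      then show ?thesis using st n0 by (intro disjI1) (simp add: mult_nonneg_nonpos)
    next
      case False
      then have "x > b" using x by auto
      then have "1 / real n \<le> x - t" "1 / real n \<le> x - s" using nb st by auto
      then show ?thesis using n0 by (intro disjI2) (simp add: field_simps)
    qed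
    then show "\<phi> n x = 0" "\<phi>' n x = 0"
      by (auto simp: \<phi>_def \<phi>'_def S(5,6,7))
  qed
  have main: "integral {s..b} (\<lambda>x. \<phi>' n x * v x) = - (LINT x|lebesgue_on {s..b}. \<phi> n x * g x)"
    if n: "n \<ge> Suc N" for n
  proof -
    have "test_function {0<..<T} (\<phi> n)"
      unfolding test_function_def using Ck supp[OF n] st b by (intro conjI allI exI[of _ "{s..b}"]) auto
    with wd have "(LINT t|lebesgue_on {0<..<T}. deriv (\<phi> n) t *\<^sub>R u t)
        = - (LINT t|lebesgue_on {0<..<T}. \<phi> n t *\<^sub>R g t)"
      unfolding has_weak_derivative_def by blast
    then have eq: "(LINT x|lebesgue_on {0<..<T}. \<phi>' n x * u x) = - (LINT x|lebesgue_on {0<..<T}. \<phi> n x * g x)"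
      by (simp add: DERIV_imp_deriv[OF deriv])
    have restr: "(LINT x|lebesgue_on {0<..<T}. f x * h x) = (LINT x|lebesgue_on {s..b}. f x * h x)"
      if f: "\<And>x. x \<notin> {s..b} \<Longrightarrow> f x = 0" for f h :: "real \<Rightarrow> real"
    proof -
      have "(\<lambda>x. indicator {0<..<T} x * (f x * h x)) = (\<lambda>x. indicator {s..b} x * (f x * h x))"
        using f st b by (auto simp: indicator_def fun_eq_iff)
      then show ?thesis by (simp add: integral_restrict_space)
    qed
    have c: "continuous_on {s..b} (\<phi>' n)"
      unfolding \<phi>'_def by (intro continuous_intros continuous_on_compose2[OF S(3)]) auto
    have AEu: "AE x in lebesgue_on {s..b}. \<phi>' n x * u x = \<phi>' n x * v x"
      using uv by (subst AE_restrict_space_iff) (use st b in \<open>auto elim!: eventually_mono\<close>)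
    have cm: "(\<lambda>x. \<phi>' n x * v x) \<in> borel_measurable (lebesgue_on {s..b})"
      by (intro continuous_imp_measurable_on_sets_lebesgue continuous_intros c vc) auto
    have "(LINT x|lebesgue_on {s..b}. \<phi>' n x * u x) = (LINT x|lebesgue_on {s..b}. \<phi>' n x * v x)"
      using AEu by (intro integral_cong_AE borel_measurable_times cm borel_measurable_integrable[OF ui]
        continuous_imp_measurable_on_sets_lebesgue c) auto
    also have "\<dots> = integral {s..b} (\<lambda>x. \<phi>' n x * v x)"
      by (intro lebesgue_integral_eq_integral continuous_imp_integrable_real continuous_intros c vc) auto
    finally show ?thesis using eq restr[of "\<phi>' n" u] restr[of "\<phi> n" g] supp[OF n] by simp
  qed
  have lim1: "(\<lambda>n. integral {s..b} (\<lambda>x. \<phi>' n x * v x)) \<longlonglongrightarrow> v s - v t"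
  proof -
    have c: "continuous_on {s..b} (\<lambda>x. S' (real n * (x - c)))" for n c
      by (intro continuous_intros continuous_on_compose2[OF S(3)]) auto
    have "integral {s..b} (\<lambda>x. \<phi>' n x * v x) = integral {s..b} (\<lambda>x. real n * S' (real n * (x - s)) * v x)
      - integral {s..b} (\<lambda>x. real n * S' (real n * (x - t)) * v x)" for n
      unfolding \<phi>'_def left_diff_distrib
      by (intro Henstock_Kurzweil_Integration.integral_diff integrable_continuous_real continuous_intros c vc)
    then show ?thesis
      using st b by (simp only:) (intro tendsto_diff smooth_step_kernel_limit[OF S(2-7) vc]; simp)
  qed
  have lim2: "(\<lambda>n. LINT x|lebesgue_on {s..b}. \<phi> n x * g x) \<longlonglongrightarrow> (LINT x|lebesgue_on {s..b}. indicator {s..t} x * g x)"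
  proof (rule integral_dominated_convergence[where w = "\<lambda>x. norm (g x)"])
    show "(\<lambda>x. \<phi> n x * g x) \<in> borel_measurable (lebesgue_on {s..b})" for n
      using Ck_continuous[OF Ck[of 0 n]]
      by (intro borel_measurable_times borel_measurable_integrable[OF gi] continuous_imp_measurable_on_sets_lebesgue)
        (auto intro: continuous_on_subset)
    show "(\<lambda>x. indicat_real {s..t} x * g x) \<in> borel_measurable (lebesgue_on {s..b})"
      using b by (intro borel_measurable_times borel_measurable_integrable[OF gi] borel_measurable_indicator)
        (simp add: sets_restrict_space_iff)
    have "\<bar>\<phi> n x\<bar> \<le> 1" for n x
      using S(8,9)[of "real n * (x - s)"] S(8,9)[of "real n * (x - t)"] by (auto simp: \<phi>_def)
    then show "AE x in lebesgue_on {s..b}. norm (\<phi> n x * g x) \<le> norm (g x)" for n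
      by (auto simp: abs_mult intro!: mult_left_le_one_le)
    have "(\<lambda>n. S (real n * (x - c))) \<longlonglongrightarrow> (if x \<le> c then 0 else 1)" for x c
    proof (cases "x \<le> c")
      case True
      then show ?thesis by (simp add: S(6) mult_nonneg_nonpos)
    next
      case False
      then obtain M where "inverse (real (Suc M)) < x - c" using reals_Archimedean[of "x - c"] by auto
      then have M: "1 \<le> real (Suc M) * (x - c)" by (simp add: field_simps)
      have "\<forall>\<^sub>F n in sequentially. 1 = S (real n * (x - c))"
      proof (rule eventually_sequentiallyI[of "Suc M"])
        fix n assume "Suc M \<le> n"
        then have "real (Suc M) * (x - c) \<le> real n * (x - c)" using False by (intro mult_right_mono) auto
        with M show "1 = S (real n * (x - c))" by (intro S(7)[symmetric]) simp
      qed
      then show ?thesis using False by (auto intro: Lim_transform_eventually[OF tendsto_const])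
    qed
    from tendsto_diff[OF this this]
    have "(\<lambda>n. \<phi> n x) \<longlonglongrightarrow> (if x \<le> s then 0 else 1) - (if x \<le> t then 0 else 1)" for x
      unfolding \<phi>_def .
    \<comment> \<open>The pointwise limit is the indicator of the half-open interval
      \<open>(s, t]\<close>, which differs from that of \<open>[s, t]\<close> at the single point
      \<open>s\<close>.\<close>
    moreover have "(if x \<le> s then 0 else 1) - (if x \<le> t then 0 else 1) = indicat_real {s..t} x" if "x \<noteq> s" for x
      using that st by (auto simp: indicator_def)
    ultimately have "(\<lambda>n. \<phi> n x) \<longlonglongrightarrow> indicator {s..t} x" if "x \<noteq> s" for x
      using that by metis
    then have "x \<noteq> s \<Longrightarrow> (\<lambda>n. \<phi> n x * g x) \<longlonglongrightarrow> indicat_real {s..t} x * g x" for x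
      by (intro tendsto_mult tendsto_const)
    moreover have "AE x in lebesgue. x \<noteq> s"
      using AE_lborel_singleton[of s] by (rule AE_completion)
    ultimately show "AE x in lebesgue_on {s..b}. (\<lambda>n. \<phi> n x * g x) \<longlonglongrightarrow> indicat_real {s..t} x * g x"
      by (subst AE_restrict_space_iff) (auto elim!: eventually_mono)
  qed (use gi in auto)
  have "(\<lambda>n. - (LINT x|lebesgue_on {s..b}. \<phi> n x * g x)) \<longlonglongrightarrow> v s - v t"
    using lim1 by (rule Lim_transform_eventually) (use main in \<open>auto intro: eventually_sequentiallyI\<close>)
  with tendsto_minus[OF lim2] have "v s - v t = - (LINT x|lebesgue_on {s..b}. indicator {s..t} x * g x)"
    by (rule LIMSEQ_unique[rotated])
  moreover have "(LINT x|lebesgue_on {s..b}. indicator {s..t} x * g x) = (LINT x|lebesgue_on {s..t}. g x)"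
    using b by (simp add: integral_restrict_space) (intro Bochner_Integration.integral_cong, auto simp: indicator_def)
  moreover have "integrable (lebesgue_on {s..t}) g"
    using b by (intro integrable_lebesgue_on_subset[OF gi]) auto
  ultimately show ?thesis by (simp add: lebesgue_integral_eq_integral)
qed

subsection \<open>Square roots of positive definite matrices\<close>

lemma spd_inner_nonneg: "spd R \<Longrightarrow> 0 \<le> x \<bullet> (R *v x)"
  unfolding spd_def by (cases "x = 0") (auto intro: less_imp_le)

lemma symmetric_matrix_inner: "transpose R = R \<Longrightarrow> x \<bullet> (R *v y) = (R *v x) \<bullet> y"
  for R :: "real^'n^'n"
  by (metis dot_lmul_matrix vector_transpose_matrix transpose_matrix_vector)

text \<open>For \<open>D = S - S'\<close> equality of the squares gives
  \<open>S D + D S' = 0\<close>. Multiplying by \<open>D\<close> and taking the trace writes 0 as a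
  sum of quadratic forms of \<open>S\<close> and of \<open>S'\<close> at the rows of
  \<open>D\<close>, all nonnegative, so every row of \<open>D\<close> is zero.\<close>

lemma spd_square_unique:
  fixes S S' :: "real^'n^'n"
  assumes S: "spd S" and S': "spd S'" and eq: "S ** S = S' ** S'"
  shows "S = S'"
proof -
  define D where "D = S - S'"
  have symD: "transpose D = D"
    using S S' by (simp add: D_def spd_def transpose_def vec_eq_iff)
  \<comment> \<open>The sum telescopes to \<open>S ** S - S' ** S'\<close> without commuting the
    factors.\<close>
  have z: "S ** D + D ** S' = 0"
    using eq unfolding D_def vec_eq_iff matrix_matrix_mult_def
    by (simp add: right_diff_distrib left_diff_distrib sum_subtractf)
  have "trace (D ** (S ** D)) + trace (D ** (D ** S')) = trace (D ** (S ** D + D ** S'))"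
    by (simp add: matrix_add_ldistrib trace_add)
  also have "\<dots> = 0" by (simp add: z trace_def)
  finally have t: "trace (D ** (S ** D)) + trace (D ** (D ** S')) = 0" .
  \<comment> \<open>Symmetry of \<open>D\<close> identifies its columns with its rows, so each
    diagonal entry is a quadratic form of \<open>Q\<close>.\<close>
  have tr: "trace (D ** (Q ** D)) = (\<Sum>i\<in>UNIV. row i D \<bullet> (Q *v row i D))" for Q :: "real^'n^'n"
  proof -
    have "(D ** (Q ** D)) $ i $ i = row i D \<bullet> (Q *v row i D)" for i
    proof -
      have "(Q *v row i D) $ k = (Q ** D) $ k $ i" for k
      proof -
        have "D $ i $ l = D $ l $ i" for l
          using symD by (metis transpose_def vec_lambda_beta)
        then show ?thesis by (simp add: matrix_vector_mult_def matrix_matrix_mult_def row_def)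
      qed
      then show ?thesis
        by (simp add: matrix_matrix_mult_def[of D] inner_vec_def row_def)
    qed
    then show ?thesis by (simp add: trace_def)
  qed
  have "trace (D ** (D ** S')) = trace ((D ** S') ** D)" by (rule trace_mul_sym)
  also have "\<dots> = trace (D ** (S' ** D))" by (simp add: matrix_mul_assoc)
  finally have "(\<Sum>i\<in>UNIV. row i D \<bullet> (S *v row i D)) + (\<Sum>i\<in>UNIV. row i D \<bullet> (S' *v row i D)) = 0"
    using t by (simp add: tr)
  moreover have "0 \<le> (\<Sum>i\<in>UNIV. row i D \<bullet> (S' *v row i D))" "0 \<le> (\<Sum>i\<in>UNIV. row i D \<bullet> (S *v row i D))"
    using S S' by (auto intro!: sum_nonneg spd_inner_nonneg)
  ultimately have "(\<Sum>i\<in>UNIV. row i D \<bullet> (S *v row i D)) = 0" by linarith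
  then have "row i D \<bullet> (S *v row i D) = 0" for i
    by (subst (asm) sum_nonneg_eq_0_iff) (auto intro: spd_inner_nonneg S)
  then have "row i D = 0" for i
    using S unfolding spd_def by (metis less_irrefl)
  then have "D = 0" by (simp add: row_def vec_eq_iff)
  then show ?thesis by (simp add: D_def)
qed

text \<open>
  Contraction argument: if \<open>R = 1 - B\<close> with \<open>0 \<le> B \<le> q < 1\<close>, then \<open>1 - Y\<close> is a square root
  of \<open>R\<close> iff \<open>Y = (B + Y\<^sup>2) / 2\<close>, and this map contracts the ball of radius \<open>1 - \<surd>(1 - q)\<close>.
\<close>

lemma operator_square_root_exists:
  fixes B :: "'a::euclidean_space \<Rightarrow>\<^sub>L 'a"
  assumes B: "\<And>x y. x \<bullet> B y = B x \<bullet> y" and q: "norm B \<le> q" "0 \<le> q" "q < 1"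
  obtains Y :: "'a \<Rightarrow>\<^sub>L 'a" where "\<And>x y. x \<bullet> blinfun_apply Y y = blinfun_apply Y x \<bullet> y" "norm Y < 1"
    "2 *\<^sub>R Y = B + (Y o\<^sub>L Y)"
proof -
  \<comment> \<open>The smaller root of \<open>r = (q + r^2) / 2\<close>: the ball of radius
    \<open>r\<close> is mapped into itself, and \<open>r < 1\<close> is a contraction constant on
    it.\<close>
  define r where "r = 1 - sqrt (1 - q)"
  have r: "0 \<le> r" "r < 1" using q by (auto simp: r_def)
  have rq: "r\<^sup>2 = 2 * r - q"
    using q by (simp add: r_def power2_diff)
  define K where "K = {Y :: 'a \<Rightarrow>\<^sub>L 'a. norm Y \<le> r \<and> (\<forall>x y. x \<bullet> blinfun_apply Y y = blinfun_apply Y x \<bullet> y)}"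
  define f where "f Y = (1/2) *\<^sub>R (B + (Y o\<^sub>L Y))" for Y :: "'a \<Rightarrow>\<^sub>L 'a"
  have "closed K"
  proof -
    have "K = cball 0 r \<inter> (\<Inter>x. \<Inter>y. {Y. x \<bullet> blinfun_apply Y y = blinfun_apply Y x \<bullet> y})"
      by (auto simp: K_def dist_norm)
    then show ?thesis
      by (simp only:) (intro closed_Int closed_cball closed_INT ballI closed_Collect_eq continuous_intros)
  qed
  then have "complete K" by (simp add: complete_eq_closed)
  moreover have "K \<noteq> {}" using r by (auto simp: K_def intro!: exI[of _ 0])
  moreover have "f ` K \<subseteq> K"
  proof (intro image_subsetI)
    fix Y assume Y: "Y \<in> K"
    have "norm (f Y) \<le> 1/2 * (q + r\<^sup>2)"
    proof -
      have "norm (Y o\<^sub>L Y) \<le> norm Y * norm Y" by (rule norm_blinfun_compose)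
      also have "\<dots> \<le> r * r" using Y r by (intro mult_mono) (auto simp: K_def)
      finally show ?thesis using q norm_triangle_ineq[of B "Y o\<^sub>L Y"] by (simp add: f_def power2_eq_square)
    qed
    then have "norm (f Y) \<le> r" using rq by simp
    moreover have "x \<bullet> blinfun_apply (f Y) y = blinfun_apply (f Y) x \<bullet> y" for x y
    proof -
      have "x \<bullet> blinfun_apply Y (blinfun_apply Y y) = blinfun_apply Y (blinfun_apply Y x) \<bullet> y" using Y by (simp add: K_def)
      then show ?thesis using B[of x y]
        by (simp add: f_def blinfun.add_left blinfun.scaleR_left inner_add_left inner_add_right)
    qed
    ultimately show "f Y \<in> K" by (simp add: K_def)
  qed
  moreover have "dist (f Y) (f Z) \<le> r * dist Y Z" if "Y \<in> K" "Z \<in> K" for Y Z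
  proof -
    \<comment> \<open>The difference of squares is split as \<open>Y (Y - Z) + (Y - Z) Z\<close>,
      which is valid for non-commuting operators.\<close>
    have "f Y - f Z = (1/2) *\<^sub>R ((Y o\<^sub>L (Y - Z)) + ((Y - Z) o\<^sub>L Z))"
      by (rule blinfun_eqI) (simp add: f_def blinfun.bilinear_simps algebra_simps)
    moreover have "norm ((Y o\<^sub>L (Y - Z)) + ((Y - Z) o\<^sub>L Z)) \<le> r * norm (Y - Z) + norm (Y - Z) * r"
    proof (rule norm_triangle_mono)
      show "norm (Y o\<^sub>L (Y - Z)) \<le> r * norm (Y - Z)"
        using that by (intro order_trans[OF norm_blinfun_compose] mult_right_mono) (auto simp: K_def)
      show "norm ((Y - Z) o\<^sub>L Z) \<le> norm (Y - Z) * r"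
        using that r by (intro order_trans[OF norm_blinfun_compose] mult_left_mono) (auto simp: K_def)
    qed
    ultimately show ?thesis by (simp add: dist_norm)
  qed
  ultimately obtain Y where Y: "Y \<in> K" "f Y = Y"
    using Banach_fix[of K r f] r by blast
  show thesis
  proof
    show "\<And>x y. x \<bullet> blinfun_apply Y y = blinfun_apply Y x \<bullet> y" using Y(1) by (simp add: K_def)
    show "norm Y < 1" using Y(1) r by (simp add: K_def)
    have "2 *\<^sub>R f Y = B + (Y o\<^sub>L Y)" by (simp add: f_def)
    then show "2 *\<^sub>R Y = B + (Y o\<^sub>L Y)" using Y(2) by simp
  qed
qed

text \<open>Cauchy-Schwarz for the semidefinite form \<open>x \<bullet> B y\<close>, taken at
  \<open>x = B y\<close>, bounds \<open>|B y|^4\<close> by the product of the forms at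
  \<open>B y\<close> and at \<open>y\<close>, hence by \<open>q |B y|^2 * q |y|^2\<close>.\<close>

lemma nonneg_symmetric_operator_norm_le:
  fixes B :: "'a::euclidean_space \<Rightarrow>\<^sub>L 'a"
  assumes B: "\<And>x y. x \<bullet> B y = B x \<bullet> y" and nn: "\<And>x. 0 \<le> x \<bullet> B x" and le: "\<And>x. x \<bullet> B x \<le> q * (norm x)\<^sup>2"
    and q: "0 \<le> q"
  shows "norm B \<le> q"
proof (rule norm_blinfun_bound[OF q])
  fix y
  have cs: "(x \<bullet> B y)\<^sup>2 \<le> (x \<bullet> B x) * (y \<bullet> B y)" for x
  proof -
    have pos: "0 \<le> (x \<bullet> B x) + 2 * t * (x \<bullet> B y) + t\<^sup>2 * (y \<bullet> B y)" for t
    proof -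
      have "0 \<le> (x + t *\<^sub>R y) \<bullet> B (x + t *\<^sub>R y)" by (rule nn)
      also have "\<dots> = (x \<bullet> B x) + 2 * t * (x \<bullet> B y) + t\<^sup>2 * (y \<bullet> B y)"
        using B[of y x] by (simp add: blinfun.bilinear_simps inner_simps power2_eq_square algebra_simps inner_commute)
      finally show ?thesis .
    qed
    show ?thesis
    proof (cases "y \<bullet> B y = 0")
      case True
      have "x \<bullet> B y = 0"
      proof (rule ccontr)
        assume "x \<bullet> B y \<noteq> 0"
        \<comment> \<open>With \<open>y \<bullet> B y = 0\<close> the quadratic in \<open>t\<close>
          is affine; this \<open>t\<close> gives it the value -1, contradicting
          nonnegativity.\<close>
        moreover define t where "t = - ((x \<bullet> B x) + 1) / (2 * (x \<bullet> B y))"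
        ultimately have "2 * t * (x \<bullet> B y) = - ((x \<bullet> B x) + 1)" by simp
        then show False using pos[of t] by (simp add: True)
      qed
      then show ?thesis by (simp add: True)
    next
      case False
      then have p: "y \<bullet> B y > 0" using nn[of y] by simp
      have "0 \<le> (x \<bullet> B x) + 2 * (- (x \<bullet> B y) / (y \<bullet> B y)) * (x \<bullet> B y) + (- (x \<bullet> B y) / (y \<bullet> B y))\<^sup>2 * (y \<bullet> B y)"
        by (rule pos)
      also have "\<dots> = (x \<bullet> B x) - (x \<bullet> B y)\<^sup>2 / (y \<bullet> B y)"
        using p by (simp add: field_simps power2_eq_square)
      finally show ?thesis using p by (simp add: field_simps)
    qed
  qed
  have "(norm (B y))\<^sup>2 * (norm (B y))\<^sup>2 = (B y \<bullet> B y)\<^sup>2" by (simp only: power2_norm_eq_inner power2_eq_square[of "B y \<bullet> B y"])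
  also have "\<dots> \<le> (B y \<bullet> B (B y)) * (y \<bullet> B y)" by (rule cs)
  also have "\<dots> \<le> (q * (norm (B y))\<^sup>2) * (q * (norm y)\<^sup>2)"
    using q by (intro mult_mono le nn) auto
  finally have *: "(norm (B y))\<^sup>2 * (norm (B y))\<^sup>2 \<le> (norm (B y))\<^sup>2 * (q * norm y)\<^sup>2"
    by (simp add: power_mult_distrib power2_eq_square ac_simps)
  show "norm (B y) \<le> q * norm y"
  proof (cases "B y = 0")
    case False
    then have "(norm (B y))\<^sup>2 \<le> (q * norm y)\<^sup>2" by (intro mult_left_le_imp_le[OF *]) simp
    then show ?thesis using q by (simp add: power2_le_iff_abs_le)
  qed (use q in simp)
qed

lemma spd_coercive:
  fixes R :: "real^'n^'n"
  assumes "spd R"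
  obtains m where "m > 0" "\<And>x. m * (norm x)\<^sup>2 \<le> x \<bullet> (R *v x)"
proof -
  let ?S = "sphere (0 :: real^'n) 1"
  have "continuous_on ?S (\<lambda>x. x \<bullet> (R *v x))"
    by (intro continuous_intros linear_continuous_on matrix_vector_mul_bounded_linear)
  moreover have "?S \<noteq> {}" by simp
  ultimately obtain x0 where x0: "x0 \<in> ?S" "\<And>x. x \<in> ?S \<Longrightarrow> x0 \<bullet> (R *v x0) \<le> x \<bullet> (R *v x)"
    using continuous_attains_inf[OF compact_sphere] by blast
  show thesis
  proof
    show "x0 \<bullet> (R *v x0) > 0" using assms x0(1) unfolding spd_def by (metis norm_zero mem_sphere_0 zero_neq_one)
    show "x0 \<bullet> (R *v x0) * (norm x)\<^sup>2 \<le> x \<bullet> (R *v x)" for x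
    proof (cases "x = 0")
      case False
      define y where "y = inverse (norm x) *\<^sub>R x"
      have x: "x = norm x *\<^sub>R y" using False by (simp add: y_def)
      have "x0 \<bullet> (R *v x0) \<le> y \<bullet> (R *v y)" using False by (intro x0) (simp add: y_def)
      moreover have "x \<bullet> (R *v x) = (norm x)\<^sup>2 * (y \<bullet> (R *v y))"
        by (subst (1 2) x) (simp add: matrix_vector_mult_scaleR power2_eq_square)
      ultimately show ?thesis by (simp add: mult.commute[of _ "(norm x)\<^sup>2"] mult_left_mono)
    qed simp
  qed
qed

text \<open>Dividing \<open>R\<close> by an upper bound \<open>c\<close> of its form makes
  \<open>B = 1 - R / c\<close> nonnegative, and coercivity keeps its norm at most
  \<open>1 - m / c < 1\<close>, which is the setting of the fixed point argument.\<close>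

lemma spd_square_root_exists:
  fixes R :: "real^'n^'n"
  assumes R: "spd R"
  shows "\<exists>S. spd S \<and> S ** S = R"
proof -
  obtain m where m: "m > 0" "\<And>x. m * (norm x)\<^sup>2 \<le> x \<bullet> (R *v x)" using spd_coercive[OF R] by metis
  \<comment> \<open>The operator norm makes \<open>B\<close> nonnegative; the maximum with
    \<open>m\<close> secures \<open>c > 0\<close> and \<open>1 - m / c \<ge> 0\<close>
    directly.\<close>
  define c where "c = max m (onorm (\<lambda>x. R *v x))"
  have c: "c > 0" "m \<le> c" using m(1) by (auto simp: c_def)
  have Rc: "x \<bullet> (R *v x) \<le> c * (norm x)\<^sup>2" for x
  proof -
    have "x \<bullet> (R *v x) \<le> norm x * norm (R *v x)" by (rule norm_cauchy_schwarz)
    also have "\<dots> \<le> norm x * (c * norm x)"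
      by (intro mult_left_mono order_trans[OF onorm[OF matrix_vector_mul_bounded_linear]] mult_right_mono)
        (auto simp: c_def)
    finally show ?thesis by (simp add: power2_eq_square ac_simps)
  qed
  define B where "B = Blinfun (\<lambda>x. x - (1/c) *\<^sub>R (R *v x))"
  have "bounded_linear (\<lambda>x. x - (1/c) *\<^sub>R (R *v x))"
    by (intro bounded_linear_sub bounded_linear_ident
        bounded_linear_compose[OF bounded_linear_scaleR_right matrix_vector_mul_bounded_linear])
  then have Bx: "B x = x - (1/c) *\<^sub>R (R *v x)" for x
    by (simp add: B_def bounded_linear_Blinfun_apply)
  have symR: "x \<bullet> (R *v y) = (R *v x) \<bullet> y" for x y
    using R by (intro symmetric_matrix_inner) (simp add: spd_def)
  have symB: "x \<bullet> B y = B x \<bullet> y" for x y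
    by (simp add: Bx inner_diff_left inner_diff_right symR)
  have xBx: "x \<bullet> B x = (norm x)\<^sup>2 - (x \<bullet> (R *v x)) / c" for x
    by (simp add: Bx inner_diff_right power2_norm_eq_inner)
  have "norm B \<le> 1 - m / c"
  proof (rule nonneg_symmetric_operator_norm_le[OF symB])
    show "0 \<le> x \<bullet> B x" for x using Rc[of x] c by (simp add: xBx field_simps)
    show "x \<bullet> B x \<le> (1 - m / c) * (norm x)\<^sup>2" for x using m(2)[of x] c by (simp add: xBx field_simps)
    show "0 \<le> 1 - m / c" using c by simp
  qed
  then obtain Y where Y: "\<And>x y. x \<bullet> blinfun_apply Y y = blinfun_apply Y x \<bullet> y" "norm Y < 1" "2 *\<^sub>R Y = B + (Y o\<^sub>L Y)"
    using operator_square_root_exists[OF symB, of "1 - m / c"] c m(1) by (auto simp: field_simps)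
  \<comment> \<open>The square of this map is \<open>c (1 - 2 Y + Y^2) = c (1 - B) = R\<close> by
    the fixed point equation, and \<open>norm Y < 1\<close> makes it positive definite.\<close>
  define s where "s x = sqrt c *\<^sub>R (x - Y x)" for x
  have lin: "linear s" unfolding s_def
    by (intro linear_compose_scale_right linear_compose_sub linear_id[unfolded id_def] bounded_linear.linear blinfun.bounded_linear_right)
  define S where "S = matrix s"
  have Sx: "S *v x = s x" for x using fun_cong[OF matrix_vector_mul(2)[OF lin]] by (simp add: S_def)
  have YY: "Y (Y x) = 2 *\<^sub>R Y x - B x" for x
    using arg_cong[OF Y(3), of "\<lambda>Z. blinfun_apply Z x"] by (simp add: blinfun.bilinear_simps)
  have "S ** S = R"
  proof (rule matrix_eq[THEN iffD2], rule allI)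
    fix x
    have "(S ** S) *v x = c *\<^sub>R (x - 2 *\<^sub>R Y x + Y (Y x))"
      using c by (simp add: Sx s_def matrix_vector_mul_assoc[symmetric] blinfun.bilinear_simps
        scaleR_2 algebra_simps flip: power2_eq_square)
    also have "\<dots> = R *v x" using c by (simp add: YY Bx)
    finally show "(S ** S) *v x = R *v x" .
  qed
  moreover have "spd S"
    unfolding spd_def
  proof (intro conjI allI impI)
    have sym: "x \<bullet> (S *v y) = (S *v x) \<bullet> y" for x y
      by (simp add: Sx s_def inner_diff_left inner_diff_right Y(1))
    have "S $ i $ j = S $ j $ i" for i j
      using sym[of "axis i 1" "axis j 1"]
      by (simp add: inner_axis inner_axis' matrix_vector_mul_component)
    then show "transpose S = S" by (simp add: transpose_def vec_eq_iff)
    fix x :: "real^'n" assume "x \<noteq> 0"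
    have "x \<bullet> Y x \<le> norm x * norm (Y x)" by (rule norm_cauchy_schwarz)
    also have "\<dots> \<le> norm x * (norm Y * norm x)" by (intro mult_left_mono norm_blinfun) auto
    also have "\<dots> < norm x * (1 * norm x)"
      using \<open>x \<noteq> 0\<close> Y(2) by (intro mult_strict_left_mono mult_strict_right_mono) auto
    also have "\<dots> = x \<bullet> x" by (simp add: power2_norm_eq_inner[symmetric] power2_eq_square)
    finally show "0 < x \<bullet> (S *v x)"
      using c by (simp add: Sx s_def inner_diff_right)
  qed
  ultimately show ?thesis by blast
qed

lemma matrix_sqrt_works:
  assumes "spd R"
  shows "spd (matrix_sqrt R)" "matrix_sqrt R ** matrix_sqrt R = R"
proof -
  obtain S where S: "spd S" "S ** S = R" using spd_square_root_exists[OF assms] by blast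
  then have "matrix_sqrt R = S"
    unfolding matrix_sqrt_def by (intro the_equality) (auto intro: spd_square_unique)
  with S show "spd (matrix_sqrt R)" "matrix_sqrt R ** matrix_sqrt R = R" by auto
qed

lemma spd_invertible:
  fixes S :: "real^'n^'n"
  assumes "spd S"
  shows "matrix_inv S *v (S *v x) = x" "S *v (matrix_inv S *v x) = x"
proof -
  have "\<forall>x. S *v x = 0 \<longrightarrow> x = 0"
    using assms unfolding spd_def by (metis inner_zero_right less_irrefl)
  then have "invertible S" by (simp add: invertible_left_inverse matrix_left_invertible_ker)
  then have "S ** matrix_inv S = mat 1 \<and> matrix_inv S ** S = mat 1"
    unfolding invertible_def matrix_inv_def by (rule someI_ex)
  then show "matrix_inv S *v (S *v x) = x" "S *v (matrix_inv S *v x) = x"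
    by (simp_all add: matrix_vector_mul_assoc)
qed

subsection \<open>Square integrable functions on an interval\<close>

lemma square_integrable_on_inner:
  fixes f g :: "'a::euclidean_space \<Rightarrow> 'b::{real_inner, second_countable_topology}"
  assumes "f square_integrable_on S" "g square_integrable_on S"
  shows "integrable (lebesgue_on S) (\<lambda>x. f x \<bullet> g x)"
proof (rule Bochner_Integration.integrable_bound)
  show "integrable (lebesgue_on S) (\<lambda>x. (norm (f x))\<^sup>2 + (norm (g x))\<^sup>2)"
    using assms by (simp add: square_integrable_on_def)
  show "(\<lambda>x. f x \<bullet> g x) \<in> borel_measurable (lebesgue_on S)"
    using assms by (auto simp: square_integrable_on_def)
  show "AE x in lebesgue_on S. norm (f x \<bullet> g x) \<le> norm ((norm (f x))\<^sup>2 + (norm (g x))\<^sup>2)"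
  proof (rule AE_I2)
    fix x
    have "\<bar>f x \<bullet> g x\<bar> \<le> norm (f x) * norm (g x)" by (rule Cauchy_Schwarz_ineq2)
    also have "\<dots> \<le> (norm (f x))\<^sup>2 + (norm (g x))\<^sup>2"
      using zero_le_power2[of "norm (f x) - norm (g x)"]
      by (simp add: power2_eq_square algebra_simps) (smt (verit) mult_nonneg_nonneg norm_ge_zero)
    finally show "norm (f x \<bullet> g x) \<le> norm ((norm (f x))\<^sup>2 + (norm (g x))\<^sup>2)" by simp
  qed
qed

lemma inner_le_weighted_squares:
  fixes x y :: "'b::real_inner"
  assumes "r > 0"
  shows "\<bar>x \<bullet> y\<bar> \<le> (r * (norm x)\<^sup>2 + (norm y)\<^sup>2 / r) / 2"
proof -
  have "\<bar>x \<bullet> y\<bar> \<le> norm x * norm y" by (rule Cauchy_Schwarz_ineq2)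
  moreover have "0 \<le> (r * norm x - norm y)\<^sup>2 / r" using assms by simp
  then have "norm x * norm y \<le> (r * (norm x)\<^sup>2 + (norm y)\<^sup>2 / r) / 2"
    using assms by (simp add: field_simps power2_eq_square)
  ultimately show ?thesis by simp
qed

lemma square_integrable_on_young:
  fixes f g :: "'a::euclidean_space \<Rightarrow> 'b::{real_inner, second_countable_topology}"
  assumes f: "f square_integrable_on S" and g: "g square_integrable_on S" and r: "r > 0"
  shows "\<bar>LINT x|lebesgue_on S. f x \<bullet> g x\<bar>
    \<le> (r * (LINT x|lebesgue_on S. (norm (f x))\<^sup>2) + (LINT x|lebesgue_on S. (norm (g x))\<^sup>2) / r) / 2"
proof -
  have i: "integrable (lebesgue_on S) (\<lambda>x. (norm (f x))\<^sup>2)" "integrable (lebesgue_on S) (\<lambda>x. (norm (g x))\<^sup>2)"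
    using f g by (auto simp: square_integrable_on_def)
  have "\<bar>LINT x|lebesgue_on S. f x \<bullet> g x\<bar> \<le> (LINT x|lebesgue_on S. \<bar>f x \<bullet> g x\<bar>)"
    by (rule integral_abs_bound)
  also have "\<dots> \<le> (LINT x|lebesgue_on S. (r * (norm (f x))\<^sup>2 + (norm (g x))\<^sup>2 / r) / 2)"
    by (intro integral_mono integrable_abs square_integrable_on_inner f g inner_le_weighted_squares r)
      (use i in auto)
  also have "\<dots> = (r * (LINT x|lebesgue_on S. (norm (f x))\<^sup>2) + (LINT x|lebesgue_on S. (norm (g x))\<^sup>2) / r) / 2"
    using i by simp
  finally show ?thesis .
qed

lemma square_integrable_on_scaleR:
  fixes f :: "'a::euclidean_space \<Rightarrow> 'b::{real_normed_vector, second_countable_topology}"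
  shows "f square_integrable_on S \<Longrightarrow> (\<lambda>x. c *\<^sub>R f x) square_integrable_on S"
  by (auto simp: square_integrable_on_def power_mult_distrib intro: borel_measurable_scaleR)

lemma square_integrable_on_add:
  fixes f g :: "'a::euclidean_space \<Rightarrow> 'b::{real_normed_vector, second_countable_topology}"
  assumes "f square_integrable_on S" "g square_integrable_on S"
  shows "(\<lambda>x. f x + g x) square_integrable_on S"
  unfolding square_integrable_on_def
proof
  show "(\<lambda>x. f x + g x) \<in> borel_measurable (lebesgue_on S)"
    using assms by (auto simp: square_integrable_on_def)
  show "integrable (lebesgue_on S) (\<lambda>x. (norm (f x + g x))\<^sup>2)"
  proof (rule Bochner_Integration.integrable_bound)
    show "integrable (lebesgue_on S) (\<lambda>x. 2 * (norm (f x))\<^sup>2 + 2 * (norm (g x))\<^sup>2)"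
      using assms by (simp add: square_integrable_on_def)
    show "(\<lambda>x. (norm (f x + g x))\<^sup>2) \<in> borel_measurable (lebesgue_on S)"
      using assms by (auto simp: square_integrable_on_def)
    show "AE x in lebesgue_on S. norm ((norm (f x + g x))\<^sup>2) \<le> norm (2 * (norm (f x))\<^sup>2 + 2 * (norm (g x))\<^sup>2)"
    proof (rule AE_I2)
      fix x
      have "(norm (f x + g x))\<^sup>2 \<le> (norm (f x) + norm (g x))\<^sup>2"
        by (simp add: norm_triangle_ineq power_mono)
      also have "\<dots> \<le> 2 * (norm (f x))\<^sup>2 + 2 * (norm (g x))\<^sup>2"
        using zero_le_power2[of "norm (f x) - norm (g x)"]
        by (simp add: power2_eq_square algebra_simps)
      finally show "norm ((norm (f x + g x))\<^sup>2) \<le> norm (2 * (norm (f x))\<^sup>2 + 2 * (norm (g x))\<^sup>2)" by simp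
    qed
  qed
qed

lemma square_integrable_on_diff:
  fixes f g :: "'a::euclidean_space \<Rightarrow> 'b::{real_normed_vector, second_countable_topology}"
  assumes "f square_integrable_on S" "g square_integrable_on S"
  shows "(\<lambda>x. f x - g x) square_integrable_on S"
  using square_integrable_on_add[OF assms(1) square_integrable_on_scaleR[OF assms(2), of "-1"]] by simp

lemma square_integrable_on_bound:
  fixes f :: "'a::euclidean_space \<Rightarrow> 'b::{real_normed_vector, second_countable_topology}"
    and g :: "'a \<Rightarrow> 'c::real_normed_vector"
  assumes "g square_integrable_on S" "f \<in> borel_measurable (lebesgue_on S)"
    "AE x in lebesgue_on S. norm (f x) \<le> norm (g x)"
  shows "f square_integrable_on S"
  unfolding square_integrable_on_def
proof
  show "integrable (lebesgue_on S) (\<lambda>x. (norm (f x))\<^sup>2)"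
  proof (rule Bochner_Integration.integrable_bound)
    show "integrable (lebesgue_on S) (\<lambda>x. (norm (g x))\<^sup>2)" using assms(1) by (simp add: square_integrable_on_def)
    show "AE x in lebesgue_on S. norm ((norm (f x))\<^sup>2) \<le> norm ((norm (g x))\<^sup>2)"
      using assms(3) by eventually_elim (simp add: power_mono)
  qed (use assms in auto)
qed (rule assms)

lemma square_integrable_on_bounded_Icc:
  fixes f :: "real \<Rightarrow> 'b::{real_normed_vector, second_countable_topology}"
  assumes "f \<in> borel_measurable (lebesgue_on {a..b})" "\<And>x. a \<le> x \<Longrightarrow> x \<le> b \<Longrightarrow> norm (f x) \<le> C"
  shows "f square_integrable_on {a..b}"
proof (rule square_integrable_on_bound)
  show "(\<lambda>x. C) square_integrable_on {a..b}"
    by (auto simp: square_integrable_on_def intro!: continuous_imp_integrable_real)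
  show "AE x in lebesgue_on {a..b}. norm (f x) \<le> norm C"
    using assms(2) by (auto intro!: AE_I2 order_trans[OF _ abs_ge_self])
qed (rule assms)

lemma square_integrable_on_continuous:
  fixes f :: "real \<Rightarrow> 'b::{real_normed_vector, second_countable_topology}"
  assumes "continuous_on {a..b} f"
  shows "f square_integrable_on {a..b}"
  unfolding square_integrable_on_def
  by (intro conjI continuous_imp_measurable_on_sets_lebesgue continuous_imp_integrable_real
      continuous_intros assms) auto

lemma square_integrable_on_subset:
  fixes f :: "'a::euclidean_space \<Rightarrow> 'b::{real_normed_vector, second_countable_topology}"
  assumes "f square_integrable_on S" "T \<subseteq> S" "S \<in> sets lebesgue" "T \<in> sets lebesgue"
  shows "f square_integrable_on T"
proof -
  have "f \<in> borel_measurable (lebesgue_on T)"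
    using assms(1,2) by (auto simp: square_integrable_on_def intro: measurable_restrict_mono)
  moreover have "integrable (lebesgue_on T) (\<lambda>x. (norm (f x))\<^sup>2)"
    using assms set_integrable_subset[of lebesgue S "\<lambda>x. (norm (f x))\<^sup>2" T]
    by (simp add: square_integrable_on_def integrable_restrict_space set_integrable_def)
  ultimately show ?thesis by (simp add: square_integrable_on_def)
qed

lemma square_integrable_on_dominated_convergence:
  fixes s :: "nat \<Rightarrow> 'a::euclidean_space \<Rightarrow> 'b::{real_normed_vector, second_countable_topology}"
  assumes s: "\<And>n. s n \<in> borel_measurable (lebesgue_on S)" and f: "f \<in> borel_measurable (lebesgue_on S)"
    and w: "w square_integrable_on S"
    and lim: "AE x in lebesgue_on S. (\<lambda>n. s n x) \<longlonglongrightarrow> f x"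
    and bound: "\<And>n. AE x in lebesgue_on S. norm (s n x - f x) \<le> norm (w x)"
  shows "(\<lambda>n. LINT x|lebesgue_on S. (norm (s n x - f x))\<^sup>2) \<longlonglongrightarrow> 0"
proof -
  have "(\<lambda>n. LINT x|lebesgue_on S. (norm (s n x - f x))\<^sup>2) \<longlonglongrightarrow> (LINT x|lebesgue_on S. 0)"
  proof (rule integral_dominated_convergence[where w = "\<lambda>x. (norm (w x))\<^sup>2"])
    show "integrable (lebesgue_on S) (\<lambda>x. (norm (w x))\<^sup>2)" using w by (simp add: square_integrable_on_def)
    show "AE x in lebesgue_on S. (\<lambda>n. (norm (s n x - f x))\<^sup>2) \<longlonglongrightarrow> 0"
      using lim
    proof eventually_elim
      case (elim x)
      then have "(\<lambda>n. norm (s n x - f x)) \<longlonglongrightarrow> 0" by (simp add: LIM_zero tendsto_norm_zero)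
      then show ?case using tendsto_power[of _ 0 _ 2] by fastforce
    qed
    show "AE x in lebesgue_on S. norm ((norm (s n x - f x))\<^sup>2) \<le> (norm (w x))\<^sup>2" for n
      using bound[of n] by eventually_elim (simp add: power_mono)
  qed (use s f in auto)
  then show ?thesis by simp
qed

text \<open>Density of step functions on intervals in the square integrable functions, cast as an
  induction rule. A limit statement that is linear and stable under \<open>L\<^sup>2\<close>
  convergence in \<open>p\<close> then has to be checked for multiples of interval indicators
  only.\<close>

lemma square_integrable_on_Icc_induct [consumes 1, case_names interval lin lim]:
  fixes p :: "real \<Rightarrow> 'b::{real_normed_vector, second_countable_topology}"
  assumes p: "p square_integrable_on {a..b}"
    and interval: "\<And>\<alpha> \<beta> c. a \<le> \<alpha> \<Longrightarrow> \<alpha> \<le> \<beta> \<Longrightarrow> \<beta> \<le> b \<Longrightarrow> P (\<lambda>t. indicator {\<alpha>..\<beta>} t *\<^sub>R c)"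
    and lin: "\<And>f g r. f square_integrable_on {a..b} \<Longrightarrow> g square_integrable_on {a..b} \<Longrightarrow>
      P f \<Longrightarrow> P g \<Longrightarrow> P (\<lambda>t. f t + r *\<^sub>R g t)"
    and lim: "\<And>s f. f square_integrable_on {a..b} \<Longrightarrow> (\<And>n. s n square_integrable_on {a..b}) \<Longrightarrow>
      (\<And>n. P (s n)) \<Longrightarrow> (\<lambda>n. LINT x|lebesgue_on {a..b}. (norm (s n x - f x))\<^sup>2) \<longlonglongrightarrow> 0 \<Longrightarrow> P f"
    and ab: "a \<le> b"
  shows "P p"
proof -
  let ?M = "lebesgue_on {a..b}"
  \<comment> \<open>A constant sequence in the closure hypothesis shows that \<open>P\<close>
    respects equality almost everywhere.\<close>
  have cong: "P f" if "P h" and h: "h square_integrable_on {a..b}" and f: "f \<in> borel_measurable ?M"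
    and eq: "AE x in ?M. h x = f x" for f h
  proof (rule lim[of f "\<lambda>n. h"])
    show "f square_integrable_on {a..b}"
      by (rule square_integrable_on_bound[OF h f]) (use eq in \<open>auto elim: eventually_mono\<close>)
    have "(LINT x|?M. (norm (h x - f x))\<^sup>2) = (LINT x|?M. 0)"
      using h f eq by (intro integral_cong_AE) (auto simp: square_integrable_on_def elim: eventually_mono)
    then show "(\<lambda>n. LINT x|?M. (norm (h x - f x))\<^sup>2) \<longlonglongrightarrow> 0" by simp
  qed (use that in auto)
  have m: "(\<lambda>t. indicat_real A t *\<^sub>R c) \<in> borel_measurable ?M" if "A \<in> sets lebesgue" for A and c :: 'b
    using that by (intro measurable_restrict_space1 borel_measurable_scaleR) auto
  have si: "(\<lambda>t. indicat_real A t *\<^sub>R c) square_integrable_on {a..b}" if "A \<in> sets lebesgue" for A and c :: 'b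
    by (rule square_integrable_on_bounded_Icc[OF m[OF that], where C = "norm c"]) (auto simp: indicator_def)
  have zero: "P (\<lambda>t. 0)" using interval[of a a 0] ab by simp
  have borel: "\<forall>c. P (\<lambda>t. indicator A t *\<^sub>R c)" if "A \<in> sets borel" for A
  proof -
    have sets: "sets borel = sigma_sets UNIV (range (\<lambda>(a, b). box a b :: real set))"
      by (subst borel_eq_box) (rule sets_measure_of, simp)
    have "Int_stable (range (\<lambda>(a, b). box a b :: real set))"
      by (auto simp: Int_stable_def box_Int_box)
    moreover have "range (\<lambda>(a, b). box a b :: real set) \<subseteq> Pow UNIV" by simp
    moreover have "A \<in> sigma_sets UNIV (range (\<lambda>(a, b). box a b))"
      using that unfolding sets .
    ultimately show ?thesis
    proof (induction rule: sigma_sets_induct_disjoint)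
      case (basic A)
      then obtain \<alpha> \<beta> where A: "A = {\<alpha><..<\<beta>}" by auto
      \<comment> \<open>The generating open interval is clipped to \<open>[a, b]\<close> and then
        closed, which changes its indicator on \<open>[a, b]\<close> at most at two points.\<close>
      define \<alpha>' \<beta>' where "\<alpha>' = max a \<alpha>" and "\<beta>' = min b \<beta>"
      have A': "A \<in> sets lebesgue" by (simp add: A)
      show ?case
      proof
        fix c
        show "P (\<lambda>t. indicator A t *\<^sub>R c)"
        proof (cases "\<alpha>' \<le> \<beta>'")
          case True
          have "AE t in lebesgue. t \<noteq> \<alpha>' \<and> t \<noteq> \<beta>'"
            using AE_completion[OF AE_lborel_singleton[of \<alpha>']] AE_completion[OF AE_lborel_singleton[of \<beta>']]
            by eventually_elim auto
          then have "AE t in lebesgue. t \<in> {a..b} \<longrightarrow> indicat_real {\<alpha>'..\<beta>'} t *\<^sub>R c = indicat_real A t *\<^sub>R c"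
            by eventually_elim (auto simp: A \<alpha>'_def \<beta>'_def indicator_def)
          then have "AE t in ?M. indicat_real {\<alpha>'..\<beta>'} t *\<^sub>R c = indicat_real A t *\<^sub>R c"
            by (subst AE_restrict_space_iff) auto
          from cong[OF interval si m[OF A'] this] True show ?thesis
            by (simp add: \<alpha>'_def \<beta>'_def)
        next
          case False
          have "AE t in ?M. (0 :: 'b) = indicat_real A t *\<^sub>R c"
            using False by (intro AE_I2) (auto simp: A \<alpha>'_def \<beta>'_def indicator_def)
          from cong[OF zero _ m[OF A'] this] show ?thesis using si[of "{}"] by simp
        qed
      qed
    next
      case empty
      show ?case using zero by simp
    next
      case (compl A)
      then have "A \<in> sets borel" unfolding sets by blast
      then have A: "A \<in> sets lebesgue" by simp
      show ?case
      proof
        fix c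
        \<comment> \<open>Since only values on \<open>[a, b]\<close> count, the complement may be
          taken relative to \<open>[a, b]\<close>, so that the whole line never has to be
          treated.\<close>
        have "P (\<lambda>t. indicat_real {a..b} t *\<^sub>R c + (-1) *\<^sub>R indicat_real A t *\<^sub>R c)"
          using compl ab A by (intro lin si interval) auto
        moreover have "(\<lambda>t. indicat_real {a..b} t *\<^sub>R c + (-1) *\<^sub>R indicat_real A t *\<^sub>R c) square_integrable_on {a..b}"
          using A by (intro square_integrable_on_add square_integrable_on_scaleR si) auto
        moreover have "UNIV - A \<in> sets lebesgue" using A by auto
        ultimately show "P (\<lambda>t. indicat_real (UNIV - A) t *\<^sub>R c)"
          by (rule cong[OF _ _ m]) (auto simp: indicator_def intro!: AE_I2)
      qed
    next
      case (union A)
      have "A i \<in> sets borel" for i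
        unfolding sets by (rule subsetD[OF union(2)]) (rule rangeI)
      then have A: "A i \<in> sets lebesgue" for i by simp
      define S where "S k = (\<Union>i<k. A i)" for k
      have S: "S k \<in> sets lebesgue" for k using A by (auto simp: S_def)
      have AU: "(\<Union>i. A i) \<in> sets lebesgue" using A by auto
      show ?case
      proof
        fix c
        have PS: "P (\<lambda>t. indicat_real (S k) t *\<^sub>R c)" for k
        proof (induction k)
          case 0
          then show ?case using zero by (simp add: S_def)
        next
          case (Suc k)
          have disj: "S k \<inter> A k = {}"
            using union(1) unfolding S_def disjoint_family_on_def
            by (auto simp: disjoint_iff) (metis IntI UNIV_I empty_iff less_irrefl)
          have "S (Suc k) = S k \<union> A k" by (auto simp: S_def lessThan_Suc)
          then have "(\<lambda>t. indicat_real (S (Suc k)) t *\<^sub>R c)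
            = (\<lambda>t. indicat_real (S k) t *\<^sub>R c + 1 *\<^sub>R indicat_real (A k) t *\<^sub>R c)"
            using disj by (auto simp: indicator_def fun_eq_iff)
          moreover have "P (\<lambda>t. indicat_real (S k) t *\<^sub>R c + 1 *\<^sub>R indicat_real (A k) t *\<^sub>R c)"
            using union(3) by (intro lin si S A Suc) auto
          ultimately show ?case by simp
        qed
        show "P (\<lambda>t. indicat_real (\<Union>i. A i) t *\<^sub>R c)"
        proof (rule lim[OF si[OF AU] si[OF S] PS])
          show "(\<lambda>n. LINT x|?M. (norm (indicat_real (S n) x *\<^sub>R c - indicat_real (\<Union>i. A i) x *\<^sub>R c))\<^sup>2) \<longlonglongrightarrow> 0"
          proof (rule square_integrable_on_dominated_convergence[OF m[OF S] m[OF AU]])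
            show "(\<lambda>x. indicat_real UNIV x *\<^sub>R c) square_integrable_on {a..b}" by (intro si) auto
            show "AE x in ?M. (\<lambda>n. indicat_real (S n) x *\<^sub>R c) \<longlonglongrightarrow> indicat_real (\<Union>i. A i) x *\<^sub>R c"
            proof (rule AE_I2)
              fix x
              have "\<forall>\<^sub>F k in sequentially. indicat_real (S k) x = indicat_real (\<Union>i. A i) x"
              proof (cases "\<exists>i. x \<in> A i")
                case True
                then obtain i where "x \<in> A i" by blast
                then show ?thesis
                  by (intro eventually_sequentiallyI[of "Suc i"]) (auto simp: S_def indicator_def)
              qed (auto simp: S_def indicator_def)
              then have "(\<lambda>k. indicat_real (S k) x) \<longlonglongrightarrow> indicat_real (\<Union>i. A i) x"
                by (rule tendsto_eventually)
              then show "(\<lambda>n. indicat_real (S n) x *\<^sub>R c) \<longlonglongrightarrow> indicat_real (\<Union>i. A i) x *\<^sub>R c"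
                by (intro tendsto_intros)
            qed
            show "AE x in ?M. norm (indicat_real (S n) x *\<^sub>R c - indicat_real (\<Union>i. A i) x *\<^sub>R c)
              \<le> norm (indicat_real UNIV x *\<^sub>R c)" for n
              by (rule AE_I2) (auto simp: indicator_def S_def)
          qed
        qed
      qed
    qed
  qed
  have leb: "P (\<lambda>t. indicator A t *\<^sub>R c)" if A: "A \<in> sets lebesgue" for A c
  proof -
    let ?N = "main_part lborel A"
    have N: "?N \<in> sets borel" using A main_part_sets[of A lborel] by simp
    have "AE x in ?M. indicat_real ?N x *\<^sub>R c = indicat_real A x *\<^sub>R c"
      using AE_lebesgue_mem_main_part[OF A]
      by (subst AE_restrict_space_iff) (auto simp: indicator_def elim!: eventually_mono)
    from cong[OF _ si m[OF A] this] show ?thesis using borel[OF N] N by simp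
  qed
  have "p \<in> borel_measurable ?M" using p by (simp add: square_integrable_on_def)
  from borel_measurable_implies_sequence_metric[OF this, of 0] obtain s where
    s: "\<forall>i. simple_function ?M (s i)" and
    slim': "\<forall>x\<in>space ?M. (\<lambda>i. s i x) \<longlonglongrightarrow> p x" and
    bound': "\<forall>i. \<forall>x\<in>space ?M. dist (s i x) 0 \<le> 2 * dist (p x) 0"
    by metis
  note s = s[rule_format] and slim = slim'[rule_format]
  have bound: "norm (s i x) \<le> 2 * norm (p x)" if "x \<in> space ?M" for i x
    using bound' that by simp
  have sm: "s i \<in> borel_measurable ?M" for i using s by (rule borel_measurable_simple_function)
  have sP: "s i square_integrable_on {a..b} \<and> P (s i)" for i
  proof -
    define F where "F = s i ` space ?M"
    have finF: "finite F" using s[of i] by (simp add: simple_function_def F_def)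
    define J where "J y t = indicat_real (s i -` {y} \<inter> {a..b}) t *\<^sub>R y" for y t
    have A: "s i -` {y} \<inter> {a..b} \<in> sets lebesgue" for y
      using simple_functionD(2)[OF s, of i "{y}"] by (simp add: sets_restrict_space_iff)
    have sum: "(\<lambda>t. \<Sum>y\<in>G. J y t) square_integrable_on {a..b} \<and> P (\<lambda>t. \<Sum>y\<in>G. J y t)" if "finite G" for G
      using that
    proof induction
      case empty
      then show ?case using zero si[of "{}" 0] by simp
    next
      case (insert y G)
      have J: "J y square_integrable_on {a..b}" "P (J y)"
        unfolding J_def using si[OF A] leb[OF A] by auto
      have "P (\<lambda>t. (\<Sum>y\<in>G. J y t) + 1 *\<^sub>R J y t)" using insert J by (intro lin) auto
      then show ?case using insert J by (simp add: square_integrable_on_add add.commute)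
    qed
    have eq: "(\<Sum>y\<in>F. J y x) = s i x" if x: "x \<in> space ?M" for x
    proof -
      have "(\<Sum>y\<in>F. J y x) = (\<Sum>y\<in>{s i x}. J y x)"
        using finF x by (intro sum.mono_neutral_right) (auto simp: indicator_def J_def F_def)
      then show ?thesis using x by (simp add: J_def indicator_def)
    qed
    have "P (s i)"
      by (rule cong[OF conjunct2[OF sum[OF finF]] conjunct1[OF sum[OF finF]] sm AE_I2[OF eq]])
    moreover have "s i square_integrable_on {a..b}"
      by (rule square_integrable_on_bound[OF conjunct1[OF sum[OF finF]] sm AE_I2]) (simp add: eq del: space_restrict_space)
    ultimately show ?thesis by blast
  qed
  show ?thesis
  proof (rule lim[OF p])
    show "(\<lambda>n. LINT x|?M. (norm (s n x - p x))\<^sup>2) \<longlonglongrightarrow> 0"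
    proof (rule square_integrable_on_dominated_convergence[OF sm])
      show "(\<lambda>x. 3 *\<^sub>R p x) square_integrable_on {a..b}" by (rule square_integrable_on_scaleR[OF p])
      show "AE x in ?M. norm (s n x - p x) \<le> norm (3 *\<^sub>R p x)" for n
      proof (rule AE_I2)
        fix x assume "x \<in> space ?M"
        then show "norm (s n x - p x) \<le> norm (3 *\<^sub>R p x)"
          using norm_triangle_ineq4[of "s n x" "p x"] bound[of x n] by simp
      qed
      show "AE x in ?M. (\<lambda>n. s n x) \<longlonglongrightarrow> p x" using slim by (rule AE_I2)
    qed (use p in \<open>simp add: square_integrable_on_def\<close>)
  qed (use sP in auto)
qed

subsection \<open>Backward difference quotients\<close>

lemma integrable_lebesgue_on_shift:
  fixes v :: "real \<Rightarrow> real"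
  assumes v: "integrable (lebesgue_on {a - h..b - h}) v"
  shows "integrable (lebesgue_on {a..b}) (\<lambda>t. v (t - h))"
    and "(LINT t|lebesgue_on {a..b}. v (t - h)) = (LINT t|lebesgue_on {a - h..b - h}. v t)"
proof -
  have eq: "integrable (lebesgue_on {c..d}) w \<longleftrightarrow> w absolutely_integrable_on {c..d}" for w :: "real \<Rightarrow> real" and c d
    by (simp add: integrable_restrict_space set_integrable_def)
  have shift: "(\<lambda>t. w (t - h)) integrable_on {a..b}" if "w integrable_on {a - h..b - h}" for w :: "real \<Rightarrow> real"
    using integrable_shift_real_ivl[OF that, of "-h"] by simp
  show *: "integrable (lebesgue_on {a..b}) (\<lambda>t. v (t - h))"
    using v shift[of v] shift[of "\<lambda>x. \<bar>v x\<bar>"] unfolding eq by (simp add: absolutely_integrable_on_def)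
  show "(LINT t|lebesgue_on {a..b}. v (t - h)) = (LINT t|lebesgue_on {a - h..b - h}. v t)"
    using integral_shift_real_ivl[of "a - h" "-h" "b - h" v]
    by (simp add: lebesgue_integral_eq_integral[OF *] lebesgue_integral_eq_integral[OF v])
qed

lemma integral_lebesgue_on_combine:
  fixes v :: "real \<Rightarrow> real"
  assumes v: "integrable (lebesgue_on {a..c}) v" and "a \<le> b" "b \<le> c"
  shows "(LINT t|lebesgue_on {a..c}. v t) = (LINT t|lebesgue_on {a..b}. v t) + (LINT t|lebesgue_on {b..c}. v t)"
proof -
  have 1: "integrable (lebesgue_on {a..b}) v" "integrable (lebesgue_on {b..c}) v"
    using assms by (auto intro!: integrable_lebesgue_on_subset[OF v])
  have "v integrable_on {a..c}"
    using has_integral_integral_lebesgue_on[OF v] by auto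
  then show ?thesis
    using assms 1 v by (simp add: lebesgue_integral_eq_integral Henstock_Kurzweil_Integration.integral_combine)
qed

text \<open>The integral over \<open>[\<alpha> - h, \<beta>]\<close> is split once at \<alpha> and
  once at \<open>\<beta> - h\<close>; comparing the two splittings gives the identity for every
  \<open>h \<ge> 0\<close>, including \<open>h > \<beta> - \<alpha>\<close>.\<close>

lemma integral_shift_difference:
  fixes v :: "real \<Rightarrow> real"
  assumes v: "continuous_on {\<alpha> - h..\<beta>} v" and "\<alpha> \<le> \<beta>" "0 \<le> h"
  shows "(LINT t|lebesgue_on {\<alpha>..\<beta>}. v t - v (t - h))
    = (LINT t|lebesgue_on {\<beta> - h..\<beta>}. v t) - (LINT t|lebesgue_on {\<alpha> - h..\<alpha>}. v t)"
proof -
  have i: "integrable (lebesgue_on {c..d}) v" if "\<alpha> - h \<le> c" "d \<le> \<beta>" for c d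
    using that by (intro continuous_imp_integrable_real continuous_on_subset[OF v]) auto
  have "(LINT t|lebesgue_on {\<alpha>..\<beta>}. v t - v (t - h))
    = (LINT t|lebesgue_on {\<alpha>..\<beta>}. v t) - (LINT t|lebesgue_on {\<alpha> - h..\<beta> - h}. v t)"
    using assms by (subst Bochner_Integration.integral_diff)
      (auto intro!: i integrable_lebesgue_on_shift simp: integrable_lebesgue_on_shift(2)[OF i])
  moreover have "(LINT t|lebesgue_on {\<alpha> - h..\<beta>}. v t)
    = (LINT t|lebesgue_on {\<alpha> - h..\<alpha>}. v t) + (LINT t|lebesgue_on {\<alpha>..\<beta>}. v t)"
    using assms by (intro integral_lebesgue_on_combine i) auto
  moreover have "(LINT t|lebesgue_on {\<alpha> - h..\<beta>}. v t)
    = (LINT t|lebesgue_on {\<alpha> - h..\<beta> - h}. v t) + (LINT t|lebesgue_on {\<beta> - h..\<beta>}. v t)"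
    using assms by (intro integral_lebesgue_on_combine i) auto
  ultimately show ?thesis by simp
qed

text \<open>The average is the left-hand difference quotient at \<open>x\<close> of the primitive of
  \<open>v\<close>.\<close>

lemma backward_average_limit:
  fixes v :: "real \<Rightarrow> real"
  assumes v: "continuous_on {a..x} v" and h: "h \<longlonglongrightarrow> 0" "\<And>n. 0 < h n" "\<And>n. h n \<le> x - a"
  shows "(\<lambda>n. (LINT t|lebesgue_on {x - h n..x}. v t) / h n) \<longlonglongrightarrow> v x"
proof -
  define V where "V y = integral {a..y} v" for y
  have ax: "a < x" using h(2)[of 0] h(3)[of 0] by simp
  have "(V has_real_derivative v x) (at x within {a..x})"
    unfolding V_def using v ax by (intro integral_has_real_derivative) auto
  then have "((\<lambda>y. (V y - V x) / (y - x)) \<longlongrightarrow> v x) (at x within {a..x})"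
    by (simp add: has_field_derivative_iff)
  moreover have "filterlim (\<lambda>n. x - h n) (at x within {a..x}) sequentially"
    unfolding filterlim_at
  proof
    show "\<forall>\<^sub>F n in sequentially. x - h n \<in> {a..x} \<and> x - h n \<noteq> x"
    proof (rule always_eventually, rule allI)
      fix n show "x - h n \<in> {a..x} \<and> x - h n \<noteq> x" using h(2)[of n] h(3)[of n] by auto
    qed
    show "(\<lambda>n. x - h n) \<longlonglongrightarrow> x" using tendsto_diff[OF tendsto_const h(1), of x] by simp
  qed
  ultimately have "(\<lambda>n. (V (x - h n) - V x) / (x - h n - x)) \<longlonglongrightarrow> v x"
    by (rule filterlim_compose)
  moreover have "(V (x - h n) - V x) / (x - h n - x) = (LINT t|lebesgue_on {x - h n..x}. v t) / h n" for n
  proof -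
    have "(LINT t|lebesgue_on {x - h n..x}. v t) = integral {x - h n..x} v"
      using h(2,3)[of n] by (intro lebesgue_integral_eq_integral continuous_imp_integrable_real continuous_on_subset[OF v]) auto
    moreover have "integral {a..x - h n} v + integral {x - h n..x} v = integral {a..x} v"
      using h(2,3)[of n] v by (intro Henstock_Kurzweil_Integration.integral_combine integrable_continuous_real) auto
    ultimately have "V (x - h n) - V x = - (LINT t|lebesgue_on {x - h n..x}. v t)" by (simp add: V_def)
    then show ?thesis by simp
  qed
  ultimately show ?thesis by simp
qed

lemma difference_quotient_integral_limit:
  fixes v :: "real \<Rightarrow> real"
  assumes v: "continuous_on {a..\<beta>} v" and h: "h \<longlonglongrightarrow> 0" "\<And>n. 0 < h n" "\<And>n. h n \<le> \<alpha> - a" and "\<alpha> \<le> \<beta>"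
  shows "(\<lambda>n. LINT t|lebesgue_on {\<alpha>..\<beta>}. (v t - v (t - h n)) / h n) \<longlonglongrightarrow> v \<beta> - v \<alpha>"
proof -
  have "(LINT t|lebesgue_on {\<alpha>..\<beta>}. (v t - v (t - h n)) / h n)
    = (LINT t|lebesgue_on {\<beta> - h n..\<beta>}. v t) / h n - (LINT t|lebesgue_on {\<alpha> - h n..\<alpha>}. v t) / h n" for n
  proof -
    have "(LINT t|lebesgue_on {\<alpha>..\<beta>}. v t - v (t - h n))
      = (LINT t|lebesgue_on {\<beta> - h n..\<beta>}. v t) - (LINT t|lebesgue_on {\<alpha> - h n..\<alpha>}. v t)"
      using h(2,3)[of n] \<open>\<alpha> \<le> \<beta>\<close> by (intro integral_shift_difference continuous_on_subset[OF v]) auto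
    then show ?thesis by (simp only: Bochner_Integration.integral_divide_zero diff_divide_distrib[symmetric])
  qed
  moreover have "(\<lambda>n. (LINT t|lebesgue_on {\<beta> - h n..\<beta>}. v t) / h n) \<longlonglongrightarrow> v \<beta>"
  proof (rule backward_average_limit[OF v h(1,2)])
    show "h n \<le> \<beta> - a" for n using h(3)[of n] \<open>\<alpha> \<le> \<beta>\<close> by simp
  qed
  moreover have "(\<lambda>n. (LINT t|lebesgue_on {\<alpha> - h n..\<alpha>}. v t) / h n) \<longlonglongrightarrow> v \<alpha>"
    using \<open>\<alpha> \<le> \<beta>\<close> by (intro backward_average_limit[OF continuous_on_subset[OF v] h]) auto
  ultimately show ?thesis by (simp add: tendsto_diff)
qed

text \<open>
  \<open>u\<close> is absolutely continuous on \<open>[a,b]\<close> with derivative \<open>g\<close> in \<open>L\<^sup>2\<close>, expressed by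
  scalar integrals only.
\<close>

definition H1_primitive ::
    "real \<Rightarrow> real \<Rightarrow> (real \<Rightarrow> 'b::{real_inner, second_countable_topology}) \<Rightarrow> (real \<Rightarrow> 'b) \<Rightarrow> bool"
  where "H1_primitive a b u g \<longleftrightarrow> continuous_on {a..b} u \<and> g square_integrable_on {a..b} \<and>
    (\<forall>c s t. a \<le> s \<longrightarrow> s \<le> t \<longrightarrow> t \<le> b \<longrightarrow>
      c \<bullet> (u t - u s) = (LINT r|lebesgue_on {s..t}. c \<bullet> g r))"

text \<open>The increment is paired with itself. Young's inequality with weight
  \<open>1 / (t - s)\<close> turns the constant factor into half of the squared increment, which is
  absorbed on the left.\<close>

lemma H1_primitive_increment_bound:
  fixes u g :: "real \<Rightarrow> 'b::{real_inner, second_countable_topology}"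
  assumes "H1_primitive a b u g" "a \<le> s" "s < t" "t \<le> b"
  shows "(norm (u t - u s))\<^sup>2 \<le> (t - s) * (LINT r|lebesgue_on {s..t}. (norm (g r))\<^sup>2)"
proof -
  define c where "c = u t - u s"
  have g: "g square_integrable_on {s..t}"
    by (rule square_integrable_on_subset[where S = "{a..b}"]) (use assms in \<open>auto simp: H1_primitive_def\<close>)
  have cs: "(\<lambda>r. c) square_integrable_on {s..t}" by (intro square_integrable_on_continuous continuous_intros)
  have "(norm c)\<^sup>2 = c \<bullet> (u t - u s)" by (simp add: c_def power2_norm_eq_inner)
  also have "\<dots> = (LINT r|lebesgue_on {s..t}. c \<bullet> g r)" using assms by (simp add: H1_primitive_def)
  also have "\<dots> \<le> (1 / (t - s) * (LINT r|lebesgue_on {s..t}. (norm c)\<^sup>2)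
      + (LINT r|lebesgue_on {s..t}. (norm (g r))\<^sup>2) / (1 / (t - s))) / 2"
    using square_integrable_on_young[OF cs g, of "1 / (t - s)"] assms by simp
  also have "(LINT r|lebesgue_on {s..t}. (norm c)\<^sup>2) = (t - s) * (norm c)\<^sup>2"
    using assms by (simp add: measure_restrict_space)
  finally have "(norm c)\<^sup>2 \<le> ((norm c)\<^sup>2 + (t - s) * (LINT r|lebesgue_on {s..t}. (norm (g r))\<^sup>2)) / 2"
    using assms by (simp add: mult.commute)
  then show ?thesis by (simp add: c_def)
qed

text \<open>With \<open>G\<close> a primitive of \<open>|g|^2\<close>, the increment bound reads
  \<open>|quotient|^2 \<le> (G t - G (t - h)) / h\<close>. After integration only an average of
  \<open>G\<close> near \<open>b\<close> minus an average near \<open>a\<close> remains, so the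
  bound \<open>G b\<close> is uniform in \<open>h\<close>.\<close>

lemma difference_quotient_norm_le:
  fixes u g :: "real \<Rightarrow> 'b::{real_inner, second_countable_topology}"
  assumes ug: "H1_primitive a0 b u g" and h: "0 < h" "h \<le> a - a0" and ab: "a \<le> b"
  shows "(LINT t|lebesgue_on {a..b}. (norm ((1 / h) *\<^sub>R (u t - u (t - h))))\<^sup>2)
    \<le> (LINT t|lebesgue_on {a0..b}. (norm (g t))\<^sup>2)"
    and "(\<lambda>t. (1 / h) *\<^sub>R (u t - u (t - h))) square_integrable_on {a..b}"
proof -
  have uc: "continuous_on {a0..b} u" using ug by (simp add: H1_primitive_def)
  have c1: "continuous_on {a..b} (\<lambda>t. (1 / h) *\<^sub>R (u t - u (t - h)))"
    using h by (intro continuous_intros continuous_on_subset[OF uc] continuous_on_compose2[OF uc]) auto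
  then show "(\<lambda>t. (1 / h) *\<^sub>R (u t - u (t - h))) square_integrable_on {a..b}"
    by (rule square_integrable_on_continuous)
  have g2: "integrable (lebesgue_on {c..d}) (\<lambda>r. (norm (g r))\<^sup>2)" if "a0 \<le> c" "d \<le> b" for c d
    by (rule integrable_lebesgue_on_subset[where S = "{a0..b}"])
      (use ug that in \<open>auto simp: H1_primitive_def square_integrable_on_def\<close>)
  define G where "G t = (LINT r|lebesgue_on {a0..t}. (norm (g r))\<^sup>2)" for t
  have G_HK: "G t = integral {a0..t} (\<lambda>r. (norm (g r))\<^sup>2)" if "t \<in> {a0..b}" for t
    unfolding G_def using that by (intro lebesgue_integral_eq_integral g2) auto
  have "(\<lambda>r. (norm (g r))\<^sup>2) integrable_on {a0..b}"
    using has_integral_integral_lebesgue_on[OF g2[of a0 b]] by auto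
  then have Gc: "continuous_on {a0..b} G"
    using indefinite_integral_continuous_1 by (subst continuous_on_cong[OF refl G_HK]) auto
  have Gdiff: "G t - G s = (LINT r|lebesgue_on {s..t}. (norm (g r))\<^sup>2)" if "a0 \<le> s" "s \<le> t" "t \<le> b" for s t
    using integral_lebesgue_on_combine[OF g2, of a0 t s] that by (simp add: G_def)
  have G0: "0 \<le> G t" for t unfolding G_def by simp
  have Gb: "G t \<le> G b" if "t \<in> {a0..b}" for t
  proof -
    have "0 \<le> G b - G t" using Gdiff[of t b] that by simp
    then show ?thesis by simp
  qed
  have Gi: "integrable (lebesgue_on {c..d}) G" if "a0 \<le> c" "d \<le> b" for c d
    using that by (intro continuous_imp_integrable_real continuous_on_subset[OF Gc]) auto
  have "(LINT t|lebesgue_on {a..b}. (norm ((1 / h) *\<^sub>R (u t - u (t - h))))\<^sup>2)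
    \<le> (LINT t|lebesgue_on {a..b}. (G t - G (t - h)) / h)"
  proof (rule integral_mono)
    show "integrable (lebesgue_on {a..b}) (\<lambda>t. (norm ((1 / h) *\<^sub>R (u t - u (t - h))))\<^sup>2)"
      by (intro continuous_imp_integrable_real continuous_intros c1)
    show "integrable (lebesgue_on {a..b}) (\<lambda>t. (G t - G (t - h)) / h)"
      using h by (intro continuous_imp_integrable_real continuous_intros continuous_on_subset[OF Gc] continuous_on_compose2[OF Gc]) auto
    fix t assume "t \<in> space (lebesgue_on {a..b})"
    then have t: "a \<le> t" "t \<le> b" by auto
    have "(norm (u t - u (t - h)))\<^sup>2 \<le> h * (G t - G (t - h))"
      using H1_primitive_increment_bound[OF ug, of "t - h" t] Gdiff[of "t - h" t] t h by simp
    moreover have "(norm ((1 / h) *\<^sub>R w))\<^sup>2 = (norm w)\<^sup>2 / h / h" for w :: 'b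
      by (simp add: power2_eq_square)
    ultimately show "(norm ((1 / h) *\<^sub>R (u t - u (t - h))))\<^sup>2 \<le> (G t - G (t - h)) / h"
      using h by (simp only:) (simp add: divide_right_mono pos_divide_le_eq mult.commute)
  qed
  also have "\<dots> = ((LINT t|lebesgue_on {b - h..b}. G t) - (LINT t|lebesgue_on {a - h..a}. G t)) / h"
    using integral_shift_difference[OF continuous_on_subset[OF Gc], of a h b] h ab by simp
  also have "\<dots> \<le> G b"
  proof -
    have "(LINT t|lebesgue_on {b - h..b}. G t) \<le> (LINT t|lebesgue_on {b - h..b}. G b)"
      using h ab by (intro integral_mono Gi Gb) (auto intro: continuous_imp_integrable_real)
    also have "\<dots> = h * G b" using h by (simp add: measure_restrict_space)
    finally have "(LINT t|lebesgue_on {b - h..b}. G t) \<le> h * G b" .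
    moreover have "0 \<le> (LINT t|lebesgue_on {a - h..a}. G t)" using G0 by simp
    ultimately show ?thesis using h by (simp add: field_simps)
  qed
  finally show "(LINT t|lebesgue_on {a..b}. (norm ((1 / h) *\<^sub>R (u t - u (t - h))))\<^sup>2)
    \<le> (LINT t|lebesgue_on {a0..b}. (norm (g t))\<^sup>2)" by (simp add: G_def)
qed

text \<open>The quotients are bounded in \<open>L\<^sup>2\<close> uniformly in \<open>n\<close>, so
  convergence has to be checked on interval steps only. There the integral of the quotient tends to
  the increment of \<open>c \<bullet> u\<close>, which is the integral of
  \<open>c \<bullet> g\<close>.\<close>

lemma difference_quotient_weak_limit:
  fixes u g p :: "real \<Rightarrow> 'b::{real_inner, second_countable_topology}"
  assumes ug: "H1_primitive a0 b u g" and h: "h \<longlonglongrightarrow> 0" "\<And>n. 0 < h n" "\<And>n. h n \<le> a - a0"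
    and ab: "a \<le> b" and p: "p square_integrable_on {a..b}"
  shows "(\<lambda>n. LINT t|lebesgue_on {a..b}. p t \<bullet> ((1 / h n) *\<^sub>R (u t - u (t - h n))))
    \<longlonglongrightarrow> (LINT t|lebesgue_on {a..b}. p t \<bullet> g t)"
proof -
  define D where "D n t = (1 / h n) *\<^sub>R (u t - u (t - h n))" for n t
  define \<Gamma> where "\<Gamma> = (LINT t|lebesgue_on {a0..b}. (norm (g t))\<^sup>2)"
  have a0: "a0 < a" using h(2)[of 0] h(3)[of 0] by simp
  have uc: "continuous_on {a0..b} u" using ug by (simp add: H1_primitive_def)
  have D: "D n square_integrable_on {a..b}" "(LINT t|lebesgue_on {a..b}. (norm (D n t))\<^sup>2) \<le> \<Gamma>" for n
    unfolding D_def \<Gamma>_def using difference_quotient_norm_le[OF ug h(2,3) ab] by auto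
  have g0: "g square_integrable_on {a0..b}" using ug by (simp add: H1_primitive_def)
  have g: "g square_integrable_on {a..b}"
    using a0 by (intro square_integrable_on_subset[OF g0]) auto
  have \<Gamma>: "(LINT t|lebesgue_on {a..b}. (norm (g t))\<^sup>2) \<le> \<Gamma>"
    using integral_lebesgue_on_combine[of a0 b "\<lambda>t. (norm (g t))\<^sup>2" a] g0 a0 ab
    by (simp add: \<Gamma>_def square_integrable_on_def)
  have "(\<lambda>n. LINT t|lebesgue_on {a..b}. p t \<bullet> D n t) \<longlonglongrightarrow> (LINT t|lebesgue_on {a..b}. p t \<bullet> g t)"
    using p
  proof (induction rule: square_integrable_on_Icc_induct)
    case (interval \<alpha> \<beta> c)
    have restr: "(LINT t|lebesgue_on {a..b}. indicat_real {\<alpha>..\<beta>} t * F t) = (LINT t|lebesgue_on {\<alpha>..\<beta>}. F t)" for F :: "real \<Rightarrow> real"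
      using interval by (simp add: integral_restrict_space) (intro Bochner_Integration.integral_cong, auto simp: indicator_def)
    have "(\<lambda>n. LINT t|lebesgue_on {\<alpha>..\<beta>}. (c \<bullet> u t - c \<bullet> u (t - h n)) / h n) \<longlonglongrightarrow> c \<bullet> u \<beta> - c \<bullet> u \<alpha>"
    proof (rule difference_quotient_integral_limit[OF _ h(1,2)])
      show "continuous_on {a0..\<beta>} (\<lambda>t. c \<bullet> u t)"
        using interval by (intro continuous_intros continuous_on_subset[OF uc]) auto
      show "h n \<le> \<alpha> - a0" for n using h(3)[of n] interval by simp
    qed (rule interval)
    moreover have "c \<bullet> u \<beta> - c \<bullet> u \<alpha> = (LINT t|lebesgue_on {\<alpha>..\<beta>}. c \<bullet> g t)"
      using ug interval a0 by (simp add: H1_primitive_def inner_diff_right[symmetric])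
    moreover have "(indicat_real {\<alpha>..\<beta>} t *\<^sub>R c) \<bullet> D n t
        = indicat_real {\<alpha>..\<beta>} t * ((c \<bullet> u t - c \<bullet> u (t - h n)) / h n)" for n t
      by (simp add: D_def inner_diff_right right_diff_distrib diff_divide_distrib)
    moreover have "(indicat_real {\<alpha>..\<beta>} t *\<^sub>R c) \<bullet> g t = indicat_real {\<alpha>..\<beta>} t * (c \<bullet> g t)" for t
      by simp
    ultimately show ?case by (simp only: restr)
  next
    case (lin f f' r)
    have "(LINT t|lebesgue_on {a..b}. (f t + r *\<^sub>R f' t) \<bullet> G t)
      = (LINT t|lebesgue_on {a..b}. f t \<bullet> G t) + r * (LINT t|lebesgue_on {a..b}. f' t \<bullet> G t)"
      if "G square_integrable_on {a..b}" for G
      using square_integrable_on_inner[OF lin(1) that] square_integrable_on_inner[OF lin(2) that]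
      by (simp add: inner_add_left)
    then show ?case using lin D(1) g by (simp only:) (intro tendsto_intros)
  next
    case (lim s f)
    show ?case
    proof (rule LIMSEQ_I)
      fix e :: real assume e: "e > 0"
      \<comment> \<open>This Young weight makes \<open>r * \<Gamma> \<le> e / 4\<close> for the
        common bound \<Gamma> of the quotients and of \<open>g\<close>; adding 1 covers \<Gamma> =
        0. The approximant \<open>s k\<close> is then chosen so close to \<open>f\<close> that the
        other Young term is below \<open>e / 4\<close> as well.\<close>
      define r where "r = e / (4 * (\<Gamma> + 1))"
      have \<Gamma>0: "\<Gamma> \<ge> 0" by (simp add: \<Gamma>_def)
      have r: "r > 0" using e \<Gamma>0 by (simp add: r_def)
      have small: "\<bar>LINT t|lebesgue_on {a..b}. (s k t - f t) \<bullet> G t\<bar>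
        \<le> ((1 / r) * (LINT t|lebesgue_on {a..b}. (norm (s k t - f t))\<^sup>2) + r * \<Gamma>) / 2"
        if G: "G square_integrable_on {a..b}" "(LINT t|lebesgue_on {a..b}. (norm (G t))\<^sup>2) \<le> \<Gamma>" for k G
      proof -
        have "\<bar>LINT t|lebesgue_on {a..b}. (s k t - f t) \<bullet> G t\<bar>
          \<le> ((1 / r) * (LINT t|lebesgue_on {a..b}. (norm (s k t - f t))\<^sup>2)
            + (LINT t|lebesgue_on {a..b}. (norm (G t))\<^sup>2) / (1 / r)) / 2"
          using r by (intro square_integrable_on_young square_integrable_on_diff lim.hyps G) auto
        also have "\<dots> \<le> ((1 / r) * (LINT t|lebesgue_on {a..b}. (norm (s k t - f t))\<^sup>2) + r * \<Gamma>) / 2"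
          using mult_left_mono[OF G(2), of r] r by (simp add: mult.commute)
        finally show ?thesis .
      qed
      have "\<exists>k. (LINT t|lebesgue_on {a..b}. (norm (s k t - f t))\<^sup>2) < r * (e / 4)"
        using order_tendstoD(2)[OF lim.hyps(3), of "r * (e / 4)"] r e by (auto dest: eventually_happens)
      then obtain k where k: "(LINT t|lebesgue_on {a..b}. (norm (s k t - f t))\<^sup>2) < r * (e / 4)" by blast
      have "r * \<Gamma> \<le> e / 4" using \<Gamma>0 e by (simp add: r_def field_simps)
      moreover have "(1 / r) * (LINT t|lebesgue_on {a..b}. (norm (s k t - f t))\<^sup>2) < e / 4"
        using k r by (simp add: field_simps)
      moreover have "x < c" if "x \<le> (y + z) / 2" "y < c" "z \<le> c" for x y z c :: real
        using that by argo
      ultimately have small': "\<bar>LINT t|lebesgue_on {a..b}. (s k t - f t) \<bullet> G t\<bar> < e / 4"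
        if "G square_integrable_on {a..b}" "(LINT t|lebesgue_on {a..b}. (norm (G t))\<^sup>2) \<le> \<Gamma>" for G
        using small[OF that, of k] by blast
      have split: "(LINT t|lebesgue_on {a..b}. (s k t - f t) \<bullet> G t)
        = (LINT t|lebesgue_on {a..b}. s k t \<bullet> G t) - (LINT t|lebesgue_on {a..b}. f t \<bullet> G t)"
        if "G square_integrable_on {a..b}" for G
        using square_integrable_on_inner[OF lim.hyps(2) that] square_integrable_on_inner[OF lim.hyps(1) that]
        by (simp add: inner_diff_left)
      obtain N where N: "\<And>n. n \<ge> N \<Longrightarrow> norm ((LINT t|lebesgue_on {a..b}. s k t \<bullet> D n t)
          - (LINT t|lebesgue_on {a..b}. s k t \<bullet> g t)) < e / 4"
        using LIMSEQ_D[OF lim.IH[of k], of "e / 4"] e by auto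
      have "norm ((LINT t|lebesgue_on {a..b}. f t \<bullet> D n t) - (LINT t|lebesgue_on {a..b}. f t \<bullet> g t)) < e"
        if "n \<ge> N" for n
        using N[OF that] small'[OF D[of n]] small'[OF g \<Gamma>] e
        unfolding split[OF D(1)] split[OF g] real_norm_def abs_less_iff by argo
      then show "\<exists>no. \<forall>n\<ge>no. norm ((LINT t|lebesgue_on {a..b}. f t \<bullet> D n t)
        - (LINT t|lebesgue_on {a..b}. f t \<bullet> g t)) < e" by blast
    qed
  qed (rule ab)
  then show ?thesis by (simp only: D_def)
qed

subsection \<open>Dissipation from a subgradient inequality\<close>

lemma vanishing_steps:
  fixes d :: real
  assumes "0 < d"
  obtains h :: "nat \<Rightarrow> real" where "h \<longlonglongrightarrow> 0" "\<And>n. 0 < h n" "\<And>n. h n \<le> d"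
proof
  have "(\<lambda>n. d * inverse (real (Suc n))) \<longlonglongrightarrow> d * 0"
    by (intro tendsto_intros LIMSEQ_inverse_real_of_nat)
  then show "(\<lambda>n. d * inverse (real (Suc n))) \<longlonglongrightarrow> 0" by simp
  show "0 < d * inverse (real (Suc n))" for n using assms by simp
  have "inverse (real (Suc n)) \<le> 1" for n by (simp add: inverse_eq_divide)
  then show "d * inverse (real (Suc n)) \<le> d" for n using assms mult_left_mono[of _ 1 d] by simp
qed

text \<open>
  The chain rule, read off from \<open>z t \<bullet> (z t - z s) \<ge> ((norm (z t))\<^sup>2 - (norm (z s))\<^sup>2) / 2\<close>.
\<close>

lemma H1_primitive_half_square:
  fixes u g :: "real \<Rightarrow> 'b::{real_inner, second_countable_topology}"
  assumes ug: "H1_primitive a0 b u g" and a: "a0 < a" "a \<le> b"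
  shows "((norm (u b - c))\<^sup>2 - (norm (u a - c))\<^sup>2) / 2 \<le> (LINT t|lebesgue_on {a..b}. (u t - c) \<bullet> g t)"
proof -
  obtain h where h: "h \<longlonglongrightarrow> 0" "\<And>n. 0 < h n" "\<And>n. h n \<le> a - a0"
    using vanishing_steps[of "a - a0"] a by auto
  have uc: "continuous_on {a0..b} u" using ug by (simp add: H1_primitive_def)
  define v where "v t = (norm (u t - c))\<^sup>2 / 2" for t
  have vc: "continuous_on {a0..b} v" unfolding v_def by (intro continuous_intros uc) auto
  have zc: "continuous_on {a..b} (\<lambda>t. u t - c)"
    using a by (intro continuous_intros continuous_on_subset[OF uc]) auto
  have lim: "(\<lambda>n. LINT t|lebesgue_on {a..b}. (u t - c) \<bullet> ((1 / h n) *\<^sub>R (u t - u (t - h n))))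
    \<longlonglongrightarrow> (LINT t|lebesgue_on {a..b}. (u t - c) \<bullet> g t)"
    by (rule difference_quotient_weak_limit[OF ug h a(2) square_integrable_on_continuous[OF zc]])
  have lim2: "(\<lambda>n. LINT t|lebesgue_on {a..b}. (v t - v (t - h n)) / h n) \<longlonglongrightarrow> v b - v a"
    by (rule difference_quotient_integral_limit[OF vc h a(2)])
  have "v b - v a \<le> (LINT t|lebesgue_on {a..b}. (u t - c) \<bullet> g t)"
  proof (rule LIMSEQ_le[OF lim2 lim], intro exI allI impI)
    fix n
    show "(LINT t|lebesgue_on {a..b}. (v t - v (t - h n)) / h n)
      \<le> (LINT t|lebesgue_on {a..b}. (u t - c) \<bullet> ((1 / h n) *\<^sub>R (u t - u (t - h n))))"
    proof (rule integral_mono)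
      have shift: "continuous_on {a..b} (\<lambda>t. w (t - h n))" if "continuous_on {a0..b} w"
        for w :: "real \<Rightarrow> 'c::topological_space"
        using h(2,3)[of n] by (intro continuous_on_compose2[OF that] continuous_intros) auto
      have sub: "continuous_on {a..b} w" if "continuous_on {a0..b} w" for w :: "real \<Rightarrow> 'c::topological_space"
        using a by (intro continuous_on_subset[OF that]) auto
      show "integrable (lebesgue_on {a..b}) (\<lambda>t. (v t - v (t - h n)) / h n)"
        using h(2)[of n] by (intro continuous_imp_integrable_real continuous_intros shift sub vc) auto
      show "integrable (lebesgue_on {a..b}) (\<lambda>t. (u t - c) \<bullet> ((1 / h n) *\<^sub>R (u t - u (t - h n))))"
        by (intro continuous_imp_integrable_real continuous_intros shift sub uc)
      fix t
      have "v t - v (t - h n) \<le> (u t - c) \<bullet> (u t - u (t - h n))"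
      proof -
        have ineq: "(norm x)\<^sup>2 / 2 - (norm y)\<^sup>2 / 2 \<le> x \<bullet> (x - y)" for x y :: 'b
          using inner_ge_zero[of "x - y"]
          by (simp add: power2_norm_eq_inner inner_diff_left inner_diff_right inner_commute)
        show ?thesis using ineq[of "u t - c" "u (t - h n) - c"] by (simp add: v_def)
      qed
      then show "(v t - v (t - h n)) / h n \<le> (u t - c) \<bullet> ((1 / h n) *\<^sub>R (u t - u (t - h n)))"
        using h(2)[of n] by (simp only: inner_scaleR_right) (simp add: divide_right_mono)
    qed
  qed
  then show ?thesis by (simp add: v_def diff_divide_distrib)
qed

lemma integral_lebesgue_on_mono_interval:
  fixes v :: "real \<Rightarrow> real"
  assumes v: "integrable (lebesgue_on {a..b}) v" "\<And>t. t \<in> {a..b} \<Longrightarrow> 0 \<le> v t" and "a \<le> c" "d \<le> b"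
  shows "(LINT t|lebesgue_on {c..d}. v t) \<le> (LINT t|lebesgue_on {a..b}. v t)"
proof (cases "c \<le> d")
  case True
  have "(LINT t|lebesgue_on {a..b}. v t)
      = (LINT t|lebesgue_on {a..c}. v t) + ((LINT t|lebesgue_on {c..d}. v t) + (LINT t|lebesgue_on {d..b}. v t))"
    using True assms(3,4) integrable_lebesgue_on_subset[OF v(1), of "{c..b}"]
    by (subst integral_lebesgue_on_combine[OF v(1), of c], simp, simp, subst integral_lebesgue_on_combine[of c b v d]) auto
  moreover have "0 \<le> (LINT t|lebesgue_on {a..c}. v t)" "0 \<le> (LINT t|lebesgue_on {d..b}. v t)"
    using v(2) True assms(3,4) by (auto intro!: Bochner_Integration.integral_nonneg)
  ultimately show ?thesis by simp
next
  case False
  then have "(LINT t|lebesgue_on {c..d}. v t) = 0" by (simp add: integral_restrict_space)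
  moreover have "0 \<le> (LINT t|lebesgue_on {a..b}. v t)"
    using v(2) by (intro integral_nonneg_AE AE_I2) simp
  ultimately show ?thesis by simp
qed

lemma integral_upper_limit_tendsto_0:
  fixes v :: "real \<Rightarrow> real"
  assumes "integrable (lebesgue_on {0..b}) v"
  shows "((\<lambda>\<tau>. LINT t|lebesgue_on {0..\<tau>}. v t) \<longlongrightarrow> 0) (at 0 within {0..b})"
proof (cases "0 \<le> b")
  case True
  have "v integrable_on {0..b}" using has_integral_integral_lebesgue_on[OF assms] by auto
  then have "continuous_on {0..b} (\<lambda>\<tau>. integral {0..\<tau>} v)" by (rule indefinite_integral_continuous_1)
  then have "((\<lambda>\<tau>. integral {0..\<tau>} v) \<longlongrightarrow> integral {0..0} v) (at 0 within {0..b})"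
    using True by (auto simp only: continuous_on_def atLeastAtMost_iff)
  then have "((\<lambda>\<tau>. integral {0..\<tau>} v) \<longlongrightarrow> 0) (at 0 within {0..b})" by simp
  moreover have "\<forall>\<^sub>F \<tau> in at 0 within {0..b}. integral {0..\<tau>} v = (LINT t|lebesgue_on {0..\<tau>}. v t)"
    unfolding eventually_at_filter
  proof (rule always_eventually, intro allI impI)
    fix \<tau> assume "\<tau> \<in> {0..b}"
    then have "integrable (lebesgue_on {0..\<tau>}) v" by (intro integrable_lebesgue_on_subset[OF assms]) auto
    then show "integral {0..\<tau>} v = (LINT t|lebesgue_on {0..\<tau>}. v t)" by (simp add: lebesgue_integral_eq_integral)
  qed
  ultimately show ?thesis by (rule Lim_transform_eventually)
qed simp

text \<open>The energy functional is forgotten and only its values \<open>e\<close> along the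
  trajectory and \<open>e0\<close> at the initial state are kept. Since \<open>g\<close> may be too
  singular at 0, the primitive property is demanded on \<open>[\<delta>, b]\<close> only, together
  with continuity of \<open>u\<close> up to 0. A single null set \<open>N\<close> serves all pairs
  of times, so that the inequality can be used at \<open>t\<close> and \<open>t - h\<close>
  simultaneously.\<close>

locale subgradient_inequality =
  fixes u g p f :: "real \<Rightarrow> 'b::{real_inner, second_countable_topology}" and e :: "real \<Rightarrow> real"
    and e0 b :: real and N :: "real set"
  assumes b: "0 < b"
    and u: "continuous_on {0..b} u"
    and ug: "\<And>\<delta>. 0 < \<delta> \<Longrightarrow> \<delta> < b \<Longrightarrow> H1_primitive \<delta> b u g"
    and p: "\<And>t. p t = f t - g t"
    and f: "f square_integrable_on {0..b}"
    and e: "integrable (lebesgue_on {0..b}) e" "\<And>t. 0 \<le> e t" and e0: "0 \<le> e0"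
    and N: "N \<in> null_sets lebesgue"
    and sub: "\<And>s t. s \<in> {0..b} - N \<Longrightarrow> t \<in> {0..b} - N \<Longrightarrow> e t - e s \<le> p t \<bullet> (u t - u s)"
    and sub0: "\<And>t. t \<in> {0..b} - N \<Longrightarrow> e t - e0 \<le> p t \<bullet> (u t - u 0)"
begin

lemma AE_N: "AE t in lebesgue. t \<notin> N"
  using N by (rule AE_not_in)

lemma f_subset: "0 \<le> c \<Longrightarrow> d \<le> b \<Longrightarrow> f square_integrable_on {c..d}"
  by (rule square_integrable_on_subset[OF f]) auto

lemma g_subset: "0 < c \<Longrightarrow> c < b \<Longrightarrow> d \<le> b \<Longrightarrow> g square_integrable_on {c..d}"
  by (rule square_integrable_on_subset[of _ "{c..b}"]) (use ug[of c] in \<open>auto simp: H1_primitive_def\<close>)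

lemma p_subset: "0 < c \<Longrightarrow> c < b \<Longrightarrow> d \<le> b \<Longrightarrow> p square_integrable_on {c..d}"
  using square_integrable_on_diff[OF f_subset g_subset, of c d] by (simp add: p[abs_def])

lemma e_subset: "0 \<le> c \<Longrightarrow> d \<le> b \<Longrightarrow> integrable (lebesgue_on {c..d}) e"
  by (rule integrable_lebesgue_on_subset[OF e(1)]) auto

text \<open>Tests the inequality with \<open>s = t - h\<close> and a ramp that rises from \<open>0\<close> to \<open>1\<close> on \<open>[\<tau>', \<tau>]\<close>.\<close>

lemma weighted_dissipation:
  assumes \<tau>: "0 < \<tau>'" "\<tau>' < \<tau>" "\<tau> < b"
    and \<theta>_def: "\<And>t. \<theta> t = max 0 (min 1 ((t - \<tau>') / (\<tau> - \<tau>')))"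
  shows "- (LINT t|lebesgue_on {\<tau>'..b}. \<theta> t * (p t \<bullet> g t)) \<le> (LINT t|lebesgue_on {0..\<tau>}. e t) / (\<tau> - \<tau>')"
proof -
  obtain h where h: "h \<longlonglongrightarrow> 0" "\<And>n. 0 < h n" "\<And>n. h n \<le> \<tau>' - \<tau>' / 2"
    using vanishing_steps[of "\<tau>' - \<tau>' / 2"] \<tau> by auto
  have ug': "H1_primitive (\<tau>' / 2) b u g" using \<tau> by (intro ug) auto
  have uc: "continuous_on {\<tau>' / 2..b} u" using ug' by (simp add: H1_primitive_def)
  have \<theta>c: "continuous_on S \<theta>" for S
    unfolding \<theta>_def[abs_def] using \<tau> by (intro continuous_intros) auto
  have \<theta>m: "\<theta> \<in> borel_measurable (lebesgue_on {c..d})" for c d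
    by (intro continuous_imp_measurable_on_sets_lebesgue \<theta>c) auto
  have \<theta>: "0 \<le> \<theta> t" "\<theta> t \<le> 1" for t by (auto simp: \<theta>_def)
  have \<theta>0: "\<theta> t = 0" if "t \<le> \<tau>'" for t
  proof -
    have "(t - \<tau>') / (\<tau> - \<tau>') \<le> 0" using that \<tau> by (simp add: divide_nonpos_pos)
    then show ?thesis by (simp add: \<theta>_def)
  qed
  have \<theta>1: "\<theta> t = 1" if "\<tau> \<le> t" for t
  proof -
    have "1 \<le> (t - \<tau>') / (\<tau> - \<tau>')" using that \<tau> by simp
    then show ?thesis by (simp add: \<theta>_def)
  qed
  define P where "P t = \<theta> t *\<^sub>R p t" for t
  have pm: "p \<in> borel_measurable (lebesgue_on {\<tau>'..b})"
    using p_subset[of \<tau>' b] \<tau> by (simp add: square_integrable_on_def)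
  have P: "P square_integrable_on {\<tau>'..b}"
  proof (rule square_integrable_on_bound)
    show "p square_integrable_on {\<tau>'..b}" using \<tau> by (intro p_subset) auto
    show "P \<in> borel_measurable (lebesgue_on {\<tau>'..b})" unfolding P_def[abs_def] by (intro borel_measurable_scaleR \<theta>m pm)
    show "AE x in lebesgue_on {\<tau>'..b}. norm (P x) \<le> norm (p x)"
      using \<theta> by (auto simp: P_def intro!: AE_I2 mult_left_le_one_le)
  qed
  have lim: "(\<lambda>n. LINT t|lebesgue_on {\<tau>'..b}. P t \<bullet> ((1 / h n) *\<^sub>R (u t - u (t - h n))))
    \<longlonglongrightarrow> (LINT t|lebesgue_on {\<tau>'..b}. P t \<bullet> g t)"
    using \<tau> by (intro difference_quotient_weak_limit[OF ug' h _ P]) auto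
  have "- ((LINT t|lebesgue_on {0..\<tau>}. e t) / (\<tau> - \<tau>'))
      \<le> (LINT t|lebesgue_on {\<tau>'..b}. P t \<bullet> ((1 / h n) *\<^sub>R (u t - u (t - h n))))" for n
  proof -
    have hn: "0 < h n" "h n \<le> \<tau>' / 2" using h(2,3)[of n] by auto
    have ei: "integrable (lebesgue_on {\<tau>'..b}) (\<lambda>t. \<theta> t * e t)"
    proof (rule Bochner_Integration.integrable_bound[OF e_subset])
      show "(\<lambda>t. \<theta> t * e t) \<in> borel_measurable (lebesgue_on {\<tau>'..b})"
        using e_subset[of \<tau>' b] \<tau> by (intro borel_measurable_times \<theta>m) auto
      show "AE x in lebesgue_on {\<tau>'..b}. norm (\<theta> x * e x) \<le> norm (e x)"
        using \<theta> by (auto simp: abs_mult intro!: AE_I2 mult_left_le_one_le)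
    qed (use \<tau> in auto)
    have esi: "integrable (lebesgue_on {\<tau>' - h n..b - h n}) (\<lambda>t. \<theta> (t + h n) * e t)"
    proof (rule Bochner_Integration.integrable_bound[OF e_subset])
      show "(\<lambda>t. \<theta> (t + h n) * e t) \<in> borel_measurable (lebesgue_on {\<tau>' - h n..b - h n})"
      proof (rule borel_measurable_times)
        show "(\<lambda>t. \<theta> (t + h n)) \<in> borel_measurable (lebesgue_on {\<tau>' - h n..b - h n})"
          by (intro continuous_imp_measurable_on_sets_lebesgue
            continuous_on_compose2[OF \<theta>c[of UNIV]] continuous_intros) auto
        show "e \<in> borel_measurable (lebesgue_on {\<tau>' - h n..b - h n})"
          using \<tau> hn by (intro borel_measurable_integrable e_subset) auto
      qed
      show "AE x in lebesgue_on {\<tau>' - h n..b - h n}. norm (\<theta> (x + h n) * e x) \<le> norm (e x)"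
        using \<theta> by (auto simp: abs_mult intro!: AE_I2 mult_left_le_one_le)
    qed (use \<tau> hn in auto)
    have esh: "integrable (lebesgue_on {\<tau>'..b}) (\<lambda>t. \<theta> t * e (t - h n))"
      "(LINT t|lebesgue_on {\<tau>'..b}. \<theta> t * e (t - h n))
        = (LINT t|lebesgue_on {\<tau>' - h n..b - h n}. \<theta> (t + h n) * e t)"
      using integrable_lebesgue_on_shift[OF esi] by simp_all
    \<comment> \<open>Replacing \<open>\<theta> (t + h)\<close> by \<open>\<theta> t\<close> costs
      at most the ramp slope times \<open>h\<close> for \<open>t \<le> \<tau>\<close> and nothing
      later, where the ramp is already 1. As \<open>e\<close> is nonnegative, the integral on the
      right may extend up to \<open>b\<close>.\<close>
    have "(LINT t|lebesgue_on {\<tau>' - h n..b - h n}. \<theta> (t + h n) * e t)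
        \<le> (LINT t|lebesgue_on {\<tau>'..b}. \<theta> t * e t) + h n / (\<tau> - \<tau>') * (LINT t|lebesgue_on {0..\<tau>}. e t)"
    proof -
      have i1: "integrable lebesgue (\<lambda>t. indicat_real {\<tau>' - h n..b - h n} t * (\<theta> (t + h n) * e t))"
        using esi by (simp add: integrable_restrict_space)
      have i2: "integrable lebesgue (\<lambda>t. indicat_real {\<tau>'..b} t * (\<theta> t * e t))"
        using ei by (simp add: integrable_restrict_space)
      have "integrable (lebesgue_on {0..\<tau>}) e" using \<tau> by (intro e_subset) auto
      then have i3: "integrable lebesgue (\<lambda>t. indicat_real {0..\<tau>} t * e t)"
        by (simp add: integrable_restrict_space)
      have "(LINT t|lebesgue. indicat_real {\<tau>' - h n..b - h n} t * (\<theta> (t + h n) * e t))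
        \<le> (LINT t|lebesgue. indicat_real {\<tau>'..b} t * (\<theta> t * e t) + h n / (\<tau> - \<tau>') * (indicat_real {0..\<tau>} t * e t))"
      proof (rule integral_mono[OF i1])
        show "integrable lebesgue (\<lambda>t. indicat_real {\<tau>'..b} t * (\<theta> t * e t) + h n / (\<tau> - \<tau>') * (indicat_real {0..\<tau>} t * e t))"
          using i2 i3 by simp
        fix t
        show "indicat_real {\<tau>' - h n..b - h n} t * (\<theta> (t + h n) * e t)
          \<le> indicat_real {\<tau>'..b} t * (\<theta> t * e t) + h n / (\<tau> - \<tau>') * (indicat_real {0..\<tau>} t * e t)"
        proof (cases "t \<in> {\<tau>' - h n..b - h n}")
          case True
          have "\<theta> (t + h n) \<le> \<theta> t + (if t \<le> \<tau> then h n / (\<tau> - \<tau>') else 0)"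
          proof (cases "t \<le> \<tau>")
            case True
            have "(t + h n - \<tau>') / (\<tau> - \<tau>') = (t - \<tau>') / (\<tau> - \<tau>') + h n / (\<tau> - \<tau>')"
              by (simp add: add_divide_distrib diff_divide_distrib)
            moreover have "0 \<le> h n / (\<tau> - \<tau>')" using \<tau> hn by simp
            moreover have "max 0 (min 1 (x + y)) \<le> max 0 (min 1 x) + y" if "0 \<le> y" for x y :: real
              using that by (simp add: max_def min_def)
            ultimately show ?thesis using True by (simp only: \<theta>_def if_True)
          qed (use \<theta> \<theta>1 in simp)
          from mult_right_mono[OF this e(2)[of t]]
          have *: "\<theta> (t + h n) * e t \<le> \<theta> t * e t + (if t \<le> \<tau> then h n / (\<tau> - \<tau>') * e t else 0)"
            by (simp add: distrib_right split: if_splits)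
          moreover have "indicat_real {\<tau>'..b} t * (\<theta> t * e t) = \<theta> t * e t"
            using True hn \<theta>0[of t] by (auto simp: indicator_def)
          moreover have "h n / (\<tau> - \<tau>') * (indicat_real {0..\<tau>} t * e t) = (if t \<le> \<tau> then h n / (\<tau> - \<tau>') * e t else 0)"
            using True \<tau> hn by (auto simp: indicator_def)
          moreover have "indicat_real {\<tau>' - h n..b - h n} t = 1" using True by simp
          ultimately show ?thesis by (simp only: mult_1)
        next
          case False
          have "0 \<le> indicat_real {\<tau>'..b} t * (\<theta> t * e t)" "0 \<le> h n / (\<tau> - \<tau>') * (indicat_real {0..\<tau>} t * e t)"
            using \<theta>(1) e(2) \<tau> hn by (intro mult_nonneg_nonneg divide_nonneg_nonneg; simp)+
          with False show ?thesis by simp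
        qed
      qed
      also have "\<dots> = (LINT t|lebesgue. indicat_real {\<tau>'..b} t * (\<theta> t * e t)) + h n / (\<tau> - \<tau>') * (LINT t|lebesgue. indicat_real {0..\<tau>} t * e t)"
        using i2 i3 by simp
      finally show ?thesis by (simp add: integral_restrict_space)
    qed
    then have "- (h n / (\<tau> - \<tau>') * (LINT t|lebesgue_on {0..\<tau>}. e t))
      \<le> (LINT t|lebesgue_on {\<tau>'..b}. \<theta> t * e t) - (LINT t|lebesgue_on {\<tau>'..b}. \<theta> t * e (t - h n))"
      by (simp add: esh(2))
    also have "\<dots> = (LINT t|lebesgue_on {\<tau>'..b}. \<theta> t * e t - \<theta> t * e (t - h n))"
      using ei esh(1) by simp
    also have "\<dots> \<le> (LINT t|lebesgue_on {\<tau>'..b}. P t \<bullet> (u t - u (t - h n)))"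
    proof (rule integral_mono_AE)
      show "integrable (lebesgue_on {\<tau>'..b}) (\<lambda>t. \<theta> t * e t - \<theta> t * e (t - h n))" using ei esh(1) by simp
      have "continuous_on {\<tau>'..b} (\<lambda>t. u t - u (t - h n))"
        using hn \<tau> by (intro continuous_intros continuous_on_subset[OF uc] continuous_on_compose2[OF uc]) auto
      then show "integrable (lebesgue_on {\<tau>'..b}) (\<lambda>t. P t \<bullet> (u t - u (t - h n)))"
        by (intro square_integrable_on_inner P square_integrable_on_continuous)
      \<comment> \<open>The inequality is used at both \<open>t\<close> and \<open>t - h\<close>,
        and a translate of a null set is null.\<close>
      have "AE t in lebesgue. t - h n \<notin> N"
      proof -
        have "negligible ((+) (h n) ` N)"
          using N by (intro negligible_translation) (simp add: negligible_iff_null_sets)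
        then have "AE t in lebesgue. t \<notin> (+) (h n) ` N"
          unfolding negligible_iff_null_sets by (rule AE_not_in)
        then show ?thesis by eventually_elim (auto simp: image_iff algebra_simps)
      qed
      then have "AE t in lebesgue. t \<in> {\<tau>'..b} \<longrightarrow> \<theta> t * e t - \<theta> t * e (t - h n) \<le> P t \<bullet> (u t - u (t - h n))"
        using AE_N
      proof eventually_elim
        case (elim t)
        show ?case
        proof
          assume "t \<in> {\<tau>'..b}"
          then have "e t - e (t - h n) \<le> p t \<bullet> (u t - u (t - h n))"
            using elim hn \<tau> by (intro sub) auto
          from mult_left_mono[OF this \<theta>(1)[of t]]
          show "\<theta> t * e t - \<theta> t * e (t - h n) \<le> P t \<bullet> (u t - u (t - h n))"
            by (simp add: P_def right_diff_distrib)
        qed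
      qed
      then show "AE t in lebesgue_on {\<tau>'..b}. \<theta> t * e t - \<theta> t * e (t - h n) \<le> P t \<bullet> (u t - u (t - h n))"
        by (subst AE_restrict_space_iff) auto
    qed
    finally have "- (h n / (\<tau> - \<tau>') * (LINT t|lebesgue_on {0..\<tau>}. e t)) / h n
      \<le> (LINT t|lebesgue_on {\<tau>'..b}. P t \<bullet> (u t - u (t - h n))) / h n"
      using hn by (intro divide_right_mono) auto
    moreover have "(LINT t|lebesgue_on {\<tau>'..b}. P t \<bullet> ((1 / h n) *\<^sub>R (u t - u (t - h n))))
      = (LINT t|lebesgue_on {\<tau>'..b}. P t \<bullet> (u t - u (t - h n))) / h n"
      by (simp only: inner_scaleR_right) simp
    ultimately show ?thesis using hn by simp
  qed
  then have "- ((LINT t|lebesgue_on {0..\<tau>}. e t) / (\<tau> - \<tau>')) \<le> (LINT t|lebesgue_on {\<tau>'..b}. P t \<bullet> g t)"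
    by (intro LIMSEQ_le_const[OF lim]) auto
  then show ?thesis by (simp add: P_def)
qed

text \<open>Tests the inequality with the initial value as competitor.\<close>

lemma initial_energy_average:
  assumes \<tau>: "0 < \<tau>" "\<tau> < b" and \<kappa>: "0 < \<kappa>"
  defines "\<eta> \<equiv> (LINT t|lebesgue_on {0..\<tau>}. (norm (f t))\<^sup>2)"
  shows "(LINT t|lebesgue_on {0..\<tau>}. e t) / \<tau> \<le> e0 + \<kappa> * (e0 + \<eta>) + \<eta> / \<kappa>"
proof -
  define z where "z t = u t - u 0" for t
  have zc: "continuous_on {0..b} z" unfolding z_def by (intro continuous_intros u)
  have "compact {0..\<tau>}" "{0..\<tau>} \<noteq> {}" using \<tau> by auto
  moreover have "continuous_on {0..\<tau>} (\<lambda>t. norm (z t))"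
    using \<tau> by (intro continuous_intros continuous_on_subset[OF zc]) auto
  ultimately obtain m where m: "m \<in> {0..\<tau>}" "\<And>t. t \<in> {0..\<tau>} \<Longrightarrow> norm (z t) \<le> norm (z m)"
    using continuous_attains_sup by metis
  define Z where "Z = norm (z m)"
  have nf2: "integrable (lebesgue_on {c..d}) (\<lambda>t. (norm (f t))\<^sup>2)" if "0 \<le> c" "d \<le> b" for c d
    using f_subset[OF that] by (simp add: square_integrable_on_def)
  \<comment> \<open>The comparison with the initial value is integrated over
    \<open>[\<delta>, t]\<close>: the term \<open>z \<bullet> g\<close> is at least the increment of
    \<open>|z|^2 / 2\<close>, and \<open>f \<bullet> z\<close> is split by Young's inequality with
    weight \<open>r\<close>. Then \<delta> tends to 0, where \<open>z\<close> vanishes.\<close>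
  have main: "(norm (z t))\<^sup>2 / 2 + (LINT r|lebesgue_on {0..t}. e r) \<le> t * e0 + r * Z\<^sup>2 * t / 2 + \<eta> / (2 * r)"
    if t: "0 < t" "t \<le> \<tau>" and r: "0 < r" for t r
  proof -
    have step: "(norm (z t))\<^sup>2 / 2 - (norm (z \<delta>))\<^sup>2 / 2 + ((LINT s|lebesgue_on {0..t}. e s) - (LINT s|lebesgue_on {0..\<delta>}. e s))
      \<le> t * e0 + r * Z\<^sup>2 * t / 2 + \<eta> / (2 * r)" if \<delta>: "0 < \<delta>" "\<delta> < t" for \<delta>
    proof -
      have ug': "H1_primitive (\<delta> / 2) b u g" using \<delta> t \<tau> by (intro ug) auto
      then have ugt: "H1_primitive (\<delta> / 2) t u g"
        using t \<tau> unfolding H1_primitive_def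
        by (auto intro: continuous_on_subset square_integrable_on_subset)
      have zsq: "z square_integrable_on {\<delta>..t}"
        using \<delta> t \<tau> by (intro square_integrable_on_continuous continuous_on_subset[OF zc]) auto
      have fsq: "f square_integrable_on {\<delta>..t}" using \<delta> t \<tau> by (intro f_subset) auto
      have gsq: "g square_integrable_on {\<delta>..t}" using \<delta> t \<tau> by (intro g_subset) auto
      have "(norm (z t))\<^sup>2 / 2 - (norm (z \<delta>))\<^sup>2 / 2 \<le> (LINT s|lebesgue_on {\<delta>..t}. z s \<bullet> g s)"
        using H1_primitive_half_square[OF ugt, of \<delta> "u 0"] \<delta> by (simp add: z_def diff_divide_distrib)
      moreover have "(LINT s|lebesgue_on {\<delta>..t}. e s) \<le> (LINT s|lebesgue_on {\<delta>..t}. e0 + (f s \<bullet> z s - z s \<bullet> g s))"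
      proof (rule integral_mono_AE)
        show "integrable (lebesgue_on {\<delta>..t}) e" using \<delta> t \<tau> by (intro e_subset) auto
        have "integrable (lebesgue_on {\<delta>..t}) (\<lambda>s. e0)" by (intro continuous_imp_integrable_real continuous_intros)
        then show "integrable (lebesgue_on {\<delta>..t}) (\<lambda>s. e0 + (f s \<bullet> z s - z s \<bullet> g s))"
          by (intro Bochner_Integration.integrable_add Bochner_Integration.integrable_diff square_integrable_on_inner zsq fsq gsq)
        have "AE s in lebesgue. s \<in> {\<delta>..t} \<longrightarrow> e s \<le> e0 + (f s \<bullet> z s - z s \<bullet> g s)"
          using AE_N
        proof eventually_elim
          case (elim s)
          show ?case
          proof
            assume "s \<in> {\<delta>..t}"
            then have "e s - e0 \<le> p s \<bullet> (u s - u 0)" using elim \<delta> t \<tau> by (intro sub0) auto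
            then show "e s \<le> e0 + (f s \<bullet> z s - z s \<bullet> g s)"
              by (simp add: p z_def inner_diff_left inner_commute)
          qed
        qed
        then show "AE s in lebesgue_on {\<delta>..t}. e s \<le> e0 + (f s \<bullet> z s - z s \<bullet> g s)"
          by (subst AE_restrict_space_iff) auto
      qed
      moreover have "(LINT s|lebesgue_on {\<delta>..t}. e0 + (f s \<bullet> z s - z s \<bullet> g s))
        = (t - \<delta>) * e0 + ((LINT s|lebesgue_on {\<delta>..t}. f s \<bullet> z s) - (LINT s|lebesgue_on {\<delta>..t}. z s \<bullet> g s))"
      proof -
        have "integrable (lebesgue_on {\<delta>..t}) (\<lambda>s. e0)" by (intro continuous_imp_integrable_real continuous_intros)
        then show ?thesis
          using square_integrable_on_inner[OF fsq zsq] square_integrable_on_inner[OF zsq gsq] \<delta>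
          by (simp add: measure_restrict_space)
      qed
      moreover have "(LINT s|lebesgue_on {\<delta>..t}. f s \<bullet> z s) \<le> r * Z\<^sup>2 * t / 2 + \<eta> / (2 * r)"
      proof -
        have "(LINT s|lebesgue_on {\<delta>..t}. f s \<bullet> z s)
          \<le> (1 / r * (LINT s|lebesgue_on {\<delta>..t}. (norm (f s))\<^sup>2) + (LINT s|lebesgue_on {\<delta>..t}. (norm (z s))\<^sup>2) / (1 / r)) / 2"
          using square_integrable_on_young[OF fsq zsq, of "1 / r"] r by simp
        moreover have "(LINT s|lebesgue_on {\<delta>..t}. (norm (f s))\<^sup>2) \<le> \<eta>"
          unfolding \<eta>_def using \<delta> t \<tau> by (intro integral_lebesgue_on_mono_interval nf2) auto
        moreover have "(LINT s|lebesgue_on {\<delta>..t}. (norm (z s))\<^sup>2) \<le> t * Z\<^sup>2"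
        proof -
          have "(LINT s|lebesgue_on {\<delta>..t}. (norm (z s))\<^sup>2) \<le> (LINT s|lebesgue_on {\<delta>..t}. Z\<^sup>2)"
          proof (rule integral_mono)
            show "integrable (lebesgue_on {\<delta>..t}) (\<lambda>s. (norm (z s))\<^sup>2)" using zsq by (simp add: square_integrable_on_def)
            show "integrable (lebesgue_on {\<delta>..t}) (\<lambda>s. Z\<^sup>2)" by (intro continuous_imp_integrable_real continuous_intros)
            show "(norm (z s))\<^sup>2 \<le> Z\<^sup>2" if "s \<in> space (lebesgue_on {\<delta>..t})" for s
              using m(2)[of s] that \<delta> t by (simp add: Z_def power_mono)
          qed
          also have "\<dots> = (t - \<delta>) * Z\<^sup>2" using \<delta> by (simp add: measure_restrict_space)
          also have "\<dots> \<le> t * Z\<^sup>2" using \<delta> by (intro mult_right_mono) auto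
          finally show ?thesis .
        qed
        ultimately have "(LINT s|lebesgue_on {\<delta>..t}. f s \<bullet> z s) \<le> (1 / r * \<eta> + t * Z\<^sup>2 / (1 / r)) / 2"
          using r by (elim order_trans) (intro divide_right_mono add_mono mult_left_mono; simp)
        then show ?thesis by (simp add: algebra_simps add_divide_distrib)
      qed
      moreover have "(t - \<delta>) * e0 \<le> t * e0" using \<delta> e0 by (intro mult_right_mono) auto
      moreover have "(LINT s|lebesgue_on {0..t}. e s) = (LINT s|lebesgue_on {0..\<delta>}. e s) + (LINT s|lebesgue_on {\<delta>..t}. e s)"
        using \<delta> t \<tau> by (intro integral_lebesgue_on_combine e_subset) auto
      ultimately show ?thesis by linarith
    qed
    have lim: "((\<lambda>\<delta>. (norm (z t))\<^sup>2 / 2 - (norm (z \<delta>))\<^sup>2 / 2 + ((LINT s|lebesgue_on {0..t}. e s) - (LINT s|lebesgue_on {0..\<delta>}. e s)))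
      \<longlongrightarrow> (norm (z t))\<^sup>2 / 2 - (norm (z 0))\<^sup>2 / 2 + ((LINT s|lebesgue_on {0..t}. e s) - 0)) (at 0 within {0..b})"
    proof (intro tendsto_intros integral_upper_limit_tendsto_0 e(1))
      show "(z \<longlongrightarrow> z 0) (at 0 within {0..b})" using zc b by (auto simp: continuous_on_def)
    qed simp
    have nt: "at 0 within {0..b} \<noteq> bot"
      using b by (simp add: at_within_Icc_at_right)
    have "\<forall>\<^sub>F \<delta> in at 0 within {0..b}. (norm (z t))\<^sup>2 / 2 - (norm (z \<delta>))\<^sup>2 / 2 + ((LINT s|lebesgue_on {0..t}. e s) - (LINT s|lebesgue_on {0..\<delta>}. e s))
      \<le> t * e0 + r * Z\<^sup>2 * t / 2 + \<eta> / (2 * r)"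
      unfolding eventually_at using t by (intro exI[of _ t]) (auto simp: dist_real_def intro!: step)
    from tendsto_upperbound[OF lim this nt] show ?thesis by (simp add: z_def)
  qed
  have \<eta>: "0 \<le> \<eta>" by (simp add: \<eta>_def)
  have Z: "Z\<^sup>2 \<le> 4 * \<tau> * (e0 + \<eta>)"
  proof (cases "m = 0")
    case True
    then show ?thesis using \<tau> e0 \<eta> by (simp add: Z_def z_def)
  next
    case False
    then have m': "0 < m" "m \<le> \<tau>" using m(1) by auto
    have "0 \<le> (LINT r|lebesgue_on {0..m}. e r)" using e(2) by simp
    \<comment> \<open>At the maximiser of \<open>|z|\<close> this weight bounds the Young term by
      \<open>Z^2 / 4\<close>, which is absorbed in \<open>Z^2 / 2\<close>. Hence \<open>Z^2\<close>
      is of order \<tau>.\<close>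
    moreover have "0 < 1 / (2 * \<tau>)" using \<tau> by simp
    note main[OF m' this]
    ultimately have "Z\<^sup>2 / 2 \<le> m * e0 + 1 / (2 * \<tau>) * Z\<^sup>2 * m / 2 + \<eta> / (2 * (1 / (2 * \<tau>)))"
      unfolding Z_def by linarith
    moreover have "m * e0 \<le> \<tau> * e0" using m' e0 by (intro mult_right_mono) auto
    moreover have "1 / (2 * \<tau>) * Z\<^sup>2 * m / 2 \<le> Z\<^sup>2 / 4"
    proof -
      have "m / \<tau> * Z\<^sup>2 \<le> 1 * Z\<^sup>2" using m' \<tau> by (intro mult_right_mono) auto
      then show ?thesis by (simp add: mult.commute)
    qed
    moreover have "\<eta> / (2 * (1 / (2 * \<tau>))) = \<tau> * \<eta>" by simp
    ultimately have "Z\<^sup>2 / 4 \<le> \<tau> * e0 + \<tau> * \<eta>" by argo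
    then show ?thesis by (simp add: algebra_simps)
  qed
  \<comment> \<open>The second use of the estimate, now with the bound on \<open>Z\<close>
    available. After division by \<tau> this weight leaves at most
    \<open>\<kappa> (e0 + \<eta>)\<close> and \<open>\<eta> / \<kappa>\<close>, both free of inverse
    powers of \<tau>.\<close>
  have r: "0 < \<kappa> / (2 * \<tau>)" using \<kappa> \<tau> by simp
  have "0 \<le> (norm (z \<tau>))\<^sup>2 / 2" by simp
  with main[OF \<tau>(1) order_refl r]
  have "(LINT r|lebesgue_on {0..\<tau>}. e r) \<le> \<tau> * e0 + \<kappa> / (2 * \<tau>) * Z\<^sup>2 * \<tau> / 2 + \<eta> / (2 * (\<kappa> / (2 * \<tau>)))"
    by linarith
  also have "\<dots> = \<tau> * e0 + \<kappa> * (Z\<^sup>2 / 4) + \<tau> * (\<eta> / \<kappa>)" using \<tau> \<kappa> by simp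
  also have "\<dots> \<le> \<tau> * e0 + \<kappa> * (\<tau> * (e0 + \<eta>)) + \<tau> * (\<eta> / \<kappa>)"
    using Z \<kappa> \<tau> by (intro add_mono order_refl mult_left_mono) auto
  finally have "(LINT r|lebesgue_on {0..\<tau>}. e r) \<le> \<tau> * (e0 + \<kappa> * (e0 + \<eta>) + \<eta> / \<kappa>)"
    by (simp add: algebra_simps)
  then show ?thesis using \<tau> by (simp add: pos_divide_le_eq mult.commute)
qed

text \<open>The identity \<open>- p \<bullet> g = |p|^2 - p \<bullet> f\<close> and Young's
  inequality bound the integrand from below. The limits are taken in a forced order:
  \<open>\<tau>'\<close> tends to 0 first, leaving the mean of \<open>e\<close> over
  \<open>[0, \<tau>]\<close>, to which the comparison with the initial value applies; then \<tau>
  tends to 0 with \<kappa> fixed, since \<open>\<eta> / \<kappa>\<close> has to vanish before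
  \<kappa> does.\<close>

theorem dissipation_estimate:
  assumes \<epsilon>: "0 < \<epsilon>" "\<epsilon> < 2" and \<delta>: "0 < \<delta>" "\<delta> < b"
  shows "(1 - \<epsilon> / 2) * (LINT t|lebesgue_on {\<delta>..b}. (norm (p t))\<^sup>2)
    \<le> e0 + (LINT t|lebesgue_on {0..b}. (norm (f t))\<^sup>2) / (2 * \<epsilon>)"
proof -
  define C where "C = (LINT t|lebesgue_on {0..b}. (norm (f t))\<^sup>2) / (2 * \<epsilon>)"
  define W where "W \<tau> = (1 - \<epsilon> / 2) * (LINT t|lebesgue_on {\<tau>..b}. (norm (p t))\<^sup>2)" for \<tau>
  have p2: "integrable (lebesgue_on {c..b}) (\<lambda>t. (norm (p t))\<^sup>2)" if "0 < c" "c < b" for c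
    using p_subset[of c b] that by (simp add: square_integrable_on_def)
  have f2: "integrable (lebesgue_on {0..b}) (\<lambda>t. (norm (f t))\<^sup>2)"
    using f by (simp add: square_integrable_on_def)
  have W1: "(W \<tau> - C) * (\<tau> - \<tau>') \<le> (LINT t|lebesgue_on {0..\<tau>}. e t)" if \<tau>: "0 < \<tau>'" "\<tau>' < \<tau>" "\<tau> < b" for \<tau> \<tau>'
  proof -
    define \<theta> where "\<theta> t = max 0 (min 1 ((t - \<tau>') / (\<tau> - \<tau>')))" for t
    have \<theta>: "0 \<le> \<theta> t" "\<theta> t \<le> 1" for t by (auto simp: \<theta>_def)
    have \<theta>1: "\<theta> t = 1" if "\<tau> \<le> t" for t
    proof -
      have "1 \<le> (t - \<tau>') / (\<tau> - \<tau>')" using that \<tau> by simp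
      then show ?thesis by (simp add: \<theta>_def)
    qed
    have pg: "integrable (lebesgue_on {\<tau>'..b}) (\<lambda>t. p t \<bullet> g t)"
      using \<tau> by (intro square_integrable_on_inner p_subset g_subset) auto
    have "continuous_on {\<tau>'..b} \<theta>" unfolding \<theta>_def[abs_def] using \<tau> by (intro continuous_intros) auto
    then have \<theta>m: "\<theta> \<in> borel_measurable (lebesgue_on {\<tau>'..b})"
      by (intro continuous_imp_measurable_on_sets_lebesgue) auto
    have \<theta>pg: "integrable (lebesgue_on {\<tau>'..b}) (\<lambda>t. - (\<theta> t * (p t \<bullet> g t)))"
    proof (rule Bochner_Integration.integrable_bound[OF pg])
      show "(\<lambda>t. - (\<theta> t * (p t \<bullet> g t))) \<in> borel_measurable (lebesgue_on {\<tau>'..b})"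
        using pg \<theta>m by (intro borel_measurable_uminus borel_measurable_times) auto
      show "AE x in lebesgue_on {\<tau>'..b}. norm (- (\<theta> x * (p x \<bullet> g x))) \<le> norm (p x \<bullet> g x)"
        using \<theta> by (intro AE_I2) (simp add: abs_mult mult_left_le_one_le)
    qed
    have fi: "integrable (lebesgue_on {\<tau>'..b}) (\<lambda>t. (norm (f t))\<^sup>2)"
      using \<tau> by (intro integrable_lebesgue_on_subset[OF f2]) auto
    have pi: "integrable (lebesgue_on {\<tau>'..b}) (\<lambda>t. indicat_real {\<tau>..b} t * (norm (p t))\<^sup>2)"
    proof (rule Bochner_Integration.integrable_bound[OF p2])
      show "(\<lambda>t. indicat_real {\<tau>..b} t * (norm (p t))\<^sup>2) \<in> borel_measurable (lebesgue_on {\<tau>'..b})"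
        using p2[of \<tau>'] \<tau> by (intro borel_measurable_times borel_measurable_indicator) (auto simp: sets_restrict_space_iff)
    qed (use \<tau> in \<open>auto simp: indicator_def\<close>)
    have "W \<tau> - (LINT t|lebesgue_on {\<tau>'..b}. (norm (f t))\<^sup>2) / (2 * \<epsilon>)
      = (LINT t|lebesgue_on {\<tau>'..b}. (1 - \<epsilon> / 2) * (indicat_real {\<tau>..b} t * (norm (p t))\<^sup>2) - (norm (f t))\<^sup>2 / (2 * \<epsilon>))"
    proof -
      have "(LINT t|lebesgue_on {\<tau>'..b}. indicat_real {\<tau>..b} t * (norm (p t))\<^sup>2) = (LINT t|lebesgue_on {\<tau>..b}. (norm (p t))\<^sup>2)"
        using \<tau> by (simp add: integral_restrict_space) (intro Bochner_Integration.integral_cong, auto simp: indicator_def)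
      then show ?thesis using fi pi by (simp add: W_def)
    qed
    also have "\<dots> \<le> (LINT t|lebesgue_on {\<tau>'..b}. - (\<theta> t * (p t \<bullet> g t)))"
    proof (rule integral_mono[OF _ \<theta>pg])
      show "integrable (lebesgue_on {\<tau>'..b}) (\<lambda>t. (1 - \<epsilon> / 2) * (indicat_real {\<tau>..b} t * (norm (p t))\<^sup>2) - (norm (f t))\<^sup>2 / (2 * \<epsilon>))"
        using fi pi by simp
      fix t assume "t \<in> space (lebesgue_on {\<tau>'..b})"
      then have t: "\<tau>' \<le> t" "t \<le> b" by auto
      have "\<bar>p t \<bullet> f t\<bar> \<le> (\<epsilon> * (norm (p t))\<^sup>2 + (norm (f t))\<^sup>2 / \<epsilon>) / 2"
        by (rule inner_le_weighted_squares[OF \<epsilon>(1)])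
      moreover have "- (p t \<bullet> g t) = (norm (p t))\<^sup>2 - p t \<bullet> f t"
        by (simp add: p inner_diff_right inner_diff_left power2_norm_eq_inner)
      ultimately have low: "(1 - \<epsilon> / 2) * (norm (p t))\<^sup>2 - (norm (f t))\<^sup>2 / (2 * \<epsilon>) \<le> - (p t \<bullet> g t)"
        by (simp add: algebra_simps add_divide_distrib abs_le_iff)
      \<comment> \<open>The ramp is 1 after \<tau>, and before \<tau> the nonnegative loss term is
        discarded. The subtracted term only shrinks under the weight because
        \<open>\<theta> \<le> 1\<close>.\<close>
      have "(1 - \<epsilon> / 2) * (indicat_real {\<tau>..b} t * (norm (p t))\<^sup>2) \<le> \<theta> t * ((1 - \<epsilon> / 2) * (norm (p t))\<^sup>2)"
        using \<theta>1[of t] \<theta>(1)[of t] t \<epsilon> by (cases "\<tau> \<le> t") (auto intro!: mult_nonneg_nonneg)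
      moreover have "\<theta> t * ((norm (f t))\<^sup>2 / (2 * \<epsilon>)) \<le> (norm (f t))\<^sup>2 / (2 * \<epsilon>)"
        using \<theta>[of t] \<epsilon> by (intro mult_left_le_one_le) auto
      moreover have "\<theta> t * ((1 - \<epsilon> / 2) * (norm (p t))\<^sup>2 - (norm (f t))\<^sup>2 / (2 * \<epsilon>)) \<le> \<theta> t * - (p t \<bullet> g t)"
        using low \<theta>(1) by (rule mult_left_mono)
      ultimately show "(1 - \<epsilon> / 2) * (indicat_real {\<tau>..b} t * (norm (p t))\<^sup>2) - (norm (f t))\<^sup>2 / (2 * \<epsilon>) \<le> - (\<theta> t * (p t \<bullet> g t))"
        by (simp add: right_diff_distrib)
    qed
    also have "\<dots> \<le> (LINT t|lebesgue_on {0..\<tau>}. e t) / (\<tau> - \<tau>')"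
      using weighted_dissipation[OF \<tau> \<theta>_def] by simp
    finally have "W \<tau> - (LINT t|lebesgue_on {\<tau>'..b}. (norm (f t))\<^sup>2) / (2 * \<epsilon>) \<le> (LINT t|lebesgue_on {0..\<tau>}. e t) / (\<tau> - \<tau>')" .
    moreover have "(LINT t|lebesgue_on {\<tau>'..b}. (norm (f t))\<^sup>2) / (2 * \<epsilon>) \<le> C"
      unfolding C_def using \<tau> \<epsilon> by (intro divide_right_mono integral_lebesgue_on_mono_interval f2) auto
    ultimately have "W \<tau> - C \<le> (LINT t|lebesgue_on {0..\<tau>}. e t) / (\<tau> - \<tau>')" by linarith
    then show ?thesis using \<tau> by (simp add: pos_le_divide_eq)
  qed
  have W2: "W \<tau> - C \<le> (LINT t|lebesgue_on {0..\<tau>}. e t) / \<tau>" if \<tau>: "0 < \<tau>" "\<tau> < b" for \<tau>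
  proof -
    have "((\<lambda>\<tau>'. (W \<tau> - C) * (\<tau> - \<tau>')) \<longlongrightarrow> (W \<tau> - C) * (\<tau> - 0)) (at_right 0)"
      by (intro tendsto_intros)
    moreover have "\<forall>\<^sub>F \<tau>' in at_right 0. (W \<tau> - C) * (\<tau> - \<tau>') \<le> (LINT t|lebesgue_on {0..\<tau>}. e t)"
      using \<tau> by (intro eventually_at_rightI[of 0 \<tau>] W1) auto
    ultimately have "(W \<tau> - C) * (\<tau> - 0) \<le> (LINT t|lebesgue_on {0..\<tau>}. e t)"
      by (rule tendsto_upperbound) simp
    then show ?thesis using \<tau> by (simp add: pos_le_divide_eq)
  qed
  define \<eta> where "\<eta> \<tau> = (LINT t|lebesgue_on {0..\<tau>}. (norm (f t))\<^sup>2)" for \<tau>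
  have \<eta>: "(\<eta> \<longlongrightarrow> 0) (at_right 0)"
    using integral_upper_limit_tendsto_0[OF f2] b at_within_Icc_at_right[of 0 b] by (simp add: \<eta>_def[abs_def])
  have W3: "W \<delta> - C \<le> e0 + \<kappa> * e0" if \<kappa>: "0 < \<kappa>" for \<kappa>
  proof -
    have "((\<lambda>\<tau>. e0 + \<kappa> * (e0 + \<eta> \<tau>) + \<eta> \<tau> / \<kappa>) \<longlongrightarrow> e0 + \<kappa> * (e0 + 0) + 0 / \<kappa>) (at_right 0)"
      using \<kappa> by (intro tendsto_intros \<eta>) auto
    moreover have "\<forall>\<^sub>F \<tau> in at_right 0. W \<delta> - C \<le> e0 + \<kappa> * (e0 + \<eta> \<tau>) + \<eta> \<tau> / \<kappa>"
    proof (rule eventually_at_rightI[of 0 \<delta>])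
      fix \<tau> assume "\<tau> \<in> {0<..<\<delta>}"
      then have \<tau>: "0 < \<tau>" "\<tau> < \<delta>" "\<tau> < b" using \<delta> by auto
      have "W \<delta> \<le> W \<tau>"
        unfolding W_def using \<tau> \<epsilon> by (intro mult_left_mono integral_lebesgue_on_mono_interval p2) auto
      with W2[OF \<tau>(1,3)] initial_energy_average[OF \<tau>(1,3) \<kappa>]
      show "W \<delta> - C \<le> e0 + \<kappa> * (e0 + \<eta> \<tau>) + \<eta> \<tau> / \<kappa>" by (simp add: \<eta>_def)
    qed (rule \<delta>)
    ultimately have "W \<delta> - C \<le> e0 + \<kappa> * (e0 + 0) + 0 / \<kappa>"
      by (rule tendsto_lowerbound) simp
    then show ?thesis by simp
  qed
  have "((\<lambda>\<kappa>. e0 + \<kappa> * e0) \<longlongrightarrow> e0 + 0 * e0) (at_right 0)" by (intro tendsto_intros)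
  moreover have "\<forall>\<^sub>F \<kappa> in at_right 0. W \<delta> - C \<le> e0 + \<kappa> * e0"
    by (intro eventually_at_rightI[of 0 1] W3) auto
  ultimately have "W \<delta> - C \<le> e0 + 0 * e0" by (rule tendsto_lowerbound) simp
  then show ?thesis by (simp add: W_def C_def)
qed

end

subsection \<open>Weak curls\<close>

lemma square_integrable_on_extend_zero:
  fixes f :: "'a::euclidean_space \<Rightarrow> 'b::euclidean_space"
  assumes "f square_integrable_on S" "S \<in> sets lebesgue"
  shows "(\<lambda>x. if x \<in> S then f x else 0) square_integrable_on UNIV"
proof -
  have "(\<lambda>x. (norm (if x \<in> S then f x else 0))\<^sup>2) = (\<lambda>x. indicator S x *\<^sub>R (norm (f x))\<^sup>2)"
    by (auto simp: indicator_def)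
  then show ?thesis
    using assms
    by (simp add: square_integrable_on_def lebesgue_on_UNIV_eq integrable_restrict_space borel_measurable_if)
qed

lemma square_integrable_on_UNIV_subset:
  fixes f :: "'a::euclidean_space \<Rightarrow> 'b::euclidean_space"
  assumes "f square_integrable_on UNIV" "S \<in> sets lebesgue"
  shows "f square_integrable_on S"
  by (rule square_integrable_on_subset[OF assms(1)]) (use assms(2) in auto)

lemma rep_L2_of_AE:
  fixes f :: "'a::euclidean_space \<Rightarrow> 'b::euclidean_space"
  assumes "f square_integrable_on S" "S \<in> sets lebesgue"
  shows "AE x in lebesgue. rep_L2 (L2_of S f) x = (if x \<in> S then f x else 0)"
  unfolding L2_of_def by (rule rep_abs_L2_AE[OF square_integrable_on_extend_zero[OF assms]])

lemma L2_of_in_L2_space: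
  fixes f :: "'a::euclidean_space \<Rightarrow> 'b::euclidean_space"
  assumes "f square_integrable_on S" "S \<in> sets lebesgue"
  shows "L2_of S f \<in> L2_space S"
  unfolding L2_space_def using rep_L2_of_AE[OF assms] by (auto elim!: eventually_mono)

lemma inner_L2_of:
  fixes f :: "'a::euclidean_space \<Rightarrow> 'b::euclidean_space"
  assumes "f square_integrable_on S" "S \<in> sets lebesgue"
  shows "A \<bullet> L2_of S f = (LINT x|lebesgue_on S. rep_L2 A x \<bullet> f x)"
proof -
  have "A \<bullet> L2_of S f = (LINT x|lebesgue. rep_L2 A x \<bullet> (if x \<in> S then f x else 0))"
    using inner_abs_L2[OF rep_L2_square_integrable square_integrable_on_extend_zero[OF assms], of A]
    by (simp add: L2_of_def abs_rep_L2)
  also have "\<dots> = (LINT x|lebesgue. indicator S x *\<^sub>R (rep_L2 A x \<bullet> f x))"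
    by (intro Bochner_Integration.integral_cong) (auto simp: indicator_def)
  finally show ?thesis using assms(2) by (simp add: integral_restrict_space)
qed

lemma rep_L2_diff_AE: "AE x in lebesgue. rep_L2 (u - v) x = rep_L2 u x - rep_L2 v x"
  using rep_abs_L2_AE[OF square_integrable_diff[OF rep_L2_square_integrable rep_L2_square_integrable], of u v]
  by (simp add: abs_L2_diff rep_L2_square_integrable abs_rep_L2)

lemma L2_eqI: "AE x in lebesgue. rep_L2 u x = rep_L2 v x \<Longrightarrow> u = v"
  using abs_L2_eqI[OF rep_L2_square_integrable rep_L2_square_integrable, of u v] by (simp add: abs_rep_L2)

lemma rep_L2_zero_AE: "AE x in lebesgue. rep_L2 0 x = 0"
  unfolding zero_L2_def using rep_abs_L2_AE[OF square_integrable_zero] by simp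

lemma L2_space_zero: "0 \<in> L2_space S"
  unfolding L2_space_def using rep_L2_zero_AE by (auto elim!: eventually_mono)

lemma L2_space_diff: "u \<in> L2_space S \<Longrightarrow> v \<in> L2_space S \<Longrightarrow> u - v \<in> L2_space S"
proof -
  assume "u \<in> L2_space S" "v \<in> L2_space S"
  then have "AE x in lebesgue. x \<notin> S \<longrightarrow> rep_L2 u x = 0" "AE x in lebesgue. x \<notin> S \<longrightarrow> rep_L2 v x = 0"
    by (auto simp: L2_space_def)
  then have "AE x in lebesgue. x \<notin> S \<longrightarrow> rep_L2 (u - v) x = 0"
    using rep_L2_diff_AE[of u v] by eventually_elim auto
  then show "u - v \<in> L2_space S" by (simp add: L2_space_def)
qed

lemma L2_of_rep:
  assumes "u \<in> L2_space S" "S \<in> sets lebesgue"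
  shows "L2_of S (rep_L2 u) = u"
proof (rule L2_eqI)
  have "AE x in lebesgue. x \<notin> S \<longrightarrow> rep_L2 u x = 0" using assms by (simp add: L2_space_def)
  with rep_L2_of_AE[OF square_integrable_on_UNIV_subset[OF rep_L2_square_integrable assms(2)] assms(2), of u]
  show "AE x in lebesgue. rep_L2 (L2_of S (rep_L2 u)) x = rep_L2 u x"
    by eventually_elim auto
qed

lemma square_integrable_on_continuous_bounded:
  fixes f :: "'a::euclidean_space \<Rightarrow> 'b::euclidean_space"
  assumes f: "continuous_on UNIV f" and S: "bounded S" "open S"
  shows "f square_integrable_on S"
proof -
  have S': "S \<in> sets lebesgue" using S by auto
  have "compact (closure S)" using S by simp
  then have "bounded (f ` closure S)"
    by (intro compact_imp_bounded compact_continuous_image continuous_on_subset[OF f]) auto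
  then obtain C where C: "\<And>x. x \<in> S \<Longrightarrow> norm (f x) \<le> C"
    using closure_subset[of S] by (auto simp: bounded_iff)
  show ?thesis
  proof (rule square_integrable_on_bound)
    show "(\<lambda>x. C) square_integrable_on S"
      using finite_measure.integrable_const[OF finite_measure_lebesgue_on[OF bounded_set_imp_lmeasurable[OF S(1) S']]]
      by (simp add: square_integrable_on_def)
    show "f \<in> borel_measurable (lebesgue_on S)"
      by (intro continuous_imp_measurable_on_sets_lebesgue continuous_on_subset[OF f] S') auto
    show "AE x in lebesgue_on S. norm (f x) \<le> norm C"
      using C by (intro AE_I2) (force intro: order_trans[OF _ abs_ge_self])
  qed
qed

lemma test_function_continuous: "test_function U \<phi> \<Longrightarrow> continuous_on UNIV \<phi>"
  unfolding test_function_def by (auto intro: Ck_continuous[of 0] simp del: Ck.simps)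

lemma test_function_curl_continuous:
  assumes "test_function U \<phi>"
  shows "continuous_on UNIV (curl \<phi>)"
proof -
  have "Ck (Suc 0) \<phi>" using assms unfolding test_function_def by blast
  then have "\<forall>b\<in>Basis. continuous_on UNIV (\<lambda>x. frechet_derivative \<phi> (at x) b)" by simp
  then have pd: "continuous_on UNIV (pd j \<phi>)" for j
    unfolding pd_def[abs_def] by (simp add: Basis_vec_def)
  have "continuous_on UNIV (\<lambda>x. curl \<phi> x $ i)" for i
    using exhaust_3[of i]
    by (elim disjE; simp add: curl_def vector_3; intro continuous_intros pd)
  then have "continuous_on UNIV (\<lambda>x. \<chi> i. curl \<phi> x $ i)" by (rule continuous_on_vec_lambda)
  then show ?thesis by simp
qed

locale bounded_domain =
  fixes \<Omega> :: "(real^3) set"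
  assumes open_domain: "open \<Omega>" and bounded_domain: "bounded \<Omega>"
begin

lemma domain_lebesgue: "\<Omega> \<in> sets lebesgue"
  using open_domain by auto

lemma test_square_integrable:
  assumes "test_function U \<phi>"
  shows "\<phi> square_integrable_on \<Omega>" "curl \<phi> square_integrable_on \<Omega>"
  using test_function_continuous[OF assms] test_function_curl_continuous[OF assms] bounded_domain open_domain
  by (auto intro: square_integrable_on_continuous_bounded)

text \<open>Written as inner products with fixed elements of \<open>L2\<close>, the defining
  identities are visibly linear in the pair \<open>(A, B)\<close> and independent of
  representatives.\<close>

lemma has_weak_curl_iff:
  "has_weak_curl \<Omega> A B \<longleftrightarrow>
    (\<forall>\<phi>. test_function \<Omega> \<phi> \<longrightarrow> A \<bullet> L2_of \<Omega> (curl \<phi>) = B \<bullet> L2_of \<Omega> \<phi>)"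
  unfolding has_weak_curl_def
  by (intro all_cong1 imp_cong refl) (simp add: inner_L2_of test_square_integrable domain_lebesgue)

lemma has_weak_curl_diff:
  "has_weak_curl \<Omega> A B \<Longrightarrow> has_weak_curl \<Omega> A' B' \<Longrightarrow> has_weak_curl \<Omega> (A - A') (B - B')"
  by (simp add: has_weak_curl_iff inner_diff_left)

text \<open>The fundamental lemma is applied to each component, with test fields along one
  coordinate axis. This makes weak curls unique, so the description in \<open>wcurl\<close>
  denotes.\<close>

lemma orthogonal_test_functions_zero:
  fixes D :: "(real^3, real^3) L2"
  assumes D: "D \<in> L2_space \<Omega>" and orth: "\<And>\<phi>. test_function \<Omega> \<phi> \<Longrightarrow> D \<bullet> L2_of \<Omega> \<phi> = 0"
  shows "D = 0"
proof -
  have "AE x in lebesgue. x \<in> \<Omega> \<longrightarrow> indicator \<Omega> x * rep_L2 D x $ j = 0" for j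
  proof (rule fundamental_lemma_variations[OF open_domain])
    have "continuous_on UNIV (\<lambda>x :: real^3. axis j 1 :: real^3)" by (intro continuous_intros)
    then have "(\<lambda>x :: real^3. axis j 1 :: real^3) square_integrable_on \<Omega>"
      using bounded_domain open_domain by (rule square_integrable_on_continuous_bounded)
    from square_integrable_on_extend_zero[OF this domain_lebesgue]
    have "integrable lebesgue (\<lambda>x. rep_L2 D x \<bullet> (if x \<in> \<Omega> then axis j 1 else 0))"
      by (intro square_integrable_inner rep_L2_square_integrable)
    then show "integrable lebesgue (\<lambda>x. indicator \<Omega> x * rep_L2 D x $ j)"
      by (rule Bochner_Integration.integrable_cong[THEN iffD1, rotated 2])
        (auto simp: inner_axis indicator_def)
    fix \<phi> :: "real^3 \<Rightarrow> real" assume \<phi>: "test_function \<Omega> \<phi>"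
    have test: "test_function \<Omega> (\<lambda>x. \<phi> x *\<^sub>R axis j (1::real))"
      unfolding test_function_def
    proof
      show "\<forall>k. Ck k (\<lambda>x. \<phi> x *\<^sub>R axis j (1::real))"
        using \<phi> unfolding test_function_def by (intro allI Ck_scaleR Ck_const) blast
      show "\<exists>K. compact K \<and> K \<subseteq> \<Omega> \<and> (\<forall>x. x \<notin> K \<longrightarrow> \<phi> x *\<^sub>R axis j (1::real) = 0)"
        using \<phi> unfolding test_function_def by (metis scaleR_eq_0_iff)
    qed
    have "(LINT x|lebesgue. \<phi> x * (indicator \<Omega> x * rep_L2 D x $ j))
      = (LINT x|lebesgue_on \<Omega>. rep_L2 D x \<bullet> (\<phi> x *\<^sub>R axis j 1))"
      using domain_lebesgue
      by (simp add: integral_restrict_space inner_axis) (intro Bochner_Integration.integral_cong, auto)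
    also have "\<dots> = 0"
      using orth[OF test] inner_L2_of[OF test_square_integrable(1)[OF test] domain_lebesgue, of D] by simp
    finally show "(LINT x|lebesgue. \<phi> x * (indicator \<Omega> x * rep_L2 D x $ j)) = 0" .
  qed
  then have "AE x in lebesgue. \<forall>j\<in>UNIV. x \<in> \<Omega> \<longrightarrow> indicator \<Omega> x * rep_L2 D x $ j = 0"
    by (intro AE_finite_allI) auto
  moreover have "AE x in lebesgue. x \<notin> \<Omega> \<longrightarrow> rep_L2 D x = 0" using D by (simp add: L2_space_def)
  ultimately have "AE x in lebesgue. rep_L2 D x = rep_L2 0 x"
    using rep_L2_zero_AE[where 'a = "real^3" and 'b = "real^3"]
  proof eventually_elim
    case (elim x)
    have "rep_L2 D x = 0"
    proof (cases "x \<in> \<Omega>")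
      case True
      then show ?thesis using elim(1) by (simp add: vec_eq_iff)
    qed (use elim in simp)
    then show ?case using elim(3) by simp
  qed
  then show ?thesis by (rule L2_eqI)
qed

lemma wcurl_eqI:
  assumes "B \<in> L2_space \<Omega>" "has_weak_curl \<Omega> A B"
  shows "wcurl \<Omega> A = B"
  unfolding wcurl_def
proof (rule the_equality)
  fix B' assume B': "B' \<in> L2_space \<Omega> \<and> has_weak_curl \<Omega> A B'"
  have "B' - B = 0"
  proof (rule orthogonal_test_functions_zero)
    show "B' - B \<in> L2_space \<Omega>" using assms B' by (auto intro: L2_space_diff)
    show "(B' - B) \<bullet> L2_of \<Omega> \<phi> = 0" if "test_function \<Omega> \<phi>" for \<phi>
      using assms B' that by (simp add: has_weak_curl_iff inner_diff_left)
  qed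
  then show "B' = B" by simp
qed (use assms in auto)

lemma wcurl_works:
  assumes "A \<in> H_curl \<Omega>"
  shows "wcurl \<Omega> A \<in> L2_space \<Omega>" "has_weak_curl \<Omega> A (wcurl \<Omega> A)"
  using assms wcurl_eqI unfolding H_curl_def by force+

lemma H_curl_diff: "A \<in> H_curl \<Omega> \<Longrightarrow> A' \<in> H_curl \<Omega> \<Longrightarrow> A - A' \<in> H_curl \<Omega>"
  using has_weak_curl_diff L2_space_diff unfolding H_curl_def by blast

lemma wcurl_diff:
  "A \<in> H_curl \<Omega> \<Longrightarrow> A' \<in> H_curl \<Omega> \<Longrightarrow> wcurl \<Omega> (A - A') = wcurl \<Omega> A - wcurl \<Omega> A'"
  by (intro wcurl_eqI L2_space_diff has_weak_curl_diff wcurl_works)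

lemma wcurl_zero: "wcurl \<Omega> 0 = 0"
  by (intro wcurl_eqI L2_space_zero) (simp add: has_weak_curl_iff)

lemma H0_curl_iff:
  "A \<in> H0_curl \<Omega> \<longleftrightarrow> A \<in> H_curl \<Omega> \<and>
    (\<forall>\<phi>. test_function UNIV \<phi> \<longrightarrow> wcurl \<Omega> A \<bullet> L2_of \<Omega> \<phi> - A \<bullet> L2_of \<Omega> (curl \<phi>) = 0)"
proof -
  have int: "integrable (lebesgue_on \<Omega>) (\<lambda>x. rep_L2 B x \<bullet> f x)" if "f square_integrable_on \<Omega>" for B and f :: "real^3 \<Rightarrow> real^3"
    using that by (intro square_integrable_on_inner
        square_integrable_on_UNIV_subset[OF rep_L2_square_integrable domain_lebesgue])
  have "(LINT x|lebesgue_on \<Omega>. rep_L2 (wcurl \<Omega> A) x \<bullet> \<phi> x - rep_L2 A x \<bullet> curl \<phi> x)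
    = wcurl \<Omega> A \<bullet> L2_of \<Omega> \<phi> - A \<bullet> L2_of \<Omega> (curl \<phi>)" if "test_function UNIV \<phi>" for \<phi>
    using int[OF test_square_integrable(1)[OF that]] int[OF test_square_integrable(2)[OF that]]
    by (simp add: inner_L2_of test_square_integrable[OF that] domain_lebesgue)
  then show ?thesis unfolding H0_curl_def by auto
qed

text \<open>It makes the difference of two field states admissible as a test function in the weak
  equation.\<close>

lemma X0_curl_diff:
  assumes "A \<in> X0_curl \<Omega> \<Omega>C" "A' \<in> X0_curl \<Omega> \<Omega>C"
  shows "A - A' \<in> X0_curl \<Omega> \<Omega>C"
proof -
  have "A - A' \<in> H0_curl \<Omega>"
    using assms by (auto simp: X0_curl_def H0_curl_iff H_curl_diff wcurl_diff inner_diff_left)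
  moreover have "A - A' \<in> X_space \<Omega> \<Omega>C"
    unfolding X_space_def
  proof (intro CollectI conjI ballI case_prodI2 impI)
    show "A - A' \<in> L2_space \<Omega>"
      using assms by (auto simp: X0_curl_def X_space_def intro: L2_space_diff)
    fix p \<psi> g assume "p \<in> H10 \<Omega>" "p = (\<psi>, g)" "\<forall>\<Gamma>\<in>interfaces \<Omega> \<Omega>C. constant_trace \<Omega> \<Gamma> (\<psi>, g)"
    then have "A \<bullet> g = 0" "A' \<bullet> g = 0"
      using assms by (auto simp: X0_curl_def X_space_def)
    then show "(A - A') \<bullet> g = 0" by (simp add: inner_diff_left)
  qed
  ultimately show ?thesis by (simp add: X0_curl_def)
qed

lemma X0_curl_H_curl: "A \<in> X0_curl \<Omega> \<Omega>C \<Longrightarrow> A \<in> H_curl \<Omega>"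
  by (simp add: X0_curl_def H0_curl_def)

end

subsection \<open>The nonlinear magnetic energy\<close>

lemma AE_lborel_exists_in_interval:
  assumes "AE x in lborel. P (x :: real)" "a < b"
  obtains x where "a < x" "x < b" "P x"
proof -
  have "\<exists>x. a < x \<and> x < b \<and> P x"
  proof (rule ccontr)
    assume "\<nexists>x. a < x \<and> x < b \<and> P x"
    then have "AE x in lborel. x \<notin> {a<..<b}" using assms(1) by (auto elim!: eventually_mono)
    then have "{a<..<b} \<in> null_sets lborel" by (simp add: AE_iff_null_sets)
    then show False using assms(2) by (simp add: null_sets_def)
  qed
  then show thesis using that by blast
qed

text \<open>Rounding \<open>b x\<close> down to a multiple of \<open>1 / (n + 1)\<close> gives a
  function with countably many values, for which measurability is checked value by value; continuity
  in the second argument passes it to the limit.\<close>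

lemma caratheodory_measurable:
  fixes N :: "'a \<Rightarrow> real \<Rightarrow> real"
  assumes N: "\<And>r. 0 \<le> r \<Longrightarrow> (\<lambda>x. N x r) \<in> borel_measurable M"
    and cont: "\<And>x. x \<in> space M \<Longrightarrow> continuous_on {0..} (N x)"
    and b: "b \<in> borel_measurable M" "\<And>x. x \<in> space M \<Longrightarrow> 0 \<le> b x"
  shows "(\<lambda>x. N x (b x)) \<in> borel_measurable M"
proof -
  define q where "q n x = real (nat \<lfloor>real (Suc n) * b x\<rfloor>) / real (Suc n)" for n x
  have "(\<lambda>x. N x (q n x)) \<in> borel_measurable M" for n
    unfolding q_def
  proof (rule measurable_compose_countable[where f = "\<lambda>k x. N x (real k / real (Suc n))"])
    show "(\<lambda>x. N x (real k / real (Suc n))) \<in> borel_measurable M" for k by (intro N) simp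
    show "(\<lambda>x. nat \<lfloor>real (Suc n) * b x\<rfloor>) \<in> measurable M (count_space UNIV)"
      using b(1) by measurable
  qed
  moreover have "(\<lambda>n. N x (q n x)) \<longlonglongrightarrow> N x (b x)" if x: "x \<in> space M" for x
  proof -
    have q: "\<bar>q n x - b x\<bar> \<le> inverse (real (Suc n))" for n
    proof -
      have "0 \<le> real (Suc n) * b x" using b(2)[OF x] by simp
      then have "real (nat \<lfloor>real (Suc n) * b x\<rfloor>) = of_int \<lfloor>real (Suc n) * b x\<rfloor>"
        by (intro of_nat_nat) simp
      then have "\<bar>real (nat \<lfloor>real (Suc n) * b x\<rfloor>) - real (Suc n) * b x\<bar> \<le> 1"
        using floor_correct[of "real (Suc n) * b x"] by linarith
      moreover have "q n x - b x = (real (nat \<lfloor>real (Suc n) * b x\<rfloor>) - real (Suc n) * b x) / real (Suc n)"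
        unfolding q_def by (simp only: diff_divide_distrib) simp
      ultimately show ?thesis by (simp add: inverse_eq_divide abs_divide divide_right_mono)
    qed
    have "(\<lambda>n. q n x - b x) \<longlonglongrightarrow> 0"
      using q by (intro Lim_null_comparison[OF _ LIMSEQ_inverse_real_of_nat] always_eventually) simp
    then have "(\<lambda>n. q n x) \<longlonglongrightarrow> b x" by (simp add: LIM_zero_iff)
    moreover have "\<forall>\<^sub>F n in sequentially. q n x \<in> {0..}"
      by (intro always_eventually allI) (simp add: q_def)
    moreover have "b x \<in> {0..}" using b(2)[OF x] by simp
    ultimately show ?thesis by (intro continuous_on_tendsto_compose[OF cont[OF x]])
  qed
  ultimately show ?thesis by (rule borel_measurable_LIMSEQ_real[rotated])
qed

text \<open>Each of the \<open>n\<close> cells contributes an error of at most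
  \<open>L * h * h\<close>. The bound serves to write an integral with variable upper limit as a
  limit of finite sums, from which measurability is read off.\<close>

lemma left_riemann_sum_error:
  fixes f :: "real \<Rightarrow> real"
  assumes f: "\<And>s t. 0 \<le> s \<Longrightarrow> 0 \<le> t \<Longrightarrow> \<bar>f s - f t\<bar> \<le> L * \<bar>s - t\<bar>" and h: "0 \<le> h" and L: "0 \<le> L"
  shows "\<bar>integral {0..real n * h} f - (\<Sum>k<n. h * f (real k * h))\<bar> \<le> real n * (L * h * h)"
proof (induction n)
  case (Suc n)
  have "L-lipschitz_on {0..} f"
    using f L by (intro lipschitz_onI) (auto simp: dist_real_def)
  then have c: "continuous_on {0..} f" by (rule lipschitz_on_continuous_on)
  have i: "f integrable_on {u..w}" if "0 \<le> u" for u w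
    using that by (intro integrable_continuous_real continuous_on_subset[OF c]) auto
  have le: "real n * h \<le> real (Suc n) * h" using h by (intro mult_right_mono) auto
  have "integral {0..real (Suc n) * h} f = integral {0..real n * h} f + integral {real n * h..real (Suc n) * h} f"
    using h le by (intro Henstock_Kurzweil_Integration.integral_combine[symmetric] i) auto
  moreover have "\<bar>integral {real n * h..real (Suc n) * h} f - h * f (real n * h)\<bar> \<le> L * h * h"
  proof -
    have "integral {real n * h..real (Suc n) * h} (\<lambda>t. f t - f (real n * h))
      = integral {real n * h..real (Suc n) * h} f - h * f (real n * h)"
      using h le by (subst Henstock_Kurzweil_Integration.integral_diff) (auto intro: i simp: algebra_simps)
    moreover have "norm (integral {real n * h..real (Suc n) * h} (\<lambda>t. f t - f (real n * h)))
      \<le> (L * h) * (real (Suc n) * h - real n * h)"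
    proof (rule integral_bound[OF le])
      show "continuous_on {real n * h..real (Suc n) * h} (\<lambda>t. f t - f (real n * h))"
        using h by (intro continuous_intros continuous_on_subset[OF c]) (auto intro: order_trans[rotated])
      fix t assume t: "t \<in> {real n * h..real (Suc n) * h}"
      then have "\<bar>f t - f (real n * h)\<bar> \<le> L * \<bar>t - real n * h\<bar>" using h by (intro f) (auto intro: order_trans[rotated])
      also have "\<dots> \<le> L * h" using t L by (intro mult_left_mono) (auto simp: algebra_simps)
      finally show "norm (f t - f (real n * h)) \<le> L * h" by simp
    qed
    ultimately show ?thesis by (simp add: algebra_simps)
  qed
  ultimately show ?case using Suc by (simp add: algebra_simps abs_le_iff)
qed simp

locale nonlinear_reluctivity = bounded_domain +
  fixes \<nu> :: "real^3 \<Rightarrow> real \<Rightarrow> real" and L :: real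
  assumes nu_measurable: "(\<lambda>(x, \<zeta>). \<nu> x \<zeta>) \<in> borel_measurable (lebesgue_on (\<Omega> \<times> {0..}))"
    and nu_nonneg: "\<And>x \<zeta>. x \<in> \<Omega> \<Longrightarrow> \<zeta> \<ge> 0 \<Longrightarrow> \<nu> x \<zeta> \<ge> 0"
    and L: "L > 0"
    and nu_mono: "\<And>x \<zeta> \<zeta>'. x \<in> \<Omega> \<Longrightarrow> 0 \<le> \<zeta> \<Longrightarrow> \<zeta> \<le> \<zeta>' \<Longrightarrow> \<nu> x \<zeta> * \<zeta> \<le> \<nu> x \<zeta>' * \<zeta>'"
    and nu_lipschitz: "\<And>x \<zeta> \<zeta>'. x \<in> \<Omega> \<Longrightarrow> \<zeta> \<ge> 0 \<Longrightarrow> \<zeta>' \<ge> 0 \<Longrightarrow>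
      \<bar>\<nu> x \<zeta> * \<zeta> - \<nu> x \<zeta>' * \<zeta>'\<bar> \<le> L * \<bar>\<zeta> - \<zeta>'\<bar>"
begin

lemma nu_linear_bound: "x \<in> \<Omega> \<Longrightarrow> 0 \<le> \<zeta> \<Longrightarrow> \<nu> x \<zeta> * \<zeta> \<le> L * \<zeta>"
  using nu_lipschitz[of x \<zeta> 0] by simp

lemma nu_continuous: "x \<in> \<Omega> \<Longrightarrow> continuous_on {0..} (\<lambda>\<zeta>. \<nu> x \<zeta> * \<zeta>)"
  using nu_lipschitz[of x] L
  by (intro lipschitz_on_continuous_on[of L] lipschitz_onI) (auto simp: dist_real_def)

text \<open>Joint measurability refers to the completed product measure and therefore yields
  measurable sections for almost every \<zeta> only. The product
  \<open>\<nu> x \<zeta> * \<zeta>\<close> is continuous in \<zeta>, so the section at an arbitrary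
  \<open>r\<close> is a limit of good sections.\<close>

lemma nu_section_measurable:
  assumes r: "0 \<le> r"
  shows "(\<lambda>x. \<nu> x r * r) \<in> borel_measurable (lebesgue_on \<Omega>)"
proof -
  \<comment> \<open>After extension by zero the function agrees almost everywhere with a Borel
    function, all of whose sections are Borel.\<close>
  define F where "F p = (if p \<in> \<Omega> \<times> {0..} then (\<lambda>(x, \<zeta>). \<nu> x \<zeta>) p else 0)" for p
  have "\<Omega> \<times> {0..} \<in> sets (borel :: ((real^3) \<times> real) measure)"
    using open_domain by (intro borel_Times) auto
  then have "(\<Omega> \<times> {0..} :: ((real^3) \<times> real) set) \<in> sets lebesgue" by simp
  then have "F \<in> borel_measurable lebesgue"
    unfolding F_def[abs_def] using nu_measurable by (simp only: borel_measurable_if)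
  then obtain f where f: "f \<in> borel_measurable lborel" "AE p in lborel. F p = f p"
    using completion_ex_borel_measurable_real[of F lborel] by blast
  then obtain Z where Z: "Z \<in> sets lborel" "emeasure lborel Z = 0" "{p \<in> space lborel. F p \<noteq> f p} \<subseteq> Z"
    by (auto elim!: AE_E)
  have AEZ: "AE p in (lborel :: (real^3) measure) \<Otimes>\<^sub>M (lborel :: real measure). p \<notin> Z"
    unfolding lborel_prod using Z by (intro AE_not_in null_setsI) auto
  have "{p \<in> space (lborel \<Otimes>\<^sub>M lborel). (fst p, snd p) \<notin> Z} = space (lborel :: ((real^3) \<times> real) measure) - Z"
    by (auto simp: space_pair_measure)
  then have "{p \<in> space (lborel \<Otimes>\<^sub>M lborel). (fst p, snd p) \<notin> Z} \<in> sets (lborel \<Otimes>\<^sub>M lborel)"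
    using Z(1) unfolding lborel_prod by (simp only:) blast
  \<comment> \<open>Fubini gives the null sections for almost every \<open>x\<close>; exchanging the
    variables gives them for almost every \<zeta>.\<close>
  from lborel_pair.AE_commute[OF this] lborel_pair.AE_pair[OF AEZ]
  have "AE \<zeta> in lborel. AE x in lborel. (x, \<zeta>) \<notin> Z" by simp
  then have good: "AE \<zeta> in lborel. AE x in lborel. F (x, \<zeta>) = f (x, \<zeta>)"
    by eventually_elim (use Z(3) in \<open>auto elim!: eventually_mono\<close>)
  \<comment> \<open>Good parameters have full measure, so they occur arbitrarily close to
    \<open>r\<close>; approaching from above keeps them nonnegative.\<close>
  have "\<exists>\<zeta>. r < \<zeta> \<and> \<zeta> < r + inverse (real (Suc n)) \<and> (AE x in lborel. F (x, \<zeta>) = f (x, \<zeta>))" for n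
    using AE_lborel_exists_in_interval[OF good, of r "r + inverse (real (Suc n))"] by auto
  then have "\<forall>n. \<exists>\<zeta>. r < \<zeta> \<and> \<zeta> < r + inverse (real (Suc n)) \<and> (AE x in lborel. F (x, \<zeta>) = f (x, \<zeta>))"
    by (rule allI)
  from choice[OF this] obtain \<zeta> where
    "\<forall>n. r < \<zeta> n \<and> \<zeta> n < r + inverse (real (Suc n)) \<and> (AE x in lborel. F (x, \<zeta> n) = f (x, \<zeta> n))" ..
  then have \<zeta>: "\<And>n. r < \<zeta> n" "\<And>n. \<zeta> n < r + inverse (real (Suc n))"
    "\<And>n. AE x in lborel. F (x, \<zeta> n) = f (x, \<zeta> n)" by simp_all
  have "(\<lambda>x. \<nu> x (\<zeta> n) * \<zeta> n) \<in> borel_measurable (lebesgue_on \<Omega>)" for n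
  proof -
    have "(\<lambda>x. f (x, \<zeta> n)) \<in> borel_measurable lborel"
      using f(1) by (intro measurable_compose[OF _ f(1)]) (simp add: borel_measurable_Pair)
    then have "(\<lambda>x. f (x, \<zeta> n)) \<in> borel_measurable lebesgue" by (rule measurable_completion)
    moreover have "AE x in lebesgue. f (x, \<zeta> n) = F (x, \<zeta> n)"
      using AE_completion[OF \<zeta>(3)[of n]] by eventually_elim simp
    ultimately have "(\<lambda>x. F (x, \<zeta> n)) \<in> borel_measurable lebesgue"
      by (rule borel_measurable_AE)
    then have "(\<lambda>x. F (x, \<zeta> n)) \<in> borel_measurable (lebesgue_on \<Omega>)" by (rule measurable_restrict_space1)
    then have "(\<lambda>x. \<nu> x (\<zeta> n)) \<in> borel_measurable (lebesgue_on \<Omega>)"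
      by (rule measurable_cong[THEN iffD1, rotated]) (use r \<zeta>(1)[of n] in \<open>auto simp: F_def\<close>)
    then show ?thesis by simp
  qed
  moreover have "(\<lambda>n. \<nu> x (\<zeta> n) * \<zeta> n) \<longlonglongrightarrow> \<nu> x r * r" if "x \<in> space (lebesgue_on \<Omega>)" for x
  proof -
    have x: "x \<in> \<Omega>" using that by simp
    have "(\<lambda>n. \<zeta> n - r) \<longlonglongrightarrow> 0"
    proof (intro Lim_null_comparison[OF _ LIMSEQ_inverse_real_of_nat] always_eventually allI)
      show "norm (\<zeta> n - r) \<le> inverse (real (Suc n))" for n using \<zeta>(1,2)[of n] by simp
    qed
    then have "\<zeta> \<longlonglongrightarrow> r" by (simp add: LIM_zero_iff)
    moreover have "\<forall>\<^sub>F n in sequentially. \<zeta> n \<in> {0..}"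
    proof (intro always_eventually allI)
      show "\<zeta> n \<in> {0..}" for n using r \<zeta>(1)[of n] by simp
    qed
    moreover have "r \<in> {0..}" using r by simp
    ultimately show ?thesis by (intro continuous_on_tendsto_compose[OF nu_continuous[OF x]])
  qed
  ultimately show ?thesis by (rule borel_measurable_LIMSEQ_real[rotated])
qed

lemma flux_density_measurable:
  assumes "b \<in> borel_measurable (lebesgue_on \<Omega>)" "\<And>x. x \<in> \<Omega> \<Longrightarrow> 0 \<le> b x"
  shows "(\<lambda>x. \<nu> x (b x) * b x) \<in> borel_measurable (lebesgue_on \<Omega>)"
  by (rule caratheodory_measurable[of "\<lambda>x r. \<nu> x r * r"])
    (use assms nu_section_measurable nu_continuous in auto)

text \<open>Riemann sums whose mesh \<open>b x / (n + 1)\<close> depends on the point have a fixed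
  number of terms, each of them measurable.\<close>

lemma energy_density_measurable:
  assumes b: "b \<in> borel_measurable (lebesgue_on \<Omega>)" "\<And>x. x \<in> \<Omega> \<Longrightarrow> 0 \<le> b x"
  shows "(\<lambda>x. energy_density \<nu> x ((b x)\<^sup>2)) \<in> borel_measurable (lebesgue_on \<Omega>)"
proof (rule borel_measurable_LIMSEQ_real)
  define h where "h n x = b x / real (Suc n)" for n x
  have hm: "h n \<in> borel_measurable (lebesgue_on \<Omega>)" for n unfolding h_def[abs_def] using b(1) by simp
  have "(\<lambda>x. \<nu> x (real k * h n x) * (real k * h n x)) \<in> borel_measurable (lebesgue_on \<Omega>)" for n k
  proof (rule flux_density_measurable)
    show "(\<lambda>x. real k * h n x) \<in> borel_measurable (lebesgue_on \<Omega>)"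
      by (intro borel_measurable_times hm borel_measurable_const)
    show "0 \<le> real k * h n x" if "x \<in> \<Omega>" for x using b(2)[OF that] by (simp add: h_def)
  qed
  then show "(\<lambda>x. \<Sum>k<Suc n. h n x * (\<nu> x (real k * h n x) * (real k * h n x))) \<in> borel_measurable (lebesgue_on \<Omega>)" for n
    by (rule borel_measurable_sum[OF borel_measurable_times[OF hm]])
  fix x assume "x \<in> space (lebesgue_on \<Omega>)"
  then have x: "x \<in> \<Omega>" by simp
  have eq: "energy_density \<nu> x ((b x)\<^sup>2) = integral {0..real (Suc n) * h n x} (\<lambda>\<zeta>. \<nu> x \<zeta> * \<zeta>)" for n
    using b(2)[OF x] by (simp add: energy_density_def h_def)
  have "\<bar>energy_density \<nu> x ((b x)\<^sup>2) - (\<Sum>k<Suc n. h n x * (\<nu> x (real k * h n x) * (real k * h n x)))\<bar>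
      \<le> L * (b x)\<^sup>2 * inverse (real (Suc n))" for n
  proof -
    have "\<bar>energy_density \<nu> x ((b x)\<^sup>2) - (\<Sum>k<Suc n. h n x * (\<nu> x (real k * h n x) * (real k * h n x)))\<bar>
      \<le> real (Suc n) * (L * h n x * h n x)"
      unfolding eq[of n] using L b(2)[OF x]
      by (intro left_riemann_sum_error nu_lipschitz x) (auto simp: h_def)
    also have "\<dots> = L * (b x)\<^sup>2 * inverse (real (Suc n))"
      unfolding h_def by (simp add: power2_eq_square divide_inverse)
    finally show ?thesis .
  qed
  then have ev: "\<forall>\<^sub>F n in sequentially. norm (energy_density \<nu> x ((b x)\<^sup>2)
      - (\<Sum>k<Suc n. h n x * (\<nu> x (real k * h n x) * (real k * h n x)))) \<le> L * (b x)\<^sup>2 * inverse (real (Suc n))"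
    unfolding real_norm_def by (intro always_eventually allI)
  have "(\<lambda>n. L * (b x)\<^sup>2 * inverse (real (Suc n))) \<longlonglongrightarrow> L * (b x)\<^sup>2 * 0"
    by (intro tendsto_intros LIMSEQ_inverse_real_of_nat)
  then have "(\<lambda>n. L * (b x)\<^sup>2 * inverse (real (Suc n))) \<longlonglongrightarrow> 0" by (simp only: mult_zero_right)
  with ev have "(\<lambda>n. energy_density \<nu> x ((b x)\<^sup>2) - (\<Sum>k<Suc n. h n x * (\<nu> x (real k * h n x) * (real k * h n x)))) \<longlonglongrightarrow> 0"
    by (rule Lim_null_comparison)
  then have "(\<lambda>n. energy_density \<nu> x ((b x)\<^sup>2) - (energy_density \<nu> x ((b x)\<^sup>2) - (\<Sum>k<Suc n. h n x * (\<nu> x (real k * h n x) * (real k * h n x)))))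
    \<longlonglongrightarrow> energy_density \<nu> x ((b x)\<^sup>2) - 0"
    by (rule tendsto_diff[OF tendsto_const])
  then show "(\<lambda>n. \<Sum>k<Suc n. h n x * (\<nu> x (real k * h n x) * (real k * h n x))) \<longlonglongrightarrow> energy_density \<nu> x ((b x)\<^sup>2)"
    by (simp only: diff_diff_eq2 diff_zero add_diff_cancel_left')
qed

text \<open>The density is a primitive of the nondecreasing function
  \<open>\<nu> x \<zeta> * \<zeta>\<close>, hence convex: between \<open>r\<close> and
  \<open>s\<close> the integrand is compared with its value at \<open>r\<close>.\<close>

lemma energy_density_subgradient:
  assumes x: "x \<in> \<Omega>" and rs: "0 \<le> r" "0 \<le> s"
  shows "\<nu> x r * r * (s - r) \<le> energy_density \<nu> x (s\<^sup>2) - energy_density \<nu> x (r\<^sup>2)"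
proof -
  have E: "energy_density \<nu> x (t\<^sup>2) = integral {0..t} (\<lambda>\<zeta>. \<nu> x \<zeta> * \<zeta>)" if "0 \<le> t" for t
    using that by (simp add: energy_density_def)
  have i: "(\<lambda>\<zeta>. \<nu> x \<zeta> * \<zeta>) integrable_on {u..w}" if "0 \<le> u" for u w
    using that by (intro integrable_continuous_real continuous_on_subset[OF nu_continuous[OF x]]) auto
  consider "r \<le> s" | "s \<le> r" by linarith
  then show ?thesis
  proof cases
    case 1
    have "integral {0..r} (\<lambda>\<zeta>. \<nu> x \<zeta> * \<zeta>) + integral {r..s} (\<lambda>\<zeta>. \<nu> x \<zeta> * \<zeta>) = integral {0..s} (\<lambda>\<zeta>. \<nu> x \<zeta> * \<zeta>)"
      using 1 rs by (intro Henstock_Kurzweil_Integration.integral_combine i) auto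
    moreover have "integral {r..s} (\<lambda>\<zeta>. \<nu> x r * r) \<le> integral {r..s} (\<lambda>\<zeta>. \<nu> x \<zeta> * \<zeta>)"
      using rs x by (intro integral_le i nu_mono) auto
    ultimately show ?thesis using 1 rs by (simp add: E algebra_simps)
  next
    case 2
    have "integral {0..s} (\<lambda>\<zeta>. \<nu> x \<zeta> * \<zeta>) + integral {s..r} (\<lambda>\<zeta>. \<nu> x \<zeta> * \<zeta>) = integral {0..r} (\<lambda>\<zeta>. \<nu> x \<zeta> * \<zeta>)"
      using 2 rs by (intro Henstock_Kurzweil_Integration.integral_combine i) auto
    moreover have "integral {s..r} (\<lambda>\<zeta>. \<nu> x \<zeta> * \<zeta>) \<le> integral {s..r} (\<lambda>\<zeta>. \<nu> x r * r)"
      using rs x by (intro integral_le i nu_mono) auto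
    ultimately show ?thesis using 2 rs by (simp add: E algebra_simps)
  qed
qed

lemma energy_density_bounds:
  assumes x: "x \<in> \<Omega>" and r: "0 \<le> r"
  shows "0 \<le> energy_density \<nu> x (r\<^sup>2)" "energy_density \<nu> x (r\<^sup>2) \<le> L / 2 * r\<^sup>2"
proof -
  have E: "energy_density \<nu> x (r\<^sup>2) = integral {0..r} (\<lambda>\<zeta>. \<nu> x \<zeta> * \<zeta>)"
    using r by (simp add: energy_density_def)
  have i: "(\<lambda>\<zeta>. \<nu> x \<zeta> * \<zeta>) integrable_on {0..r}"
    by (intro integrable_continuous_real continuous_on_subset[OF nu_continuous[OF x]]) auto
  show "0 \<le> energy_density \<nu> x (r\<^sup>2)"
    unfolding E using x by (intro integral_nonneg i) (auto intro!: mult_nonneg_nonneg nu_nonneg)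
  have id: "((\<lambda>\<zeta>. L * \<zeta>) has_integral L * (r\<^sup>2 / 2)) {0..r}"
    using r by (intro has_integral_mult_right) (use ident_has_integral[OF r] in simp)
  then have "energy_density \<nu> x (r\<^sup>2) \<le> L * (r\<^sup>2 / 2)"
    unfolding E using x by (intro has_integral_le[OF integrable_integral[OF i] id] nu_linear_bound) auto
  then show "energy_density \<nu> x (r\<^sup>2) \<le> L / 2 * r\<^sup>2" by simp
qed

definition energy :: "(real^3, real^3) L2 \<Rightarrow> real"
  where "energy B = (LINT x|lebesgue_on \<Omega>. energy_density \<nu> x ((norm (rep_L2 B x))\<^sup>2))"

text \<open>The magnetic field strength belonging to the flux density \<open>B\<close>, which turns
  out to be a subgradient of the energy at \<open>B\<close>.\<close>

definition H_field :: "(real^3, real^3) L2 \<Rightarrow> real^3 \<Rightarrow> real^3"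
  where "H_field B x = \<nu> x (norm (rep_L2 B x)) *\<^sub>R rep_L2 B x"

lemma rep_square_integrable: "rep_L2 B square_integrable_on \<Omega>"
  by (rule square_integrable_on_UNIV_subset[OF rep_L2_square_integrable domain_lebesgue])

lemma rep_norm_measurable: "(\<lambda>x. norm (rep_L2 B x)) \<in> borel_measurable (lebesgue_on \<Omega>)"
  using rep_square_integrable[of B]
  by (intro measurable_compose[OF _ borel_measurable_norm]) (simp add: square_integrable_on_def)

lemma H_field_norm_le: "x \<in> \<Omega> \<Longrightarrow> norm (H_field B x) \<le> L * norm (rep_L2 B x)"
  using nu_linear_bound[of x "norm (rep_L2 B x)"] nu_nonneg[of x "norm (rep_L2 B x)"]
  by (simp add: H_field_def)

lemma H_field_square_integrable: "H_field B square_integrable_on \<Omega>"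
proof (rule square_integrable_on_bound)
  show "(\<lambda>x. L *\<^sub>R rep_L2 B x) square_integrable_on \<Omega>"
    by (intro square_integrable_on_scaleR rep_square_integrable)
  \<comment> \<open>Continuity is at hand for \<open>\<nu> x r * r\<close> rather than for \<nu>
    itself, so the product with the norm is formed first and divided out again. Where
    \<open>rep_L2 B x\<close> is zero both expressions vanish.\<close>
  have "H_field B = (\<lambda>x. ((\<nu> x (norm (rep_L2 B x)) * norm (rep_L2 B x)) / norm (rep_L2 B x)) *\<^sub>R rep_L2 B x)"
    by (auto simp: H_field_def fun_eq_iff)
  moreover have "\<dots> \<in> borel_measurable (lebesgue_on \<Omega>)"
    using rep_square_integrable[of B]
    by (intro borel_measurable_scaleR borel_measurable_divide flux_density_measurable rep_norm_measurable)
      (auto simp: square_integrable_on_def)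
  ultimately show "H_field B \<in> borel_measurable (lebesgue_on \<Omega>)" by simp
  show "AE x in lebesgue_on \<Omega>. norm (H_field B x) \<le> norm (L *\<^sub>R rep_L2 B x)"
    using H_field_norm_le L by (intro AE_I2) simp
qed

lemma energy_integrable:
  "integrable (lebesgue_on \<Omega>) (\<lambda>x. energy_density \<nu> x ((norm (rep_L2 B x))\<^sup>2))"
proof (rule Bochner_Integration.integrable_bound)
  show "integrable (lebesgue_on \<Omega>) (\<lambda>x. L / 2 * (norm (rep_L2 B x))\<^sup>2)"
    using rep_square_integrable[of B] by (simp add: square_integrable_on_def)
  show "(\<lambda>x. energy_density \<nu> x ((norm (rep_L2 B x))\<^sup>2)) \<in> borel_measurable (lebesgue_on \<Omega>)"
    by (intro energy_density_measurable rep_norm_measurable) simp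
  show "AE x in lebesgue_on \<Omega>. norm (energy_density \<nu> x ((norm (rep_L2 B x))\<^sup>2)) \<le> norm (L / 2 * (norm (rep_L2 B x))\<^sup>2)"
    using energy_density_bounds by (intro AE_I2) (force intro: order_trans[OF _ abs_ge_self])
qed

lemma energy_nonneg: "0 \<le> energy B"
  unfolding energy_def using energy_density_bounds(1) by (intro integral_nonneg_AE AE_I2) simp

lemma energy_le: "energy B \<le> L / 2 * (norm B)\<^sup>2"
proof -
  have i: "integrable lebesgue (\<lambda>x. (norm (rep_L2 B x))\<^sup>2)"
    using rep_L2_square_integrable[of B] by (simp add: square_integrable_on_UNIV)
  have i': "integrable (lebesgue_on \<Omega>) (\<lambda>x. (norm (rep_L2 B x))\<^sup>2)"
    using rep_square_integrable[of B] by (simp add: square_integrable_on_def)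
  have "energy B \<le> (LINT x|lebesgue_on \<Omega>. L / 2 * (norm (rep_L2 B x))\<^sup>2)"
    unfolding energy_def using i' energy_density_bounds(2)
    by (intro integral_mono energy_integrable) auto
  also have "\<dots> = L / 2 * (LINT x|lebesgue_on \<Omega>. (norm (rep_L2 B x))\<^sup>2)" by simp
  also have "(LINT x|lebesgue_on \<Omega>. (norm (rep_L2 B x))\<^sup>2) \<le> (LINT x|lebesgue. (norm (rep_L2 B x))\<^sup>2)"
    using i i' domain_lebesgue
    by (simp add: integral_restrict_space integrable_restrict_space)
      (intro integral_mono; simp add: indicator_def)
  also have "\<dots> = (norm B)\<^sup>2" by (simp add: norm_L2_power2)
  finally show ?thesis using L by (simp add: mult_left_mono)
qed

lemma energy_zero: "energy 0 = 0"
  using energy_le[of 0] energy_nonneg[of 0] by simp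

text \<open>As \<open>\<nu>\<close> is nonnegative, the Cauchy-Schwarz inequality at each point
  reduces the claim for vectors to the scalar convexity inequality for their norms.\<close>

lemma energy_subgradient: "L2_of \<Omega> (H_field B) \<bullet> (C - B) \<le> energy C - energy B"
proof -
  have "L2_of \<Omega> (H_field B) \<bullet> (C - B) = (LINT x|lebesgue_on \<Omega>. rep_L2 (C - B) x \<bullet> H_field B x)"
    by (simp add: inner_commute[of "L2_of \<Omega> (H_field B)"] inner_L2_of[OF H_field_square_integrable domain_lebesgue])
  also have "\<dots> \<le> (LINT x|lebesgue_on \<Omega>. energy_density \<nu> x ((norm (rep_L2 C x))\<^sup>2) - energy_density \<nu> x ((norm (rep_L2 B x))\<^sup>2))"
  proof (rule integral_mono_AE)
    show "integrable (lebesgue_on \<Omega>) (\<lambda>x. rep_L2 (C - B) x \<bullet> H_field B x)"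
      by (intro square_integrable_on_inner rep_square_integrable H_field_square_integrable)
    show "integrable (lebesgue_on \<Omega>) (\<lambda>x. energy_density \<nu> x ((norm (rep_L2 C x))\<^sup>2) - energy_density \<nu> x ((norm (rep_L2 B x))\<^sup>2))"
      by (intro Bochner_Integration.integrable_diff energy_integrable)
    have "AE x in lebesgue. x \<in> \<Omega> \<longrightarrow> rep_L2 (C - B) x \<bullet> H_field B x
        \<le> energy_density \<nu> x ((norm (rep_L2 C x))\<^sup>2) - energy_density \<nu> x ((norm (rep_L2 B x))\<^sup>2)"
      using rep_L2_diff_AE[of C B]
    proof eventually_elim
      case (elim x)
      show ?case
      proof
        assume x: "x \<in> \<Omega>"
        let ?b = "rep_L2 B x" and ?c = "rep_L2 C x"
        have "rep_L2 (C - B) x \<bullet> H_field B x = \<nu> x (norm ?b) * (?c \<bullet> ?b - norm ?b * norm ?b)"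
          by (simp add: elim H_field_def inner_diff_left power2_norm_eq_inner[symmetric] power2_eq_square)
        also have "\<dots> \<le> \<nu> x (norm ?b) * (norm ?c * norm ?b - norm ?b * norm ?b)"
          using nu_nonneg[OF x, of "norm ?b"] norm_cauchy_schwarz[of ?c ?b] by (intro mult_left_mono) auto
        also have "\<dots> = \<nu> x (norm ?b) * norm ?b * (norm ?c - norm ?b)" by (simp add: algebra_simps)
        also have "\<dots> \<le> energy_density \<nu> x ((norm ?c)\<^sup>2) - energy_density \<nu> x ((norm ?b)\<^sup>2)"
          by (intro energy_density_subgradient x) auto
        finally show "rep_L2 (C - B) x \<bullet> H_field B x \<le> energy_density \<nu> x ((norm ?c)\<^sup>2) - energy_density \<nu> x ((norm ?b)\<^sup>2)" .
      qed
    qed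
    then show "AE x in lebesgue_on \<Omega>. rep_L2 (C - B) x \<bullet> H_field B x
        \<le> energy_density \<nu> x ((norm (rep_L2 C x))\<^sup>2) - energy_density \<nu> x ((norm (rep_L2 B x))\<^sup>2)"
      using domain_lebesgue by (subst AE_restrict_space_iff) auto
  qed
  also have "\<dots> = energy C - energy B"
    unfolding energy_def by (intro Bochner_Integration.integral_diff energy_integrable)
  finally show ?thesis .
qed

lemma norm_H_field_le: "norm (L2_of \<Omega> (H_field B)) \<le> L * norm B"
proof -
  let ?H = "L2_of \<Omega> (H_field B)"
  have "(norm ?H)\<^sup>2 \<le> (LINT x|lebesgue. L\<^sup>2 * (norm (rep_L2 B x))\<^sup>2)"
    unfolding norm_L2_power2
  proof (rule integral_mono_AE)
    show "integrable lebesgue (\<lambda>x. (norm (rep_L2 ?H x))\<^sup>2)" "integrable lebesgue (\<lambda>x. L\<^sup>2 * (norm (rep_L2 B x))\<^sup>2)"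
      using rep_L2_square_integrable[of ?H] rep_L2_square_integrable[of B] by (auto simp: square_integrable_on_UNIV)
    show "AE x in lebesgue. (norm (rep_L2 ?H x))\<^sup>2 \<le> L\<^sup>2 * (norm (rep_L2 B x))\<^sup>2"
      using rep_L2_of_AE[OF H_field_square_integrable[of B] domain_lebesgue]
    proof eventually_elim
      case (elim x)
      then show ?case
        using H_field_norm_le[of x B] by (auto simp: power_mult_distrib[symmetric] intro!: power_mono)
    qed
  qed
  also have "\<dots> = (L * norm B)\<^sup>2" by (simp add: norm_L2_power2 power_mult_distrib)
  finally have sq: "(norm ?H)\<^sup>2 \<le> (L * norm B)\<^sup>2" .
  have "0 \<le> L * norm B" using L by (intro mult_nonneg_nonneg) simp_all
  with sq show ?thesis by (rule power2_le_imp_le)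
qed

text \<open>The subgradient inequality at both arguments, with the linear bound on the field
  strength, gives a local Lipschitz estimate. Continuity is what makes the energy along a measurable
  trajectory measurable in time.\<close>

lemma energy_continuous: "continuous_on UNIV energy"
proof (rule continuous_at_imp_continuous_on, rule ballI)
  fix B
  have lip: "energy B - energy C \<le> L * norm B * norm (B - C)" for B C
  proof -
    have "energy B - energy C \<le> L2_of \<Omega> (H_field B) \<bullet> (B - C)"
      using energy_subgradient[of B C] by (simp add: inner_diff_right)
    also have "\<dots> \<le> norm (L2_of \<Omega> (H_field B)) * norm (B - C)" by (rule norm_cauchy_schwarz)
    also have "\<dots> \<le> L * norm B * norm (B - C)" by (intro mult_right_mono norm_H_field_le) simp
    finally show ?thesis .
  qed
  have "((\<lambda>C. energy C - energy B) \<longlongrightarrow> 0) (at B)"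
  proof (rule Lim_null_comparison)
    show "\<forall>\<^sub>F C in at B. norm (energy C - energy B) \<le> L * (norm B + norm C) * norm (C - B)"
    proof (intro always_eventually allI)
      fix C
      have "0 \<le> L * norm B * norm (C - B)" "0 \<le> L * norm C * norm (C - B)" using L by auto
      then show "norm (energy C - energy B) \<le> L * (norm B + norm C) * norm (C - B)"
        using lip[of B C] lip[of C B] by (simp add: norm_minus_commute algebra_simps abs_le_iff)
    qed
    have "((\<lambda>C. L * (norm B + norm C) * norm (C - B)) \<longlongrightarrow> L * (norm B + norm B) * norm (B - B)) (at B)"
      by (intro tendsto_intros)
    then show "((\<lambda>C. L * (norm B + norm C) * norm (C - B)) \<longlongrightarrow> 0) (at B)" by simp
  qed
  then show "isCont energy B" by (simp add: isCont_def LIM_zero_iff)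
qed

end

subsection \<open>Weak derivatives of Hilbert space valued functions\<close>

lemma test_function_real_properties:
  fixes \<phi> :: "real \<Rightarrow> real"
  assumes \<phi>: "test_function {0<..<T} \<phi>"
  obtains a b where "0 < a" "a < b" "b < T"
    "continuous_on UNIV \<phi>" "continuous_on UNIV (deriv \<phi>)"
    "\<And>x. x \<notin> {a..b} \<Longrightarrow> \<phi> x = 0" "\<And>x. x \<notin> {a..b} \<Longrightarrow> deriv \<phi> x = 0"
  | "\<phi> = (\<lambda>x. 0)"
proof -
  obtain K where K: "compact K" "K \<subseteq> {0<..<T}" "\<And>x. x \<notin> K \<Longrightarrow> \<phi> x = 0"
    using \<phi> unfolding test_function_def by blast
  show thesis
  proof (cases "K = {}")
    case True
    then have "\<phi> = (\<lambda>x. 0)" using K(3) by auto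
    then show thesis by (rule that(2))
  next
    case False
    obtain l where l: "l \<in> K" "\<And>x. x \<in> K \<Longrightarrow> l \<le> x" using compact_attains_inf[OF K(1) False] by blast
    obtain r where r: "r \<in> K" "\<And>x. x \<in> K \<Longrightarrow> x \<le> r" using compact_attains_sup[OF K(1) False] by blast
    \<comment> \<open>Moving the right end beyond the support makes the interval nondegenerate even
      when the support is a single point; weak derivatives come with integrability on nondegenerate
      intervals.\<close>
    define b where "b = (r + T) / 2"
    have lr: "0 < l" "l \<le> r" "r < T" using K(2) l r by auto
    have b: "l < b" "b < T" "r < b" using lr by (auto simp: b_def)
    have out: "x \<notin> K" if "x \<notin> {l..b}" for x using that l(2)[of x] r(2)[of x] b by auto
    have C1: "Ck (Suc 0) \<phi>" using \<phi> unfolding test_function_def by blast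
    have d: "(\<phi> has_field_derivative frechet_derivative \<phi> (at x) 1) (at x)" for x
    proof -
      have hd: "(\<phi> has_derivative frechet_derivative \<phi> (at x)) (at x)" by (rule Ck_differentiable[OF C1])
      interpret bounded_linear "frechet_derivative \<phi> (at x)" using hd by (rule has_derivative_bounded_linear)
      have "frechet_derivative \<phi> (at x) = (\<lambda>h. frechet_derivative \<phi> (at x) 1 * h)"
      proof
        show "frechet_derivative \<phi> (at x) h = frechet_derivative \<phi> (at x) 1 * h" for h
          using scaleR[of h 1] by simp
      qed
      with hd show ?thesis unfolding has_field_derivative_def by simp
    qed
    have deriv: "deriv \<phi> = (\<lambda>x. frechet_derivative \<phi> (at x) 1)"
      using DERIV_imp_deriv[OF d] by auto
    show thesis
    proof (rule that(1))
      show "0 < l" "l < b" "b < T" using lr b by auto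
      show "continuous_on UNIV \<phi>" by (rule Ck_continuous[OF C1])
      show "continuous_on UNIV (deriv \<phi>)" using C1 by (simp add: deriv)
      show "\<phi> x = 0" if "x \<notin> {l..b}" for x using K(3) out[OF that] by blast
      show "deriv \<phi> x = 0" if "x \<notin> {l..b}" for x
      proof -
        have "open (- K)" using K(1) by (simp add: compact_imp_closed open_Compl)
        moreover have "x \<in> - K" using out[OF that] by simp
        ultimately have "\<forall>\<^sub>F y in nhds x. \<phi> y = 0"
          using K(3) by (auto elim!: eventually_mono dest!: eventually_nhds_in_open)
        then have "(\<phi> has_field_derivative 0) (at x)"
          using DERIV_cong_ev[of x x \<phi> "\<lambda>_. 0" 0 0] by simp
        then show ?thesis by (rule DERIV_imp_deriv)
      qed
    qed
  qed
qed

lemma integrable_compact_support_scaleR: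
  fixes \<psi> :: "real \<Rightarrow> real" and u :: "real \<Rightarrow> 'b::{banach, second_countable_topology}"
  assumes \<psi>: "continuous_on UNIV \<psi>" "\<And>x. x \<notin> {a..b} \<Longrightarrow> \<psi> x = 0"
    and u: "integrable (lebesgue_on {a..b}) u" and ab: "{a..b} \<subseteq> S" "S \<in> sets lebesgue"
  shows "integrable (lebesgue_on S) (\<lambda>x. \<psi> x *\<^sub>R u x)"
proof -
  have "bounded (\<psi> ` {a..b})"
    by (intro compact_imp_bounded compact_continuous_image continuous_on_subset[OF \<psi>(1)]) auto
  then obtain C where "\<forall>x\<in>{a..b}. \<bar>\<psi> x\<bar> \<le> C" unfolding bounded_iff by force
  then have C: "\<And>x. x \<in> {a..b} \<Longrightarrow> \<bar>\<psi> x\<bar> \<le> C" by blast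
  have "integrable (lebesgue_on {a..b}) (\<lambda>x. \<psi> x *\<^sub>R u x)"
  proof (rule Bochner_Integration.integrable_bound)
    show "integrable (lebesgue_on {a..b}) (\<lambda>x. C *\<^sub>R u x)" using u by simp
    show "(\<lambda>x. \<psi> x *\<^sub>R u x) \<in> borel_measurable (lebesgue_on {a..b})"
      by (rule borel_measurable_scaleR[OF continuous_imp_measurable_on_sets_lebesgue[OF continuous_on_subset[OF \<psi>(1)]]
          borel_measurable_integrable[OF u]]) auto
    show "AE x in lebesgue_on {a..b}. norm (\<psi> x *\<^sub>R u x) \<le> norm (C *\<^sub>R u x)"
    proof (rule AE_I2)
      fix x assume "x \<in> space (lebesgue_on {a..b})"
      then have "\<bar>\<psi> x\<bar> \<le> \<bar>C\<bar>" using C[of x] by auto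
      then show "norm (\<psi> x *\<^sub>R u x) \<le> norm (C *\<^sub>R u x)" by (simp add: mult_right_mono)
    qed
  qed
  then have i: "integrable lebesgue (\<lambda>x. indicator {a..b} x *\<^sub>R (\<psi> x *\<^sub>R u x))"
    by (simp add: integrable_restrict_space)
  have "(\<lambda>x. indicator {a..b} x *\<^sub>R (\<psi> x *\<^sub>R u x)) = (\<lambda>x. indicator S x *\<^sub>R (\<psi> x *\<^sub>R u x))"
    using \<psi>(2) ab(1) by (auto simp: indicator_def fun_eq_iff)
  with i show ?thesis using ab(2) by (simp add: integrable_restrict_space)
qed

text \<open>Taking \<open>c\<close> out of the Bochner integral uses integrability of the integrand.
  That is known on compact subintervals of \<open>(0, T)\<close>, and a test function lives on one
  of them.\<close>

lemma has_weak_derivative_inner: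
  fixes u g :: "real \<Rightarrow> 'b::{real_inner, banach, second_countable_topology}"
  assumes wd: "has_weak_derivative u g T"
  shows "has_weak_derivative (\<lambda>t. c \<bullet> u t) (\<lambda>t. c \<bullet> g t) T"
  unfolding has_weak_derivative_def
proof (intro conjI allI impI)
  fix a b :: real assume "0 < a \<and> a < b \<and> b < T"
  then show "integrable (lebesgue_on {a..b}) (\<lambda>t. c \<bullet> u t)" "integrable (lebesgue_on {a..b}) (\<lambda>t. c \<bullet> g t)"
    using wd by (auto simp: has_weak_derivative_def)
next
  fix \<phi> :: "real \<Rightarrow> real" assume \<phi>: "test_function {0<..<T} \<phi>"
  have int: "(LINT t|lebesgue_on {0<..<T}. \<psi> t *\<^sub>R (c \<bullet> h t)) = c \<bullet> (LINT t|lebesgue_on {0<..<T}. \<psi> t *\<^sub>R h t)"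
    if "integrable (lebesgue_on {0<..<T}) (\<lambda>t. \<psi> t *\<^sub>R h t)" for \<psi> and h :: "real \<Rightarrow> 'b"
    using integral_inner_right[of c "lebesgue_on {0<..<T}" "\<lambda>t. \<psi> t *\<^sub>R h t"] that by simp
  show "(LINT t|lebesgue_on {0<..<T}. deriv \<phi> t *\<^sub>R (c \<bullet> u t)) = - (LINT t|lebesgue_on {0<..<T}. \<phi> t *\<^sub>R (c \<bullet> g t))"
    using \<phi>
  proof (cases rule: test_function_real_properties)
    case (1 a b)
    then have ab: "{a..b} \<subseteq> {0<..<T}" by auto
    have ug: "integrable (lebesgue_on {a..b}) u" "integrable (lebesgue_on {a..b}) g"
      using wd 1 by (auto simp: has_weak_derivative_def)
    have "integrable (lebesgue_on {0<..<T}) (\<lambda>t. deriv \<phi> t *\<^sub>R u t)"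
      "integrable (lebesgue_on {0<..<T}) (\<lambda>t. \<phi> t *\<^sub>R g t)"
      using integrable_compact_support_scaleR[OF 1(5,7) ug(1) ab]
        integrable_compact_support_scaleR[OF 1(4,6) ug(2) ab] by auto
    moreover have "(LINT t|lebesgue_on {0<..<T}. deriv \<phi> t *\<^sub>R u t) = - (LINT t|lebesgue_on {0<..<T}. \<phi> t *\<^sub>R g t)"
      using wd \<phi> unfolding has_weak_derivative_def by blast
    ultimately show ?thesis by (simp only: int inner_minus_right)
  next
    case 2
    then show ?thesis by simp
  qed
qed

lemma weak_derivative_increment_continuous:
  fixes u g v :: "real \<Rightarrow> real"
  assumes wd: "has_weak_derivative u g T" and v: "continuous_on {0..T} v"
    and uv: "AE r in lebesgue. 0 < r \<and> r < T \<longrightarrow> u r = v r"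
    and st: "0 < s" "s \<le> t" "t < T"
  shows "integrable (lebesgue_on {s..t}) g" "v t - v s = (LINT r|lebesgue_on {s..t}. g r)"
proof -
  have "integrable (lebesgue_on {s..(t + T) / 2}) g"
    using wd st by (auto simp: has_weak_derivative_def)
  then show gi: "integrable (lebesgue_on {s..t}) g"
    by (rule integrable_lebesgue_on_subset) (use st in auto)
  have "isCont v r" if "s \<le> r" "r < T" for r
    using that st by (intro continuous_on_interior[OF v]) auto
  moreover have "continuous_on {s..t} v" using st by (intro continuous_on_subset[OF v]) auto
  ultimately have "v t - v s = integral {s..t} g"
    using st by (intro weak_derivative_increment[OF wd _ _ uv]) auto
  then show "v t - v s = (LINT r|lebesgue_on {s..t}. g r)"
    using gi by (simp add: lebesgue_integral_eq_integral)
qed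

text \<open>After cutting off to a compact subinterval, box integrals become integrals over clipped
  closed intervals, up to two endpoints. Countably many such subintervals cover
  \<open>(0, T)\<close>.\<close>

lemma AE_zero_if_interval_integrals_zero:
  fixes f :: "real \<Rightarrow> real"
  assumes f: "\<And>s t. 0 < s \<Longrightarrow> s \<le> t \<Longrightarrow> t < T \<Longrightarrow> integrable (lebesgue_on {s..t}) f"
    and z: "\<And>s t. 0 < s \<Longrightarrow> s \<le> t \<Longrightarrow> t < T \<Longrightarrow> (LINT r|lebesgue_on {s..t}. f r) = 0"
  shows "AE t in lebesgue. 0 < t \<and> t < T \<longrightarrow> f t = 0"
proof -
  have loc: "AE t in lebesgue. t \<in> {s..r} \<longrightarrow> f t = 0" if sr: "0 < s" "r < T" for s r
  proof (cases "s \<le> r")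
    case True
    have "AE t in lebesgue. indicator {s..r} t * f t = 0"
    proof (rule AE_zero_if_box_integrals_zero)
      show "integrable lebesgue (\<lambda>t. indicator {s..r} t * f t)"
        using f[OF sr(1) True sr(2)] by (simp add: integrable_restrict_space)
      fix a b :: real
      define a' b' where "a' = max s a" and "b' = min r b"
      have "AE t in lebesgue. t \<noteq> a \<and> t \<noteq> b"
        using AE_completion[OF AE_lborel_singleton[of a]] AE_completion[OF AE_lborel_singleton[of b]]
        by eventually_elim auto
      then have ae: "AE t in lebesgue. indicator (box a b) t *\<^sub>R (indicator {s..r} t * f t) = indicator {a'..b'} t *\<^sub>R f t"
        by eventually_elim (auto simp: a'_def b'_def indicator_def)
      have "integrable lebesgue (\<lambda>t. indicator {a'..b'} t *\<^sub>R f t)"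
      proof (cases "a' \<le> b'")
        case True
        then have "integrable (lebesgue_on {a'..b'}) f" using sr by (intro f) (auto simp: a'_def b'_def)
        then show ?thesis by (simp add: integrable_restrict_space)
      qed simp
      then have meas: "(\<lambda>t. indicator {a'..b'} t *\<^sub>R f t) \<in> borel_measurable lebesgue" by auto
      have "(LINT t:box a b|lebesgue. indicator {s..r} t * f t) = (LINT t|lebesgue. indicator {a'..b'} t *\<^sub>R f t)"
        unfolding set_lebesgue_integral_def
        by (rule integral_cong_AE[OF borel_measurable_AE[OF meas] meas ae]) (use ae in \<open>auto elim: eventually_mono\<close>)
      also have "\<dots> = 0"
      proof (cases "a' \<le> b'")
        case True
        then have "(LINT t|lebesgue_on {a'..b'}. f t) = 0" using sr by (intro z) (auto simp: a'_def b'_def)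
        then show ?thesis by (simp add: integral_restrict_space)
      qed simp
      finally show "(LINT t:box a b|lebesgue. indicator {s..r} t * f t) = 0" .
    qed
    then show ?thesis by eventually_elim (auto simp: indicator_def split: if_splits)
  qed auto
  have "AE t in lebesgue. \<forall>n::nat. t \<in> {inverse (real (Suc n))..T - inverse (real (Suc n))} \<longrightarrow> f t = 0"
    unfolding AE_all_countable by (intro allI loc) auto
  then show ?thesis
  proof eventually_elim
    case (elim t)
    show ?case
    proof
      assume t: "0 < t \<and> t < T"
      then obtain n where "inverse (real (Suc n)) < min t (T - t)"
        using reals_Archimedean[of "min t (T - t)"] by auto
      with elim t show "f t = 0" by (auto dest!: spec[of _ n])
    qed
  qed
qed

section \<open>Restriction to a subset as an orthogonal projection of the Hilbert space\<close>

definition L2_restrict :: "'a::euclidean_space set \<Rightarrow> ('a, 'b::euclidean_space) L2 \<Rightarrow> ('a, 'b) L2"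
  where "L2_restrict S u = L2_of S (rep_L2 u)"

context
  fixes S :: "'a::euclidean_space set"
  assumes S: "S \<in> sets lebesgue"
begin

lemma L2_restrict_inner: "L2_restrict S u \<bullet> v = (LINT x|lebesgue_on S. rep_L2 u x \<bullet> rep_L2 v x)"
  for u v :: "('a, 'b::euclidean_space) L2"
  using inner_L2_of[OF square_integrable_on_UNIV_subset[OF rep_L2_square_integrable S] S, of v u]
  by (simp add: L2_restrict_def inner_commute)

lemma L2_restrict_sym: "L2_restrict S u \<bullet> v = u \<bullet> L2_restrict S v"
  for u v :: "('a, 'b::euclidean_space) L2"
  using L2_restrict_inner[of u v] L2_restrict_inner[of v u] by (simp add: inner_commute)

lemma L2_restrict_idem: "L2_restrict S (L2_restrict S u) = L2_restrict S u"
  for u :: "('a, 'b::euclidean_space) L2"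
  using L2_of_rep[OF L2_of_in_L2_space[OF square_integrable_on_UNIV_subset[OF rep_L2_square_integrable S] S] S, of u]
  by (simp add: L2_restrict_def)

text \<open>Linearity follows from symmetry by testing against every \<open>c\<close>, which avoids
  a choice of representatives; symmetry and idempotence give
  \<open>|P u|^2 = u \<bullet> P u\<close> and hence norm at most 1.\<close>

lemma bounded_linear_L2_restrict: "bounded_linear (L2_restrict S :: ('a, 'b::euclidean_space) L2 \<Rightarrow> _)"
proof (rule bounded_linear_intro[where K = 1])
  fix u v :: "('a, 'b) L2" and r :: real
  have "L2_restrict S (u + v) \<bullet> c = (L2_restrict S u + L2_restrict S v) \<bullet> c" for c
    by (simp add: L2_restrict_sym inner_add_left)
  then show "L2_restrict S (u + v) = L2_restrict S u + L2_restrict S v" using vector_eq_rdot by blast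
  have "L2_restrict S (r *\<^sub>R u) \<bullet> c = (r *\<^sub>R L2_restrict S u) \<bullet> c" for c
    by (simp add: L2_restrict_sym)
  then show "L2_restrict S (r *\<^sub>R u) = r *\<^sub>R L2_restrict S u" using vector_eq_rdot by blast
  have "(norm (L2_restrict S u))\<^sup>2 = u \<bullet> L2_restrict S u"
    by (simp add: power2_norm_eq_inner L2_restrict_sym L2_restrict_idem)
  also have "\<dots> \<le> norm u * norm (L2_restrict S u)" by (rule norm_cauchy_schwarz)
  finally show "norm (L2_restrict S u) \<le> norm u * 1"
    by (cases "L2_restrict S u = 0") (auto simp: power2_eq_square)
qed

end

subsection \<open>The coupled system\<close>

lemma matrix_vector_square_integrable:
  fixes M :: "real^'m^'n"
  assumes "f square_integrable_on S"
  shows "(\<lambda>x. M *v f x) square_integrable_on S"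
proof (rule square_integrable_on_bound)
  show "(\<lambda>x. onorm ((*v) M) *\<^sub>R f x) square_integrable_on S"
    by (rule square_integrable_on_scaleR[OF assms])
  have "continuous_on UNIV ((*v) M)" by (intro linear_continuous_on matrix_vector_mul_bounded_linear)
  then show "(\<lambda>x. M *v f x) \<in> borel_measurable (lebesgue_on S)"
    using assms borel_measurable_continuous_onI measurable_compose
    unfolding square_integrable_on_def by blast
  show "AE x in lebesgue_on S. norm (M *v f x) \<le> norm (onorm ((*v) M) *\<^sub>R f x)"
    using onorm[OF matrix_vector_mul_bounded_linear[of M]] onorm_pos_le[OF matrix_vector_mul_bounded_linear[of M]]
    by (intro AE_I2) simp
qed

lemma square_integrable_on_Pair:
  fixes f :: "'a::euclidean_space \<Rightarrow> 'b::{real_normed_vector, second_countable_topology}"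
    and g :: "'a \<Rightarrow> 'c::{real_normed_vector, second_countable_topology}"
  assumes "f square_integrable_on S" "g square_integrable_on S"
  shows "(\<lambda>x. (f x, g x)) square_integrable_on S"
  using assms by (auto simp: square_integrable_on_def norm_Pair intro: borel_measurable_Pair)

locale mqs_problem = nonlinear_reluctivity \<Omega> \<nu> L for \<Omega> \<nu> L +
  fixes \<Omega>C :: "(real^3) set" and \<sigma>C :: real and R :: "real^'m^'m"
    and X :: "real^3 \<Rightarrow> real^'m^3" and A\<^sub>0 :: "(real^3, real^3) L2"
  assumes conductor: "open \<Omega>C" "\<Omega>C \<subseteq> \<Omega>" and \<sigma>C: "0 < \<sigma>C" and R: "spd R"
    and winding: "\<And>j. (\<lambda>x. column j (X x)) square_integrable_on \<Omega>"
    and initial: "A\<^sub>0 \<in> X0_curl \<Omega> \<Omega>C"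
begin

abbreviation "P \<equiv> L2_restrict \<Omega>C"
abbreviation "S \<equiv> matrix_sqrt R"
abbreviation "Si \<equiv> matrix_inv (matrix_sqrt R)"

lemma conductor_lebesgue: "\<Omega>C \<in> sets lebesgue"
  using conductor by auto

lemmas P_sym = L2_restrict_sym[OF conductor_lebesgue]
lemmas P_idem = L2_restrict_idem[OF conductor_lebesgue]
lemmas P_linear = bounded_linear_L2_restrict[OF conductor_lebesgue]

lemma P_diff: "P (u - w) = P u - P w" for u w :: "(real^3, real^3) L2"
  using linear_diff[OF bounded_linear.linear[OF P_linear]] .

lemma P_scaleR: "P (r *\<^sub>R u) = r *\<^sub>R P u" for u :: "(real^3, real^3) L2"
  using linear_scale[OF bounded_linear.linear[OF P_linear]] .

lemma conductivity_L2: "L2_of \<Omega> (\<lambda>x. (\<sigma>C * indicator \<Omega>C x) *\<^sub>R rep_L2 u x) = \<sigma>C *\<^sub>R P u"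
  for u :: "(real^3, real^3) L2"
proof -
  have "(\<lambda>x. if x \<in> \<Omega> then (\<sigma>C * indicator \<Omega>C x) *\<^sub>R rep_L2 u x else 0)
    = (\<lambda>x. \<sigma>C *\<^sub>R (if x \<in> \<Omega>C then rep_L2 u x else 0))"
    using conductor(2) by (auto simp: indicator_def fun_eq_iff)
  then show ?thesis
    unfolding L2_restrict_def L2_of_def
    using abs_L2_scaleR[OF square_integrable_on_extend_zero[OF square_integrable_on_UNIV_subset[OF
          rep_L2_square_integrable conductor_lebesgue] conductor_lebesgue], of \<sigma>C u]
    by (simp only:)
qed

lemma conductivity_square_integrable: "(\<lambda>x. (\<sigma>C * indicator \<Omega>C x) *\<^sub>R rep_L2 u x) square_integrable_on \<Omega>"
  for u :: "(real^3, real^3) L2"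
proof (rule square_integrable_on_bound)
  show "(\<lambda>x. \<sigma>C *\<^sub>R rep_L2 u x) square_integrable_on \<Omega>"
    by (intro square_integrable_on_scaleR rep_square_integrable)
  have "rep_L2 u \<in> borel_measurable (lebesgue_on \<Omega>)"
    using rep_square_integrable[of u] by (simp add: square_integrable_on_def)
  moreover have "(\<lambda>x. \<sigma>C * indicat_real \<Omega>C x) \<in> borel_measurable (lebesgue_on \<Omega>)"
    using conductor_lebesgue by (intro borel_measurable_times measurable_restrict_space1 borel_measurable_indicator) auto
  ultimately show "(\<lambda>x. (\<sigma>C * indicator \<Omega>C x) *\<^sub>R rep_L2 u x) \<in> borel_measurable (lebesgue_on \<Omega>)"
    by (rule borel_measurable_scaleR[rotated])
  show "AE x in lebesgue_on \<Omega>. norm ((\<sigma>C * indicat_real \<Omega>C x) *\<^sub>R rep_L2 u x) \<le> norm (\<sigma>C *\<^sub>R rep_L2 u x)"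
    by (intro AE_I2) (auto simp: indicator_def)
qed

lemma current_density_square_integrable: "(\<lambda>x. X x *v c) square_integrable_on \<Omega>"
proof -
  have "(\<lambda>x. \<Sum>j\<in>J. c $ j *\<^sub>R column j (X x)) square_integrable_on \<Omega>" if "finite J" for J
    using that
  proof induction
    case empty
    show ?case by (simp add: square_integrable_on_def)
  next
    case (insert j J)
    then show ?case
      by (simp add: square_integrable_on_add square_integrable_on_scaleR winding)
  qed
  from this[OF finite] show ?thesis
    by (simp add: matrix_mult_sum scalar_mult_eq_scaleR)
qed

text \<open>The flux is the adjoint of the map from coil currents to current densities. The same
  pairing therefore appears in the field equation and in the circuit equation, which is what couples
  them.\<close>

lemma flux_inner: "c \<bullet> flux \<Omega> X u = u \<bullet> L2_of \<Omega> (\<lambda>x. X x *v c)"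
proof -
  have comp: "(transpose (X x) *v rep_L2 u x) $ j = column j (X x) \<bullet> rep_L2 u x" for x j
    by (simp add: matrix_vector_mult_def transpose_def column_def inner_vec_def)
  have int: "integrable (lebesgue_on \<Omega>) (\<lambda>x. column j (X x) \<bullet> rep_L2 u x)" for j
    by (intro square_integrable_on_inner winding rep_square_integrable)
  have eq: "transpose (X x) *v rep_L2 u x = (\<Sum>j\<in>UNIV. (column j (X x) \<bullet> rep_L2 u x) *\<^sub>R axis j 1)" for x
    unfolding vec_eq_iff comp by (simp add: axis_def if_distrib cong: if_cong)
  have i: "integrable (lebesgue_on \<Omega>) (\<lambda>x. transpose (X x) *v rep_L2 u x)"
    unfolding eq using int by (intro Bochner_Integration.integrable_sum integrable_scaleR_left) auto
  have "c \<bullet> flux \<Omega> X u = (LINT x|lebesgue_on \<Omega>. c \<bullet> (transpose (X x) *v rep_L2 u x))"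
    unfolding flux_def using i by (intro integral_inner_right[symmetric])
  also have "\<dots> = (LINT x|lebesgue_on \<Omega>. rep_L2 u x \<bullet> (X x *v c))"
  proof (rule Bochner_Integration.integral_cong)
    show "c \<bullet> (transpose (X x) *v rep_L2 u x) = rep_L2 u x \<bullet> (X x *v c)" for x
      by (metis dot_lmul_matrix inner_commute transpose_matrix_vector)
  qed simp
  also have "\<dots> = u \<bullet> L2_of \<Omega> (\<lambda>x. X x *v c)"
    by (rule inner_L2_of[OF current_density_square_integrable domain_lebesgue, symmetric])
  finally show ?thesis .
qed

lemma S_spd: "spd S" and S_square: "S ** S = R"
  using matrix_sqrt_works[OF R] by auto

lemma S_inverse: "Si *v (S *v x) = x" "S *v (Si *v x) = x"
  using spd_invertible[OF S_spd] by auto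

lemma S_inner: "(S *v x) \<bullet> (Si *v y) = x \<bullet> y"
proof -
  have "(S *v x) \<bullet> (Si *v y) = x \<bullet> (S *v (Si *v y))"
    using S_spd by (intro symmetric_matrix_inner[symmetric]) (simp add: spd_def)
  then show ?thesis by (simp add: S_inverse)
qed

lemma Si_R: "Si *v (R *v x) = S *v x"
proof -
  have "S *v (S *v x) = R *v x" by (simp only: matrix_vector_mul_assoc S_square)
  then show ?thesis by (metis S_inverse(1))
qed

lemma Si_inner: "(Si *v x) \<bullet> y = x \<bullet> (Si *v y)"
proof -
  have "(Si *v x) \<bullet> y = (Si *v x) \<bullet> (S *v (Si *v y))" by (simp add: S_inverse)
  also have "\<dots> = x \<bullet> (Si *v y)"
    using S_inner[of "Si *v y" x] by (simp add: inner_commute)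
  finally show ?thesis .
qed

text \<open>The solution is shown to satisfy the abstract subgradient inequality on
  \<open>[0, b]\<close>. The condition \<open>b < T\<close> leaves room to the right, because
  increments of weak derivatives are controlled strictly inside \<open>(0, T)\<close>.\<close>

theorem local_dissipation_estimate:
  assumes sol: "mqs_solution \<Omega> \<Omega>C (\<lambda>x. \<sigma>C * indicator \<Omega>C x) \<nu> R X A\<^sub>0 v T A i"
    and b: "0 < b" "b < T" and v: "v square_integrable_on {0..b}"
    and \<epsilon>: "0 < \<epsilon>" "\<epsilon> < 2" and \<delta>: "0 < \<delta>" "\<delta> < b"
  shows "(\<lambda>t. S *v i t) square_integrable_on {\<delta>..b}"
    "(1 - \<epsilon> / 2) * (LINT t|lebesgue_on {\<delta>..b}. (norm (S *v i t))\<^sup>2)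
      \<le> energy (wcurl \<Omega> A\<^sub>0) + (LINT t|lebesgue_on {0..b}. (norm (Si *v v t))\<^sup>2) / (2 * \<epsilon>)"
proof -
  let ?\<sigma> = "\<lambda>x. \<sigma>C * indicat_real \<Omega>C x"
  obtain w where wc: "continuous_on {0..T} w" and wH1: "H1_loc T (X_space \<Omega> \<Omega>C) w"
    and wA: "AE t in lebesgue_on {0..T}. w t = L2_of \<Omega> (\<lambda>x. ?\<sigma> x *\<^sub>R rep_L2 (A t) x)"
    and w0: "w 0 = L2_of \<Omega> (\<lambda>x. ?\<sigma> x *\<^sub>R rep_L2 A\<^sub>0 x)"
    using sol unfolding mqs_solution_def by blast
  obtain y where yc: "continuous_on {0..T} y"
    and yA: "AE t in lebesgue_on {0..T}. y t = flux \<Omega> X (A t)" and y0: "y 0 = flux \<Omega> X A\<^sub>0"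
    using sol unfolding mqs_solution_def by blast
  have AX: "AE t in lebesgue_on {0..T}. A t \<in> X0_curl \<Omega> \<Omega>C"
    and Asq: "(\<lambda>t. (A t, wcurl \<Omega> (A t))) square_integrable_on {0..T}"
    and iloc: "L2_loc T i"
    using sol unfolding mqs_solution_def by blast+
  have test: "\<exists>d. has_weak_derivative (\<lambda>t. LINT x|lebesgue_on \<Omega>. (?\<sigma> x *\<^sub>R rep_L2 (A t) x) \<bullet> rep_L2 F x) d T \<and>
      (AE t in lebesgue_on {0..T}.
        d t + (LINT x|lebesgue_on \<Omega>. (\<nu> x (norm (rep_L2 (wcurl \<Omega> (A t)) x)) *\<^sub>R rep_L2 (wcurl \<Omega> (A t)) x)
                  \<bullet> rep_L2 (wcurl \<Omega> F) x) = (LINT x|lebesgue_on \<Omega>. (X x *v i t) \<bullet> rep_L2 F x))"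
    if "F \<in> X0_curl \<Omega> \<Omega>C" for F
    using sol that unfolding mqs_solution_def by blast
  obtain dy where dy: "has_weak_derivative (\<lambda>t. flux \<Omega> X (A t)) dy T"
    and Rv: "AE t in lebesgue_on {0..T}. dy t + R *v i t = v t"
    using sol unfolding mqs_solution_def by blast
  obtain dw where dw: "has_weak_derivative w dw T" and dwloc: "L2_loc T dw"
    using wH1 unfolding H1_loc_def by blast
  have on_T: "AE t in lebesgue. t \<in> {0..T} \<longrightarrow> Q t" if "AE t in lebesgue_on {0..T}. Q t" for Q :: "real \<Rightarrow> bool"
    using that by (subst (asm) AE_restrict_space_iff) auto
  define H where "H t = L2_of \<Omega> (H_field (wcurl \<Omega> (A t)))" for t
  define J where "J t = L2_of \<Omega> (\<lambda>x. X x *v i t)" for t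
  have curlL: "AE t in lebesgue. t \<in> {0..T} \<longrightarrow> w t = \<sigma>C *\<^sub>R P (A t)"
    using on_T[OF wA] by (simp add: conductivity_L2)
  have Pw_cont: "continuous_on {0..T} (\<lambda>t. P (w t))"
    by (rule bounded_linear.continuous_on[OF P_linear wc])
  have P_increment: "integrable (lebesgue_on {s..t}) (\<lambda>r. F \<bullet> P (dw r))"
    "F \<bullet> (P (w t) - P (w s)) = (LINT r|lebesgue_on {s..t}. F \<bullet> P (dw r))"
    if "0 < s" "s \<le> t" "t < T" for F s t
  proof -
    have c: "continuous_on {0..T} (\<lambda>t. P F \<bullet> w t)" by (intro continuous_intros wc)
    have "AE r in lebesgue. 0 < r \<and> r < T \<longrightarrow> P F \<bullet> w r = P F \<bullet> w r" by simp
    note * = weak_derivative_increment_continuous[OF has_weak_derivative_inner[OF dw] c this that]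
    from *(1) show "integrable (lebesgue_on {s..t}) (\<lambda>r. F \<bullet> P (dw r))" by (simp add: P_sym)
    from *(2) show "F \<bullet> (P (w t) - P (w s)) = (LINT r|lebesgue_on {s..t}. F \<bullet> P (dw r))"
      by (simp add: P_sym inner_diff_right)
  qed
  have y_increment: "integrable (lebesgue_on {s..t}) (\<lambda>r. c \<bullet> dy r)"
    "c \<bullet> (y t - y s) = (LINT r|lebesgue_on {s..t}. c \<bullet> dy r)"
    if "0 < s" "s \<le> t" "t < T" for c s t
  proof -
    have c: "continuous_on {0..T} (\<lambda>t. c \<bullet> y t)" by (intro continuous_intros yc)
    have "AE r in lebesgue. 0 < r \<and> r < T \<longrightarrow> c \<bullet> flux \<Omega> X (A r) = c \<bullet> y r"
      using on_T[OF yA] by eventually_elim auto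
    note * = weak_derivative_increment_continuous[OF has_weak_derivative_inner[OF dy] c this that]
    show "integrable (lebesgue_on {s..t}) (\<lambda>r. c \<bullet> dy r)" by (rule *(1))
    show "c \<bullet> (y t - y s) = (LINT r|lebesgue_on {s..t}. c \<bullet> dy r)" using *(2) by (simp add: inner_diff_right)
  qed
  have weak_F: "AE t in lebesgue. 0 < t \<and> t < T \<longrightarrow> P (dw t) \<bullet> F + H t \<bullet> wcurl \<Omega> F = J t \<bullet> F"
    if F: "F \<in> X0_curl \<Omega> \<Omega>C" for F
  proof -
    obtain d where d: "has_weak_derivative (\<lambda>t. LINT x|lebesgue_on \<Omega>. (?\<sigma> x *\<^sub>R rep_L2 (A t) x) \<bullet> rep_L2 F x) d T"
      and deq: "AE t in lebesgue_on {0..T}.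
        d t + (LINT x|lebesgue_on \<Omega>. (\<nu> x (norm (rep_L2 (wcurl \<Omega> (A t)) x)) *\<^sub>R rep_L2 (wcurl \<Omega> (A t)) x)
                  \<bullet> rep_L2 (wcurl \<Omega> F) x) = (LINT x|lebesgue_on \<Omega>. (X x *v i t) \<bullet> rep_L2 F x)"
      using test[OF F] by blast
    have sA: "(LINT x|lebesgue_on \<Omega>. (?\<sigma> x *\<^sub>R rep_L2 u x) \<bullet> rep_L2 F x) = F \<bullet> (\<sigma>C *\<^sub>R P u)" for u
      using inner_L2_of[OF conductivity_square_integrable domain_lebesgue, of F u]
      unfolding conductivity_L2 by (simp only: inner_commute)
    have uv: "AE r in lebesgue. 0 < r \<and> r < T \<longrightarrow>
      (LINT x|lebesgue_on \<Omega>. (?\<sigma> x *\<^sub>R rep_L2 (A r) x) \<bullet> rep_L2 F x) = F \<bullet> P (w r)"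
      using curlL by eventually_elim (simp only: sA, simp add: P_scaleR P_idem)
    have c: "continuous_on {0..T} (\<lambda>t. F \<bullet> P (w t))" by (intro continuous_intros Pw_cont)
    note d_inc = weak_derivative_increment_continuous[OF d c uv]
    \<comment> \<open>The derivative in the weak equation is given separately for each
      \<open>F\<close>. It has the same increments on all intervals as
      \<open>F \<bullet> P (dw t)\<close>, which ties it to the one vector valued derivative
      \<open>dw\<close>.\<close>
    have "AE t in lebesgue. 0 < t \<and> t < T \<longrightarrow> d t - F \<bullet> P (dw t) = 0"
    proof (rule AE_zero_if_interval_integrals_zero)
      fix s t assume st: "0 < s" "s \<le> t" "t < T"
      show "integrable (lebesgue_on {s..t}) (\<lambda>t. d t - F \<bullet> P (dw t))"
        by (intro Bochner_Integration.integrable_diff d_inc(1) P_increment(1) st)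
      show "(LINT r|lebesgue_on {s..t}. d r - F \<bullet> P (dw r)) = 0"
        using d_inc[OF st] P_increment[OF st, of F] by (simp add: inner_diff_right)
    qed
    then show ?thesis
      using on_T[OF deq]
    proof eventually_elim
      case (elim t)
      show ?case
      proof
        assume t: "0 < t \<and> t < T"
        have "H t \<bullet> wcurl \<Omega> F = (LINT x|lebesgue_on \<Omega>. (\<nu> x (norm (rep_L2 (wcurl \<Omega> (A t)) x)) *\<^sub>R rep_L2 (wcurl \<Omega> (A t)) x)
                  \<bullet> rep_L2 (wcurl \<Omega> F) x)"
          using inner_L2_of[OF H_field_square_integrable domain_lebesgue, of "wcurl \<Omega> F" "wcurl \<Omega> (A t)"]
          by (simp add: H_def H_field_def inner_commute)
        moreover have "J t \<bullet> F = (LINT x|lebesgue_on \<Omega>. (X x *v i t) \<bullet> rep_L2 F x)"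
          using inner_L2_of[OF current_density_square_integrable domain_lebesgue, of F "i t"]
          by (simp add: J_def inner_commute)
        ultimately show "P (dw t) \<bullet> F + H t \<bullet> wcurl \<Omega> F = J t \<bullet> F"
          using elim t by (simp add: inner_commute)
      qed
    qed
  qed
  text \<open>Separability of the test space makes the exceptional null set independent of the test function.\<close>
  have weak_all: "AE t in lebesgue. 0 < t \<and> t < T \<longrightarrow>
    (\<forall>F\<in>X0_curl \<Omega> \<Omega>C. P (dw t) \<bullet> F + H t \<bullet> wcurl \<Omega> F = J t \<bullet> F)"
  proof -
    \<comment> \<open>Recording the curl along with \<open>F\<close> makes density refer to the
      graph norm, in which every term of the equation is continuous.\<close>
    define Q where "Q = (\<lambda>F. (F, wcurl \<Omega> F)) ` X0_curl \<Omega> \<Omega>C"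
    obtain D where D: "countable D" "D \<subseteq> Q" "Q \<subseteq> closure D" using separable[of Q] by metis
    have "AE t in lebesgue. \<forall>q\<in>D. 0 < t \<and> t < T \<longrightarrow> P (dw t) \<bullet> fst q + H t \<bullet> snd q = J t \<bullet> fst q"
    proof (rule AE_ball_countable[THEN iffD2, OF D(1)], rule ballI)
      fix q assume "q \<in> D"
      then obtain F where "F \<in> X0_curl \<Omega> \<Omega>C" "q = (F, wcurl \<Omega> F)" using D(2) by (auto simp: Q_def)
      then show "AE t in lebesgue. 0 < t \<and> t < T \<longrightarrow> P (dw t) \<bullet> fst q + H t \<bullet> snd q = J t \<bullet> fst q"
        using weak_F[of F] by simp
    qed
    then show ?thesis
    proof eventually_elim
      case (elim t)
      show ?case
      proof (intro impI ballI)
        fix F assume t: "0 < t \<and> t < T" and F: "F \<in> X0_curl \<Omega> \<Omega>C"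
        let ?Z = "{q. P (dw t) \<bullet> fst q + H t \<bullet> snd q = J t \<bullet> fst q}"
        have "closed ?Z" by (intro closed_Collect_eq continuous_intros)
        moreover have "D \<subseteq> ?Z" using elim t by auto
        ultimately have "closure D \<subseteq> ?Z" by (intro closure_minimal)
        moreover have "(F, wcurl \<Omega> F) \<in> Q" using F by (simp add: Q_def)
        ultimately have "(F, wcurl \<Omega> F) \<in> ?Z" using D(3) by blast
        then show "P (dw t) \<bullet> F + H t \<bullet> wcurl \<Omega> F = J t \<bullet> F" by simp
      qed
    qed
  qed
  define good where "good t \<longleftrightarrow> w t = \<sigma>C *\<^sub>R P (A t) \<and> y t = flux \<Omega> X (A t) \<and> A t \<in> X0_curl \<Omega> \<Omega>C \<and>
    dy t + R *v i t = v t \<and> (\<forall>F\<in>X0_curl \<Omega> \<Omega>C. P (dw t) \<bullet> F + H t \<bullet> wcurl \<Omega> F = J t \<bullet> F)" for t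
  have "AE t in lebesgue. t \<noteq> 0" using AE_lborel_singleton[of 0] by (rule AE_completion)
  then have AEgood: "AE t in lebesgue. t \<in> {0..b} \<longrightarrow> good t"
    using curlL on_T[OF yA] on_T[OF AX] on_T[OF Rv] weak_all
    by eventually_elim (use b in \<open>auto simp: good_def\<close>)
  then obtain N where N: "N \<in> null_sets lebesgue" "{t. \<not> (t \<in> {0..b} \<longrightarrow> good t)} \<subseteq> N"
    by (auto simp: eventually_ae_filter)
  \<comment> \<open>Since \<open>w\<close> equals \<open>\<sigma>C *\<^sub>R P (A t)\<close>, the
    factor \<open>k * k = 1 / \<sigma>C\<close> turns the pairing of \<open>P (dw t)\<close> with an
    increment of \<open>P w\<close> into its pairing with the increment of \<open>A\<close>.\<close>
  define k where "k = 1 / sqrt \<sigma>C"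
  have k2: "k * k = 1 / \<sigma>C" using \<sigma>C by (simp add: k_def)
  \<comment> \<open>The projection leaves \<open>w\<close> unchanged almost everywhere. Applied to
    \<open>dw\<close> as well, it confines the derivative to the conductor by construction instead
    of through a property of weak derivatives.\<close>
  define u where "u t = (k *\<^sub>R P (w t), Si *v y t)" for t
  define g where "g t = (k *\<^sub>R P (dw t), Si *v dy t)" for t
  define f where "f t = (0 :: (real^3, real^3) L2, Si *v v t)" for t
  define p where "p t = f t - g t" for t
  define e where "e t = energy (wcurl \<Omega> (A t))" for t
  have p_good: "p t = (- (k *\<^sub>R P (dw t)), S *v i t)" if "good t" for t
  proof -
    have "Si *v v t - Si *v dy t = Si *v (R *v i t)"
      using that by (simp add: good_def matrix_vector_mult_diff_distrib[symmetric] eq_diff_eq[symmetric] diff_eq_eq add.commute)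
    then show ?thesis by (simp add: p_def f_def g_def Si_R)
  qed
  \<comment> \<open>Convexity of the energy at \<open>A t\<close> bounds the energy of a competitor
    \<open>B\<close> from below, and the weak equation tested with \<open>B - A t\<close> evaluates
    the linear term. The competitor will be the state at another good time or the initial
    state.\<close>
  have ineq: "e t - energy (wcurl \<Omega> B) \<le> p t \<bullet> (u t - (k *\<^sub>R P z, Si *v flux \<Omega> X B))"
    if t: "good t" and B: "B \<in> X0_curl \<Omega> \<Omega>C" and z: "z = \<sigma>C *\<^sub>R P B" for t B z
  proof -
    have At: "A t \<in> X0_curl \<Omega> \<Omega>C" "y t = flux \<Omega> X (A t)" "w t = \<sigma>C *\<^sub>R P (A t)" using t by (auto simp: good_def)
    have curl: "wcurl \<Omega> (B - A t) = wcurl \<Omega> B - wcurl \<Omega> (A t)"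
      by (intro wcurl_diff X0_curl_H_curl[OF B] X0_curl_H_curl[OF At(1)])
    have "H t \<bullet> (wcurl \<Omega> B - wcurl \<Omega> (A t)) \<le> energy (wcurl \<Omega> B) - e t"
      unfolding H_def e_def by (rule energy_subgradient)
    moreover have "P (dw t) \<bullet> (B - A t) + H t \<bullet> (wcurl \<Omega> B - wcurl \<Omega> (A t)) = J t \<bullet> (B - A t)"
      using t X0_curl_diff[OF B At(1)] unfolding good_def curl[symmetric] by blast
    moreover have "J t \<bullet> (B - A t) = i t \<bullet> (flux \<Omega> X B - y t)"
      using flux_inner[of "i t" B] flux_inner[of "i t" "A t"] At(2)
      by (simp add: J_def inner_diff_right inner_commute[of "L2_of _ _"] inner_diff_left)
    moreover have "P (dw t) \<bullet> (B - A t) = k * k * (P (dw t) \<bullet> (P z - P (w t)))"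
    proof -
      have "P (dw t) \<bullet> (B - A t) = P (dw t) \<bullet> P (B - A t)"
        using P_sym[of "P (dw t)" "B - A t"] by (simp add: P_idem)
      moreover have "P z - P (w t) = \<sigma>C *\<^sub>R P (B - A t)"
        by (simp add: z At(3) P_scaleR P_idem P_diff scaleR_diff_right)
      ultimately show ?thesis using \<sigma>C k2 by simp
    qed
    moreover have "p t \<bullet> (u t - (k *\<^sub>R P z, Si *v flux \<Omega> X B))
      = k * k * (P (dw t) \<bullet> (P z - P (w t))) - i t \<bullet> (flux \<Omega> X B - y t)"
    proof -
      have "(S *v i t) \<bullet> (Si *v y t - Si *v flux \<Omega> X B) = i t \<bullet> (y t - flux \<Omega> X B)"
        using S_inner[of "i t" "y t - flux \<Omega> X B"] by (simp add: matrix_vector_mult_diff_distrib)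
      then show ?thesis
        unfolding p_good[OF t] u_def by (simp add: inner_Pair inner_diff_right algebra_simps)
    qed
    ultimately show ?thesis by linarith
  qed
  have vb: "f square_integrable_on {0..b}"
    unfolding f_def
    by (intro square_integrable_on_Pair square_integrable_on_continuous matrix_vector_square_integrable v continuous_intros)
  have sub: "{c..b} \<subseteq> {c..T}" for c using b by auto
  have i_sq: "i square_integrable_on {c..b}" if "0 < c" "c < b" for c
    using iloc that b by (intro square_integrable_on_subset[OF _ sub]) (auto simp: L2_loc_def)
  have ug: "H1_primitive c b u g" if c: "0 < c" "c < b" for c
    unfolding H1_primitive_def
  proof (intro conjI allI impI)
    have "continuous_on {0..T} u"
      unfolding u_def by (intro continuous_intros Pw_cont
          bounded_linear.continuous_on[OF matrix_vector_mul_bounded_linear yc])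
    then show "continuous_on {c..b} u" by (rule continuous_on_subset) (use c b in auto)
    have Pdw: "(\<lambda>t. k *\<^sub>R P (dw t)) square_integrable_on {c..b}"
    proof -
      have dws: "dw square_integrable_on {c..b}"
        using dwloc c b by (intro square_integrable_on_subset[OF _ sub]) (auto simp: L2_loc_def)
      have "continuous_on UNIV (P :: (real^3, real^3) L2 \<Rightarrow> _)"
        by (intro linear_continuous_on P_linear)
      then have m: "(\<lambda>t. P (dw t)) \<in> borel_measurable (lebesgue_on {c..b})"
        using dws borel_measurable_continuous_onI measurable_compose
        unfolding square_integrable_on_def by blast
      obtain K where K: "0 \<le> K" "\<And>x :: (real^3, real^3) L2. norm (P x) \<le> norm x * K"
        using bounded_linear.nonneg_bounded[OF P_linear] by blast
      have "norm (P x) \<le> norm (K *\<^sub>R x)" for x :: "(real^3, real^3) L2"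
        using K(1) K(2)[of x] by (simp add: mult.commute)
      then show ?thesis
        by (intro square_integrable_on_scaleR
            square_integrable_on_bound[OF square_integrable_on_scaleR[OF dws] m] AE_I2)
    qed
    \<comment> \<open>Square integrability of the flux derivative is read off the circuit equation
      \<open>dy = v - R i\<close>, whose right-hand side is square integrable away from time
      0.\<close>
    have dy_sq: "dy square_integrable_on {c..b}"
    proof (rule square_integrable_on_bound)
      show "(\<lambda>t. v t - R *v i t) square_integrable_on {c..b}"
        using c by (intro square_integrable_on_diff square_integrable_on_subset[OF v]
          matrix_vector_square_integrable i_sq) auto
      have "integrable (lebesgue_on {c..b}) dy" using dy c b by (auto simp: has_weak_derivative_def)
      then show "dy \<in> borel_measurable (lebesgue_on {c..b})" by auto
      have "AE x in lebesgue. x \<in> {c..b} \<longrightarrow> norm (dy x) \<le> norm (v x - R *v i x)"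
        using AEgood
      proof eventually_elim
        case (elim x)
        show ?case
        proof
          assume "x \<in> {c..b}"
          then have "dy x + R *v i x = v x" using elim c by (auto simp: good_def)
          then have "dy x = v x - R *v i x" by (simp add: algebra_simps)
          then show "norm (dy x) \<le> norm (v x - R *v i x)" by simp
        qed
      qed
      then show "AE x in lebesgue_on {c..b}. norm (dy x) \<le> norm (v x - R *v i x)"
        by (subst AE_restrict_space_iff) auto
    qed
    show "g square_integrable_on {c..b}"
      unfolding g_def by (rule square_integrable_on_Pair[OF Pdw matrix_vector_square_integrable[OF dy_sq]])
    fix q :: "(real^3, real^3) L2 \<times> (real^'m)" and s t assume st: "c \<le> s" "s \<le> t" "t \<le> b"
    then have st': "0 < s" "s \<le> t" "t < T" using c b by auto
    have "q \<bullet> (u t - u s) = (k *\<^sub>R fst q) \<bullet> (P (w t) - P (w s)) + (Si *v snd q) \<bullet> (y t - y s)"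
      by (cases q) (simp add: u_def inner_Pair Si_inner matrix_vector_mult_diff_distrib inner_diff_right right_diff_distrib)
    also have "\<dots> = (LINT r|lebesgue_on {s..t}. (k *\<^sub>R fst q) \<bullet> P (dw r)) + (LINT r|lebesgue_on {s..t}. (Si *v snd q) \<bullet> dy r)"
      by (simp only: P_increment(2)[OF st'] y_increment(2)[OF st'])
    also have "\<dots> = (LINT r|lebesgue_on {s..t}. (k *\<^sub>R fst q) \<bullet> P (dw r) + (Si *v snd q) \<bullet> dy r)"
      by (intro Bochner_Integration.integral_add[symmetric] P_increment(1)[OF st'] y_increment(1)[OF st'])
    also have "\<dots> = (LINT r|lebesgue_on {s..t}. q \<bullet> g r)"
      by (intro Bochner_Integration.integral_cong refl) (cases q, simp add: g_def inner_Pair Si_inner)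
    finally show "q \<bullet> (u t - u s) = (LINT r|lebesgue_on {s..t}. q \<bullet> g r)" .
  qed
  have e_int: "integrable (lebesgue_on {0..b}) e"
  proof -
    have sq: "(\<lambda>t. (A t, wcurl \<Omega> (A t))) square_integrable_on {0..b}"
      using b by (intro square_integrable_on_subset[OF Asq]) auto
    show ?thesis
    proof (rule Bochner_Integration.integrable_bound)
      show "integrable (lebesgue_on {0..b}) (\<lambda>t. L / 2 * (norm (A t, wcurl \<Omega> (A t)))\<^sup>2)"
        using sq by (simp add: square_integrable_on_def)
      have "continuous_on UNIV (\<lambda>q :: (real^3, real^3) L2 \<times> (real^3, real^3) L2. energy (snd q))"
        by (intro continuous_on_compose2[OF energy_continuous] continuous_intros) auto
      from measurable_compose[OF conjunct1[OF sq[unfolded square_integrable_on_def]] borel_measurable_continuous_onI[OF this]]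
      show "e \<in> borel_measurable (lebesgue_on {0..b})" by (simp add: e_def[abs_def])
      show "AE t in lebesgue_on {0..b}. norm (e t) \<le> norm (L / 2 * (norm (A t, wcurl \<Omega> (A t)))\<^sup>2)"
      proof (rule AE_I2)
        fix t
        have "e t \<le> L / 2 * (norm (wcurl \<Omega> (A t)))\<^sup>2" unfolding e_def by (rule energy_le)
        also have "\<dots> \<le> L / 2 * (norm (A t, wcurl \<Omega> (A t)))\<^sup>2"
          using L by (intro mult_left_mono) (auto simp: norm_Pair)
        finally show "norm (e t) \<le> norm (L / 2 * (norm (A t, wcurl \<Omega> (A t)))\<^sup>2)"
          using energy_nonneg[of "wcurl \<Omega> (A t)"] by (simp add: e_def)
      qed
    qed
  qed
  interpret subgradient_inequality u g p f e "energy (wcurl \<Omega> A\<^sub>0)" b N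
  proof
    show "continuous_on {0..b} u"
      unfolding u_def using b
      by (intro continuous_intros continuous_on_subset[OF Pw_cont]
          bounded_linear.continuous_on[OF matrix_vector_mul_bounded_linear] continuous_on_subset[OF yc]) auto
    fix s t assume "s \<in> {0..b} - N" "t \<in> {0..b} - N"
    then have st: "good s" "good t" using N(2) by auto
    have "u s = (k *\<^sub>R P (w s), Si *v flux \<Omega> X (A s))" using st by (simp add: u_def good_def)
    then show "e t - e s \<le> p t \<bullet> (u t - u s)"
      using ineq[OF st(2), of "A s" "w s"] st(1) by (simp add: good_def e_def)
  next
    fix t assume "t \<in> {0..b} - N"
    then have t: "good t" using N(2) by auto
    \<comment> \<open>The continuous representatives attain the initial data, so
      \<open>A\<^sub>0\<close> enters as a competitor through the same formula as a state at a later
      time.\<close>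
    have "u 0 = (k *\<^sub>R P (w 0), Si *v flux \<Omega> X A\<^sub>0)" by (simp add: u_def y0)
    then show "e t - energy (wcurl \<Omega> A\<^sub>0) \<le> p t \<bullet> (u t - u 0)"
      using ineq[OF t initial, of "w 0"] by (simp add: w0 conductivity_L2)
  qed (use b ug vb e_int N(1) energy_nonneg in \<open>auto simp: p_def e_def\<close>)
  have Si_sq: "(\<lambda>t. S *v i t) square_integrable_on {\<delta>..b}"
    by (intro matrix_vector_square_integrable i_sq \<delta>)
  then show "(\<lambda>t. S *v i t) square_integrable_on {\<delta>..b}" .
  have psq: "p square_integrable_on {\<delta>..b}" using \<delta> by (intro p_subset) auto
  \<comment> \<open>Only the second component of \<open>p\<close> is kept; the first one, the eddy
    current loss in the conductor, is dropped.\<close>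
  have "(LINT t|lebesgue_on {\<delta>..b}. (norm (S *v i t))\<^sup>2) \<le> (LINT t|lebesgue_on {\<delta>..b}. (norm (p t))\<^sup>2)"
  proof (rule integral_mono_AE)
    have "AE t in lebesgue. t \<in> {\<delta>..b} \<longrightarrow> (norm (S *v i t))\<^sup>2 \<le> (norm (p t))\<^sup>2"
      using AEgood by eventually_elim (use \<delta> in \<open>auto simp: p_good norm_Pair\<close>)
    then show "AE t in lebesgue_on {\<delta>..b}. (norm (S *v i t))\<^sup>2 \<le> (norm (p t))\<^sup>2"
      by (subst AE_restrict_space_iff) auto
  qed (use Si_sq psq in \<open>auto simp: square_integrable_on_def\<close>)
  then have "(1 - \<epsilon> / 2) * (LINT t|lebesgue_on {\<delta>..b}. (norm (S *v i t))\<^sup>2)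
    \<le> (1 - \<epsilon> / 2) * (LINT t|lebesgue_on {\<delta>..b}. (norm (p t))\<^sup>2)"
    using \<epsilon> by (intro mult_left_mono) auto
  also have "\<dots> \<le> energy (wcurl \<Omega> A\<^sub>0) + (LINT t|lebesgue_on {0..b}. (norm (f t))\<^sup>2) / (2 * \<epsilon>)"
    by (rule dissipation_estimate[OF \<epsilon> \<delta>])
  finally show "(1 - \<epsilon> / 2) * (LINT t|lebesgue_on {\<delta>..b}. (norm (S *v i t))\<^sup>2)
      \<le> energy (wcurl \<Omega> A\<^sub>0) + (LINT t|lebesgue_on {0..b}. (norm (Si *v v t))\<^sup>2) / (2 * \<epsilon>)"
    by (simp add: f_def norm_Pair)
qed

end

section \<open>From compact time intervals to the whole half-open interval\<close>

lemma square_integrable_on_exhaustion: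
  fixes f :: "'a::euclidean_space \<Rightarrow> 'b::euclidean_space"
  assumes A: "incseq A" "\<And>n. A n \<in> sets lebesgue" and f: "\<And>n. f square_integrable_on A n"
    and K: "\<And>n. (LINT x|lebesgue_on (A n). (norm (f x))\<^sup>2) \<le> K"
  shows "f square_integrable_on (\<Union>n. A n)" "(LINT x|lebesgue_on (\<Union>n. A n). (norm (f x))\<^sup>2) \<le> K"
proof -
  have U: "(\<Union>n. A n) \<in> sets lebesgue" using A(2) by blast
  have ev: "\<forall>\<^sub>F n in sequentially. x \<in> A n \<longleftrightarrow> x \<in> (\<Union>n. A n)" for x
  proof (cases "\<exists>m. x \<in> A m")
    case True
    then obtain m where "x \<in> A m" by blast
    then show ?thesis
      using incseqD[OF A(1)] by (intro eventually_sequentiallyI[of m]) blast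
  qed simp
  have "(\<lambda>x. if x \<in> (\<Union>n. A n) then f x else 0) \<in> borel_measurable lebesgue"
  proof (rule borel_measurable_LIMSEQ_metric)
    show "(\<lambda>x. if x \<in> A n then f x else 0) \<in> borel_measurable lebesgue" for n
      using f[of n] A(2)[of n] by (simp add: square_integrable_on_def borel_measurable_if)
    show "(\<lambda>n. if x \<in> A n then f x else 0) \<longlonglongrightarrow> (if x \<in> (\<Union>n. A n) then f x else 0)" for x
      by (rule tendsto_eventually) (use ev[of x] in eventually_elim, auto)
  qed
  then have fm: "f \<in> borel_measurable (lebesgue_on (\<Union>n. A n))"
    using U by (simp only: borel_measurable_if)
  define h where "h n x = indicator (A n) x * (norm (f x))\<^sup>2" for n x
  define hU where "hU x = indicator (\<Union>n. A n) x * (norm (f x))\<^sup>2" for x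
  have hi: "integrable lebesgue (h n)" for n
    using f[of n] A(2)[of n] by (simp add: square_integrable_on_def integrable_restrict_space h_def[abs_def])
  have hint: "(LINT x|lebesgue. h n x) = (LINT x|lebesgue_on (A n). (norm (f x))\<^sup>2)" for n
    using A(2)[of n] by (simp add: integral_restrict_space h_def)
  have mono: "incseq (\<lambda>n. h n x)" for x
    using A(1) by (intro incseq_SucI) (auto simp: h_def indicator_def dest: incseq_SucD)
  have "incseq (\<lambda>n. LINT x|lebesgue. h n x)"
    using mono by (intro incseq_SucI integral_mono hi) (auto dest: incseq_SucD)
  then obtain l where l: "(\<lambda>n. LINT x|lebesgue. h n x) \<longlonglongrightarrow> l" "l \<le> K"
    using incseq_convergent[of "\<lambda>n. LINT x|lebesgue. h n x" K] K
    by (metis hint LIMSEQ_le_const2)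
  have lim: "(\<lambda>n. h n x) \<longlonglongrightarrow> hU x" for x
    by (rule tendsto_eventually) (use ev[of x] in eventually_elim, auto simp: h_def hU_def indicator_def)
  have hUm: "hU \<in> borel_measurable lebesgue"
    using hi by (intro borel_measurable_LIMSEQ_real[OF lim]) auto
  have *: "AE x in lebesgue. mono (\<lambda>n. h n x)" "AE x in lebesgue. (\<lambda>n. h n x) \<longlonglongrightarrow> hU x"
    using mono lim by (auto simp: incseq_def mono_def)
  have hUi: "integrable lebesgue hU" by (rule integrable_monotone_convergence[OF hi * l(1) hUm])
  have hUl: "(LINT x|lebesgue. hU x) = l" by (rule integral_monotone_convergence[OF hi * l(1) hUm])
  show "f square_integrable_on (\<Union>n. A n)"
    using fm hUi U by (simp add: square_integrable_on_def integrable_restrict_space hU_def[abs_def])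
  show "(LINT x|lebesgue_on (\<Union>n. A n). (norm (f x))\<^sup>2) \<le> K"
    using hUl l(2) U by (simp add: integral_restrict_space hU_def)
qed

text \<open>The local estimate starts at positive times, so the exhausting intervals miss time 0;
  this null set is put back here.\<close>

lemma square_integrable_on_insert:
  fixes f :: "'a::euclidean_space \<Rightarrow> 'b::euclidean_space"
  assumes f: "f square_integrable_on S" and S: "S \<in> sets lebesgue"
  shows "f square_integrable_on (insert a S)"
    "(LINT x|lebesgue_on (insert a S). (norm (f x))\<^sup>2) = (LINT x|lebesgue_on S. (norm (f x))\<^sup>2)"
proof -
  have T: "insert a S \<in> sets lebesgue" using sets.Un[of "{a}" lebesgue S] S by simp
  have ae: "AE x in lebesgue. x \<noteq> a" using AE_lborel_singleton[of a] by (rule AE_completion)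
  have "(\<lambda>x. if x \<in> S then f x else 0) \<in> borel_measurable lebesgue"
    using f S by (simp add: square_integrable_on_def borel_measurable_if)
  moreover have "AE x in lebesgue. (if x \<in> S then f x else 0) = (if x \<in> insert a S then f x else 0)"
    using ae by eventually_elim auto
  ultimately have "(\<lambda>x. if x \<in> insert a S then f x else 0) \<in> borel_measurable lebesgue"
    by (rule borel_measurable_AE)
  then have fm: "f \<in> borel_measurable (lebesgue_on (insert a S))" using T by (simp only: borel_measurable_if)
  define h where "h x = indicat_real S x * (norm (f x))\<^sup>2" for x
  define h' where "h' x = indicat_real (insert a S) x * (norm (f x))\<^sup>2" for x
  have hi: "integrable lebesgue h"
    using f S by (simp add: square_integrable_on_def integrable_restrict_space h_def[abs_def])
  have hh: "AE x in lebesgue. h x = h' x"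
    using ae by eventually_elim (simp add: h_def h'_def indicator_def)
  have hm: "h \<in> borel_measurable lebesgue" using hi by auto
  have hm': "h' \<in> borel_measurable lebesgue" using hm hh by (rule borel_measurable_AE)
  have "integrable lebesgue h'" using hi hm hm' hh by (subst (asm) integrable_cong_AE[of _ _ h']) auto
  then show "f square_integrable_on (insert a S)"
    using fm T by (simp add: square_integrable_on_def integrable_restrict_space h'_def[abs_def])
  have "(LINT x|lebesgue. h' x) = (LINT x|lebesgue. h x)"
    using hm hm' hh by (intro integral_cong_AE) (auto elim: eventually_mono)
  then show "(LINT x|lebesgue_on (insert a S). (norm (f x))\<^sup>2) = (LINT x|lebesgue_on S. (norm (f x))\<^sup>2)"
    using S T by (simp add: integral_restrict_space h_def h'_def)
qed

lemma Ico_exhaustion: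
  assumes "0 < T"
  obtains l r :: "nat \<Rightarrow> real" where "incseq (\<lambda>n. {l n..r n})" "Ico T = insert 0 (\<Union>n. {l n..r n})"
    "\<And>n. 0 < l n" "\<And>n. l n < r n" "\<And>n. ereal (r n) < T"
proof (rule einterval_Icc_approximation[OF assms])
  fix r l :: "nat \<Rightarrow> real"
  assume rl: "einterval 0 T = (\<Union>i. {l i..r i})" "incseq r" "decseq l"
    "\<And>i. l i < r i" "\<And>i. 0 < ereal (l i)" "\<And>i. ereal (r i) < T"
  have "Ico T = insert 0 (einterval 0 T)"
    using assms by (auto simp: Ico_def einterval_def zero_ereal_def)
  moreover have "{l n..r n} \<subseteq> {l (Suc n)..r (Suc n)}" for n
    using incseq_SucD[OF rl(2), of n] decseq_SucD[OF rl(3), of n] by auto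
  then have "incseq (\<lambda>n. {l n..r n})" by (rule incseq_SucI)
  moreover have "0 < l n" for n using rl(5)[of n] by simp
  ultimately show thesis using rl(1,4,6) by (intro that[of l r]) simp_all
qed

lemma Ico_empty: "\<not> 0 < T \<Longrightarrow> Ico T = {}"
  by (auto simp: Ico_def not_less intro: order_trans[of T 0])

lemma L2_norm_on_power2: "(L2_norm_on I u)\<^sup>2 = (LINT t|lebesgue_on I. (norm (u t))\<^sup>2)"
  by (simp add: L2_norm_on_def)

lemma Ico_lebesgue: "Ico T \<in> sets lebesgue"
proof (cases "0 < T")
  case True
  obtain l r :: "nat \<Rightarrow> real" where "incseq (\<lambda>n. {l n..r n})" "Ico T = insert 0 (\<Union>n. {l n..r n})"
    "\<And>n. 0 < l n" "\<And>n. l n < r n" "\<And>n. ereal (r n) < T"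
    by (rule Ico_exhaustion[OF True], rule that, assumption+)
  moreover have "(\<Union>n. {l n..r n}) \<in> sets lebesgue" by (intro sets.countable_UN) auto
  ultimately show ?thesis using sets.Un[of "{0}" lebesgue "\<Union>n. {l n..r n}"] by simp
next
  case False
  then show ?thesis by (simp add: Ico_empty)
qed

context mqs_problem
begin

text \<open>Enlarging the voltage integral to all of \<open>Ico T\<close> makes the local bound
  uniform over the compact subintervals, and monotone convergence finishes.\<close>

lemma global_dissipation_estimate:
  assumes sol: "mqs_solution_Ico \<Omega> \<Omega>C (\<lambda>x. \<sigma>C * indicator \<Omega>C x) \<nu> R X A\<^sub>0 v T A i"
    and v: "v square_integrable_on Ico T" and \<epsilon>: "0 < \<epsilon>" "\<epsilon> < 2"
  shows "(\<lambda>t. S *v i t) square_integrable_on Ico T"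
    "(L2_norm_on (Ico T) (\<lambda>t. S *v i t))\<^sup>2 \<le> 2 / (2 - \<epsilon>) * energy (wcurl \<Omega> A\<^sub>0)
      + 1 / (\<epsilon> * (2 - \<epsilon>)) * (L2_norm_on (Ico T) (\<lambda>t. Si *v v t))\<^sup>2"
proof -
  define V where "V = (LINT t|lebesgue_on (Ico T). (norm (Si *v v t))\<^sup>2)"
  define K where "K = 2 / (2 - \<epsilon>) * energy (wcurl \<Omega> A\<^sub>0) + 1 / (\<epsilon> * (2 - \<epsilon>)) * V"
  have V0: "0 \<le> V" by (simp add: V_def)
  have Siv: "(\<lambda>t. Si *v v t) square_integrable_on Ico T" by (rule matrix_vector_square_integrable[OF v])
  have "(\<lambda>t. S *v i t) square_integrable_on Ico T \<and> (LINT t|lebesgue_on (Ico T). (norm (S *v i t))\<^sup>2) \<le> K"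
  proof (cases "0 < T")
    case True
    obtain l r :: "nat \<Rightarrow> real" where lr: "incseq (\<lambda>n. {l n..r n})" "Ico T = insert 0 (\<Union>n. {l n..r n})"
      "\<And>n. 0 < l n" "\<And>n. l n < r n" "\<And>n. ereal (r n) < T"
      by (rule Ico_exhaustion[OF True], rule that, assumption+)
    have loc: "(\<lambda>t. S *v i t) square_integrable_on {l n..r n}"
      "(LINT t|lebesgue_on {l n..r n}. (norm (S *v i t))\<^sup>2) \<le> K" for n
    proof -
      \<comment> \<open>The local estimate lives strictly inside the interval of a solution, so a
        solution horizon \<open>T'\<close> is placed between \<open>r n\<close> and
        \<open>T\<close>.\<close>
      obtain T' where T': "ereal (r n) < ereal T'" "ereal T' < T"
        using ereal_dense2[OF lr(5)[of n]] by blast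
      have r0: "0 < r n" using lr(3,4)[of n] by simp
      have sol': "mqs_solution \<Omega> \<Omega>C (\<lambda>x. \<sigma>C * indicator \<Omega>C x) \<nu> R X A\<^sub>0 v T' A i"
        using sol T' r0 unfolding mqs_solution_Ico_def by auto
      have sub: "{0..r n} \<subseteq> Ico T"
        using lr(5)[of n] by (auto simp: Ico_def intro: le_less_trans[rotated])
      have vr: "v square_integrable_on {0..r n}"
        by (rule square_integrable_on_subset[OF v sub Ico_lebesgue]) simp
      have "r n < T'" using T'(1) by simp
      note est = local_dissipation_estimate[OF sol' r0 this vr \<epsilon> lr(3)[of n] lr(4)[of n]]
      show "(\<lambda>t. S *v i t) square_integrable_on {l n..r n}" by (rule est(1))
      have "(LINT t|lebesgue_on {0..r n}. (norm (Si *v v t))\<^sup>2) \<le> V"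
      proof -
        have i1: "integrable lebesgue (\<lambda>t. indicat_real {0..r n} t * (norm (Si *v v t))\<^sup>2)"
          using matrix_vector_square_integrable[OF vr, of Si]
          by (simp add: square_integrable_on_def integrable_restrict_space)
        have i2: "integrable lebesgue (\<lambda>t. indicat_real (Ico T) t * (norm (Si *v v t))\<^sup>2)"
          using Siv Ico_lebesgue[of T] by (simp add: square_integrable_on_def integrable_restrict_space)
        show ?thesis
          unfolding V_def using i1 i2 Ico_lebesgue[of T] sub
          by (simp add: integral_restrict_space) (intro integral_mono; auto simp: indicator_def)
      qed
      then have "(1 - \<epsilon> / 2) * (LINT t|lebesgue_on {l n..r n}. (norm (S *v i t))\<^sup>2)
        \<le> energy (wcurl \<Omega> A\<^sub>0) + V / (2 * \<epsilon>)"
        using est(2) \<epsilon> divide_right_mono[of _ V "2 * \<epsilon>"] by (smt (verit))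
      then have "2 / (2 - \<epsilon>) * ((1 - \<epsilon> / 2) * (LINT t|lebesgue_on {l n..r n}. (norm (S *v i t))\<^sup>2))
        \<le> 2 / (2 - \<epsilon>) * (energy (wcurl \<Omega> A\<^sub>0) + V / (2 * \<epsilon>))"
        using \<epsilon> by (intro mult_left_mono) auto
      moreover have "2 / (2 - \<epsilon>) * ((1 - \<epsilon> / 2) * x) = x" for x
        using \<epsilon> by (simp add: field_simps)
      moreover have "2 / (2 - \<epsilon>) * (energy (wcurl \<Omega> A\<^sub>0) + V / (2 * \<epsilon>)) = K"
        using \<epsilon> by (simp add: K_def distrib_left mult.commute)
      ultimately show "(LINT t|lebesgue_on {l n..r n}. (norm (S *v i t))\<^sup>2) \<le> K" by simp
    qed
    have "(\<Union>n. {l n..r n}) \<in> sets lebesgue" by (intro sets.countable_UN) auto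
    then show ?thesis
      using square_integrable_on_exhaustion[OF lr(1) _ loc] square_integrable_on_insert[of "\<lambda>t. S *v i t" "\<Union>n. {l n..r n}" 0]
      by (simp add: lr(2))
  next
    case False
    \<comment> \<open>With no time interval the norm of the current is 0, and the claim reduces to
      nonnegativity of the right-hand side.\<close>
    then have I: "Ico T = {}" by (rule Ico_empty)
    have "0 \<le> K" using V0 \<epsilon> energy_nonneg by (simp add: K_def)
    moreover have "(\<lambda>t. S *v i t) \<in> borel_measurable (lebesgue_on {})"
      using borel_measurable_if[of "{}" "\<lambda>t. S *v i t"] by simp
    ultimately show ?thesis
      unfolding I by (simp add: square_integrable_on_def integral_restrict_space integrable_restrict_space)
  qed
  then show "(\<lambda>t. S *v i t) square_integrable_on Ico T"
    "(L2_norm_on (Ico T) (\<lambda>t. S *v i t))\<^sup>2 \<le> 2 / (2 - \<epsilon>) * energy (wcurl \<Omega> A\<^sub>0)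
      + 1 / (\<epsilon> * (2 - \<epsilon>)) * (L2_norm_on (Ico T) (\<lambda>t. Si *v v t))\<^sup>2"
    by (auto simp: L2_norm_on_power2 K_def V_def)
qed

end

section \<open>The three estimates for the coil current\<close>

theorem theorem5p2:
  fixes \<Omega> \<Omega>C :: "(real^3) set"
    and \<sigma> :: "real^3 \<Rightarrow> real" and \<nu> :: "real^3 \<Rightarrow> real \<Rightarrow> real"
    and \<sigma>C m\<nu> L\<nu> :: real
    and R :: "real^'m^'m"
    and X :: "real^3 \<Rightarrow> real^'m^3"
    and T :: ereal
    and v i :: "real \<Rightarrow> real^'m"
    and A\<^sub>0 :: "(real^3, real^3) L2"
    and A :: "real \<Rightarrow> (real^3, real^3) L2"
  assumes geometry: "geometry \<Omega> \<Omega>C"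
    and sigma: "\<sigma>C > 0" "\<sigma> = (\<lambda>x. \<sigma>C * indicator \<Omega>C x)"
    and nu_measurable:
      "(\<lambda>(x, \<zeta>). \<nu> x \<zeta>) \<in> borel_measurable (lebesgue_on (\<Omega> \<times> {0..}))"
    and nu_nonneg: "\<And>x \<zeta>. x \<in> \<Omega> \<Longrightarrow> \<zeta> \<ge> 0 \<Longrightarrow> \<nu> x \<zeta> \<ge> 0"
    and constants: "m\<nu> > 0" "L\<nu> > 0"
    and nu_monotone: "\<And>x \<zeta> \<zeta>'. x \<in> \<Omega> \<Longrightarrow> \<zeta> \<ge> 0 \<Longrightarrow> \<zeta>' \<ge> 0 \<Longrightarrow>
      (\<nu> x \<zeta> * \<zeta> - \<nu> x \<zeta>' * \<zeta>') * (\<zeta> - \<zeta>') \<ge> m\<nu> * (\<zeta> - \<zeta>')\<^sup>2"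
    and nu_lipschitz: "\<And>x \<zeta> \<zeta>'. x \<in> \<Omega> \<Longrightarrow> \<zeta> \<ge> 0 \<Longrightarrow> \<zeta>' \<ge> 0 \<Longrightarrow>
      \<bar>\<nu> x \<zeta> * \<zeta> - \<nu> x \<zeta>' * \<zeta>'\<bar> \<le> L\<nu> * \<bar>\<zeta> - \<zeta>'\<bar>"
    and resistance: "spd R"
    and winding: "\<And>j. (\<lambda>x. column j (X x)) square_integrable_on \<Omega>"
      "\<And>j. L2_of \<Omega> (\<lambda>x. column j (X x)) \<in> X_space \<Omega> \<Omega>C"
    and T: "T \<ge> 0"
    and voltage: "v square_integrable_on Ico T"
    and initial: "A\<^sub>0 \<in> X0_curl \<Omega> \<Omega>C"
    and solution: "mqs_solution_Ico \<Omega> \<Omega>C \<sigma> \<nu> R X A\<^sub>0 v T A i"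
  shows "i square_integrable_on Ico T \<and>
    (\<forall>\<epsilon>\<in>{0<..<2}.
      ereal ((L2_norm_on (Ico T) (\<lambda>t. matrix_sqrt R *v i t))\<^sup>2)
        \<le> ereal (2 / (2 - \<epsilon>)) * magnetic_energy \<Omega> \<Omega>C \<nu> A\<^sub>0
          + ereal (1 / (\<epsilon> * (2 - \<epsilon>))
              * (L2_norm_on (Ico T) (\<lambda>t. matrix_inv (matrix_sqrt R) *v v t))\<^sup>2) \<and>
      L2_norm_on (Ico T) (\<lambda>t. matrix_sqrt R *v i t)
        \<le> sqrt (L\<nu> / (2 - \<epsilon>)) * norm (wcurl \<Omega> A\<^sub>0)
          + 1 / sqrt (\<epsilon> * (2 - \<epsilon>))
              * L2_norm_on (Ico T) (\<lambda>t. matrix_inv (matrix_sqrt R) *v v t)) \<and>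
    (A\<^sub>0 = 0 \<longrightarrow>
      L2_norm_on (Ico T) (\<lambda>t. matrix_sqrt R *v i t)
        \<le> L2_norm_on (Ico T) (\<lambda>t. matrix_inv (matrix_sqrt R) *v v t))"
proof -
  interpret mqs_problem \<Omega> \<nu> L\<nu> \<Omega>C \<sigma>C R X A\<^sub>0
  proof
    show "open \<Omega>" "bounded \<Omega>" "open \<Omega>C" using geometry by (auto simp: geometry_def)
    show "\<Omega>C \<subseteq> \<Omega>" using geometry closure_subset[of \<Omega>C] by (auto simp: geometry_def)
    fix x \<zeta> \<zeta>' :: real and \<xi> assume *: "\<xi> \<in> \<Omega>" "0 \<le> \<zeta>" "\<zeta> \<le> \<zeta>'"
    then have "0 \<le> (\<nu> \<xi> \<zeta>' * \<zeta>' - \<nu> \<xi> \<zeta> * \<zeta>) * (\<zeta>' - \<zeta>)"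
      using nu_monotone[of \<xi> \<zeta>' \<zeta>] constants(1) by (auto intro: order_trans[rotated])
    then show "\<nu> \<xi> \<zeta> * \<zeta> \<le> \<nu> \<xi> \<zeta>' * \<zeta>'"
      using * by (cases "\<zeta> = \<zeta>'") (auto simp: zero_le_mult_iff)
  qed (use nu_measurable nu_nonneg constants nu_lipschitz sigma(1) resistance winding(1) initial in auto)
  define E0 where "E0 = energy (wcurl \<Omega> A\<^sub>0)"
  define N where "N = L2_norm_on (Ico T) (\<lambda>t. matrix_sqrt R *v i t)"
  define V where "V = L2_norm_on (Ico T) (\<lambda>t. matrix_inv (matrix_sqrt R) *v v t)"
  have nn: "0 \<le> N" "0 \<le> V" by (simp_all add: N_def V_def L2_norm_on_def)
  note sol = solution[unfolded sigma(2)]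
  have bound: "N\<^sup>2 \<le> 2 / (2 - \<epsilon>) * E0 + 1 / (\<epsilon> * (2 - \<epsilon>)) * V\<^sup>2" if "0 < \<epsilon>" "\<epsilon> < 2" for \<epsilon>
    using global_dissipation_estimate(2)[OF sol voltage that] by (simp add: N_def V_def E0_def)
  have "(\<lambda>t. matrix_inv (matrix_sqrt R) *v (matrix_sqrt R *v i t)) square_integrable_on Ico T"
    by (rule matrix_vector_square_integrable[OF global_dissipation_estimate(1)[OF sol voltage, of 1]]) auto
  then have 1: "i square_integrable_on Ico T" by (simp add: S_inverse)
  have E: "magnetic_energy \<Omega> \<Omega>C \<nu> A\<^sub>0 = ereal E0"
    using initial by (simp add: magnetic_energy_def E0_def energy_def)
  have 2: "ereal (N\<^sup>2) \<le> ereal (2 / (2 - \<epsilon>)) * magnetic_energy \<Omega> \<Omega>C \<nu> A\<^sub>0 + ereal (1 / (\<epsilon> * (2 - \<epsilon>)) * V\<^sup>2)"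
    if "\<epsilon> \<in> {0<..<2}" for \<epsilon>
    using bound[of \<epsilon>] that by (simp add: E)
  have 3: "N \<le> sqrt (L\<nu> / (2 - \<epsilon>)) * norm (wcurl \<Omega> A\<^sub>0) + 1 / sqrt (\<epsilon> * (2 - \<epsilon>)) * V"
    if "\<epsilon> \<in> {0<..<2}" for \<epsilon>
  proof -
    have \<epsilon>: "0 < \<epsilon>" "\<epsilon> < 2" using that by auto
    have E0_le: "2 / (2 - \<epsilon>) * E0 \<le> 2 / (2 - \<epsilon>) * (L\<nu> / 2 * (norm (wcurl \<Omega> A\<^sub>0))\<^sup>2)"
      unfolding E0_def using \<epsilon> by (intro mult_left_mono energy_le) auto
    have "N\<^sup>2 \<le> L\<nu> / (2 - \<epsilon>) * (norm (wcurl \<Omega> A\<^sub>0))\<^sup>2 + 1 / (\<epsilon> * (2 - \<epsilon>)) * V\<^sup>2"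
    proof -
      have "2 / (2 - \<epsilon>) * (L\<nu> / 2 * r) = L\<nu> / (2 - \<epsilon>) * r" for r
        using \<epsilon> by (simp add: field_simps)
      with E0_le bound[OF \<epsilon>] show ?thesis by (simp only:)
    qed
    then have "sqrt (N\<^sup>2) \<le> sqrt (L\<nu> / (2 - \<epsilon>) * (norm (wcurl \<Omega> A\<^sub>0))\<^sup>2 + 1 / (\<epsilon> * (2 - \<epsilon>)) * V\<^sup>2)"
      by (rule real_sqrt_le_mono)
    also have "\<dots> \<le> sqrt (L\<nu> / (2 - \<epsilon>) * (norm (wcurl \<Omega> A\<^sub>0))\<^sup>2) + sqrt (1 / (\<epsilon> * (2 - \<epsilon>)) * V\<^sup>2)"
      using \<epsilon> constants by (intro sqrt_add_le_add_sqrt mult_nonneg_nonneg) auto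
    also have "\<dots> = sqrt (L\<nu> / (2 - \<epsilon>)) * norm (wcurl \<Omega> A\<^sub>0) + 1 / sqrt (\<epsilon> * (2 - \<epsilon>)) * V"
      using nn by (simp only: real_sqrt_mult real_sqrt_divide real_sqrt_abs real_sqrt_one abs_norm_cancel abs_of_nonneg)
    finally show ?thesis using nn by simp
  qed
  have 4: "N \<le> V" if "A\<^sub>0 = 0"
  proof -
    have "E0 = 0" using that by (simp add: E0_def wcurl_zero energy_zero)
    \<comment> \<open>The coefficient \<open>1 / (\<epsilon> * (2 - \<epsilon>))\<close> attains its
      minimum 1 at \<open>\<epsilon> = 1\<close>.\<close>
    then have "N\<^sup>2 \<le> V\<^sup>2" using bound[of 1] by simp
    then show ?thesis using nn(2) by (rule power2_le_imp_le)
  qed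
  show ?thesis
    using 1 2[unfolded N_def V_def] 3[unfolded N_def V_def] 4[unfolded N_def V_def]
    by (intro conjI ballI impI)
qed

end
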